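(* Let $\{N(\omega,t),\boldsymbol{F},\boldsymbol{P}\}$ be a Poisson process of rate $1$ and let $\lambda(\omega,t)$ be a process satisfying (A0)-(A4) listed in the context. Define the measure $\boldsymbol{Q}$ on $\mathscr{F}_\infty$ by $$\boldsymbol{Q}(d\omega)=\exp[\zeta_0^\infty(\lambda)(\omega)]\,\boldsymbol{P}(d\omega),$$ and assume $\boldsymbol{Q}(\boldsymbol{\varOmega})=1$. Then for any filtration $\boldsymbol{G}$ with $\boldsymbol{F}^N\leq\boldsymbol{G}\leq\boldsymbol{F}$ there exists a $\boldsymbol{G}$-predictable process $\lambda^{\boldsymbol{G}}(\omega,t)$, unique up to indistinguishability, such that $M(\lambda^{\boldsymbol{G}})$ is a $\boldsymbol{G}$-martingale under $\boldsymbol{Q}$. In particular, if $\lambda(\omega,t)$ is $\boldsymbol{G}$-predictable, then $\lambda$ is indistinguishable from $\lambda^{\boldsymbol{G}}$.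
   Context: $(\boldsymbol{\varOmega},\mathscr{F},\boldsymbol{P})$ is a probability space and $\boldsymbol{F}=\{\mathscr{F}_t:t\geq 0\}$ is a filtration, i.e. a non-decreasing family of sub-$\sigma$-algebras of $\mathscr{F}$; $\mathscr{F}_\infty$ is the smallest $\sigma$-algebra containing all $\mathscr{F}_t$. For filtrations, $\boldsymbol{G}\leq\boldsymbol{F}$ means $\mathscr{G}_t\subseteq\mathscr{F}_t$ for all $t\geq0$. $\boldsymbol{F}^N$ is the natural filtration of $N$, $\mathscr{F}^N_t=\sigma(N(\cdot,s):s\leq t)$. $\{N(\omega,t),\boldsymbol{F},\boldsymbol{P}\}$ is a Poisson process of rate $\lambda_0>0$ if: (P0) $N$ is $\boldsymbol{F}$-adapted; and for fixed $\omega$ the path $t\mapsto N(\omega,t)$, $t\ge 0$, is (P1) right-continuous, (P2) non-decreasing, (P3) integer-valued, (P4) satisfies $N(\omega,0)=0$, (P5) has jumps $N(\omega,s)-N(\omega,s-)\in\{0,1\}$; and (P6) $\int \exp[iu(N(\omega,t)-N(\omega,s))]\boldsymbol{P}(d\omega)=\exp[\lambda_0(t-s)(e^{iu}-1)]$ for $0\le s\le t$; (P7) $N_t-N_s$ is independent of $\mathscr{F}_s$ for $0\leq s\leq t$. A process is $\boldsymbol{G}$-predictable if it is jointly measurable with respect to the $\sigma$-algebra on $\boldsymbol{\varOmega}\times[0,\infty)$ generated by all left-continuous $\boldsymbol{G}$-adapted processes. Two processes $\lambda,\lambda'$ are indistinguishable if $\boldsymbol{P}(\lambda(\cdot,t)\neq\lambda'(\cdot,t)\text{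 for some }t\geq0)=0$. Assumptions on $\lambda$: (A0) $\lambda$ is $\boldsymbol{F}$-adapted; (A1) $\lambda(\omega,t)$ is jointly measurable in $(\omega,t)$; (A2) $\lambda(\omega,t)>0$ for all $\omega,t$; (A3) $\int_0^t\lambda(\omega,s)\,ds<\infty$ almost surely for each $t$; (A4) $\int_0^t\log\lambda(\omega,s)\,N(\omega,ds)$ exists almost surely for each $t$. Notation: $A(\lambda)(\omega,t)=\int_0^t\lambda(\omega,s)\,ds$, $M(\lambda)(\omega,t)=N(\omega,t)-A(\lambda)(\omega,t)$, and $$\zeta_s^t(\lambda)(\omega)=\int_s^t[1-\lambda(\omega,u)]\,du+\int_s^t\log\lambda(\omega,u)\,N(\omega,du).$$
   Formalization: M is a local martingale, a martingale if all N_t are Q-integrable; uniqueness means indistinguishable compensators and a.s. equality at Lebesgue-a.e. time and at jumps, up to Q-null sets (P-null if λ is G-predictable), as the literal uniqueness and martingale claims fail. *)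

theory Defs
  imports "HOL-Probability.Probability"
begin

text \<open>
  A process is a function \<open>X \<omega> t\<close> of which only the values with \<open>\<omega> \<in> space P\<close> and \<open>0 \<le> t\<close>
  matter; likewise only the members \<open>F t\<close> with \<open>0 \<le> t\<close> of a family of \<open>\<sigma>\<close>-algebras matter (the
  locale \<open>filtration\<close> would also constrain the negative times).  The measure
  carried by \<open>F t\<close> is irrelevant.  No completeness or right-continuity of filtrations is assumed.
\<close>

section \<open>Filtrations, predictability, martingales\<close>

definition is_filtration :: "'a measure \<Rightarrow> (real \<Rightarrow> 'a measure) \<Rightarrow> bool" where
  "is_filtration P F \<longleftrightarrow>
     (\<forall>t\<ge>0. subalgebra P (F t)) \<and> (\<forall>s\<ge>0. \<forall>t\<ge>s. sets (F s) \<subseteq> sets (F t))"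

definition filtration_le :: "(real \<Rightarrow> 'a measure) \<Rightarrow> (real \<Rightarrow> 'a measure) \<Rightarrow> bool" where
  "filtration_le G F \<longleftrightarrow> (\<forall>t\<ge>0. sets (G t) \<subseteq> sets (F t))"

definition filtration_infty :: "'a measure \<Rightarrow> (real \<Rightarrow> 'a measure) \<Rightarrow> 'a measure" where
  "filtration_infty P F = sigma (space P) (\<Union>t\<in>{0..}. sets (F t))"

definition natural_filtration :: "'a measure \<Rightarrow> ('a \<Rightarrow> real \<Rightarrow> real) \<Rightarrow> real \<Rightarrow> 'a measure" where
  "natural_filtration P X t =
     sigma (space P) (\<Union>s\<in>{0..t}. {(\<lambda>\<omega>. X \<omega> s) -` B \<inter> space P | B. B \<in> sets borel})"

definition adapted :: "(real \<Rightarrow> 'a measure) \<Rightarrow> ('a \<Rightarrow> real \<Rightarrow> real) \<Rightarrow> bool" where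
  "adapted F X \<longleftrightarrow> (\<forall>t\<ge>0. (\<lambda>\<omega>. X \<omega> t) \<in> borel_measurable (F t))"

definition left_continuous_paths :: "'a measure \<Rightarrow> ('a \<Rightarrow> real \<Rightarrow> real) \<Rightarrow> bool" where
  "left_continuous_paths P X \<longleftrightarrow> (\<forall>\<omega>\<in>space P. \<forall>t>0. continuous (at_left t) (X \<omega>))"

definition predictable_sigma :: "'a measure \<Rightarrow> (real \<Rightarrow> 'a measure) \<Rightarrow> ('a \<times> real) measure" where
  "predictable_sigma P G = sigma (space P \<times> {0..})
     {case_prod X -` B \<inter> (space P \<times> {0..}) | X B.
        adapted G X \<and> left_continuous_paths P X \<and> B \<in> sets borel}"

definition predictable :: "'a measure \<Rightarrow> (real \<Rightarrow> 'a measure) \<Rightarrow> ('a \<Rightarrow> real \<Rightarrow> real) \<Rightarrow> bool" where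
  "predictable P G X \<longleftrightarrow> case_prod X \<in> borel_measurable (predictable_sigma P G)"

definition indistinguishable ::
    "'a measure \<Rightarrow> ('a \<Rightarrow> real \<Rightarrow> real) \<Rightarrow> ('a \<Rightarrow> real \<Rightarrow> real) \<Rightarrow> bool" where
  "indistinguishable R X Y \<longleftrightarrow> (AE \<omega> in R. \<forall>t\<ge>0. X \<omega> t = Y \<omega> t)"

definition is_martingale :: "'a measure \<Rightarrow> (real \<Rightarrow> 'a measure) \<Rightarrow> ('a \<Rightarrow> real \<Rightarrow> real) \<Rightarrow> bool" where
  "is_martingale Q G X \<longleftrightarrow>
     adapted G X \<and>
     (\<forall>t\<ge>0. integrable Q (\<lambda>\<omega>. X \<omega> t)) \<and>
     (\<forall>s\<ge>0. \<forall>t\<ge>s. AE \<omega> in Q. real_cond_exp Q (G s) (\<lambda>\<omega>'. X \<omega>' t) \<omega> = X \<omega> s)"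

definition is_stopping_time :: "'a measure \<Rightarrow> (real \<Rightarrow> 'a measure) \<Rightarrow> ('a \<Rightarrow> ennreal) \<Rightarrow> bool" where
  "is_stopping_time P G \<tau> \<longleftrightarrow> (\<forall>t\<ge>0. {\<omega> \<in> space P. \<tau> \<omega> \<le> ennreal t} \<in> sets (G t))"

definition stopped :: "('a \<Rightarrow> real \<Rightarrow> real) \<Rightarrow> ('a \<Rightarrow> ennreal) \<Rightarrow> 'a \<Rightarrow> real \<Rightarrow> real" where
  "stopped X \<tau> \<omega> t = X \<omega> (enn2real (min (ennreal t) (\<tau> \<omega>)))"

definition is_local_martingale :: "'a measure \<Rightarrow> (real \<Rightarrow> 'a measure) \<Rightarrow> ('a \<Rightarrow> real \<Rightarrow> real) \<Rightarrow> bool" where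
  "is_local_martingale Q G X \<longleftrightarrow>
     (\<exists>\<tau>. (\<forall>n. is_stopping_time Q G (\<tau> n)) \<and>
          (AE \<omega> in Q. incseq (\<lambda>n. \<tau> n \<omega>) \<and> (\<lambda>n. \<tau> n \<omega>) \<longlonglongrightarrow> \<infinity>) \<and>
          (\<forall>n::nat. is_martingale Q G (stopped X (\<tau> n))))"

section \<open>Poisson processes and intensities\<close>

definition poisson_process ::
    "'a measure \<Rightarrow> (real \<Rightarrow> 'a measure) \<Rightarrow> ('a \<Rightarrow> real \<Rightarrow> real) \<Rightarrow> real \<Rightarrow> bool" where
  "poisson_process P F N rate \<longleftrightarrow>
     adapted F N \<and>
     (\<forall>\<omega>\<in>space P.
        (\<forall>t\<ge>0. continuous (at_right t) (N \<omega>)) \<and>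
        mono_on {0..} (N \<omega>) \<and>
        (\<forall>t\<ge>0. N \<omega> t \<in> \<int>) \<and>
        N \<omega> 0 = 0 \<and>
        (\<forall>t>0. N \<omega> t - Lim (at_left t) (N \<omega>) \<in> {0, 1})) \<and>
     (\<forall>s\<ge>0. \<forall>t\<ge>s. \<forall>u::real.
        (LINT \<omega>|P. exp (\<i> * complex_of_real (u * (N \<omega> t - N \<omega> s)))) =
          exp (complex_of_real (rate * (t - s)) * (exp (\<i> * complex_of_real u) - 1))) \<and>
     (\<forall>s\<ge>0. \<forall>t\<ge>s. prob_space.indep_set P
        {(\<lambda>\<omega>. N \<omega> t - N \<omega> s) -` B \<inter> space P | B. B \<in> sets borel} (sets (F s)))"

text \<open>The Lebesgue-Stieltjes measure \<open>N(\<omega>, dt)\<close>; the path is extended by its value at \<open>0\<close> to negative times.\<close>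

definition path_measure :: "('a \<Rightarrow> real \<Rightarrow> real) \<Rightarrow> 'a \<Rightarrow> real measure" where
  "path_measure N \<omega> = interval_measure (\<lambda>t. N \<omega> (max 0 t))"

definition intensity_conditions ::
    "'a measure \<Rightarrow> (real \<Rightarrow> 'a measure) \<Rightarrow> ('a \<Rightarrow> real \<Rightarrow> real) \<Rightarrow> ('a \<Rightarrow> real \<Rightarrow> real) \<Rightarrow> bool" where
  "intensity_conditions P F N lam \<longleftrightarrow>
     adapted F lam \<and>
     case_prod lam \<in> borel_measurable (P \<Otimes>\<^sub>M restrict_space borel {0..}) \<and>
     (\<forall>\<omega>\<in>space P. \<forall>t\<ge>0. lam \<omega> t > 0) \<and>
     (\<forall>t\<ge>0. AE \<omega> in P. (\<integral>\<^sup>+s\<in>{0..t}. ennreal (lam \<omega> s) \<partial>lborel) < \<infinity>) \<and>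
     (\<forall>t\<ge>0. AE \<omega> in P. set_integrable (path_measure N \<omega>) {0<..t} (\<lambda>s. ln (lam \<omega> s)))"

definition compensator :: "('a \<Rightarrow> real \<Rightarrow> real) \<Rightarrow> 'a \<Rightarrow> real \<Rightarrow> real" where
  "compensator lam \<omega> t = (LINT s:{0..t}|lborel. lam \<omega> s)"

definition compensated ::
    "('a \<Rightarrow> real \<Rightarrow> real) \<Rightarrow> ('a \<Rightarrow> real \<Rightarrow> real) \<Rightarrow> 'a \<Rightarrow> real \<Rightarrow> real" where
  "compensated N lam \<omega> t = N \<omega> t - compensator lam \<omega> t"

definition zeta ::
    "('a \<Rightarrow> real \<Rightarrow> real) \<Rightarrow> ('a \<Rightarrow> real \<Rightarrow> real) \<Rightarrow> real \<Rightarrow> real \<Rightarrow> 'a \<Rightarrow> real" where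
  "zeta N lam s t \<omega> =
     (LINT u:{s..t}|lborel. 1 - lam \<omega> u) + (LINT u:{s<..t}|path_measure N \<omega>. ln (lam \<omega> u))"

text \<open>
  \<open>\<zeta>\<^sub>s\<^sup>\<infinity>\<close> is the limit of \<open>\<zeta>\<^sub>s\<^sup>t\<close> as \<open>t \<rightarrow> \<infinity>\<close>, in the extended reals: the two
  integrals over \<open>[s, \<infinity>)\<close> need not converge separately.  The lower limit makes it total; it
  is the limit whenever that exists.
\<close>

definition zeta_infty ::
    "('a \<Rightarrow> real \<Rightarrow> real) \<Rightarrow> ('a \<Rightarrow> real \<Rightarrow> real) \<Rightarrow> real \<Rightarrow> 'a \<Rightarrow> ereal" where
  "zeta_infty N lam s \<omega> = Liminf at_top (\<lambda>t. ereal (zeta N lam s t \<omega>))"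

definition exp_ereal :: "ereal \<Rightarrow> ennreal" where
  "exp_ereal x = (case x of ereal r \<Rightarrow> ennreal (exp r) | PInfty \<Rightarrow> \<infinity> | MInfty \<Rightarrow> 0)"

definition likelihood_measure ::
    "'a measure \<Rightarrow> (real \<Rightarrow> 'a measure) \<Rightarrow> ('a \<Rightarrow> real \<Rightarrow> real) \<Rightarrow> ('a \<Rightarrow> real \<Rightarrow> real) \<Rightarrow> 'a measure" where
  "likelihood_measure P F N lam =
     restr_to_subalg (density P (\<lambda>\<omega>. exp_ereal (zeta_infty N lam 0 \<omega>))) (filtration_infty P F)"

text \<open>
  The integrability condition says that \<open>compensator lam\<close> is a genuine integral; otherwise
  \<open>compensated N lam\<close> would silently use the default value \<open>0\<close>.  A martingale is in general too
  much to ask for, since \<open>N \<omega> t\<close> need not be \<open>Q\<close>-integrable: if \<open>lam \<omega> t = \<Lambda> \<omega>\<close> for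
  \<open>t \<le> 1\<close> and \<open>lam \<omega> t = 1\<close> afterwards, with \<open>\<Lambda>\<close> measurable for \<open>F 0\<close> and
  \<open>sqrt \<Lambda>\<close> of infinite mean, then \<open>Q\<close> is a probability measure, but \<open>N \<omega> 1 - \<Lambda> \<omega>\<close>
  is not \<open>Q\<close>-integrable.
\<close>

definition is_intensity ::
    "'a measure \<Rightarrow> (real \<Rightarrow> 'a measure) \<Rightarrow> ('a \<Rightarrow> real \<Rightarrow> real) \<Rightarrow> ('a \<Rightarrow> real \<Rightarrow> real) \<Rightarrow> bool" where
  "is_intensity Q G N lam \<longleftrightarrow>
     predictable Q G lam \<and>
     (AE \<omega> in Q. \<forall>t\<ge>0. set_integrable lborel {0..t} (lam \<omega>)) \<and>
     is_local_martingale Q G (compensated N lam)"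

text \<open>
  Intensities cannot be unique in the sense of \<open>indistinguishable\<close>: adding the predictable
  process \<open>\<lambda>\<omega> t. of_bool (t = 1)\<close> to one leaves its compensator unchanged.  What is
  determined is the compensator up to indistinguishability and, almost surely, the values of the
  intensity at Lebesgue-almost every time and at the jump times of \<open>N\<close>.
\<close>

definition same_intensity ::
    "'a measure \<Rightarrow> ('a \<Rightarrow> real \<Rightarrow> real) \<Rightarrow> ('a \<Rightarrow> real \<Rightarrow> real) \<Rightarrow> ('a \<Rightarrow> real \<Rightarrow> real) \<Rightarrow> bool" where
  "same_intensity R N lam lam' \<longleftrightarrow>
     indistinguishable R (compensator lam) (compensator lam') \<and>
     (AE \<omega> in R. AE t in lborel. 0 \<le> t \<longrightarrow> lam \<omega> t = lam' \<omega> t) \<and>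
     (AE \<omega> in R. AE t in path_measure N \<omega>. 0 \<le> t \<longrightarrow> lam \<omega> t = lam' \<omega> t)"

end

theory Submission
  imports Defs "HOL-Real_Asymp.Real_Asymp"
begin

text \<open>
  Everything is expressed by two measures on the predictable \<open>\<sigma>\<close>-algebra, the Doleans measures of a
  finite measure \<open>R\<close>: \<open>jump_measure\<close> is the expected number of jumps of \<open>N\<close> in a predictable set, and
  \<open>time_measure\<close> is the expected Lebesgue measure of its sections.  The predictable \<open>\<sigma>\<close>-algebra is
  generated by rectangles \<open>A \<times> (s, t]\<close> with \<open>A\<close> in the past of \<open>s\<close>.  On a rectangle, the identity
  between the mean increments of \<open>N\<close> and of a compensator is just the identity between the jump
  measure and a density with respect to the time measure.  Hence the intensities under \<open>R\<close> are the
  predictable versions of that density.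

  Existence.  Under \<open>P\<close> the two Doleans measures agree, since the increments of \<open>N\<close> have mean \<open>t - s\<close>
  and are independent of the past.  So, given a predictable set, almost no path on which its section is
  Lebesgue-null jumps at a time in that section.  In the form of \<open>jumps_avoid_null_sets\<close> this is a statement
  about single paths.  It depends on \<open>P\<close> only through the null sets and is therefore inherited by \<open>Q\<close>.
  So the jump measure of \<open>Q\<close> is absolutely continuous with respect to its time measure, and the
  Radon-Nikodym density is the intensity (\<open>jump_density_exists\<close>, \<open>jump_density_is_intensity\<close>).  The
  process is localised by its own jump times, up to which the jump measure is finite.

  Uniqueness.  Let \<open>k\<close> be another intensity.  Its compensated process is stopped when its variation or the
  number of jumps gets too large, which makes the stopped increments bounded in the limit
  (\<open>martingale_grid_exit_limit\<close>).  They have mean zero on all events of the past, so the density and \<open>k\<close>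
  have the same integrals over the stopped rectangles and agree almost everywhere
  (\<open>intensity_eq_jump_density\<close>, \<open>intensity_unique\<close>).  Since the jumps avoid predictable sets with null
  sections, they agree at the jump times too.

  The predictable case.  For a bounded predictable \<open>l\<close> that is \<open>1\<close> after finitely many jumps, the
  likelihood solves a linear equation driven by \<open>N\<close> and by time (\<open>likelihood_equation\<close>), and equality of
  the Doleans measures gives it mean one.  By truncation the likelihood of a general predictable
  \<open>l\<close> is a supermartingale.  The total mass of \<open>Q\<close> being one, no mass is lost, and on the past of every
  finite time \<open>Q\<close> has the likelihood at that time as its density (\<open>emeasure_Q_eq\<close>).  The bound by one
  also holds for the likelihood of the intensity multiplied by \<open>1 + \<epsilon>\<close> on a predictable set \<open>D\<close>.  Its
  expansion to first order in \<open>\<epsilon>\<close> shows that under \<open>Q\<close> the expected number of jumps in \<open>D\<close> is the expected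
  integral of \<open>l\<close> over \<open>D\<close> (\<open>jump_density_local\<close>), so that \<open>l\<close> is the intensity.  The likelihoods at
  finite times are positive, so equality of intensities almost everywhere under \<open>Q\<close> is equality almost
  everywhere under \<open>P\<close>.
\<close>

section \<open>The predictable sigma-algebra\<close>

text \<open>
  The rectangle at time \<open>0\<close> takes its event from \<open>G 0\<close>: a left-continuous process is
  unconstrained by continuity there.
\<close>

definition predictable_rectangles :: "'a measure \<Rightarrow> (real \<Rightarrow> 'a measure) \<Rightarrow> ('a \<times> real) set set" where
  "predictable_rectangles P G =
     {A \<times> {0} | A. A \<in> sets (G 0)} \<union> {A \<times> {s<..t} | A s t. 0 \<le> s \<and> A \<in> sets (G s)}"

lemma rectangle_zero: "A \<in> sets (G 0) \<Longrightarrow> A \<times> {0} \<in> predictable_rectangles P G"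
  unfolding predictable_rectangles_def by blast

lemma rectangle_Ioc:
  "0 \<le> s \<Longrightarrow> A \<in> sets (G s) \<Longrightarrow> A \<times> {s<..t} \<in> predictable_rectangles P G"
  unfolding predictable_rectangles_def by blast

locale filtered_space =
  fixes P :: "'a measure" and G :: "real \<Rightarrow> 'a measure"
  assumes filtration: "is_filtration P G"
begin

abbreviation Pred :: "('a \<times> real) measure" where
  "Pred \<equiv> predictable_sigma P G"

lemma space_G [simp]: "0 \<le> t \<Longrightarrow> space (G t) = space P"
  using filtration by (auto simp: is_filtration_def subalgebra_def)

lemma sets_G_mono: "0 \<le> s \<Longrightarrow> s \<le> t \<Longrightarrow> A \<in> sets (G s) \<Longrightarrow> A \<in> sets (G t)"
  using filtration by (auto simp: is_filtration_def)

lemma measurable_G_mono: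
  "0 \<le> s \<Longrightarrow> s \<le> t \<Longrightarrow> f \<in> measurable (G s) M \<Longrightarrow> f \<in> measurable (G t) M"
  by (rule measurable_from_subalg) (auto simp: subalgebra_def intro: sets_G_mono)

lemma sets_G_space: "0 \<le> t \<Longrightarrow> space P \<in> sets (G t)"
  using sets.top[of "G t"] by simp

lemma rectangles_subset: "predictable_rectangles P G \<subseteq> Pow (space P \<times> {0..})"
proof -
  have "A \<subseteq> space P" if "A \<in> sets (G s)" "0 \<le> s" for A s
    using sets.sets_into_space[OF that(1)] that(2) by simp
  then show ?thesis
    unfolding predictable_rectangles_def by fastforce
qed

lemma predictable_generators_subset:
  "{case_prod X -` B \<inter> (space P \<times> {0..}) | X B.
      adapted G X \<and> left_continuous_paths P X \<and> B \<in> sets borel} \<subseteq> Pow (space P \<times> {0..})"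
  by auto

lemma space_Pred [simp]: "space Pred = space P \<times> {0..}"
  unfolding predictable_sigma_def by (rule space_measure_of) auto

lemma left_continuous_predictable:
  assumes "adapted G X" "left_continuous_paths P X"
  shows "case_prod X \<in> borel_measurable Pred"
proof (rule measurableI)
  fix B :: "real set" assume "B \<in> sets borel"
  then show "case_prod X -` B \<inter> space Pred \<in> sets Pred"
    unfolding space_Pred unfolding predictable_sigma_def
    by (subst sets_measure_of[OF predictable_generators_subset])
      (rule sigma_sets.Basic, use assms in blast)
qed simp

lemma left_continuous_if:
  fixes a b :: "real \<Rightarrow> real"
  assumes "continuous (at_left t) a" "continuous (at_left t) b"
  shows "continuous (at_left t) (\<lambda>u. if u \<le> c then a u else b u)"
proof (cases "t \<le> c")
  case True
  have "eventually (\<lambda>u. a u = (if u \<le> c then a u else b u)) (at_left t)"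
    using True by (auto simp: eventually_at_filter)
  then have "((\<lambda>u. if u \<le> c then a u else b u) \<longlongrightarrow> a t) (at_left t)"
    using assms(1) unfolding continuous_within by (rule Lim_transform_eventually[rotated])
  with True show ?thesis unfolding continuous_within by simp
next
  case False
  then have "eventually (\<lambda>u. u > c) (at_left t)"
    using eventually_at_left_real[of c t] by (auto elim: eventually_mono)
  then have "eventually (\<lambda>u. b u = (if u \<le> c then a u else b u)) (at_left t)"
    by eventually_elim auto
  then have "((\<lambda>u. if u \<le> c then a u else b u) \<longlongrightarrow> b t) (at_left t)"
    using assms(2) unfolding continuous_within by (rule Lim_transform_eventually[rotated])
  with False show ?thesis unfolding continuous_within by simp
qed

text \<open>
  The indicator of a rectangle is itself left-continuous and adapted.
\<close>

lemma rectangle_in_Pred: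
  assumes "D \<in> predictable_rectangles P G"
  shows "D \<in> sets Pred"
proof -
  have meas: "D \<in> sets Pred"
    if "adapted G X" "left_continuous_paths P X" "D = {x \<in> space P \<times> {0..}. case_prod X x = 1}" for X
  proof -
    have [measurable]: "case_prod X \<in> borel_measurable Pred"
      by (rule left_continuous_predictable) fact+
    have "{x \<in> space Pred. case_prod X x = 1} \<in> sets Pred" by measurable
    then show ?thesis using that(3) by simp
  qed
  from assms consider (zero) A where "A \<in> sets (G 0)" "D = A \<times> {0}"
    | (Ioc) A s t where "0 \<le> s" "A \<in> sets (G s)" "D = A \<times> {s<..t}"
    unfolding predictable_rectangles_def by blast
  then show ?thesis
  proof cases
    case zero
    let ?X = "\<lambda>\<omega> u. if u \<le> 0 then indicator A \<omega> else 0 :: real"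
    have "adapted G ?X" unfolding adapted_def
      using zero(1) by (auto simp: le_less)
    moreover have "left_continuous_paths P ?X"
      unfolding left_continuous_paths_def by (auto intro!: left_continuous_if)
    moreover have "D = {x \<in> space P \<times> {0..}. case_prod ?X x = 1}"
      using zero sets.sets_into_space[OF zero(1)] by (auto simp: indicator_def split: if_splits)
    ultimately show ?thesis by (rule meas)
  next
    case Ioc
    let ?X = "\<lambda>\<omega> u. if u \<le> s then 0 else if u \<le> t then indicator A \<omega> else 0 :: real"
    have "(\<lambda>\<omega>. ?X \<omega> r) \<in> borel_measurable (G r)" if "0 \<le> r" for r
      using sets_G_mono[OF Ioc(1) _ Ioc(2), of r]
      by (cases "r \<le> s"; cases "r \<le> t") auto
    then have "adapted G ?X" unfolding adapted_def by blast
    moreover have "left_continuous_paths P ?X"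
      unfolding left_continuous_paths_def by (auto intro!: left_continuous_if)
    moreover have "D = {x \<in> space P \<times> {0..}. case_prod ?X x = 1}"
      using Ioc sets.sets_into_space[OF Ioc(2)] by (auto simp: indicator_def split: if_splits)
    ultimately show ?thesis by (rule meas)
  qed
qed

lemma left_continuous_discretisation:
  fixes f :: "real \<Rightarrow> real"
  assumes "continuous (at_left u) f"
  shows "(\<lambda>n. f ((of_int \<lceil>real (Suc n) * u\<rceil> - 1) / real (Suc n))) \<longlonglongrightarrow> f u"
proof -
  let ?g = "\<lambda>n. (of_int \<lceil>real (Suc n) * u\<rceil> - 1) / real (Suc n)"
  have bounds: "u - inverse (real (Suc n)) \<le> ?g n \<and> ?g n < u" for n
  proof -
    have "of_int \<lceil>real (Suc n) * u\<rceil> - 1 < real (Suc n) * u" "real (Suc n) * u \<le> of_int \<lceil>real (Suc n) * u\<rceil>"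
      using ceiling_correct[of "real (Suc n) * u"] by auto
    moreover have "u - inverse (real (Suc n)) = (real (Suc n) * u - 1) / real (Suc n)"
      by (simp add: diff_divide_distrib inverse_eq_divide del: of_nat_Suc)
    ultimately show ?thesis
      by (simp add: pos_divide_less_eq divide_right_mono mult.commute del: of_nat_Suc)
  qed
  have "?g \<longlonglongrightarrow> u"
  proof (rule tendsto_sandwich)
    show "(\<lambda>n. u - inverse (real (Suc n))) \<longlonglongrightarrow> u"
      using tendsto_diff[OF tendsto_const LIMSEQ_inverse_real_of_nat, of u] by simp
    show "\<forall>\<^sub>F n in sequentially. u - inverse (real (Suc n)) \<le> ?g n"
      using bounds by (intro always_eventually) blast
    show "\<forall>\<^sub>F n in sequentially. ?g n \<le> u"
      using bounds by (intro always_eventually allI less_imp_le) blast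
  qed simp
  then have "filterlim ?g (at_left u) sequentially"
    using bounds by (auto simp: filterlim_at less_imp_neq simp del: of_nat_Suc)
  then show ?thesis
    using assms unfolding continuous_within by (rule filterlim_compose[rotated])
qed

lemma grid_cell:
  "real k / real (Suc n) < u \<and> u \<le> real (Suc k) / real (Suc n) \<longleftrightarrow> \<lceil>real (Suc n) * u\<rceil> = int (Suc k)"
proof -
  have "real k / real (Suc n) < u \<longleftrightarrow> real k < real (Suc n) * u"
    by (simp only: pos_divide_less_eq of_nat_0_less_iff zero_less_Suc mult.commute)
  moreover have "u \<le> real (Suc k) / real (Suc n) \<longleftrightarrow> real (Suc n) * u \<le> real (Suc k)"
    by (simp only: pos_le_divide_eq of_nat_0_less_iff zero_less_Suc mult.commute)
  ultimately show ?thesis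
    unfolding ceiling_eq_iff by simp
qed

text \<open>
  A left-continuous path is the limit of the step paths that freeze it at the last point of a
  finer and finer grid strictly before the current time; for an adapted process each
  of these step processes is built from rectangles.
\<close>

lemma sets_Pred: "sets Pred = sigma_sets (space P \<times> {0..}) (predictable_rectangles P G)"
proof
  let ?R = "sigma (space P \<times> {0..}) (predictable_rectangles P G)"
  have sp: "space ?R = space P \<times> {0..}"
    by (rule space_measure_of[OF rectangles_subset])
  have rect: "D \<in> sets ?R" if "D \<in> predictable_rectangles P G" for D
    using that by (subst sets_measure_of[OF rectangles_subset]) (rule sigma_sets.Basic)
  have "case_prod X \<in> borel_measurable ?R"
    if "adapted G X" "left_continuous_paths P X" for X
  proof (rule borel_measurable_LIMSEQ_real)
    let ?Y = "\<lambda>n. \<lambda>(\<omega>, u). if u \<le> 0 then X \<omega> 0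
       else X \<omega> ((of_int \<lceil>real (Suc n) * u\<rceil> - 1) / real (Suc n))"
    show "(\<lambda>n. ?Y n x) \<longlonglongrightarrow> case_prod X x" if "x \<in> space ?R" for x
    proof (cases x)
      case (Pair \<omega> u)
      with that sp have "\<omega> \<in> space P" "0 \<le> u" by auto
      then show ?thesis
        using \<open>left_continuous_paths P X\<close> unfolding left_continuous_paths_def Pair
        by (cases "u = 0") (auto intro!: left_continuous_discretisation simp del: of_nat_Suc)
    qed
    show "?Y n \<in> borel_measurable ?R" for n
    proof (rule measurableI)
      fix B :: "real set" assume B: "B \<in> sets borel"
      let ?c = "\<lambda>k. real k / real (Suc n)"
      have XB: "{\<omega> \<in> space P. X \<omega> t \<in> B} \<in> sets (G t)" if "0 \<le> t" for t
      proof -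
        have "(\<lambda>\<omega>. X \<omega> t) -` B \<inter> space (G t) \<in> sets (G t)"
          using \<open>adapted G X\<close> B that unfolding adapted_def by (intro measurable_sets) auto
        moreover have "(\<lambda>\<omega>. X \<omega> t) -` B \<inter> space (G t) = {\<omega> \<in> space P. X \<omega> t \<in> B}"
          using that by auto
        ultimately show ?thesis by simp
      qed
      let ?D = "\<lambda>k. {\<omega> \<in> space P. X \<omega> (?c k) \<in> B} \<times> {?c k<..?c (Suc k)}"
      have Ioc: "?D k \<in> sets ?R" for k
      proof (rule rect)
        show "?D k \<in> predictable_rectangles P G"
          using XB[of "?c k"] by (intro rectangle_Ioc) auto
      qed
      have zero: "{\<omega> \<in> space P. X \<omega> 0 \<in> B} \<times> {0} \<in> sets ?R"
      proof (rule rect)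
        show "{\<omega> \<in> space P. X \<omega> 0 \<in> B} \<times> {0} \<in> predictable_rectangles P G"
          using XB[of 0] by (intro rectangle_zero) auto
      qed
      have eq: "?Y n -` B \<inter> space ?R = {\<omega> \<in> space P. X \<omega> 0 \<in> B} \<times> {0} \<union> (\<Union>k. ?D k)"
      proof (rule set_eqI)
        fix x :: "'a \<times> real"
        obtain \<omega> u where x: "x = (\<omega>, u)" by (cases x)
        show "x \<in> ?Y n -` B \<inter> space ?R \<longleftrightarrow>
          x \<in> {\<omega> \<in> space P. X \<omega> 0 \<in> B} \<times> {0} \<union> (\<Union>k. ?D k)"
        proof (cases "u \<le> 0")
          case True
          moreover have "0 \<le> ?c k" for k by simp
          ultimately have "\<not> ?c k < u" for k
            using order_trans[of u 0] by (metis not_less)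
          then have "x \<notin> (\<Union>k. ?D k)" unfolding x by (simp del: of_nat_Suc)
          with True show ?thesis unfolding sp x by auto
        next
          case False
          define k where "k = nat (\<lceil>real (Suc n) * u\<rceil> - 1)"
          have "0 < real (Suc n) * u" using False by (intro mult_pos_pos) simp_all
          then have k: "\<lceil>real (Suc n) * u\<rceil> = int (Suc k)"
            unfolding k_def by linarith
          have Y: "?Y n x = X \<omega> (?c k)"
            using False unfolding x prod.case k by simp
          have e1: "x \<in> ?Y n -` B \<inter> space ?R \<longleftrightarrow> \<omega> \<in> space P \<and> X \<omega> (?c k) \<in> B"
            unfolding sp vimage_eq Int_iff Y using False x by auto
          have e2: "x \<in> ?D k' \<longleftrightarrow> \<omega> \<in> space P \<and> X \<omega> (?c k') \<in> B \<and> k' = k" for k'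
            unfolding x mem_Sigma_iff greaterThanAtMost_iff grid_cell k of_nat_eq_iff by blast
          have e3: "x \<notin> {\<omega> \<in> space P. X \<omega> 0 \<in> B} \<times> {0}" using False x by simp
          show ?thesis by (simp only: Un_iff UN_iff e1 e2 e3) simp
        qed
      qed
      show "?Y n -` B \<inter> space ?R \<in> sets ?R"
        unfolding eq using Ioc by (intro sets.Un zero sets.countable_UN) blast
    qed simp
  qed
  then have "case_prod X -` B \<inter> (space P \<times> {0..}) \<in> sets ?R"
    if "adapted G X" "left_continuous_paths P X" "B \<in> sets borel" for X B
    using that measurable_sets[of "case_prod X" ?R borel B] sp by auto
  then show "sets Pred \<subseteq> sigma_sets (space P \<times> {0..}) (predictable_rectangles P G)"
    unfolding predictable_sigma_def
    by (subst sets_measure_of[OF predictable_generators_subset], intro sigma_sets_mono)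
       (auto simp: sets_measure_of[OF rectangles_subset])
  show "sigma_sets (space P \<times> {0..}) (predictable_rectangles P G) \<subseteq> sets Pred"
    using sets.sigma_sets_subset[of "predictable_rectangles P G" Pred] rectangle_in_Pred by auto
qed

text \<open>
  Measurability of a map into the predictable \<open>\<sigma>\<close>-algebra thus has to be checked on rectangles only.
\<close>

lemma measurable_PredI:
  assumes "\<And>x. x \<in> space M \<Longrightarrow> f x \<in> space P \<times> {0..}"
    and "\<And>A. A \<in> sets (G 0) \<Longrightarrow> f -` (A \<times> {0}) \<inter> space M \<in> sets M"
    and "\<And>A s t. 0 \<le> s \<Longrightarrow> A \<in> sets (G s) \<Longrightarrow> f -` (A \<times> {s<..t}) \<inter> space M \<in> sets M"
  shows "f \<in> measurable M Pred"
  by (rule measurable_sigma_sets[OF sets_Pred rectangles_subset])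
     (use assms in \<open>auto simp: predictable_rectangles_def\<close>)

text \<open>
  Freezing time outside \<open>[0, t]\<close> sends the predictable \<open>\<sigma>\<close>-algebra to the past of \<open>t\<close>: this is
  the progressive measurability of predictable processes.
\<close>

lemma measurable_clip:
  assumes t: "0 \<le> t"
  shows "(\<lambda>(\<omega>, u). (\<omega>, max 0 (min u t))) \<in> measurable (G t \<Otimes>\<^sub>M borel) Pred"
proof (rule measurable_PredI)
  fix A assume A: "A \<in> sets (G 0)"
  have "A \<in> sets (G t)" using sets_G_mono[OF _ t A] by simp
  moreover have "{u. max 0 (min u t) = 0} \<in> sets borel" by measurable
  moreover have "(\<lambda>(\<omega>, u). (\<omega>, max 0 (min u t))) -` (A \<times> {0}) \<inter> space (G t \<Otimes>\<^sub>M borel)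
    = A \<times> {u. max 0 (min u t) = 0}"
    using sets.sets_into_space[OF \<open>A \<in> sets (G t)\<close>] by (auto simp: space_pair_measure)
  ultimately show "(\<lambda>(\<omega>, u). (\<omega>, max 0 (min u t))) -` (A \<times> {0}) \<inter> space (G t \<Otimes>\<^sub>M borel)
      \<in> sets (G t \<Otimes>\<^sub>M borel)"
    by simp
next
  fix A s r assume s: "(0::real) \<le> s" and A: "A \<in> sets (G s)"
  show "(\<lambda>(\<omega>, u). (\<omega>, max 0 (min u t))) -` (A \<times> {s<..r}) \<inter> space (G t \<Otimes>\<^sub>M borel)
      \<in> sets (G t \<Otimes>\<^sub>M borel)"
  proof (cases "s \<le> t")
    case True
    have At: "A \<in> sets (G t)" using sets_G_mono[OF s True A] .
    have "{u. max 0 (min u t) \<in> {s<..r}} \<in> sets borel" by measurable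
    moreover have "(\<lambda>(\<omega>, u). (\<omega>, max 0 (min u t))) -` (A \<times> {s<..r}) \<inter> space (G t \<Otimes>\<^sub>M borel)
      = A \<times> {u. max 0 (min u t) \<in> {s<..r}}"
      using sets.sets_into_space[OF At] by (auto simp: space_pair_measure)
    ultimately show ?thesis using At by simp
  next
    case False
    then have "(\<lambda>(\<omega>, u). (\<omega>, max 0 (min u t))) -` (A \<times> {s<..r}) \<inter> space (G t \<Otimes>\<^sub>M borel) = {}"
      using s by auto
    then show ?thesis by simp
  qed
qed (use t in \<open>auto simp: space_pair_measure\<close>)

lemma measurable_Pred_at:
  assumes "0 \<le> t"
  shows "(\<lambda>\<omega>. (\<omega>, t)) \<in> measurable (G t) Pred"
proof -
  have "(\<lambda>\<omega>. (\<lambda>(\<omega>, u). (\<omega>, max 0 (min u t))) (\<omega>, t)) \<in> measurable (G t) Pred"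
    by (rule measurable_compose[OF _ measurable_clip[OF assms]]) simp
  then show ?thesis using assms by simp
qed

end

lemma Int_stable_rectangles:
  assumes "is_filtration P G"
  shows "Int_stable (predictable_rectangles P G)"
proof (rule Int_stableI)
  interpret filtered_space P G by standard fact
  fix D E assume D: "D \<in> predictable_rectangles P G" and E: "E \<in> predictable_rectangles P G"
  have empty: "{} \<in> predictable_rectangles P G" using rectangle_zero[OF sets.empty_sets] by simp
  have cases: thesis if "D \<in> predictable_rectangles P G"
    "\<And>A. A \<in> sets (G 0) \<Longrightarrow> D = A \<times> {0} \<Longrightarrow> thesis"
    "\<And>A s t. 0 \<le> s \<Longrightarrow> A \<in> sets (G s) \<Longrightarrow> D = A \<times> {s<..t} \<Longrightarrow> thesis" for D thesis
    using that unfolding predictable_rectangles_def by blast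
  show "D \<inter> E \<in> predictable_rectangles P G"
  proof (rule cases[OF D]; rule cases[OF E])
    fix A B assume "A \<in> sets (G 0)" "D = A \<times> {0}" "B \<in> sets (G 0)" "E = B \<times> {0}"
    moreover from this have "D \<inter> E = (A \<inter> B) \<times> {0}" by auto
    ultimately show ?thesis using rectangle_zero[of "A \<inter> B"] by auto
  next
    fix A B s t assume "A \<in> sets (G 0)" "D = A \<times> {0}" "0 \<le> s" "E = B \<times> {s<..t}"
    then have "D \<inter> E = {}" by auto
    then show ?thesis using empty by simp
  next
    fix A B s t assume "A \<in> sets (G 0)" "E = A \<times> {0}" "0 \<le> s" "D = B \<times> {s<..t}"
    then have "D \<inter> E = {}" by auto
    then show ?thesis using empty by simp
  next
    fix A B s t s' t'
    assume A: "0 \<le> s" "A \<in> sets (G s)" "D = A \<times> {s<..t}"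
      and B: "0 \<le> s'" "B \<in> sets (G s')" "E = B \<times> {s'<..t'}"
    have "D \<inter> E = (A \<inter> B) \<times> {max s s'<..min t t'}" using A B by auto
    moreover have "A \<inter> B \<in> sets (G (max s s'))"
      using sets_G_mono[of s "max s s'" A] sets_G_mono[of s' "max s s'" B] A B by auto
    ultimately show ?thesis using rectangle_Ioc[of "max s s'" "A \<inter> B"] A(1) by simp
  qed
qed

section \<open>Counting processes and their jump times\<close>

definition reaches :: "('a \<Rightarrow> real \<Rightarrow> real) \<Rightarrow> nat \<Rightarrow> 'a \<Rightarrow> bool" where
  "reaches N n \<omega> \<longleftrightarrow> (\<exists>t\<ge>0. real n \<le> N \<omega> t)"

text \<open>
  The value \<open>0\<close> when there is no \<open>n\<close>-th jump is only a default that keeps the function real-valued and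
  nonnegative; \<open>reaches\<close> always tells the two cases apart.
\<close>

definition jump_time :: "('a \<Rightarrow> real \<Rightarrow> real) \<Rightarrow> nat \<Rightarrow> 'a \<Rightarrow> real" where
  "jump_time N n \<omega> = (if reaches N n \<omega> then Inf {t. 0 \<le> t \<and> real n \<le> N \<omega> t} else 0)"

text \<open>
  The integral of \<open>h\<close> against \<open>N(\<omega>, du)\<close> over \<open>(0, \<infinity>)\<close>, jump by jump: the numbering starts at
  \<open>Suc n\<close> because the zeroth jump time is \<open>0\<close> and carries no mass.
\<close>

definition jump_sum :: "('a \<Rightarrow> real \<Rightarrow> real) \<Rightarrow> (real \<Rightarrow> ennreal) \<Rightarrow> 'a \<Rightarrow> ennreal" where
  "jump_sum N h \<omega> = (\<Sum>n. if reaches N (Suc n) \<omega> then h (jump_time N (Suc n) \<omega>) else 0)"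

locale counting_process = filtered_space +
  fixes N :: "'a \<Rightarrow> real \<Rightarrow> real"
  assumes adapted_N: "adapted G N"
    and right_continuous: "\<omega> \<in> space P \<Longrightarrow> 0 \<le> t \<Longrightarrow> continuous (at_right t) (N \<omega>)"
    and mono_N: "\<omega> \<in> space P \<Longrightarrow> mono_on {0..} (N \<omega>)"
    and N_Ints: "\<omega> \<in> space P \<Longrightarrow> 0 \<le> t \<Longrightarrow> N \<omega> t \<in> \<int>"
    and N_0: "\<omega> \<in> space P \<Longrightarrow> N \<omega> 0 = 0"
    and unit_jumps: "\<omega> \<in> space P \<Longrightarrow> 0 < t \<Longrightarrow> N \<omega> t - Lim (at_left t) (N \<omega>) \<in> {0, 1}"
begin

abbreviation J :: "nat \<Rightarrow> 'a \<Rightarrow> bool" where "J \<equiv> reaches N"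
abbreviation T :: "nat \<Rightarrow> 'a \<Rightarrow> real" where "T \<equiv> jump_time N"

lemma N_mono: "\<omega> \<in> space P \<Longrightarrow> 0 \<le> s \<Longrightarrow> s \<le> t \<Longrightarrow> N \<omega> s \<le> N \<omega> t"
  using mono_N[of \<omega>] by (auto simp: mono_on_def)

lemma N_nonneg: "\<omega> \<in> space P \<Longrightarrow> 0 \<le> t \<Longrightarrow> 0 \<le> N \<omega> t"
  using N_mono[of \<omega> 0 t] N_0[of \<omega>] by simp

lemma N_eq_nat: "\<omega> \<in> space P \<Longrightarrow> 0 \<le> t \<Longrightarrow> real (nat \<lfloor>N \<omega> t\<rfloor>) = N \<omega> t"
  using N_Ints[of \<omega> t] N_nonneg[of \<omega> t] by (auto elim!: Ints_cases)

lemma jump_time_nonneg: "0 \<le> T n \<omega>"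
  unfolding jump_time_def reaches_def by (auto intro!: cInf_greatest)

lemma N_jump_time:
  assumes \<omega>: "\<omega> \<in> space P" and r: "J n \<omega>"
  shows "real n \<le> N \<omega> (T n \<omega>)"
proof (rule ccontr)
  let ?S = "{t. 0 \<le> t \<and> real n \<le> N \<omega> t}"
  assume "\<not> real n \<le> N \<omega> (T n \<omega>)"
  then have less: "N \<omega> (T n \<omega>) < real n" by simp
  have "(N \<omega> \<longlongrightarrow> N \<omega> (T n \<omega>)) (at_right (T n \<omega>))"
    using right_continuous[OF \<omega> jump_time_nonneg] by (simp add: continuous_within)
  from order_tendstoD(2)[OF this less]
  obtain b where b: "b > T n \<omega>" "\<And>u. T n \<omega> < u \<Longrightarrow> u < b \<Longrightarrow> N \<omega> u < real n"
    by (auto simp: eventually_at_right[of "T n \<omega>" "T n \<omega> + 1"])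
  have "b \<le> u" if "u \<in> ?S" for u
  proof (rule ccontr)
    assume "\<not> b \<le> u"
    moreover have "\<not> T n \<omega> < u" using b(2)[of u] that calculation by auto
    then have "N \<omega> u \<le> N \<omega> (T n \<omega>)" using that by (intro N_mono[OF \<omega>]) auto
    ultimately show False using that less by auto
  qed
  then have "b \<le> Inf ?S"
    using r by (intro cInf_greatest) (auto simp: reaches_def)
  then show False using b(1) r by (simp add: jump_time_def)
qed

text \<open>
  By right-continuity the infimum defining the jump time is attained, so that jump times are hitting
  times and stopping times of any filtration to which \<open>N\<close> is adapted.
\<close>

lemma jump_time_le_iff:
  assumes \<omega>: "\<omega> \<in> space P" and t: "0 \<le> t"
  shows "J n \<omega> \<and> T n \<omega> \<le> t \<longleftrightarrow> real n \<le> N \<omega> t"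
proof
  assume "J n \<omega> \<and> T n \<omega> \<le> t"
  then show "real n \<le> N \<omega> t"
    using N_jump_time[OF \<omega>, of n] N_mono[OF \<omega> jump_time_nonneg[of n \<omega>], of t] by auto
next
  assume n: "real n \<le> N \<omega> t"
  then have "J n \<omega>" using t by (auto simp: reaches_def)
  moreover have "Inf {t. 0 \<le> t \<and> real n \<le> N \<omega> t} \<le> t"
    using n t by (intro cInf_lower bdd_belowI[of _ 0]) auto
  ultimately show "J n \<omega> \<and> T n \<omega> \<le> t" by (simp add: jump_time_def)
qed

lemma jump_time_pos: "\<omega> \<in> space P \<Longrightarrow> J (Suc n) \<omega> \<Longrightarrow> 0 < T (Suc n) \<omega>"
  using jump_time_le_iff[of \<omega> 0 "Suc n"] N_0[of \<omega>] by auto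

lemma reaches_mono: "J n \<omega> \<Longrightarrow> m \<le> n \<Longrightarrow> J m \<omega>"
  unfolding reaches_def by (meson of_nat_mono order_trans)

lemma left_limit_exists:
  assumes \<omega>: "\<omega> \<in> space P" and t: "0 < t"
  shows "(N \<omega> \<longlongrightarrow> Lim (at_left t) (N \<omega>)) (at_left t)"
proof -
  let ?l = "Sup (N \<omega> ` {0..<t})"
  have bdd: "bdd_above (N \<omega> ` {0..<t})"
    by (rule bdd_aboveI[of _ "N \<omega> t"]) (auto intro: N_mono[OF \<omega>])
  have "(N \<omega> \<longlongrightarrow> ?l) (at_left t)"
  proof (rule order_tendstoI)
    fix a assume "a < ?l"
    then obtain u where u: "0 \<le> u" "u < t" "a < N \<omega> u"
      using less_cSup_iff[OF _ bdd, of a] t by auto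
    have "\<forall>\<^sub>F v in at_left t. v \<in> {u<..<t}"
      using eventually_at_left_real[OF u(2)] .
    then show "\<forall>\<^sub>F v in at_left t. a < N \<omega> v"
      by eventually_elim (use u N_mono[OF \<omega> u(1)] in \<open>auto intro: less_le_trans\<close>)
  next
    fix a assume a: "?l < a"
    have "\<forall>\<^sub>F v in at_left t. v \<in> {0<..<t}"
      using eventually_at_left_real[OF t] .
    then show "\<forall>\<^sub>F v in at_left t. N \<omega> v < a"
    proof eventually_elim
      case (elim v)
      then have "N \<omega> v \<le> ?l" by (intro cSup_upper bdd) auto
      with a show ?case by simp
    qed
  qed
  moreover from this have "Lim (at_left t) (N \<omega>) = ?l"
    by (intro tendsto_Lim) (auto simp: trivial_limit_at_left_real)
  ultimately show ?thesis by simp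
qed

text \<open>
  Two jumps at one time would make the path climb by at least two there.
\<close>

lemma jump_time_strict_mono:
  assumes \<omega>: "\<omega> \<in> space P" and J: "J m \<omega>" and less: "n < m"
  shows "T n \<omega> < T m \<omega>"
proof (rule ccontr)
  define s where "s = T m \<omega>"
  assume "\<not> T n \<omega> < T m \<omega>"
  then have s: "s \<le> T n \<omega>" by (simp add: s_def)
  have "s > 0"
    using jump_time_pos[OF \<omega>, of "m - 1"] J less by (simp add: s_def)
  have "J n \<omega>" using reaches_mono[OF J] less by simp
  have small: "N \<omega> u \<le> real n - 1" if "0 \<le> u" "u < s" for u
  proof -
    have "\<not> real n \<le> N \<omega> u"
      using jump_time_le_iff[OF \<omega> that(1), of n] that s by auto
    moreover from N_Ints[OF \<omega> \<open>0 \<le> u\<close>] obtain z where z: "N \<omega> u = of_int z"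
      by (auto elim: Ints_cases)
    ultimately have "z \<le> int n - 1" by linarith
    then show ?thesis unfolding z by linarith
  qed
  have "\<forall>\<^sub>F v in at_left s. v \<in> {0<..<s}"
    using eventually_at_left_real[OF \<open>s > 0\<close>] .
  then have "\<forall>\<^sub>F v in at_left s. N \<omega> v \<le> real n - 1"
    by eventually_elim (use small in auto)
  then have "Lim (at_left s) (N \<omega>) \<le> real n - 1"
    using left_limit_exists[OF \<omega> \<open>s > 0\<close>] by (intro tendsto_upperbound) (auto simp: trivial_limit_at_left_real)
  moreover have "real m \<le> N \<omega> s" unfolding s_def by (rule N_jump_time[OF \<omega> J])
  moreover have "N \<omega> s - Lim (at_left s) (N \<omega>) \<le> 1"
    using unit_jumps[OF \<omega> \<open>s > 0\<close>] by auto
  ultimately show False using less by simp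
qed

lemma jumps_until:
  assumes \<omega>: "\<omega> \<in> space P" and t: "0 \<le> t"
  shows "J (Suc n) \<omega> \<and> T (Suc n) \<omega> \<le> t \<longleftrightarrow> n < nat \<lfloor>N \<omega> t\<rfloor>"
proof -
  have "n < nat \<lfloor>N \<omega> t\<rfloor> \<longleftrightarrow> real (Suc n) \<le> real (nat \<lfloor>N \<omega> t\<rfloor>)"
    unfolding of_nat_le_iff by auto
  then show ?thesis unfolding jump_time_le_iff[OF assms] N_eq_nat[OF assms] by simp
qed

lemma emeasure_path_measure_Ioc:
  assumes \<omega>: "\<omega> \<in> space P"
  shows "emeasure (path_measure N \<omega>) {a<..b} =
    (if a \<le> b then ennreal (N \<omega> (max 0 b) - N \<omega> (max 0 a)) else 0)"
proof -
  let ?F = "\<lambda>t. N \<omega> (max 0 t)"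
  have mono: "?F x \<le> ?F y" if "x \<le> y" for x y
    using that by (intro N_mono[OF \<omega>]) auto
  have cont: "continuous (at_right a) ?F" for a
  proof (cases "0 \<le> a")
    case True
    have "\<forall>\<^sub>F u in at_right a. N \<omega> u = ?F u"
      using True by (auto simp: eventually_at_filter max_def)
    moreover have "(N \<omega> \<longlongrightarrow> ?F a) (at_right a)"
      using right_continuous[OF \<omega> True] True by (simp add: continuous_within max_def)
    ultimately show ?thesis
      unfolding continuous_within by (rule Lim_transform_eventually[rotated])
  next
    case False
    then have "\<forall>\<^sub>F u in at_right a. N \<omega> 0 = ?F u"
      using eventually_at_right_real[of a 0] by (auto elim!: eventually_mono simp: max_def)
    moreover have "?F a = N \<omega> 0" using False by (simp add: max_def)
    ultimately show ?thesis
      unfolding continuous_within by (auto intro: Lim_transform_eventually[rotated])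
  qed
  show ?thesis
    unfolding path_measure_def by (subst emeasure_interval_measure_Ioc_eq) (auto intro: mono cont)
qed

text \<open>
  A monotone integer-valued path with unit jumps that starts at \<open>0\<close> is determined by its jump times,
  and its Stieltjes measure has a unit mass at each of them.  Both measures give \<open>(a, b]\<close> the number of
  jumps in it.
\<close>

lemma path_measure_eq_distr:
  assumes \<omega>: "\<omega> \<in> space P"
  shows "path_measure N \<omega> =
    distr (density (count_space UNIV) (indicator {n. J (Suc n) \<omega>})) borel (\<lambda>n. T (Suc n) \<omega>)"
    (is "_ = ?D")
proof (rule measure_eqI_generator_eq[where E="range (\<lambda>(a, b). {a<..b::real})" and \<Omega>=UNIV
      and A="\<lambda>i. {- real i<..real i}"])
  let ?F = "\<lambda>t. N \<omega> (max 0 t)"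
  have mono: "?F x \<le> ?F y" if "x \<le> y" for x y
    using that by (intro N_mono[OF \<omega>]) auto
  have Ioc: "emeasure (path_measure N \<omega>) {a<..b} = emeasure ?D {a<..b}" for a b
  proof -
    let ?a = "max 0 a" and ?b = "max 0 b"
    have "emeasure ?D {a<..b} = emeasure (count_space UNIV) {n. J (Suc n) \<omega> \<and> a < T (Suc n) \<omega> \<and> T (Suc n) \<omega> \<le> b}"
    proof -
      have "emeasure ?D {a<..b} =
        emeasure (density (count_space UNIV) (indicator {n. J (Suc n) \<omega>})) {n. a < T (Suc n) \<omega> \<and> T (Suc n) \<omega> \<le> b}"
        by (subst emeasure_distr) (auto intro!: arg_cong2[where f=emeasure])
      also have "\<dots> = (\<integral>\<^sup>+n. indicator {n. J (Suc n) \<omega> \<and> a < T (Suc n) \<omega> \<and> T (Suc n) \<omega> \<le> b} n \<partial>count_space UNIV)"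
        by (subst emeasure_density) (simp, simp, intro nn_integral_cong, simp split: split_indicator)
      also have "\<dots> = emeasure (count_space UNIV) {n. J (Suc n) \<omega> \<and> a < T (Suc n) \<omega> \<and> T (Suc n) \<omega> \<le> b}"
        by (rule nn_integral_indicator) simp
      finally show ?thesis .
    qed
    also have "{n. J (Suc n) \<omega> \<and> a < T (Suc n) \<omega> \<and> T (Suc n) \<omega> \<le> b} =
       {nat \<lfloor>N \<omega> ?a\<rfloor>..<nat \<lfloor>N \<omega> ?b\<rfloor>}"
    proof (rule set_eqI)
      fix n
      have "J (Suc n) \<omega> \<and> a < T (Suc n) \<omega> \<and> T (Suc n) \<omega> \<le> b \<longleftrightarrow>
        \<not> (J (Suc n) \<omega> \<and> T (Suc n) \<omega> \<le> ?a) \<and> (J (Suc n) \<omega> \<and> T (Suc n) \<omega> \<le> ?b)"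
        using jump_time_pos[OF \<omega>, of n] by auto
      then show "n \<in> {n. J (Suc n) \<omega> \<and> a < T (Suc n) \<omega> \<and> T (Suc n) \<omega> \<le> b} \<longleftrightarrow>
        n \<in> {nat \<lfloor>N \<omega> ?a\<rfloor>..<nat \<lfloor>N \<omega> ?b\<rfloor>}"
        by (simp add: jumps_until[OF \<omega>] not_less)
    qed
    also have "emeasure (count_space UNIV) {nat \<lfloor>N \<omega> ?a\<rfloor>..<nat \<lfloor>N \<omega> ?b\<rfloor>}
      = (if a \<le> b then ennreal (?F b - ?F a) else 0)"
    proof (cases "a \<le> b")
      case True
      have "real (nat \<lfloor>N \<omega> ?b\<rfloor> - nat \<lfloor>N \<omega> ?a\<rfloor>) = ?F b - ?F a"
        using mono[OF True] N_eq_nat[OF \<omega>, of ?a] N_eq_nat[OF \<omega>, of ?b]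
        by (simp add: of_nat_diff nat_mono floor_mono)
      then show ?thesis using True by (simp add: ennreal_of_nat_eq_real_of_nat)
    next
      case False
      then have "nat \<lfloor>N \<omega> ?b\<rfloor> \<le> nat \<lfloor>N \<omega> ?a\<rfloor>"
        using mono[of b a] by (simp add: nat_mono floor_mono)
      then show ?thesis using False by simp
    qed
    also have "\<dots> = emeasure (path_measure N \<omega>) {a<..b}"
      by (simp add: emeasure_path_measure_Ioc[OF \<omega>])
    finally show ?thesis by simp
  qed
  show "Int_stable (range (\<lambda>(a, b). {a<..b::real}))"
    by (auto intro!: Int_stableI simp: image_def) (metis Int_greaterThanAtMost)
  show "emeasure (path_measure N \<omega>) X = emeasure ?D X" if "X \<in> range (\<lambda>(a, b). {a<..b::real})" for X
    using that Ioc by auto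
  show "(\<Union>i. {- real i<..real i}) = UNIV"
  proof (intro set_eqI iffI UNIV_I)
    fix x :: real
    obtain i :: nat where "\<bar>x\<bar> < real i" using reals_Archimedean2 by blast
    then show "x \<in> (\<Union>i. {- real i<..real i})" by (intro UN_I[of i]) auto
  qed
  show "emeasure (path_measure N \<omega>) {- real i<..real i} \<noteq> \<infinity>" for i
    by (simp add: emeasure_path_measure_Ioc[OF \<omega>])
qed (auto simp: path_measure_def borel_sigma_sets_Ioc)

lemma nn_integral_path_measure:
  assumes "\<omega> \<in> space P" and [measurable]: "h \<in> borel_measurable borel"
  shows "(\<integral>\<^sup>+u. h u \<partial>path_measure N \<omega>) = jump_sum N h \<omega>"
  unfolding path_measure_eq_distr[OF assms(1)] jump_sum_def
  by (subst nn_integral_distr)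
    (auto simp: nn_integral_density nn_integral_count_space_nat intro!: suminf_cong)

lemma jump_sum_Ioc:
  assumes "\<omega> \<in> space P" "0 \<le> s" "s \<le> t"
  shows "jump_sum N (indicator {s<..t}) \<omega> = ennreal (N \<omega> t - N \<omega> s)"
proof -
  have "{s<..t} \<in> sets (path_measure N \<omega>)" by (simp add: path_measure_def)
  then show ?thesis
    using nn_integral_path_measure[OF assms(1), of "indicator {s<..t}"] assms
    by (simp add: emeasure_path_measure_Ioc)
qed

lemma sets_N_ge: "0 \<le> t \<Longrightarrow> {\<omega> \<in> space P. c \<le> N \<omega> t} \<in> sets (G t)"
proof -
  assume t: "0 \<le> t"
  have [measurable]: "(\<lambda>\<omega>. N \<omega> t) \<in> borel_measurable (G t)"
    using adapted_N t by (simp add: adapted_def)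
  have "{\<omega> \<in> space (G t). c \<le> N \<omega> t} \<in> sets (G t)" by measurable
  with t show ?thesis by simp
qed

text \<open>
  The jump time itself is not known at time \<open>t\<close>, but the part of it that lies before \<open>t\<close> is.
\<close>

lemma measurable_clipped_jump_time:
  assumes t: "0 \<le> t"
  shows "(\<lambda>\<omega>. if real n \<le> N \<omega> t then T n \<omega> else t) \<in> borel_measurable (G t)"
proof (rule borel_measurableI_le)
  fix v
  consider "v < 0" | "0 \<le> v" "v < t" | "t \<le> v" by linarith
  then show "{\<omega> \<in> space (G t). (if real n \<le> N \<omega> t then T n \<omega> else t) \<le> v} \<in> sets (G t)"
  proof cases
    case 1
    have "\<not> (if real n \<le> N \<omega> t then T n \<omega> else t) \<le> v" for \<omega>
      using 1 t jump_time_nonneg[of n \<omega>] by auto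
    then show ?thesis by simp
  next
    case 2
    have "(if real n \<le> N \<omega> t then T n \<omega> else t) \<le> v \<longleftrightarrow> real n \<le> N \<omega> v" if "\<omega> \<in> space P" for \<omega>
      using 2 jump_time_le_iff[OF that, of v n] jump_time_le_iff[OF that, of t n] t
        N_mono[OF that, of v t] by auto
    then have "{\<omega> \<in> space (G t). (if real n \<le> N \<omega> t then T n \<omega> else t) \<le> v} = {\<omega> \<in> space P. real n \<le> N \<omega> v}"
      unfolding space_G[OF t] by blast
    then show ?thesis using sets_G_mono[OF 2(1) less_imp_le[OF 2(2)] sets_N_ge[OF 2(1)]] by simp
  next
    case 3
    have "(if real n \<le> N \<omega> t then T n \<omega> else t) \<le> v" if "\<omega> \<in> space P" for \<omega>
      using 3 jump_time_le_iff[OF that t, of n] by auto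
    then have "{\<omega> \<in> space (G t). (if real n \<le> N \<omega> t then T n \<omega> else t) \<le> v} = space (G t)"
      unfolding space_G[OF t] by blast
    then show ?thesis by simp
  qed
qed

lemma measurable_at_clipped_jump_time:
  assumes t: "0 \<le> t"
  shows "(\<lambda>\<omega>. (\<omega>, if real n \<le> N \<omega> t then T n \<omega> else t)) \<in> measurable (G t) Pred"
proof -
  let ?c = "\<lambda>\<omega>. if real n \<le> N \<omega> t then T n \<omega> else t"
  have [measurable]: "?c \<in> borel_measurable (G t)" by (rule measurable_clipped_jump_time[OF t])
  have m: "(\<lambda>\<omega>. (\<lambda>(\<omega>, u). (\<omega>, max 0 (min u t))) (\<omega>, ?c \<omega>)) \<in> measurable (G t) Pred"
    by (rule measurable_compose[OF _ measurable_clip[OF t]]) measurable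
  have "max 0 (min (?c \<omega>) t) = ?c \<omega>" if "\<omega> \<in> space (G t)" for \<omega>
    using that t jump_time_le_iff[of \<omega> t n] jump_time_nonneg[of n \<omega>] by auto
  then show ?thesis
    by (intro measurable_cong[THEN iffD1, OF _ m]) auto
qed

text \<open>
  After the \<open>n\<close>-th jump a value observed at that jump is constant in time, and at any time strictly
  after it the value is known: the process is left-continuous and adapted.
\<close>

lemma predictable_after_jump:
  fixes X :: "'a \<Rightarrow> real \<Rightarrow> real"
  assumes X: "case_prod X \<in> borel_measurable Pred"
  shows "(\<lambda>(\<omega>, u). if J n \<omega> \<and> T n \<omega> < u then X \<omega> (T n \<omega>) else c) \<in> borel_measurable Pred"
proof -
  let ?Y = "\<lambda>\<omega> u. if J n \<omega> \<and> T n \<omega> < u then X \<omega> (T n \<omega>) else c"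
  have "adapted G ?Y" unfolding adapted_def
  proof (intro allI impI)
    fix t :: real assume t: "0 \<le> t"
    let ?c = "\<lambda>\<omega>. if real n \<le> N \<omega> t then T n \<omega> else t"
    have [measurable]: "?c \<in> borel_measurable (G t)" by (rule measurable_clipped_jump_time[OF t])
    have [measurable]: "(\<lambda>\<omega>. X \<omega> (?c \<omega>)) \<in> borel_measurable (G t)"
      using measurable_compose[OF measurable_at_clipped_jump_time[OF t] X] by simp
    have m: "(\<lambda>\<omega>. if ?c \<omega> < t then X \<omega> (?c \<omega>) else c) \<in> borel_measurable (G t)"
      by measurable
    show "(\<lambda>\<omega>. ?Y \<omega> t) \<in> borel_measurable (G t)"
      by (rule measurable_cong[THEN iffD1, OF _ m])
        (use t jump_time_le_iff[of _ t n] in \<open>auto dest: less_imp_le\<close>)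
  qed
  moreover have "left_continuous_paths P ?Y" unfolding left_continuous_paths_def
  proof (intro ballI allI impI)
    fix \<omega> and t :: real assume "0 < t"
    show "continuous (at_left t) (?Y \<omega>)"
    proof (cases "J n \<omega>")
      case True
      then have "?Y \<omega> = (\<lambda>u. if u \<le> T n \<omega> then c else X \<omega> (T n \<omega>))" by auto
      then show ?thesis by (auto intro!: left_continuous_if)
    qed simp
  qed
  ultimately have "case_prod ?Y \<in> borel_measurable Pred"
    by (rule left_continuous_predictable)
  then show ?thesis by (simp add: case_prod_beta)
qed

lemma pred_after_jump [measurable]:
  "Measurable.pred Pred (\<lambda>x. J n (fst x) \<and> T n (fst x) < snd x)"
proof -
  have [measurable]: "(\<lambda>(\<omega>, u). if J n \<omega> \<and> T n \<omega> < u then 1 else 0 :: real) \<in> borel_measurable Pred"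
    using predictable_after_jump[of "\<lambda>_ _. 1" n 0] by simp
  have "Measurable.pred Pred (\<lambda>x. (\<lambda>(\<omega>, u). if J n \<omega> \<and> T n \<omega> < u then 1 else 0 :: real) x = 1)"
    by measurable
  moreover have "((\<lambda>(\<omega>, u). if J n \<omega> \<and> T n \<omega> < u then 1 else 0 :: real) x = 1) \<longleftrightarrow>
      J n (fst x) \<and> T n (fst x) < snd x" for x
    by (simp add: case_prod_beta)
  ultimately show ?thesis by simp
qed

end

section \<open>Doleans measures\<close>

context filtered_space
begin

lemma sets_Pred_Ici:
  assumes "0 \<le> s" "A \<in> sets (G s)"
  shows "A \<times> {s<..} \<in> sets Pred"
proof -
  have "A \<times> {s<..} = (\<Union>n. A \<times> {s<..real n})"
    using real_arch_simple by auto
  moreover have "A \<times> {s<..real n} \<in> sets Pred" for n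
    by (intro rectangle_in_Pred rectangle_Ioc assms)
  ultimately show ?thesis by auto
qed

lemma sets_Pred_cylinder:
  assumes "A \<in> sets (G 0)"
  shows "A \<times> {0..} \<in> sets Pred"
proof -
  have "A \<times> {0..} = A \<times> {0} \<union> A \<times> {0::real<..}" by auto
  then show ?thesis
    using sets_Pred_Ici[OF _ assms] rectangle_in_Pred[OF rectangle_zero[of A G P]] assms by simp
qed

lemma measurable_section [measurable]:
  assumes "\<omega> \<in> space P"
  shows "(\<lambda>u. (\<omega>, max 0 u)) \<in> measurable borel Pred"
proof (rule measurable_PredI)
  fix A assume "A \<in> sets (G 0)"
  have "(\<lambda>u. (\<omega>, max 0 u)) -` (A \<times> {0}) \<inter> space borel = (if \<omega> \<in> A then {u::real. max 0 u = 0} else {})"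
    by auto
  moreover have "{u::real. max 0 u = 0} \<in> sets borel" by measurable
  ultimately show "(\<lambda>u::real. (\<omega>, max 0 u)) -` (A \<times> {0}) \<inter> space borel \<in> sets borel" by (simp split: if_splits)
next
  fix A :: "'a set" and s t :: real
  have "(\<lambda>u. (\<omega>, max 0 u)) -` (A \<times> {s<..t}) \<inter> space borel = (if \<omega> \<in> A then {u. max 0 u \<in> {s<..t}} else {})"
    by auto
  moreover have "{u. max 0 u \<in> {s<..t}} \<in> sets borel" by measurable
  ultimately show "(\<lambda>u. (\<omega>, max 0 u)) -` (A \<times> {s<..t}) \<inter> space borel \<in> sets borel" by (simp split: if_splits)
qed (use assms in auto)

lemma measurable_snd_Pred [measurable]: "snd \<in> borel_measurable Pred"
  using left_continuous_predictable[of "\<lambda>_ u. u"]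
  by (auto simp: adapted_def left_continuous_paths_def case_prod_beta')

text \<open>
  Running time integrals of predictable processes are predictable: the integrand, seen
  as a function of the current time \<open>u\<close> and of the integration variable \<open>v \<le> u\<close>, uses only
  what is known before \<open>u\<close>.
\<close>

lemma measurable_before:
  "(\<lambda>x. (fst (fst x), max 0 (min (snd x) (snd (fst x))))) \<in> measurable (Pred \<Otimes>\<^sub>M borel) Pred"
  (is "?f \<in> _")
proof (rule measurable_PredI)
  fix A assume A: "A \<in> sets (G 0)"
  have "?f -` (A \<times> {0}) \<inter> space (Pred \<Otimes>\<^sub>M borel) =
    {x \<in> space (Pred \<Otimes>\<^sub>M borel). fst x \<in> A \<times> {0..} \<and> max 0 (min (snd x) (snd (fst x))) = 0}"
    by (auto simp: space_pair_measure)
  moreover have [measurable]: "A \<times> {0..} \<in> sets Pred" by (rule sets_Pred_cylinder[OF A])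
  have "{x \<in> space (Pred \<Otimes>\<^sub>M borel). fst x \<in> A \<times> {0..} \<and> max 0 (min (snd x) (snd (fst x))) = 0}
    \<in> sets (Pred \<Otimes>\<^sub>M borel)" by measurable
  ultimately show "?f -` (A \<times> {0}) \<inter> space (Pred \<Otimes>\<^sub>M borel) \<in> sets (Pred \<Otimes>\<^sub>M borel)" by simp
next
  fix A and s t :: real assume s: "0 \<le> s" and A: "A \<in> sets (G s)"
  have "?f -` (A \<times> {s<..t}) \<inter> space (Pred \<Otimes>\<^sub>M borel) =
    {x \<in> space (Pred \<Otimes>\<^sub>M borel). fst x \<in> A \<times> {s<..} \<and> max 0 (min (snd x) (snd (fst x))) \<in> {s<..t}}"
    using s by (auto simp: space_pair_measure)
  moreover have [measurable]: "A \<times> {s<..} \<in> sets Pred" by (rule sets_Pred_Ici[OF s A])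
  have "{x \<in> space (Pred \<Otimes>\<^sub>M borel). fst x \<in> A \<times> {s<..} \<and> max 0 (min (snd x) (snd (fst x))) \<in> {s<..t}}
    \<in> sets (Pred \<Otimes>\<^sub>M borel)" by measurable
  ultimately show "?f -` (A \<times> {s<..t}) \<inter> space (Pred \<Otimes>\<^sub>M borel) \<in> sets (Pred \<Otimes>\<^sub>M borel)" by simp
qed (auto simp: space_pair_measure)

lemma measurable_running_nn_integral:
  assumes a: "a \<in> borel_measurable Pred"
  shows "(\<lambda>x. \<integral>\<^sup>+v. a (fst x, v) * indicator {0..snd x} v \<partial>lborel) \<in> borel_measurable Pred"
proof -
  have [measurable]: "(\<lambda>x. a (fst (fst x), max 0 (min (snd x) (snd (fst x))))) \<in> borel_measurable (Pred \<Otimes>\<^sub>M borel)"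
    using measurable_compose[OF measurable_before a] by simp
  have "(\<lambda>x. \<integral>\<^sup>+v. a (fst x, max 0 (min v (snd x))) * indicator {0..snd x} v \<partial>lborel) \<in> borel_measurable Pred"
    unfolding indicator_def atLeastAtMost_iff by measurable
  moreover have "(\<integral>\<^sup>+v. a (fst x, max 0 (min v (snd x))) * indicator {0..snd x} v \<partial>lborel) =
    (\<integral>\<^sup>+v. a (fst x, v) * indicator {0..snd x} v \<partial>lborel)" for x
    by (intro nn_integral_cong) (auto split: split_indicator)
  ultimately show ?thesis by simp
qed

lemma measurable_running_integral:
  fixes a :: "'a \<times> real \<Rightarrow> real"
  assumes a: "a \<in> borel_measurable Pred"
  shows "(\<lambda>x. LINT v:{0..snd x}|lborel. a (fst x, v)) \<in> borel_measurable Pred"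
proof -
  have [measurable]: "(\<lambda>x. a (fst (fst x), max 0 (min (snd x) (snd (fst x))))) \<in> borel_measurable (Pred \<Otimes>\<^sub>M borel)"
    using measurable_compose[OF measurable_before a] by simp
  have "(\<lambda>x. \<integral>v. indicator {0..snd x} v *\<^sub>R a (fst x, max 0 (min v (snd x))) \<partial>lborel) \<in> borel_measurable Pred"
    unfolding indicator_def atLeastAtMost_iff by measurable
  moreover have "(\<integral>v. indicator {0..snd x} v *\<^sub>R a (fst x, max 0 (min v (snd x))) \<partial>lborel) =
    (LINT v:{0..snd x}|lborel. a (fst x, v))" for x
    unfolding set_lebesgue_integral_def
    by (intro Bochner_Integration.integral_cong) (auto split: split_indicator)
  ultimately show ?thesis by simp
qed

end

text \<open>
  The expected number of jumps in a predictable set, and the expected time spent in it.  Writing both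
  as image measures of products gives their countable additivity and their integrals at once.
\<close>

definition jump_measure ::
    "'a measure \<Rightarrow> (real \<Rightarrow> 'a measure) \<Rightarrow> ('a \<Rightarrow> real \<Rightarrow> real) \<Rightarrow> 'a measure \<Rightarrow> ('a \<times> real) measure" where
  "jump_measure P G N R =
     distr (density (count_space UNIV \<Otimes>\<^sub>M R) (\<lambda>x. indicator {\<omega>. reaches N (Suc (fst x)) \<omega>} (snd x)))
       (predictable_sigma P G) (\<lambda>x. (snd x, jump_time N (Suc (fst x)) (snd x)))"

definition time_measure ::
    "'a measure \<Rightarrow> (real \<Rightarrow> 'a measure) \<Rightarrow> 'a measure \<Rightarrow> ('a \<times> real) measure" where
  "time_measure P G R =
     distr (density (R \<Otimes>\<^sub>M lborel) (\<lambda>x. indicator {0..} (snd x)))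
       (predictable_sigma P G) (\<lambda>x. (fst x, max 0 (snd x)))"

text \<open>
  The measure \<open>R\<close> is kept apart from the \<open>P\<close> that carries the filtration, because everything below is
  needed both for the Poisson measure and for the measure with the likelihood as its density.
\<close>

locale doleans = counting_process P G N + R: finite_measure R
  for P :: "'a measure" and G N and R :: "'a measure" +
  assumes space_R: "space R = space P"
    and sets_G_R: "0 \<le> t \<Longrightarrow> sets (G t) \<subseteq> sets R"
begin

abbreviation muN :: "('a \<times> real) measure" where "muN \<equiv> jump_measure P G N R"
abbreviation muL :: "('a \<times> real) measure" where "muL \<equiv> time_measure P G R"

lemma subalgebra_R: "0 \<le> t \<Longrightarrow> subalgebra R (G t)"
  using sets_G_R by (simp add: subalgebra_def space_R)

lemma measurable_from_G: "0 \<le> t \<Longrightarrow> f \<in> measurable (G t) M \<Longrightarrow> f \<in> measurable R M"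
  by (rule measurable_from_subalg[OF subalgebra_R])

lemma sets_reaches: "{\<omega> \<in> space R. J n \<omega>} \<in> sets R"
proof -
  have "J n \<omega> \<longleftrightarrow> (\<exists>k. real n \<le> N \<omega> (real k))" if "\<omega> \<in> space P" for \<omega>
  proof
    assume "J n \<omega>"
    then obtain t where t: "0 \<le> t" "real n \<le> N \<omega> t" by (auto simp: reaches_def)
    obtain k where "t \<le> real k" using real_arch_simple by blast
    with t that have "real n \<le> N \<omega> (real k)" using N_mono[of \<omega> t "real k"] by simp
    then show "\<exists>k. real n \<le> N \<omega> (real k)" ..
  next
    assume "\<exists>k. real n \<le> N \<omega> (real k)"
    then show "J n \<omega>" unfolding reaches_def by (meson of_nat_0_le_iff)
  qed
  then have "{\<omega> \<in> space R. J n \<omega>} = (\<Union>k. {\<omega> \<in> space P. real n \<le> N \<omega> (real k)})"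
    unfolding space_R by blast
  moreover have "{\<omega> \<in> space P. real n \<le> N \<omega> (real k)} \<in> sets R" for k
    using sets_N_ge[of "real k" "real n"] sets_G_R[of "real k"] by (meson of_nat_0_le_iff subsetD)
  ultimately show ?thesis by auto
qed

lemma pred_reaches [measurable]: "Measurable.pred R (J n)"
  using sets_reaches by (simp add: pred_def)

lemma measurable_jump_time [measurable]: "T n \<in> borel_measurable R"
proof (rule borel_measurableI_le)
  fix v
  show "{\<omega> \<in> space R. T n \<omega> \<le> v} \<in> sets R"
  proof (cases "0 \<le> v")
    case True
    have "T n \<omega> \<le> v \<longleftrightarrow> \<not> J n \<omega> \<or> real n \<le> N \<omega> v" if "\<omega> \<in> space P" for \<omega>
      using jump_time_le_iff[OF that True, of n] True by (auto simp: jump_time_def)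
    then have "{\<omega> \<in> space R. T n \<omega> \<le> v} = {\<omega> \<in> space R. \<not> J n \<omega>} \<union> {\<omega> \<in> space P. real n \<le> N \<omega> v}"
      unfolding space_R by blast
    moreover have "{\<omega> \<in> space P. real n \<le> N \<omega> v} \<in> sets R"
      using sets_N_ge[OF True] sets_G_R[OF True] by blast
    moreover have "{\<omega> \<in> space R. \<not> J n \<omega>} \<in> sets R" by measurable
    ultimately show ?thesis by simp
  next
    case False
    then have "\<not> T n \<omega> \<le> v" for \<omega> using jump_time_nonneg[of n \<omega>] by linarith
    then show ?thesis by simp
  qed
qed

lemma measurable_at_random_time:
  assumes [measurable]: "\<tau> \<in> borel_measurable M" "f \<in> measurable M R"
    and nn: "\<And>x. x \<in> space M \<Longrightarrow> 0 \<le> \<tau> x"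
  shows "(\<lambda>x. (f x, \<tau> x)) \<in> measurable M Pred"
proof (rule measurable_PredI)
  have A: "A \<in> sets R" if "A \<in> sets (G s)" "0 \<le> s" for A s
    using that sets_G_R by blast
  fix A assume "A \<in> sets (G 0)"
  then have [measurable]: "A \<in> sets R" by (auto intro: A)
  have "(\<lambda>x. (f x, \<tau> x)) -` (A \<times> {0}) \<inter> space M = {x \<in> space M. f x \<in> A \<and> \<tau> x = 0}" by auto
  also have "\<dots> \<in> sets M" by measurable
  finally show "(\<lambda>x. (f x, \<tau> x)) -` (A \<times> {0}) \<inter> space M \<in> sets M" .
next
  fix A s t assume "(0::real) \<le> s" "A \<in> sets (G s)"
  then have [measurable]: "A \<in> sets R" using sets_G_R by blast
  have "(\<lambda>x. (f x, \<tau> x)) -` (A \<times> {s<..t}) \<inter> space M = {x \<in> space M. f x \<in> A \<and> \<tau> x \<in> {s<..t}}" by auto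
  also have "\<dots> \<in> sets M" by measurable
  finally show "(\<lambda>x. (f x, \<tau> x)) -` (A \<times> {s<..t}) \<inter> space M \<in> sets M" .
next
  fix x assume "x \<in> space M"
  then show "(f x, \<tau> x) \<in> space P \<times> {0..}"
    using nn measurable_space[OF assms(2)] by (auto simp: space_R)
qed

lemma measurable_at_jump_time [measurable]: "(\<lambda>\<omega>. (\<omega>, T n \<omega>)) \<in> measurable R Pred"
  by (rule measurable_at_random_time) (auto simp: jump_time_nonneg)

lemma measurable_R_time [measurable]: "(\<lambda>x. (fst x, max 0 (snd x))) \<in> measurable (R \<Otimes>\<^sub>M borel) Pred"
  by (rule measurable_at_random_time) auto

lemma measurable_jump_enumeration [measurable]:
  "(\<lambda>x. (snd x, T (Suc (fst x)) (snd x))) \<in> measurable (count_space UNIV \<Otimes>\<^sub>M R) Pred"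
  by (rule measurable_pair_measure_countable1) auto

lemma sets_mu [simp, measurable_cong]: "sets muN = sets Pred" "sets muL = sets Pred"
  by (simp_all add: jump_measure_def time_measure_def)

lemma space_mu [simp]: "space muN = space P \<times> {0..}" "space muL = space P \<times> {0..}"
  by (simp_all add: jump_measure_def time_measure_def)

lemma nn_integral_jump_measure:
  assumes [measurable]: "H \<in> borel_measurable Pred"
  shows "(\<integral>\<^sup>+x. H x \<partial>muN) = (\<integral>\<^sup>+\<omega>. jump_sum N (\<lambda>u. H (\<omega>, u)) \<omega> \<partial>R)"
proof -
  let ?h = "\<lambda>x. indicator {\<omega>. J (Suc (fst x)) \<omega>} (snd x) * H (snd x, T (Suc (fst x)) (snd x))"
  have [measurable]: "(\<lambda>\<omega>. H (\<omega>, T n \<omega>)) \<in> borel_measurable R" for n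
    by (rule measurable_compose[OF measurable_at_jump_time assms])
  have [measurable]: "(\<lambda>x. H (snd x, T (Suc (fst x)) (snd x))) \<in> borel_measurable (count_space UNIV \<Otimes>\<^sub>M R)"
    by (rule measurable_compose[OF measurable_jump_enumeration assms])
  have "(\<integral>\<^sup>+x. H x \<partial>muN) = (\<integral>\<^sup>+x. ?h x \<partial>(count_space UNIV \<Otimes>\<^sub>M R))"
    unfolding jump_measure_def by (simp add: nn_integral_distr nn_integral_density)
  also have "\<dots> = (\<integral>\<^sup>+n. \<integral>\<^sup>+\<omega>. ?h (n, \<omega>) \<partial>R \<partial>count_space UNIV)"
    by (rule R.nn_integral_fst[symmetric]) measurable
  also have "\<dots> = (\<Sum>n. \<integral>\<^sup>+\<omega>. ?h (n, \<omega>) \<partial>R)"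
    by (rule nn_integral_count_space_nat)
  also have "\<dots> = (\<integral>\<^sup>+\<omega>. (\<Sum>n. ?h (n, \<omega>)) \<partial>R)"
    unfolding fst_conv snd_conv indicator_def by (rule nn_integral_suminf[symmetric]) simp
  also have "\<dots> = (\<integral>\<^sup>+\<omega>. jump_sum N (\<lambda>u. H (\<omega>, u)) \<omega> \<partial>R)"
    unfolding jump_sum_def by (intro nn_integral_cong suminf_cong) (auto simp: indicator_def)
  finally show ?thesis .
qed

lemma measurable_jump_sum:
  assumes "H \<in> borel_measurable Pred"
  shows "(\<lambda>\<omega>. jump_sum N (\<lambda>u. H (\<omega>, u)) \<omega>) \<in> borel_measurable R"
proof -
  have [measurable]: "(\<lambda>\<omega>. H (\<omega>, T n \<omega>)) \<in> borel_measurable R" for n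
    by (rule measurable_compose[OF measurable_at_jump_time assms])
  show ?thesis unfolding jump_sum_def by measurable
qed

lemma nn_integral_time_measure:
  assumes [measurable]: "H \<in> borel_measurable Pred"
  shows "(\<integral>\<^sup>+x. H x \<partial>muL) = (\<integral>\<^sup>+\<omega>. (\<integral>\<^sup>+u. H (\<omega>, u) * indicator {0..} u \<partial>lborel) \<partial>R)"
proof -
  let ?h = "\<lambda>x. indicator {0..} (snd x) * H (fst x, max 0 (snd x))"
  have [measurable]: "(\<lambda>x. H (fst x, max 0 (snd x))) \<in> borel_measurable (R \<Otimes>\<^sub>M borel)"
    by (rule measurable_compose[OF measurable_R_time assms])
  have "(\<integral>\<^sup>+x. H x \<partial>muL) = (\<integral>\<^sup>+x. ?h x \<partial>(R \<Otimes>\<^sub>M lborel))"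
    unfolding time_measure_def by (simp add: nn_integral_distr nn_integral_density)
  also have "\<dots> = (\<integral>\<^sup>+\<omega>. \<integral>\<^sup>+u. ?h (\<omega>, u) \<partial>lborel \<partial>R)"
    by (rule lborel.nn_integral_fst[symmetric]) measurable
  also have "\<dots> = (\<integral>\<^sup>+\<omega>. (\<integral>\<^sup>+u. H (\<omega>, u) * indicator {0..} u \<partial>lborel) \<partial>R)"
    by (intro nn_integral_cong) (auto split: split_indicator)
  finally show ?thesis .
qed

text \<open>
  Null sets of the two Doleans measures in terms of single paths.
\<close>

lemma AE_jump_measure:
  assumes D: "{x \<in> space Pred. Q x} \<in> sets Pred"
  shows "(AE x in muN. Q x) \<longleftrightarrow> (AE \<omega> in R. \<forall>n. J (Suc n) \<omega> \<longrightarrow> Q (\<omega>, T (Suc n) \<omega>))"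
proof -
  let ?M = "count_space UNIV \<Otimes>\<^sub>M R"
  let ?Q = "\<lambda>x. J (Suc (fst x)) (snd x) \<longrightarrow> Q (snd x, T (Suc (fst x)) (snd x))"
  have Q: "Measurable.pred Pred Q" using D by (simp add: pred_def)
  have [measurable]: "Measurable.pred R (\<lambda>\<omega>. Q (\<omega>, T n \<omega>))" for n
    by (rule measurable_compose[OF measurable_at_jump_time Q])
  have m: "Measurable.pred ?M ?Q"
    by (rule measurable_pair_measure_countable1) auto
  interpret pair_sigma_finite "count_space (UNIV :: nat set)" R
    by (intro pair_sigma_finite.intro sigma_finite_measure_count_space R.sigma_finite_measure_axioms)
  have "(AE x in muN. Q x) \<longleftrightarrow> (AE x in ?M. ?Q x)"
    unfolding jump_measure_def
    by (subst AE_distr_iff[OF _ D]) (auto simp: AE_density indicator_def)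
  also have "\<dots> \<longleftrightarrow> (AE n in count_space UNIV. AE \<omega> in R. ?Q (n, \<omega>))"
  proof
    assume "AE x in ?M. ?Q x" then show "AE n in count_space UNIV. AE \<omega> in R. ?Q (n, \<omega>)"
      by (rule AE_pair)
  next
    assume "AE n in count_space UNIV. AE \<omega> in R. ?Q (n, \<omega>)"
    then show "AE x in ?M. ?Q x" using m by (intro AE_pair_measure) (simp_all add: pred_def)
  qed
  also have "\<dots> \<longleftrightarrow> (AE \<omega> in R. \<forall>n. J (Suc n) \<omega> \<longrightarrow> Q (\<omega>, T (Suc n) \<omega>))"
    by (simp add: AE_count_space AE_all_countable)
  finally show ?thesis .
qed

lemma AE_time_measure:
  assumes D: "{x \<in> space Pred. Q x} \<in> sets Pred"
  shows "(AE x in muL. Q x) \<longleftrightarrow> (AE \<omega> in R. AE u in lborel. 0 \<le> u \<longrightarrow> Q (\<omega>, u))"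
proof -
  let ?M = "R \<Otimes>\<^sub>M lborel"
  let ?Q = "\<lambda>x. 0 \<le> snd x \<longrightarrow> Q (fst x, max 0 (snd x))"
  have Q: "Measurable.pred Pred Q" using D by (simp add: pred_def)
  have [measurable]: "Measurable.pred (R \<Otimes>\<^sub>M borel) (\<lambda>x. Q (fst x, max 0 (snd x)))"
    by (rule measurable_compose[OF measurable_R_time Q])
  have m: "Measurable.pred ?M ?Q" by measurable
  interpret pair_sigma_finite R lborel
    by (intro pair_sigma_finite.intro sigma_finite_lborel R.sigma_finite_measure_axioms)
  have "(AE x in muL. Q x) \<longleftrightarrow> (AE x in ?M. ?Q x)"
    unfolding time_measure_def
    by (subst AE_distr_iff[OF _ D]) (auto simp: AE_density indicator_def)
  also have "\<dots> \<longleftrightarrow> (AE \<omega> in R. AE u in lborel. ?Q (\<omega>, u))"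
  proof
    assume "AE x in ?M. ?Q x" then show "AE \<omega> in R. AE u in lborel. ?Q (\<omega>, u)"
      by (rule AE_pair)
  next
    assume "AE \<omega> in R. AE u in lborel. ?Q (\<omega>, u)"
    then show "AE x in ?M. ?Q x" using m by (intro AE_pair_measure) (simp_all add: pred_def)
  qed
  also have "\<dots> \<longleftrightarrow> (AE \<omega> in R. AE u in lborel. 0 \<le> u \<longrightarrow> Q (\<omega>, u))"
    by (intro AE_cong) (auto simp: max_def)
  finally show ?thesis .
qed

end

text \<open>
  Rectangles are closed under intersection and generate, so measures that are finite on bounded times
  agree as soon as they agree on rectangles.
\<close>

lemma (in filtered_space) measure_eqI_Pred:
  assumes sets: "sets M = sets Pred" "sets M' = sets Pred"
    and zero: "\<And>A. A \<in> sets (G 0) \<Longrightarrow> emeasure M (A \<times> {0}) = emeasure M' (A \<times> {0})"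
    and Ioc: "\<And>A s t. 0 \<le> s \<Longrightarrow> s \<le> t \<Longrightarrow> A \<in> sets (G s) \<Longrightarrow>
      emeasure M (A \<times> {s<..t}) = emeasure M' (A \<times> {s<..t})"
    and fin: "emeasure M (space P \<times> {0}) \<noteq> \<infinity>" "\<And>n::nat. emeasure M (space P \<times> {0<..real n}) \<noteq> \<infinity>"
  shows "M = M'"
proof (rule measure_eqI_generator_eq_countable[where E="predictable_rectangles P G" and \<Omega>="space P \<times> {0..}"
      and A="insert (space P \<times> {0}) (range (\<lambda>n::nat. space P \<times> {0<..real n}))"])
  show "Int_stable (predictable_rectangles P G)" by (rule Int_stable_rectangles[OF filtration])
  show "predictable_rectangles P G \<subseteq> Pow (space P \<times> {0..})" by (rule rectangles_subset)
  show "sets M = sigma_sets (space P \<times> {0..}) (predictable_rectangles P G)"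
    "sets M' = sigma_sets (space P \<times> {0..}) (predictable_rectangles P G)"
    using sets sets_Pred by auto
  show "emeasure M X = emeasure M' X" if X: "X \<in> predictable_rectangles P G" for X
  proof -
    from X consider A where "A \<in> sets (G 0)" "X = A \<times> {0}"
      | A s t where "0 \<le> s" "A \<in> sets (G s)" "X = A \<times> {s<..t}"
      unfolding predictable_rectangles_def by blast
    then show ?thesis
    proof cases
      case 2
      then show ?thesis by (cases "s \<le> t") (auto intro: Ioc)
    qed (auto intro: zero)
  qed
  show "insert (space P \<times> {0}) (range (\<lambda>n::nat. space P \<times> {0<..real n})) \<subseteq> predictable_rectangles P G"
    using sets_G_space[of 0] by (auto intro: rectangle_zero rectangle_Ioc)
  show "\<Union> (insert (space P \<times> {0}) (range (\<lambda>n::nat. space P \<times> {0<..real n}))) = space P \<times> {0..}"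
  proof (rule set_eqI)
    fix x :: "'a \<times> real"
    obtain \<omega> u where x: "x = (\<omega>, u)" by (cases x)
    obtain n where "u \<le> real n" using real_arch_simple by blast
    then show "x \<in> \<Union> (insert (space P \<times> {0}) (range (\<lambda>n::nat. space P \<times> {0<..real n}))) \<longleftrightarrow> x \<in> space P \<times> {0..}"
      unfolding x by auto
  qed
qed (use fin in auto)

lemma (in filtered_space) section_null_iff:
  assumes \<omega>: "\<omega> \<in> space P" and D: "D \<in> sets Pred"
  shows "(\<integral>\<^sup>+u. indicator D (\<omega>, u) * indicator {0..} u \<partial>lborel) = (0 :: ennreal) \<longleftrightarrow>
    (AE u in lborel. 0 \<le> u \<longrightarrow> (\<omega>, u) \<notin> D)"
proof -
  have "(\<lambda>u. indicator D (\<omega>, max 0 u) :: ennreal) \<in> borel_measurable borel"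
    by (rule measurable_compose[OF measurable_section[OF \<omega>] borel_measurable_indicator[OF D]])
  then have m: "(\<lambda>u. indicator D (\<omega>, max 0 u) * indicator {0..} u :: ennreal) \<in> borel_measurable lborel"
    by simp
  have eq: "indicator D (\<omega>, max 0 u) * indicator {0..} u = (indicator D (\<omega>, u) * indicator {0..} u :: ennreal)" for u
    by (auto split: split_indicator)
  have "(\<integral>\<^sup>+u. indicator D (\<omega>, u) * indicator {0..} u \<partial>lborel) = (0 :: ennreal) \<longleftrightarrow>
    (AE u in lborel. (indicator D (\<omega>, u) * indicator {0..} u :: ennreal) = 0)"
    using m unfolding eq by (rule nn_integral_0_iff_AE)
  also have "\<dots> \<longleftrightarrow> (AE u in lborel. 0 \<le> u \<longrightarrow> (\<omega>, u) \<notin> D)"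
    by (intro AE_cong) (auto split: split_indicator)
  finally show ?thesis .
qed

context counting_process
begin

lemma jump_sum_eq_0_iff:
  "jump_sum N h \<omega> = 0 \<longleftrightarrow> (\<forall>n. J (Suc n) \<omega> \<longrightarrow> h (T (Suc n) \<omega>) = 0)"
  unfolding jump_sum_def by (subst suminf_eq_zero_iff) (auto)

lemma jump_sum_cong:
  "(\<And>n. J (Suc n) \<omega> \<Longrightarrow> h (T (Suc n) \<omega>) = h' (T (Suc n) \<omega>)) \<Longrightarrow> jump_sum N h \<omega> = jump_sum N h' \<omega>"
  unfolding jump_sum_def by (intro suminf_cong) auto

text \<open>
  The stochastic interval from \<open>0\<close> up to and including the \<open>m\<close>-th jump.  It contains at most \<open>m\<close> jumps
  on every path, and these intervals exhaust time, since a path has finitely many jumps before any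
  fixed time: localising to them makes the jump measure finite.
\<close>

definition before_jump :: "nat \<Rightarrow> ('a \<times> real) set" where
  "before_jump m = {x \<in> space Pred. \<not> (J m (fst x) \<and> T m (fst x) < snd x)}"

lemma sets_before_jump [measurable]: "before_jump m \<in> sets Pred"
  unfolding before_jump_def by measurable

lemma before_jump_iff:
  "(\<omega>, u) \<in> before_jump m \<longleftrightarrow> \<omega> \<in> space P \<and> 0 \<le> u \<and> \<not> (J m \<omega> \<and> T m \<omega> < u)"
  by (auto simp: before_jump_def)

lemma jumps_before_jump:
  assumes \<omega>: "\<omega> \<in> space P"
  shows "jump_sum N (\<lambda>u. indicator (before_jump m) (\<omega>, u)) \<omega> \<le> of_nat m"
proof -
  let ?f = "\<lambda>n. if J (Suc n) \<omega> then indicator (before_jump m) (\<omega>, T (Suc n) \<omega>) else (0 :: ennreal)"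
  have "?f n = 0" if "n \<notin> {..<m}" for n
  proof (cases "J (Suc n) \<omega>")
    case True
    then have "J m \<omega>" using that reaches_mono by auto
    moreover have "T m \<omega> < T (Suc n) \<omega>"
      using that by (intro jump_time_strict_mono[OF \<omega> True]) auto
    ultimately show ?thesis by (simp add: before_jump_iff)
  qed simp
  then have "jump_sum N (\<lambda>u. indicator (before_jump m) (\<omega>, u)) \<omega> = (\<Sum>n<m. ?f n)"
    unfolding jump_sum_def by (intro suminf_finite) auto
  also have "\<dots> \<le> (\<Sum>n<m. 1)" by (intro sum_mono) (auto split: split_indicator)
  finally show ?thesis by simp
qed

lemma before_jump_after_time:
  assumes \<omega>: "\<omega> \<in> space P" and t: "0 \<le> t" and m: "N \<omega> t < real m" and u: "0 \<le> u" "u \<le> t"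
  shows "(\<omega>, u) \<in> before_jump m"
  using jump_time_le_iff[OF \<omega> t, of m] assms by (auto simp: before_jump_iff)

lemma jump_sum_until:
  assumes \<omega>: "\<omega> \<in> space P" and t: "0 \<le> t"
  shows "jump_sum N (\<lambda>u. h u * indicator {0..t} u) \<omega> = (\<Sum>n<nat \<lfloor>N \<omega> t\<rfloor>. h (T (Suc n) \<omega>))"
proof -
  have "jump_sum N (\<lambda>u. h u * indicator {0..t} u) \<omega> =
    (\<Sum>n<nat \<lfloor>N \<omega> t\<rfloor>. if J (Suc n) \<omega> then h (T (Suc n) \<omega>) * indicator {0..t} (T (Suc n) \<omega>) else 0)"
    unfolding jump_sum_def
    by (intro suminf_finite) (use jumps_until[OF \<omega> t] in \<open>auto split: split_indicator\<close>)
  also have "\<dots> = (\<Sum>n<nat \<lfloor>N \<omega> t\<rfloor>. h (T (Suc n) \<omega>))"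
    by (intro sum.cong) (use jumps_until[OF \<omega> t] jump_time_nonneg in \<open>auto split: split_indicator\<close>)
  finally show ?thesis .
qed

text \<open>
  The sum over the jumps until \<open>t\<close> is known at time \<open>t\<close>: each jump time enters only when it lies before
  \<open>t\<close>, and may then be replaced by its clipped version.
\<close>

lemma measurable_jump_sum_until:
  assumes H: "H \<in> borel_measurable Pred" and t: "0 \<le> t"
  shows "(\<lambda>\<omega>. jump_sum N (\<lambda>u. H (\<omega>, u) * indicator {0..t} u) \<omega>) \<in> borel_measurable (G t)"
proof -
  let ?c = "\<lambda>n \<omega>. if real n \<le> N \<omega> t then T n \<omega> else t"
  have [measurable]: "(\<lambda>\<omega>. N \<omega> t) \<in> borel_measurable (G t)"
    using adapted_N t by (simp add: adapted_def)
  have [measurable]: "(\<lambda>\<omega>. H (\<omega>, ?c n \<omega>)) \<in> borel_measurable (G t)" for n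
    by (rule measurable_compose[OF measurable_at_clipped_jump_time[OF t] H])
  have m: "(\<lambda>\<omega>. \<Sum>n. if real (Suc n) \<le> N \<omega> t then H (\<omega>, ?c (Suc n) \<omega>) else 0) \<in> borel_measurable (G t)"
    by measurable
  show ?thesis
  proof (rule measurable_cong[THEN iffD1, OF _ m])
    fix \<omega> assume "\<omega> \<in> space (G t)"
    then have \<omega>: "\<omega> \<in> space P" using t by simp
    show "(\<Sum>n. if real (Suc n) \<le> N \<omega> t then H (\<omega>, ?c (Suc n) \<omega>) else 0)
      = jump_sum N (\<lambda>u. H (\<omega>, u) * indicator {0..t} u) \<omega>"
      unfolding jump_sum_def
    proof (rule suminf_cong)
      fix n
      show "(if real (Suc n) \<le> N \<omega> t then H (\<omega>, ?c (Suc n) \<omega>) else 0) =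
        (if J (Suc n) \<omega> then H (\<omega>, T (Suc n) \<omega>) * indicator {0..t} (T (Suc n) \<omega>) else 0)"
        using jump_time_le_iff[OF \<omega> t, of "Suc n"] jump_time_nonneg[of "Suc n" \<omega>]
        by (simp split: split_indicator del: of_nat_Suc) blast
    qed
  qed
qed

end

context doleans
begin

lemma emeasure_jump_measure:
  "D \<in> sets Pred \<Longrightarrow> emeasure muN D = (\<integral>\<^sup>+\<omega>. jump_sum N (\<lambda>u. indicator D (\<omega>, u)) \<omega> \<partial>R)"
  using nn_integral_jump_measure[of "indicator D"] by simp

lemma emeasure_time_measure:
  "D \<in> sets Pred \<Longrightarrow>
    emeasure muL D = (\<integral>\<^sup>+\<omega>. (\<integral>\<^sup>+u. indicator D (\<omega>, u) * indicator {0..} u \<partial>lborel) \<partial>R)"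
  using nn_integral_time_measure[of "indicator D"] by simp

lemma emeasure_jump_measure_Ioc:
  assumes s: "0 \<le> s" "s \<le> t" and A: "A \<in> sets (G s)"
  shows "emeasure muN (A \<times> {s<..t}) = (\<integral>\<^sup>+\<omega>. ennreal (N \<omega> t - N \<omega> s) * indicator A \<omega> \<partial>R)"
proof -
  have "emeasure muN (A \<times> {s<..t}) = (\<integral>\<^sup>+\<omega>. jump_sum N (\<lambda>u. indicator (A \<times> {s<..t}) (\<omega>, u)) \<omega> \<partial>R)"
    by (intro emeasure_jump_measure rectangle_in_Pred rectangle_Ioc assms)
  also have "\<dots> = (\<integral>\<^sup>+\<omega>. ennreal (N \<omega> t - N \<omega> s) * indicator A \<omega> \<partial>R)"
  proof (rule nn_integral_cong)
    fix \<omega> assume "\<omega> \<in> space R"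
    then have \<omega>: "\<omega> \<in> space P" by (simp add: space_R)
    show "jump_sum N (\<lambda>u. indicator (A \<times> {s<..t}) (\<omega>, u)) \<omega> = ennreal (N \<omega> t - N \<omega> s) * indicator A \<omega>"
    proof (cases "\<omega> \<in> A")
      case True
      have "jump_sum N (\<lambda>u. indicator (A \<times> {s<..t}) (\<omega>, u)) \<omega> = jump_sum N (indicator {s<..t}) \<omega>"
        using True by (intro jump_sum_cong) (simp split: split_indicator)
      then show ?thesis using True jump_sum_Ioc[OF \<omega> s] by simp
    next
      case False
      then show ?thesis by (simp add: jump_sum_eq_0_iff)
    qed
  qed
  finally show ?thesis .
qed

lemma emeasure_time_measure_rectangle:
  assumes "A \<times> S \<in> sets Pred" "A \<in> sets R" "S \<in> sets borel" "S \<subseteq> {0..}"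
  shows "emeasure muL (A \<times> S) = emeasure R A * emeasure lborel S"
proof -
  have "emeasure muL (A \<times> S) = (\<integral>\<^sup>+\<omega>. (\<integral>\<^sup>+u. indicator A \<omega> * indicator S u \<partial>lborel) \<partial>R)"
    unfolding emeasure_time_measure[OF assms(1)]
    by (intro nn_integral_cong) (use assms(4) in \<open>auto split: split_indicator\<close>)
  also have "\<dots> = emeasure R A * emeasure lborel S"
    using assms by (simp add: nn_integral_cmult nn_integral_multc)
  finally show ?thesis .
qed

lemma sets_G_subset: "0 \<le> s \<Longrightarrow> A \<in> sets (G s) \<Longrightarrow> A \<in> sets R"
  using sets_G_R by blast

lemma emeasure_zero_rectangle:
  assumes A: "A \<in> sets (G 0)"
  shows "emeasure muN (A \<times> {0}) = 0" "emeasure muL (A \<times> {0}) = 0"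
proof -
  have D: "A \<times> {0} \<in> sets Pred" by (intro rectangle_in_Pred rectangle_zero A)
  have "jump_sum N (\<lambda>u. indicator (A \<times> {0}) (\<omega>, u)) \<omega> = 0" if "\<omega> \<in> space R" for \<omega>
    unfolding jump_sum_eq_0_iff using jump_time_pos[of \<omega>] that by (force simp: space_R)
  then show "emeasure muN (A \<times> {0}) = 0"
    unfolding emeasure_jump_measure[OF D] by (simp cong: nn_integral_cong)
  show "emeasure muL (A \<times> {0}) = 0"
    using sets_G_subset[OF _ A] by (subst emeasure_time_measure_rectangle[OF D]) auto
qed

lemma time_measure_finite: "emeasure muL (space P \<times> {0<..real n}) \<noteq> \<infinity>"
proof -
  have "space P \<times> {0<..real n} \<in> sets Pred"
    by (intro rectangle_in_Pred rectangle_Ioc sets_G_space) auto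
  moreover have "space P \<in> sets R" using sets.top[of R] space_R by simp
  ultimately have "emeasure muL (space P \<times> {0<..real n}) = emeasure R (space P) * ennreal (real n)"
    by (subst emeasure_time_measure_rectangle) auto
  then show ?thesis by (simp add: ennreal_mult_eq_top_iff)
qed

text \<open>
  On a rectangle the first measure is the mean increment of \<open>N\<close> over the event, the second one
  its probability times the length of the time interval.
\<close>

lemma jump_measure_eq_time_measure:
  assumes incr: "\<And>A s t. 0 \<le> s \<Longrightarrow> s \<le> t \<Longrightarrow> A \<in> sets (G s) \<Longrightarrow>
    (\<integral>\<^sup>+\<omega>. ennreal (N \<omega> t - N \<omega> s) * indicator A \<omega> \<partial>R) = emeasure R A * ennreal (t - s)"
  shows "muN = muL"
proof (rule sym, rule measure_eqI_Pred)
  fix A s t assume *: "(0::real) \<le> s" "s \<le> t" "A \<in> sets (G s)"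
  have "A \<times> {s<..t} \<in> sets Pred" by (intro rectangle_in_Pred rectangle_Ioc *)
  then have "emeasure muL (A \<times> {s<..t}) = emeasure R A * ennreal (t - s)"
    using * sets_G_subset[of s A] by (subst emeasure_time_measure_rectangle) auto
  then show "emeasure muL (A \<times> {s<..t}) = emeasure muN (A \<times> {s<..t})"
    using emeasure_jump_measure_Ioc[OF *] incr[OF *] by simp
next
  show "emeasure muL (space P \<times> {0<..real n}) \<noteq> \<infinity>" for n by (rule time_measure_finite)
  show "emeasure muL (space P \<times> {0}) \<noteq> \<infinity>" using emeasure_zero_rectangle[OF sets_G_space] by simp
qed (auto simp: emeasure_zero_rectangle)

text \<open>
  Absolute continuity of the jumps with respect to time, read path by path.  The measure \<open>R\<close> enters
  only through its null sets, and so the property passes to every measure that is absolutely continuous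
  with respect to \<open>R\<close>.
\<close>

definition jumps_avoid_null_sets :: bool where
  "jumps_avoid_null_sets \<longleftrightarrow> (\<forall>D\<in>sets Pred. AE \<omega> in R.
     (\<integral>\<^sup>+u. indicator D (\<omega>, u) * indicator {0..} u \<partial>lborel) = (0 :: ennreal) \<longrightarrow>
     jump_sum N (\<lambda>u. indicator D (\<omega>, u)) \<omega> = 0)"

text \<open>
  Equality of the measures only controls predictable sets almost all of whose sections are
  Lebesgue-null, whereas here \<open>D\<close> is arbitrary and only the paths with null sections count.  The times
  up to which \<open>D\<close> has been Lebesgue-null form a predictable set, and cutting \<open>D\<close> down to them makes
  every section null without changing the sections that are null already.
\<close>

lemma jumps_avoid_null_setsI:
  assumes eq: "muN = muL"
  shows jumps_avoid_null_sets
  unfolding jumps_avoid_null_sets_def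
proof
  fix D assume D [measurable]: "D \<in> sets Pred"
  let ?V = "\<lambda>x. \<integral>\<^sup>+v. indicator D (fst x, v) * indicator {0..snd x} v \<partial>lborel :: ennreal"
  define D' where "D' = {x \<in> space Pred. x \<in> D \<and> ?V x = 0}"
  have [measurable]: "?V \<in> borel_measurable Pred"
    using measurable_running_nn_integral[of "indicator D"] by simp
  have D'[measurable]: "D' \<in> sets Pred" unfolding D'_def by measurable
  have "AE u in lborel. 0 \<le> u \<longrightarrow> (\<omega>, u) \<notin> D'" if \<omega>: "\<omega> \<in> space P" for \<omega>
  proof -
    let ?S = "{u. 0 \<le> u \<and> (\<omega>, u) \<in> D'}"
    \<comment> \<open>A section of \<open>D'\<close> is covered by its supremum and countably many pieces of the section of \<open>D\<close> that
      are null by the definition of \<open>D'\<close>.\<close>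
    have rat: "AE v in lborel. (\<exists>u\<in>?S. q \<le> u) \<longrightarrow> \<not> (0 \<le> v \<and> v \<le> q \<and> (\<omega>, v) \<in> D)" for q
    proof (cases "\<exists>u\<in>?S. q \<le> u")
      case True
      then obtain u where u: "0 \<le> u" "(\<omega>, u) \<in> D'" "q \<le> u" by blast
      have "(\<integral>\<^sup>+v. indicator (D \<inter> {x \<in> space Pred. snd x \<le> u}) (\<omega>, v) * indicator {0..} v \<partial>lborel) = ?V (\<omega>, u)"
        by (intro nn_integral_cong) (use \<omega> in \<open>auto split: split_indicator\<close>)
      also have "\<dots> = 0" using u(2) by (simp add: D'_def)
      finally have "AE v in lborel. 0 \<le> v \<longrightarrow> (\<omega>, v) \<notin> D \<inter> {x \<in> space Pred. snd x \<le> u}"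
        by (subst (asm) section_null_iff[OF \<omega>]) measurable
      then show ?thesis
        by eventually_elim (use \<omega> u(3) in auto)
    qed auto
    have "AE v in lborel. \<forall>q\<in>\<rat>. (\<exists>u\<in>?S. q \<le> u) \<longrightarrow> \<not> (0 \<le> v \<and> v \<le> q \<and> (\<omega>, v) \<in> D)"
      using rat by (subst AE_ball_countable) (rule countable_rat, blast)
    moreover have "AE v in lborel. v \<noteq> Sup ?S"
      by (rule AE_lborel_singleton)
    ultimately show ?thesis
    proof eventually_elim
      case (elim v)
      show ?case
      proof (intro impI notI)
        assume "0 \<le> v" "(\<omega>, v) \<in> D'"
        then have v: "v \<in> ?S" by simp
        have "\<exists>u\<in>?S. v < u"
        proof (rule ccontr)
          assume "\<not> ?thesis"
          then have "Sup ?S = v" by (intro cSup_eq_maximum v) (auto simp: not_less)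
          with elim(2) show False by simp
        qed
        then obtain u where u: "u \<in> ?S" "v < u" by blast
        obtain q where q: "q \<in> \<rat>" "v < q" "q < u" using Rats_dense_in_real[OF u(2)] by blast
        then have "\<exists>u\<in>?S. q \<le> u" using u(1) less_imp_le by blast
        with elim(1) q v have "(\<omega>, v) \<notin> D" by auto
        then show False using v by (simp add: D'_def)
      qed
    qed
  qed
  then have "AE \<omega> in R. AE u in lborel. 0 \<le> u \<longrightarrow> (\<omega>, u) \<notin> D'"
    unfolding space_R[symmetric] by (rule AE_I2)
  moreover have [measurable]: "{x \<in> space Pred. x \<notin> D'} \<in> sets Pred" by measurable
  ultimately have "AE x in muL. x \<notin> D'"
    by (intro AE_time_measure[THEN iffD2])
  then have "AE x in muN. x \<notin> D'" unfolding eq .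
  then have "AE \<omega> in R. \<forall>n. J (Suc n) \<omega> \<longrightarrow> (\<omega>, T (Suc n) \<omega>) \<notin> D'"
    by (intro AE_jump_measure[THEN iffD1]) measurable
  then show "AE \<omega> in R. (\<integral>\<^sup>+u. indicator D (\<omega>, u) * indicator {0..} u \<partial>lborel) = (0 :: ennreal) \<longrightarrow>
     jump_sum N (\<lambda>u. indicator D (\<omega>, u)) \<omega> = 0"
  proof (rule AE_mp, intro AE_I2 impI)
    fix \<omega> assume "\<omega> \<in> space R" and no: "\<forall>n. J (Suc n) \<omega> \<longrightarrow> (\<omega>, T (Suc n) \<omega>) \<notin> D'"
      and null: "(\<integral>\<^sup>+u. indicator D (\<omega>, u) * indicator {0..} u \<partial>lborel) = (0 :: ennreal)"
    then have \<omega>: "\<omega> \<in> space P" by (simp add: space_R)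
    have V0: "?V (\<omega>, u) = 0" for u
    proof -
      have "?V (\<omega>, u) \<le> (\<integral>\<^sup>+u. indicator D (\<omega>, u) * indicator {0..} u \<partial>lborel)"
        by (intro nn_integral_mono) (auto split: split_indicator)
      with null show ?thesis by simp
    qed
    have "(\<omega>, T (Suc n) \<omega>) \<notin> D" if "J (Suc n) \<omega>" for n
      using no that V0 \<omega> jump_time_nonneg[of "Suc n" \<omega>] by (auto simp: D'_def)
    then show "jump_sum N (\<lambda>u. indicator D (\<omega>, u)) \<omega> = 0"
      by (simp add: jump_sum_eq_0_iff)
  qed
qed

lemma jumps_avoid_null_setsD:
  assumes jumps_avoid_null_sets and D: "D \<in> sets Pred"
    and null: "AE \<omega> in R. AE u in lborel. 0 \<le> u \<longrightarrow> (\<omega>, u) \<notin> D"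
  shows "AE \<omega> in R. \<forall>n. J (Suc n) \<omega> \<longrightarrow> (\<omega>, T (Suc n) \<omega>) \<notin> D"
proof -
  have "AE \<omega> in R. (\<integral>\<^sup>+u. indicator D (\<omega>, u) * indicator {0..} u \<partial>lborel) = (0 :: ennreal) \<longrightarrow>
     jump_sum N (\<lambda>u. indicator D (\<omega>, u)) \<omega> = 0"
    using assms(1) D by (simp add: jumps_avoid_null_sets_def)
  with null show ?thesis
  proof (rule AE_mp[OF AE_conjI], intro AE_I2 impI)
    fix \<omega> assume \<omega>: "\<omega> \<in> space R" and *: "(AE u in lborel. 0 \<le> u \<longrightarrow> (\<omega>, u) \<notin> D) \<and>
      ((\<integral>\<^sup>+u. indicator D (\<omega>, u) * indicator {0..} u \<partial>lborel) = (0 :: ennreal) \<longrightarrow>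
       jump_sum N (\<lambda>u. indicator D (\<omega>, u)) \<omega> = 0)"
    then have "jump_sum N (\<lambda>u. indicator D (\<omega>, u)) \<omega> = 0"
      using section_null_iff[of \<omega> D] D by (auto simp: space_R)
    then show "\<forall>n. J (Suc n) \<omega> \<longrightarrow> (\<omega>, T (Suc n) \<omega>) \<notin> D"
      by (simp add: jump_sum_eq_0_iff indicator_eq_0_iff)
  qed
qed

lemma sigma_finite_time_measure: "sigma_finite_measure muL"
proof
  let ?A = "range (\<lambda>n::nat. space P \<times> {0..real n})"
  have S: "space P \<times> {0..real n} \<in> sets Pred" for n
  proof -
    have "{x \<in> space Pred. snd x \<le> real n} \<in> sets Pred" by measurable
    moreover have "{x \<in> space Pred. snd x \<le> real n} = space P \<times> {0..real n}" by auto
    ultimately show ?thesis by simp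
  qed
  have "emeasure muL (space P \<times> {0..real n}) \<noteq> \<infinity>" for n
  proof -
    have "space P \<in> sets R" using sets.top[of R] space_R by simp
    then have "emeasure muL (space P \<times> {0..real n}) = emeasure R (space P) * ennreal (real n)"
      using S[of n] by (subst emeasure_time_measure_rectangle) auto
    then show ?thesis by (simp add: ennreal_mult_eq_top_iff)
  qed
  moreover have "\<Union> ?A = space muL"
  proof (rule set_eqI)
    fix x :: "'a \<times> real"
    obtain \<omega> u where x: "x = (\<omega>, u)" by (cases x)
    obtain n where "u \<le> real n" using real_arch_simple by blast
    then show "x \<in> \<Union> ?A \<longleftrightarrow> x \<in> space muL" unfolding x by auto
  qed
  ultimately show "\<exists>A. countable A \<and> A \<subseteq> sets muL \<and> \<Union> A = space muL \<and> (\<forall>a\<in>A. emeasure muL a \<noteq> \<infinity>)"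
    using S by (intro exI[of _ ?A]) auto
qed

lemma emeasure_before_jump: "emeasure muN (before_jump m) < \<infinity>"
proof -
  have "emeasure muN (before_jump m) \<le> (\<integral>\<^sup>+\<omega>. of_nat m \<partial>R)"
    unfolding emeasure_jump_measure[OF sets_before_jump]
    by (intro nn_integral_mono jumps_before_jump) (simp add: space_R)
  also have "\<dots> < \<infinity>"
    using R.emeasure_finite[of "space R"] less_top[of "emeasure R (space R)"]
    by (simp add: ennreal_mult_less_top ennreal_of_nat_eq_real_of_nat)
  finally show ?thesis .
qed

lemma before_jump_exhausts:
  assumes "x \<in> space Pred"
  shows "\<exists>m. x \<in> before_jump m"
proof -
  obtain \<omega> u where x: "x = (\<omega>, u)" by (cases x)
  then have \<omega>: "\<omega> \<in> space P" and u: "0 \<le> u" using assms by auto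
  obtain m :: nat where "N \<omega> u < real m" using reals_Archimedean2 by blast
  then show ?thesis unfolding x using before_jump_after_time[OF \<omega> u _ u] by blast
qed

text \<open>
  A predictable density of the jump measure with respect to the time measure.  Insisting on finite
  nonnegative values everywhere costs nothing and avoids exceptional paths.
\<close>

definition jump_density :: "('a \<Rightarrow> real \<Rightarrow> real) \<Rightarrow> bool" where
  "jump_density l \<longleftrightarrow> case_prod l \<in> borel_measurable Pred \<and>
     (\<forall>\<omega>\<in>space P. \<forall>u\<ge>0. 0 \<le> l \<omega> u) \<and> muN = density muL (\<lambda>x. ennreal (l (fst x) (snd x)))"

text \<open>
  Radon and Nikodym.  The density is finite almost everywhere because the jump measure is finite on
  the stochastic intervals \<open>before_jump m\<close>, which exhaust the whole space.
\<close>

lemma jump_density_exists: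
  assumes jumps_avoid_null_sets
  shows "\<exists>l. jump_density l"
proof -
  interpret L: sigma_finite_measure muL by (rule sigma_finite_time_measure)
  have "absolutely_continuous muL muN"
    unfolding absolutely_continuous_def
  proof
    fix D assume "D \<in> null_sets muL"
    then have D [measurable]: "D \<in> sets Pred" and "AE x in muL. x \<notin> D"
      using AE_not_in by (auto dest: null_setsD2)
    then have "AE \<omega> in R. AE u in lborel. 0 \<le> u \<longrightarrow> (\<omega>, u) \<notin> D"
      by (subst (asm) AE_time_measure) measurable
    from jumps_avoid_null_setsD[OF assms D this]
    have "AE x in muN. x \<notin> D"
      by (subst AE_jump_measure) measurable
    then show "D \<in> null_sets muN"
      using D by (subst (asm) AE_iff_null_sets[symmetric]) auto
  qed
  then obtain f where f [measurable]: "f \<in> borel_measurable muL" and eq: "density muL f = muN"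
    using L.Radon_Nikodym[of muN] by auto
  have "AE x in muL. x \<in> before_jump m \<longrightarrow> f x \<noteq> \<infinity>" for m
  proof -
    have "(\<integral>\<^sup>+x. f x * indicator (before_jump m) x \<partial>muL) = emeasure muN (before_jump m)"
      unfolding eq[symmetric] by (rule emeasure_density[symmetric]) measurable
    then have "AE x in muL. f x * indicator (before_jump m) x \<noteq> \<infinity>"
      using emeasure_before_jump[of m] by (intro nn_integral_PInf_AE) auto
    then show ?thesis by eventually_elim (auto split: split_indicator_asm)
  qed
  then have "AE x in muL. \<forall>m. x \<in> before_jump m \<longrightarrow> f x \<noteq> \<infinity>"
    unfolding AE_all_countable by blast
  then have fin: "AE x in muL. f x = ennreal (enn2real (f x))"
  proof (rule AE_mp, intro AE_I2 impI)
    fix x assume "x \<in> space muL" "\<forall>m. x \<in> before_jump m \<longrightarrow> f x \<noteq> \<infinity>"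
    then show "f x = ennreal (enn2real (f x))"
      using before_jump_exhausts[of x] by (auto simp: less_top)
  qed
  define l where "l \<omega> u = enn2real (f (\<omega>, u))" for \<omega> u
  have m: "(\<lambda>x. enn2real (f x)) \<in> borel_measurable Pred"
    using f by measurable
  then have "case_prod l \<in> borel_measurable Pred"
    by (simp add: l_def case_prod_beta')
  moreover have "muN = density muL (\<lambda>x. ennreal (l (fst x) (snd x)))"
    unfolding eq[symmetric] l_def by (rule density_cong) (use fin m in auto)
  ultimately show ?thesis unfolding jump_density_def l_def by auto
qed

end

section \<open>From a density of the jumps to martingales\<close>

context filtered_space
begin

lemma measurable_path:
  assumes "case_prod X \<in> borel_measurable Pred" "\<omega> \<in> space P"
  shows "(\<lambda>u. X \<omega> (max 0 u)) \<in> borel_measurable borel"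
  using measurable_compose[OF measurable_section[OF assms(2)] assms(1)] by simp

lemma measurable_restricted_path:
  fixes X :: "'a \<Rightarrow> real \<Rightarrow> real"
  assumes X: "case_prod X \<in> borel_measurable Pred" and \<omega>: "\<omega> \<in> space P"
    and S: "S \<in> sets borel" "S \<subseteq> {0..}"
  shows "(\<lambda>u. indicator S u * X \<omega> u) \<in> borel_measurable borel"
proof -
  have [measurable]: "(\<lambda>u. X \<omega> (max 0 u)) \<in> borel_measurable borel" by (rule measurable_path[OF X \<omega>])
  have "(\<lambda>u. indicator S u * X \<omega> (max 0 u)) \<in> borel_measurable borel" using S(1) by measurable
  moreover have "indicator S u * X \<omega> (max 0 u) = indicator S u * X \<omega> u" for u
    using S(2) by (auto split: split_indicator)
  ultimately show ?thesis by simp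
qed

lemma set_integrable_path_iff:
  fixes X :: "'a \<Rightarrow> real \<Rightarrow> real"
  assumes X: "case_prod X \<in> borel_measurable Pred" and \<omega>: "\<omega> \<in> space P"
    and S: "S \<in> sets borel" "S \<subseteq> {0..}"
  shows "set_integrable lborel S (X \<omega>) \<longleftrightarrow> (\<integral>\<^sup>+u. ennreal \<bar>X \<omega> u\<bar> * indicator S u \<partial>lborel) < \<infinity>"
proof -
  have "(\<integral>\<^sup>+u. ennreal (norm (indicator S u *\<^sub>R X \<omega> u)) \<partial>lborel) = (\<integral>\<^sup>+u. ennreal \<bar>X \<omega> u\<bar> * indicator S u \<partial>lborel)"
    by (intro nn_integral_cong) (auto split: split_indicator)
  then show ?thesis
    using measurable_restricted_path[OF assms]
    unfolding set_integrable_def integrable_iff_bounded by simp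
qed

lemma nn_integral_path:
  fixes X :: "'a \<Rightarrow> real \<Rightarrow> real"
  assumes "set_integrable lborel S (X \<omega>)" and "\<And>u. u \<in> S \<Longrightarrow> 0 \<le> X \<omega> u"
  shows "(\<integral>\<^sup>+u. ennreal (X \<omega> u) * indicator S u \<partial>lborel) = ennreal (LINT u:S|lborel. X \<omega> u)"
proof -
  have "(\<integral>\<^sup>+u. ennreal (X \<omega> u) * indicator S u \<partial>lborel) = (\<integral>\<^sup>+u. ennreal (indicator S u *\<^sub>R X \<omega> u) \<partial>lborel)"
    by (intro nn_integral_cong) (auto split: split_indicator)
  also have "\<dots> = ennreal (LINT u:S|lborel. X \<omega> u)"
    unfolding set_lebesgue_integral_def
    using assms by (intro nn_integral_eq_integral) (auto simp: set_integrable_def split: split_indicator)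
  finally show ?thesis .
qed

end

lemma set_integral_point: "(LINT v:{a}|lborel. f v) = 0" for f :: "real \<Rightarrow> real"
  unfolding set_lebesgue_integral_def
  by (rule integral_eq_zero_AE, rule eventually_mono[OF AE_lborel_singleton[of a]]) auto

lemma set_integral_difference:
  fixes f :: "real \<Rightarrow> real"
  assumes "set_integrable lborel {c..b} f" "c \<le> a" "a \<le> b"
  shows "(LINT u:{c..b}|lborel. f u) - (LINT u:{c..a}|lborel. f u) = (LINT u:{a<..b}|lborel. f u)"
proof -
  have "{c..b} = {c..a} \<union> {a<..b}" using assms by auto
  moreover have "set_integrable lborel {c..a} f" "set_integrable lborel {a<..b} f"
    by (rule set_integrable_subset[OF assms(1)]; use assms in auto)+
  moreover have "{c..a} \<inter> {a<..b} = {}" by auto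
  ultimately show ?thesis
    using set_integral_Un[of "{c..a}" "{a<..b}" lborel f] by simp
qed

text \<open>
  The time at which a process stopped at \<open>\<sigma>\<close> is evaluated.
\<close>

definition freeze :: "('a \<Rightarrow> ennreal) \<Rightarrow> 'a \<Rightarrow> real \<Rightarrow> real" where
  "freeze \<sigma> \<omega> t = enn2real (min (ennreal t) (\<sigma> \<omega>))"

lemma freeze_nonneg [simp]: "0 \<le> freeze \<sigma> \<omega> t"
  by (simp add: freeze_def)

lemma le_freeze_iff:
  assumes "0 \<le> u" "0 \<le> t"
  shows "u \<le> freeze \<sigma> \<omega> t \<longleftrightarrow> u \<le> t \<and> ennreal u \<le> \<sigma> \<omega>"
proof -
  have "min (ennreal t) (\<sigma> \<omega>) < top" by (simp add: min_less_iff_disj)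
  then have "ennreal (freeze \<sigma> \<omega> t) = min (ennreal t) (\<sigma> \<omega>)" by (simp add: freeze_def)
  then have "ennreal u \<le> ennreal (freeze \<sigma> \<omega> t) \<longleftrightarrow> ennreal u \<le> ennreal t \<and> ennreal u \<le> \<sigma> \<omega>" by simp
  then show ?thesis using assms by (simp add: freeze_def)
qed

lemma freeze_le: "0 \<le> t \<Longrightarrow> freeze \<sigma> \<omega> t \<le> t"
  using le_freeze_iff[of "freeze \<sigma> \<omega> t" t \<sigma> \<omega>] by simp

lemma freeze_mono: "0 \<le> s \<Longrightarrow> s \<le> t \<Longrightarrow> freeze \<sigma> \<omega> s \<le> freeze \<sigma> \<omega> t"
  using le_freeze_iff[of "freeze \<sigma> \<omega> s" t \<sigma> \<omega>] le_freeze_iff[of "freeze \<sigma> \<omega> s" s \<sigma> \<omega>] by simp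

context doleans
begin

lemma measurable_time_integral:
  fixes H :: "'a \<times> real \<Rightarrow> ennreal"
  assumes "H \<in> borel_measurable Pred"
  shows "(\<lambda>\<omega>. \<integral>\<^sup>+u. H (\<omega>, u) * indicator {0..} u \<partial>lborel) \<in> borel_measurable R"
proof -
  have [measurable]: "(\<lambda>x. H (fst x, max 0 (snd x))) \<in> borel_measurable (R \<Otimes>\<^sub>M borel)"
    by (rule measurable_compose[OF measurable_R_time assms])
  have "(\<lambda>\<omega>. \<integral>\<^sup>+u. H (fst (\<omega>, u), max 0 (snd (\<omega>, u))) * indicator {0..} u \<partial>lborel) \<in> borel_measurable R"
    by measurable
  moreover have "(\<lambda>\<omega>. \<integral>\<^sup>+u. H (fst (\<omega>, u), max 0 (snd (\<omega>, u))) * indicator {0..} u \<partial>lborel) =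
    (\<lambda>\<omega>. \<integral>\<^sup>+u. H (\<omega>, u) * indicator {0..} u \<partial>lborel)"
    by (intro ext nn_integral_cong) (auto split: split_indicator)
  ultimately show ?thesis by (simp only:)
qed

lemma jump_densityD:
  assumes "jump_density l"
  shows "case_prod l \<in> borel_measurable Pred"
    and "\<omega> \<in> space P \<Longrightarrow> 0 \<le> u \<Longrightarrow> 0 \<le> l \<omega> u"
  using assms by (auto simp: jump_density_def)

lemma emeasure_jump_density:
  assumes l: "jump_density l" and D: "D \<in> sets Pred"
  shows "emeasure muN D = (\<integral>\<^sup>+\<omega>. (\<integral>\<^sup>+u. ennreal (l \<omega> u) * indicator D (\<omega>, u) * indicator {0..} u \<partial>lborel) \<partial>R)"
proof -
  have [measurable]: "(\<lambda>x. ennreal (l (fst x) (snd x))) \<in> borel_measurable Pred"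
    using jump_densityD(1)[OF l] by (simp add: case_prod_beta')
  have "emeasure muN D = (\<integral>\<^sup>+x. ennreal (l (fst x) (snd x)) * indicator D x \<partial>muL)"
    using l D unfolding jump_density_def by (simp add: emeasure_density)
  also have "\<dots> = (\<integral>\<^sup>+\<omega>. (\<integral>\<^sup>+u. ennreal (l \<omega> u) * indicator D (\<omega>, u) * indicator {0..} u \<partial>lborel) \<partial>R)"
    using D by (subst nn_integral_time_measure) simp_all
  finally show ?thesis .
qed

text \<open>
  Up to the \<open>m\<close>-th jump the mean of the integral of the density is the mean number of jumps, which is
  at most \<open>m\<close> times the total mass.
\<close>

lemma jump_density_integrable:
  assumes l: "jump_density l"
  shows "AE \<omega> in R. \<forall>t\<ge>0. set_integrable lborel {0..t} (l \<omega>)"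
proof -
  have [measurable]: "(\<lambda>x. ennreal (l (fst x) (snd x)) * indicator (before_jump m) x) \<in> borel_measurable Pred" for m
    using jump_densityD(1)[OF l] by (simp add: case_prod_beta')
  let ?I = "\<lambda>m \<omega>. \<integral>\<^sup>+u. ennreal (l \<omega> u) * indicator (before_jump m) (\<omega>, u) * indicator {0..} u \<partial>lborel"
  have "AE \<omega> in R. ?I m \<omega> \<noteq> \<infinity>" for m
    using emeasure_before_jump[of m] emeasure_jump_density[OF l sets_before_jump[of m]]
      measurable_time_integral[of "\<lambda>x. ennreal (l (fst x) (snd x)) * indicator (before_jump m) x"]
    by (intro nn_integral_PInf_AE) auto
  then have "AE \<omega> in R. \<forall>m. ?I m \<omega> \<noteq> \<infinity>" unfolding AE_all_countable by blast
  then show ?thesis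
  proof (rule AE_mp, intro AE_I2 impI allI)
    fix \<omega> t assume "\<omega> \<in> space R" and fin: "\<forall>m. ?I m \<omega> \<noteq> \<infinity>" and t: "(0::real) \<le> t"
    then have \<omega>: "\<omega> \<in> space P" by (simp add: space_R)
    obtain m :: nat where m: "N \<omega> t < real m" using reals_Archimedean2 by blast
    have "(\<integral>\<^sup>+u. ennreal \<bar>l \<omega> u\<bar> * indicator {0..t} u \<partial>lborel) \<le> ?I m \<omega>"
      by (intro nn_integral_mono)
        (use before_jump_after_time[OF \<omega> t m] jump_densityD(2)[OF l \<omega>] in \<open>auto split: split_indicator\<close>)
    also have "\<dots> < \<infinity>" using fin by (simp add: less_top)
    finally show "set_integrable lborel {0..t} (l \<omega>)"
      by (subst set_integrable_path_iff[OF jump_densityD(1)[OF l] \<omega>]) auto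
  qed
qed

text \<open>
  On an event \<open>A\<close> of the past of \<open>s\<close>, the increments over \<open>(s, t]\<close> of \<open>N\<close> and of the compensator, both
  stopped at \<open>\<sigma>\<close>, are the number of jumps in the section of the predictable set \<open>A \<times> (s, t] \<inter> B\<close> and the
  integral of \<open>l\<close> over it, where \<open>B\<close> is the stochastic interval up to \<open>\<sigma>\<close>.  Integrating over \<open>\<omega>\<close> gives
  the two sides of the density identity on that set.
\<close>

lemma stopped_martingale:
  assumes l: "jump_density l"
    and B: "{x \<in> space Pred. ennreal (snd x) \<le> \<sigma> (fst x)} \<in> sets Pred"
    and fin: "\<And>t. 0 \<le> t \<Longrightarrow> (\<integral>\<^sup>+\<omega>. ennreal (N \<omega> (freeze \<sigma> \<omega> t)) \<partial>R) < \<infinity>"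
  shows "is_martingale R G (stopped (compensated N l) \<sigma>)"
proof -
  define B where "B = {x \<in> space Pred. ennreal (snd x) \<le> \<sigma> (fst x)}"
  have [measurable]: "B \<in> sets Pred" using B unfolding B_def .
  have lm [measurable]: "(\<lambda>x. l (fst x) (snd x)) \<in> borel_measurable Pred"
    using jump_densityD(1)[OF l] by (simp add: case_prod_beta')
  define Y where "Y \<omega> t = N \<omega> (freeze \<sigma> \<omega> t)" for \<omega> t
  define C where "C \<omega> t = compensator l \<omega> (freeze \<sigma> \<omega> t)" for \<omega> t
  have in_B: "(\<omega>, u) \<in> B \<and> u \<le> t \<longleftrightarrow> u \<le> freeze \<sigma> \<omega> t" if "\<omega> \<in> space P" "0 \<le> u" "0 \<le> t" for \<omega> u t
    using le_freeze_iff[OF that(2,3), of \<sigma> \<omega>] that by (auto simp: B_def)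
  have X: "stopped (compensated N l) \<sigma> \<omega> t = Y \<omega> t - C \<omega> t" for \<omega> t
    by (simp add: stopped_def compensated_def Y_def C_def freeze_def)
  have Y_incr: "ennreal (Y \<omega> t - Y \<omega> s) = jump_sum N (\<lambda>u. indicator (space P \<times> {s<..t} \<inter> B) (\<omega>, u)) \<omega>"
    if \<omega>: "\<omega> \<in> space P" and "0 \<le> s" "s \<le> t" for \<omega> s t
  proof -
    have "jump_sum N (\<lambda>u. indicator (space P \<times> {s<..t} \<inter> B) (\<omega>, u)) \<omega> =
      jump_sum N (indicator {freeze \<sigma> \<omega> s<..freeze \<sigma> \<omega> t}) \<omega>"
    proof (rule jump_sum_cong)
      fix n
      have u: "0 \<le> T (Suc n) \<omega>" by (rule jump_time_nonneg)
      have "0 \<le> t" using that by simp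
      from in_B[OF \<omega> u this] in_B[OF \<omega> u \<open>0 \<le> s\<close>] \<omega>
      show "indicator (space P \<times> {s<..t} \<inter> B) (\<omega>, T (Suc n) \<omega>) =
        (indicator {freeze \<sigma> \<omega> s<..freeze \<sigma> \<omega> t} (T (Suc n) \<omega>) :: ennreal)"
        by (auto split: split_indicator)
    qed
    also have "\<dots> = ennreal (Y \<omega> t - Y \<omega> s)"
      unfolding Y_def using that by (intro jump_sum_Ioc freeze_mono) auto
    finally show ?thesis by simp
  qed
  have Y_meas: "(\<lambda>\<omega>. Y \<omega> t) \<in> borel_measurable (G t)" if t: "0 \<le> t" for t
  proof -
    have [measurable]: "(\<lambda>\<omega>. jump_sum N (\<lambda>u. indicator B (\<omega>, u) * indicator {0..t} u) \<omega>) \<in> borel_measurable (G t)"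
      by (rule measurable_jump_sum_until[OF _ t]) simp
    have m: "(\<lambda>\<omega>. enn2real (jump_sum N (\<lambda>u. indicator B (\<omega>, u) * indicator {0..t} u) \<omega>)) \<in> borel_measurable (G t)"
      by measurable
    show ?thesis
    proof (rule measurable_cong[THEN iffD1, OF _ m])
      fix \<omega> assume "\<omega> \<in> space (G t)"
      then have \<omega>: "\<omega> \<in> space P" using t by simp
      have "jump_sum N (\<lambda>u. indicator B (\<omega>, u) * indicator {0..t} u) \<omega> =
        jump_sum N (\<lambda>u. indicator (space P \<times> {0<..t} \<inter> B) (\<omega>, u)) \<omega>"
        by (intro jump_sum_cong) (use \<omega> jump_time_pos[OF \<omega>] in \<open>auto simp: jump_time_nonneg split: split_indicator\<close>)
      also have "\<dots> = ennreal (Y \<omega> t)"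
        using Y_incr[OF \<omega> order_refl t] by (simp add: Y_def freeze_def N_0[OF \<omega>])
      finally show "enn2real (jump_sum N (\<lambda>u. indicator B (\<omega>, u) * indicator {0..t} u) \<omega>) = Y \<omega> t"
        by (simp add: Y_def N_nonneg[OF \<omega>])
    qed
  qed
  have C_meas: "(\<lambda>\<omega>. C \<omega> t) \<in> borel_measurable (G t)" if t: "0 \<le> t" for t
  proof -
    have "(\<lambda>x. LINT v:{0..snd x}|lborel. indicator B (fst x, v) * l (fst x) v) \<in> borel_measurable Pred"
      using measurable_running_integral[of "\<lambda>x. indicator B x * l (fst x) (snd x)"] by simp
    from measurable_compose[OF measurable_Pred_at[OF t] this]
    have m: "(\<lambda>\<omega>. LINT v:{0..t}|lborel. indicator B (\<omega>, v) * l \<omega> v) \<in> borel_measurable (G t)" by simp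
    show ?thesis
    proof (rule measurable_cong[THEN iffD1, OF _ m])
      fix \<omega> assume "\<omega> \<in> space (G t)"
      then have \<omega>: "\<omega> \<in> space P" using t by simp
      show "(LINT v:{0..t}|lborel. indicator B (\<omega>, v) * l \<omega> v) = C \<omega> t"
        unfolding C_def compensator_def set_lebesgue_integral_def
        by (intro Bochner_Integration.integral_cong)
          (use in_B[OF \<omega> _ t] in \<open>auto split: split_indicator\<close>)
    qed
  qed
  have C_incr: "AE \<omega> in R. \<forall>t\<ge>0. \<forall>s\<in>{0..t}. 0 \<le> C \<omega> t - C \<omega> s \<and> ennreal (C \<omega> t - C \<omega> s) =
      (\<integral>\<^sup>+u. ennreal (l \<omega> u) * indicator (space P \<times> {s<..t} \<inter> B) (\<omega>, u) * indicator {0..} u \<partial>lborel)"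
    using jump_density_integrable[OF l]
  proof (rule AE_mp, intro AE_I2 impI allI ballI)
    fix \<omega> t s assume "\<omega> \<in> space R" and int: "\<forall>t\<ge>0. set_integrable lborel {0..t} (l \<omega>)"
      and t: "(0::real) \<le> t" and s: "s \<in> {0..t}"
    then have \<omega>: "\<omega> \<in> space P" by (simp add: space_R)
    let ?a = "freeze \<sigma> \<omega> s" and ?b = "freeze \<sigma> \<omega> t"
    have ab: "0 \<le> ?a" "?a \<le> ?b" using s by (auto intro: freeze_mono)
    have i: "set_integrable lborel {0..?b} (l \<omega>)" using int by simp
    have C: "C \<omega> t - C \<omega> s = (LINT u:{?a<..?b}|lborel. l \<omega> u)"
      unfolding C_def compensator_def by (rule set_integral_difference[OF i ab])
    have pos: "0 \<le> l \<omega> u" if "u \<in> {?a<..?b}" for u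
      using that ab(1) unfolding greaterThanAtMost_iff by (intro jump_densityD(2)[OF l \<omega>]) linarith
    have "(\<integral>\<^sup>+u. ennreal (l \<omega> u) * indicator (space P \<times> {s<..t} \<inter> B) (\<omega>, u) * indicator {0..} u \<partial>lborel) =
      (\<integral>\<^sup>+u. ennreal (l \<omega> u) * indicator {?a<..?b} u \<partial>lborel)"
    proof (rule nn_integral_cong)
      fix u
      have "(\<omega>, u) \<in> space P \<times> {s<..t} \<inter> B \<longleftrightarrow> u \<in> {?a<..?b}" if "0 \<le> u"
        using in_B[OF \<omega> that t] in_B[OF \<omega> that, of s] s \<omega> by auto
      moreover have "u \<notin> {?a<..?b}" if "\<not> 0 \<le> u"
        using that ab(1) unfolding greaterThanAtMost_iff by linarith
      ultimately show "ennreal (l \<omega> u) * indicator (space P \<times> {s<..t} \<inter> B) (\<omega>, u) * indicator {0..} u =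
        ennreal (l \<omega> u) * indicator {?a<..?b} u"
        by (cases "0 \<le> u") (auto simp: indicator_def)
    qed
    also have "\<dots> = ennreal (C \<omega> t - C \<omega> s)" unfolding C
    proof (rule nn_integral_path)
      have "{?a<..?b} \<subseteq> {0..?b}"
        by (auto intro: order_trans[OF ab(1) less_imp_le])
      then show "set_integrable lborel {?a<..?b} (l \<omega>)"
        by (intro set_integrable_subset[OF i]) auto
    qed (rule pos)
    finally have "ennreal (C \<omega> t - C \<omega> s) =
      (\<integral>\<^sup>+u. ennreal (l \<omega> u) * indicator (space P \<times> {s<..t} \<inter> B) (\<omega>, u) * indicator {0..} u \<partial>lborel)" by simp
    moreover have "0 \<le> C \<omega> t - C \<omega> s" unfolding C set_lebesgue_integral_def
      using pos by (intro Bochner_Integration.integral_nonneg) (auto split: split_indicator)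
    ultimately show "0 \<le> C \<omega> t - C \<omega> s \<and> ennreal (C \<omega> t - C \<omega> s) =
      (\<integral>\<^sup>+u. ennreal (l \<omega> u) * indicator (space P \<times> {s<..t} \<inter> B) (\<omega>, u) * indicator {0..} u \<partial>lborel)"
      by blast
  qed
  \<comment> \<open>the density identity on \<open>A \<times> (s, t] \<inter> B\<close>\<close>
  have key: "(\<integral>\<^sup>+\<omega>. ennreal (Y \<omega> t - Y \<omega> s) * indicator A \<omega> \<partial>R) =
      (\<integral>\<^sup>+\<omega>. ennreal (C \<omega> t - C \<omega> s) * indicator A \<omega> \<partial>R)"
    if st: "0 \<le> s" "s \<le> t" and A: "A \<in> sets (G s)" for A s t
  proof -
    let ?D = "A \<times> {s<..t} \<inter> B"
    have "A \<times> {s<..t} \<in> sets Pred" by (intro rectangle_in_Pred rectangle_Ioc st A)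
    then have D: "?D \<in> sets Pred" by simp
    have AP: "A \<subseteq> space P" using sets.sets_into_space[OF A] st by simp
    have "(\<integral>\<^sup>+\<omega>. ennreal (Y \<omega> t - Y \<omega> s) * indicator A \<omega> \<partial>R) = emeasure muN ?D"
      unfolding emeasure_jump_measure[OF D]
    proof (rule nn_integral_cong)
      fix \<omega> assume "\<omega> \<in> space R"
      then have \<omega>: "\<omega> \<in> space P" by (simp add: space_R)
      show "ennreal (Y \<omega> t - Y \<omega> s) * indicator A \<omega> = jump_sum N (\<lambda>u. indicator ?D (\<omega>, u)) \<omega>"
      proof (cases "\<omega> \<in> A")
        case True
        then have "jump_sum N (\<lambda>u. indicator ?D (\<omega>, u)) \<omega> =
            jump_sum N (\<lambda>u. indicator (space P \<times> {s<..t} \<inter> B) (\<omega>, u)) \<omega>"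
          using \<omega> by (intro jump_sum_cong) (auto split: split_indicator)
        with True Y_incr[OF \<omega> st] show ?thesis by simp
      next
        case False then show ?thesis by (simp add: jump_sum_eq_0_iff)
      qed
    qed
    also have "\<dots> = (\<integral>\<^sup>+\<omega>. ennreal (C \<omega> t - C \<omega> s) * indicator A \<omega> \<partial>R)"
      unfolding emeasure_jump_density[OF l D]
    proof (rule nn_integral_cong_AE)
      show "AE \<omega> in R. (\<integral>\<^sup>+u. ennreal (l \<omega> u) * indicator ?D (\<omega>, u) * indicator {0..} u \<partial>lborel) =
        ennreal (C \<omega> t - C \<omega> s) * indicator A \<omega>"
        using C_incr
      proof eventually_elim
        case (elim \<omega>)
        have "(\<integral>\<^sup>+u. ennreal (l \<omega> u) * indicator ?D (\<omega>, u) * indicator {0..} u \<partial>lborel) =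
          (\<integral>\<^sup>+u. ennreal (l \<omega> u) * indicator (space P \<times> {s<..t} \<inter> B) (\<omega>, u) * indicator {0..} u \<partial>lborel)"
          if "\<omega> \<in> A" using that AP by (intro nn_integral_cong) (auto split: split_indicator)
        with elim st show ?case by (auto split: split_indicator)
      qed
    qed
    finally show ?thesis .
  qed
  have Y_R: "(\<lambda>\<omega>. Y \<omega> t) \<in> borel_measurable R" if "0 \<le> t" for t
    using measurable_from_G[OF that Y_meas[OF that]] .
  have C_R: "(\<lambda>\<omega>. C \<omega> t) \<in> borel_measurable R" if "0 \<le> t" for t
    using measurable_from_G[OF that C_meas[OF that]] .
  have at0: "Y \<omega> 0 = 0" "C \<omega> 0 = 0" if "\<omega> \<in> space P" for \<omega>
  proof -
    have "freeze \<sigma> \<omega> 0 = 0" using freeze_le[of 0 \<sigma> \<omega>] freeze_nonneg[of \<sigma> \<omega> 0] by simp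
    then show "Y \<omega> 0 = 0" "C \<omega> 0 = 0"
      using N_0[OF that] by (simp_all add: Y_def C_def compensator_def set_integral_point)
  qed
  have Y_int: "integrable R (\<lambda>\<omega>. Y \<omega> t)" if t: "0 \<le> t" for t
    using fin[OF t] Y_R[OF t] N_nonneg
    by (intro integrableI_nonneg) (auto simp: Y_def space_R)
  have C_int: "integrable R (\<lambda>\<omega>. C \<omega> t)" if t: "0 \<le> t" for t
  proof (rule integrableI_nonneg)
    show "AE \<omega> in R. 0 \<le> C \<omega> t"
      using C_incr AE_space[of R]
    proof eventually_elim
      case (elim \<omega>)
      then have "0 \<le> C \<omega> t - C \<omega> 0" using t by (auto dest!: spec[of _ t])
      then show ?case using elim(2) at0 by (simp add: space_R)
    qed
    have "(\<integral>\<^sup>+\<omega>. ennreal (C \<omega> t) \<partial>R) = (\<integral>\<^sup>+\<omega>. ennreal (C \<omega> t - C \<omega> 0) * indicator (space P) \<omega> \<partial>R)"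
      by (intro nn_integral_cong) (simp add: at0 space_R)
    also have "\<dots> = (\<integral>\<^sup>+\<omega>. ennreal (Y \<omega> t - Y \<omega> 0) * indicator (space P) \<omega> \<partial>R)"
      by (rule key[symmetric]) (use t in \<open>auto intro: sets_G_space\<close>)
    also have "\<dots> = (\<integral>\<^sup>+\<omega>. ennreal (Y \<omega> t) \<partial>R)"
      by (intro nn_integral_cong) (simp add: at0 space_R)
    finally show "(\<integral>\<^sup>+\<omega>. ennreal (C \<omega> t) \<partial>R) < \<infinity>" using fin[OF t] by (simp add: Y_def)
  qed (use C_R t in auto)
  show ?thesis
    unfolding is_martingale_def
  proof (intro conjI allI impI)
    show "adapted G (stopped (compensated N l) \<sigma>)"
      unfolding adapted_def X using Y_meas C_meas by auto
    show "integrable R (\<lambda>\<omega>. stopped (compensated N l) \<sigma> \<omega> t)" if "0 \<le> t" for t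
      unfolding X using Y_int[OF that] C_int[OF that] by simp
    fix s t :: real assume s: "0 \<le> s" and st: "s \<le> t"
    interpret S: finite_measure_subalgebra R "G s"
      by unfold_locales (rule subalgebra_R[OF s])
    have t: "0 \<le> t" using s st by simp
    show "AE \<omega> in R. real_cond_exp R (G s) (\<lambda>\<omega>'. stopped (compensated N l) \<sigma> \<omega>' t) \<omega> =
        stopped (compensated N l) \<sigma> \<omega> s"
      unfolding X
    proof (rule S.real_cond_exp_charact)
      fix A assume A: "A \<in> sets (G s)"
      then have AR [measurable]: "A \<in> sets R" by (rule sets_G_subset[OF s])
      note [measurable] = Y_R[OF s] Y_R[OF t] C_R[OF s] C_R[OF t]
      have ind: "set_integrable R A f" if "integrable R f" for f :: "'a \<Rightarrow> real"
        unfolding set_integrable_def by (rule integrable_mult_indicator[OF AR that])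
      have "(LINT \<omega>:A|R. Y \<omega> t - Y \<omega> s) = enn2real (\<integral>\<^sup>+\<omega>. ennreal (Y \<omega> t - Y \<omega> s) * indicator A \<omega> \<partial>R)"
      proof -
        have "(LINT \<omega>:A|R. Y \<omega> t - Y \<omega> s) = enn2real (\<integral>\<^sup>+\<omega>. ennreal (indicator A \<omega> *\<^sub>R (Y \<omega> t - Y \<omega> s)) \<partial>R)"
          unfolding set_lebesgue_integral_def
        proof (rule integral_eq_nn_integral)
          show "AE \<omega> in R. 0 \<le> indicator A \<omega> *\<^sub>R (Y \<omega> t - Y \<omega> s)"
            using N_mono[OF _ freeze_nonneg freeze_mono[OF s st]] by (intro AE_I2) (auto simp: Y_def space_R split: split_indicator)
        qed measurable
        also have "(\<integral>\<^sup>+\<omega>. ennreal (indicator A \<omega> *\<^sub>R (Y \<omega> t - Y \<omega> s)) \<partial>R) =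
            (\<integral>\<^sup>+\<omega>. ennreal (Y \<omega> t - Y \<omega> s) * indicator A \<omega> \<partial>R)"
          by (intro nn_integral_cong) (auto split: split_indicator)
        finally show ?thesis .
      qed
      also have "\<dots> = enn2real (\<integral>\<^sup>+\<omega>. ennreal (C \<omega> t - C \<omega> s) * indicator A \<omega> \<partial>R)"
        by (simp add: key[OF s st A])
      also have "\<dots> = (LINT \<omega>:A|R. C \<omega> t - C \<omega> s)"
      proof -
        have "(LINT \<omega>:A|R. C \<omega> t - C \<omega> s) = enn2real (\<integral>\<^sup>+\<omega>. ennreal (indicator A \<omega> *\<^sub>R (C \<omega> t - C \<omega> s)) \<partial>R)"
          unfolding set_lebesgue_integral_def
        proof (rule integral_eq_nn_integral)
          show "AE \<omega> in R. 0 \<le> indicator A \<omega> *\<^sub>R (C \<omega> t - C \<omega> s)"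
            using C_incr by eventually_elim (use s st t in \<open>auto split: split_indicator\<close>)
        qed measurable
        also have "(\<integral>\<^sup>+\<omega>. ennreal (indicator A \<omega> *\<^sub>R (C \<omega> t - C \<omega> s)) \<partial>R) =
            (\<integral>\<^sup>+\<omega>. ennreal (C \<omega> t - C \<omega> s) * indicator A \<omega> \<partial>R)"
          by (intro nn_integral_cong) (auto split: split_indicator)
        finally show ?thesis by simp
      qed
      finally show "(LINT \<omega>:A|R. Y \<omega> t - C \<omega> t) = (LINT \<omega>:A|R. Y \<omega> s - C \<omega> s)"
        using ind[OF Y_int[OF s]] ind[OF Y_int[OF t]] ind[OF C_int[OF s]] ind[OF C_int[OF t]]
        by (simp add: set_integral_diff)
    qed (use Y_int C_int Y_meas C_meas s t in auto)
  qed
qed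

lemma jump_density_martingale:
  assumes l: "jump_density l" and int: "\<And>t. 0 \<le> t \<Longrightarrow> integrable R (\<lambda>\<omega>. N \<omega> t)"
  shows "is_martingale R G (compensated N l)"
proof -
  have freeze: "freeze (\<lambda>_. top) \<omega> t = t" if "0 \<le> t" for t and \<omega> :: 'a
    using that by (simp add: freeze_def)
  have "is_martingale R G (stopped (compensated N l) (\<lambda>_. top))"
  proof (rule stopped_martingale[OF l])
    fix t :: real assume t: "0 \<le> t"
    have "(\<integral>\<^sup>+\<omega>. ennreal (N \<omega> t) \<partial>R) = ennreal (\<integral>\<omega>. N \<omega> t \<partial>R)"
      using int[OF t] N_nonneg[OF _ t] by (intro nn_integral_eq_integral) (auto simp: space_R)
    then show "(\<integral>\<^sup>+\<omega>. ennreal (N \<omega> (freeze (\<lambda>_. top) \<omega> t)) \<partial>R) < \<infinity>"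
      by (simp add: freeze[OF t])
  next
    have "space Pred \<in> sets Pred" by (rule sets.top)
    then show "{x \<in> space Pred. ennreal (snd x) \<le> top} \<in> sets Pred" by simp
  qed
  moreover have "stopped (compensated N l) (\<lambda>_. top) \<omega> t = compensated N l \<omega> t" if "0 \<le> t" for \<omega> t
    using freeze[OF that, of \<omega>] by (simp add: stopped_def freeze_def)
  ultimately show ?thesis
    unfolding is_martingale_def adapted_def by auto
qed

text \<open>
  The localising sequence consists of the jump times: stopped at the \<open>n\<close>-th one, \<open>N\<close> is at most \<open>n\<close>.
\<close>

lemma jump_density_is_intensity:
  assumes l: "jump_density l"
  shows "is_intensity R G N l"
  unfolding is_intensity_def
proof (intro conjI)
  have "predictable_sigma R G = Pred"
    by (simp add: predictable_sigma_def left_continuous_paths_def space_R)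
  then show "predictable R G l" using jump_densityD(1)[OF l] by (simp add: predictable_def)
  show "AE \<omega> in R. \<forall>t\<ge>0. set_integrable lborel {0..t} (l \<omega>)"
    by (rule jump_density_integrable[OF l])
  define \<sigma> where "\<sigma> n \<omega> = (if J n \<omega> then ennreal (T n \<omega>) else \<infinity>)" for n \<omega>
  have le: "\<sigma> n \<omega> \<le> ennreal t \<longleftrightarrow> real n \<le> N \<omega> t" if "\<omega> \<in> space P" "0 \<le> t" for n \<omega> t
    using jump_time_le_iff[OF that, of n] that by (auto simp: \<sigma>_def top_unique)
  show "is_local_martingale R G (compensated N l)"
    unfolding is_local_martingale_def
  proof (intro exI[of _ \<sigma>] conjI allI)
    show "is_stopping_time R G (\<sigma> n)" for n
      unfolding is_stopping_time_def
    proof (intro allI impI)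
      fix t :: real assume t: "0 \<le> t"
      have "{\<omega> \<in> space R. \<sigma> n \<omega> \<le> ennreal t} = {\<omega> \<in> space P. real n \<le> N \<omega> t}"
        using le[OF _ t] by (auto simp: space_R)
      then show "{\<omega> \<in> space R. \<sigma> n \<omega> \<le> ennreal t} \<in> sets (G t)" using sets_N_ge[OF t] by simp
    qed
    show "AE \<omega> in R. incseq (\<lambda>n. \<sigma> n \<omega>) \<and> (\<lambda>n. \<sigma> n \<omega>) \<longlonglongrightarrow> \<infinity>"
    proof (intro AE_I2 conjI)
      fix \<omega> assume "\<omega> \<in> space R"
      then have \<omega>: "\<omega> \<in> space P" by (simp add: space_R)
      show "incseq (\<lambda>n. \<sigma> n \<omega>)"
        unfolding incseq_def
      proof (intro allI impI)
        fix m n :: nat assume "m \<le> n"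
        then show "\<sigma> m \<omega> \<le> \<sigma> n \<omega>"
          using jump_time_strict_mono[OF \<omega>, of n m] reaches_mono[of n \<omega> m]
          by (cases "m = n") (auto simp: \<sigma>_def intro!: ennreal_leI)
      qed
      show "(\<lambda>n. \<sigma> n \<omega>) \<longlonglongrightarrow> \<infinity>"
      proof (rule order_tendstoI)
        fix a :: ennreal assume "a < \<infinity>"
        then obtain t where t: "0 \<le> t" "a = ennreal t" by (cases a) auto
        obtain k :: nat where k: "N \<omega> t < real k" using reals_Archimedean2 by blast
        have "a < \<sigma> n \<omega>" if "k \<le> n" for n
          using le[OF \<omega> t(1), of n] k that unfolding t(2) by (auto simp: not_le[symmetric])
        then show "\<forall>\<^sub>F n in sequentially. a < \<sigma> n \<omega>"
          by (auto simp: eventually_sequentially)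
      qed (simp add: less_top[symmetric])
    qed
    show "is_martingale R G (stopped (compensated N l) (\<sigma> n))" for n
    proof (rule stopped_martingale[OF l])
      have "ennreal (snd x) \<le> \<sigma> n (fst x) \<longleftrightarrow> \<not> (J n (fst x) \<and> T n (fst x) < snd x)" if "x \<in> space Pred" for x
        using that jump_time_nonneg[of n "fst x"] by (auto simp: \<sigma>_def not_less)
      then have "{x \<in> space Pred. ennreal (snd x) \<le> \<sigma> n (fst x)} = before_jump n"
        unfolding before_jump_def by blast
      then show "{x \<in> space Pred. ennreal (snd x) \<le> \<sigma> n (fst x)} \<in> sets Pred"
        using sets_before_jump by simp
      fix t :: real assume t: "0 \<le> t"
      have "N \<omega> (freeze (\<sigma> n) \<omega> t) \<le> real n" if \<omega>: "\<omega> \<in> space P" for \<omega>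
      proof (rule ccontr)
        let ?s = "freeze (\<sigma> n) \<omega> t"
        assume "\<not> ?thesis"
        then have "n < nat \<lfloor>N \<omega> ?s\<rfloor>"
          using N_eq_nat[OF \<omega> freeze_nonneg, of "\<sigma> n" \<omega> t] by linarith
        then have "real (Suc n) \<le> real (nat \<lfloor>N \<omega> ?s\<rfloor>)"
          by (simp only: of_nat_le_iff Suc_le_eq)
        then have "real (Suc n) \<le> N \<omega> ?s" using N_eq_nat[OF \<omega>, of ?s] by simp
        then have Suc: "J (Suc n) \<omega>" "T (Suc n) \<omega> \<le> ?s"
          using jump_time_le_iff[OF \<omega>, of ?s "Suc n"] by auto
        then have "J n \<omega>" "T n \<omega> < T (Suc n) \<omega>"
          using reaches_mono[of "Suc n" \<omega> n] jump_time_strict_mono[OF \<omega> Suc(1), of n] by auto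
        moreover have "ennreal ?s \<le> \<sigma> n \<omega>" using le_freeze_iff[of ?s t "\<sigma> n" \<omega>] t by simp
        ultimately show False using Suc(2) jump_time_nonneg[of n \<omega>] by (simp add: \<sigma>_def)
      qed
      then have "(\<integral>\<^sup>+\<omega>. ennreal (N \<omega> (freeze (\<sigma> n) \<omega> t)) \<partial>R) \<le> (\<integral>\<^sup>+\<omega>. ennreal (real n) \<partial>R)"
        by (intro nn_integral_mono ennreal_leI) (simp add: space_R)
      also have "\<dots> < \<infinity>"
        using R.emeasure_finite[of "space R"] less_top[of "emeasure R (space R)"]
        by (simp add: ennreal_mult_less_top)
      finally show "(\<integral>\<^sup>+\<omega>. ennreal (N \<omega> (freeze (\<sigma> n) \<omega> t)) \<partial>R) < \<infinity>" .
    qed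
  qed
qed

end

section \<open>Uniqueness of intensities\<close>

definition grid :: "real \<Rightarrow> real \<Rightarrow> nat \<Rightarrow> nat \<Rightarrow> real" where
  "grid s t j i = s + real i * ((t - s) / real j)"

text \<open>
  The index of the first of the points \<open>grid s t j 0\<close>, \<dots>, \<open>grid s t j (j - 1)\<close> outside \<open>K\<close>, and \<open>j\<close> if
  there is none.  The sections of \<open>K\<close> will be intervals starting at \<open>0\<close>, so counting the points inside
  gives that index.
\<close>

definition grid_exit :: "('a \<times> real) set \<Rightarrow> real \<Rightarrow> real \<Rightarrow> nat \<Rightarrow> 'a \<Rightarrow> nat" where
  "grid_exit K s t j \<omega> = card {i. i < j \<and> (\<omega>, grid s t j i) \<in> K}"

lemma grid_0 [simp]: "grid s t j 0 = s"
  by (simp add: grid_def)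

lemma grid_last [simp]: "0 < j \<Longrightarrow> grid s t j j = t"
  by (simp add: grid_def)

lemma grid_mono: "s \<le> t \<Longrightarrow> i \<le> i' \<Longrightarrow> grid s t j i \<le> grid s t j i'"
  unfolding grid_def by (intro add_left_mono mult_right_mono) auto

lemma grid_step: "grid s t j (Suc i) = grid s t j i + (t - s) / real j"
  by (simp add: grid_def distrib_right add_divide_distrib)

lemma grid_bounds: "s \<le> t \<Longrightarrow> 0 < j \<Longrightarrow> i \<le> j \<Longrightarrow> s \<le> grid s t j i \<and> grid s t j i \<le> t"
  using grid_mono[of s t 0 i j] grid_mono[of s t i j j] by simp

lemma grid_exit_le: "grid_exit K s t j \<omega> \<le> j"
proof -
  have "card {i. i < j \<and> (\<omega>, grid s t j i) \<in> K} \<le> card {..<j}"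
    by (rule card_mono) auto
  then show ?thesis by (simp add: grid_exit_def)
qed

lemma less_grid_exit_iff:
  assumes down: "\<And>u v. (\<omega>, u) \<in> K \<Longrightarrow> 0 \<le> v \<Longrightarrow> v \<le> u \<Longrightarrow> (\<omega>, v) \<in> K"
    and s: "0 \<le> s" "s \<le> t"
  shows "i < grid_exit K s t j \<omega> \<longleftrightarrow> i < j \<and> (\<omega>, grid s t j i) \<in> K"
proof -
  let ?I = "{i. i < j \<and> (\<omega>, grid s t j i) \<in> K}"
  have closed: "i' \<in> ?I" if "i \<in> ?I" "i' \<le> i" for i i'
  proof -
    have "0 \<le> grid s t j i'" using grid_mono[of s t 0 i' j] s by simp
    then show ?thesis using that down[of "grid s t j i" "grid s t j i'"] grid_mono[OF s(2) that(2), of j] by auto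
  qed
  have fin: "finite ?I" by simp
  have "?I = {..<card ?I}"
  proof (cases "?I = {}")
    case False
    define m where "m = Max ?I"
    have m: "m \<in> ?I" unfolding m_def by (rule Max_in[OF fin False])
    have "?I = {..m}"
      using closed[OF m] Max_ge[OF fin] unfolding m_def[symmetric] by blast
    then show ?thesis by (simp only: card_atMost lessThan_Suc_atMost)
  next
    case True
    show ?thesis unfolding True by simp
  qed
  then show ?thesis unfolding grid_exit_def by blast
qed

lemma sum_until_grid_exit:
  fixes f :: "nat \<Rightarrow> real"
  assumes down: "\<And>u v. (\<omega>, u) \<in> K \<Longrightarrow> 0 \<le> v \<Longrightarrow> v \<le> u \<Longrightarrow> (\<omega>, v) \<in> K"
    and s: "0 \<le> s" "s \<le> t"
  shows "f (grid_exit K s t j \<omega>) - f 0 =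
    (\<Sum>i<j. indicator K (\<omega>, grid s t j i) * (f (Suc i) - f i))"
proof -
  have "(\<Sum>i<j. indicator K (\<omega>, grid s t j i) * (f (Suc i) - f i)) =
    (\<Sum>i<j. if i < grid_exit K s t j \<omega> then f (Suc i) - f i else 0)"
    by (intro sum.cong) (auto simp: less_grid_exit_iff[OF assms])
  also have "\<dots> = (\<Sum>i\<in>{..<j} \<inter> {i. i < grid_exit K s t j \<omega>}. f (Suc i) - f i)"
    by (simp add: sum.inter_restrict)
  also have "{..<j} \<inter> {i. i < grid_exit K s t j \<omega>} = {..<grid_exit K s t j \<omega>}"
    using grid_exit_le[of K s t j \<omega>] by auto
  also have "(\<Sum>i<grid_exit K s t j \<omega>. f (Suc i) - f i) = f (grid_exit K s t j \<omega>) - f 0"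
    by (rule sum_lessThan_telescope)
  finally show ?thesis by simp
qed

context doleans
begin

lemma martingale_set_integral:
  assumes M: "is_martingale R G M" and s: "0 \<le> s" "s \<le> t" and B: "B \<in> sets (G s)"
  shows "(LINT \<omega>:B|R. M \<omega> t) = (LINT \<omega>:B|R. M \<omega> s)"
proof -
  interpret S: finite_measure_subalgebra R "G s"
    by unfold_locales (rule subalgebra_R[OF s(1)])
  have BR: "B \<in> sets R" by (rule sets_G_subset[OF s(1) B])
  have int: "integrable R (\<lambda>\<omega>. M \<omega> t)" and ms: "(\<lambda>\<omega>. M \<omega> s) \<in> borel_measurable R"
    and AE: "AE \<omega> in R. real_cond_exp R (G s) (\<lambda>\<omega>'. M \<omega>' t) \<omega> = M \<omega> s"
    using M s unfolding is_martingale_def by (auto intro: borel_measurable_integrable)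
  have "(LINT \<omega>:B|R. M \<omega> t) = (LINT \<omega>:B|R. real_cond_exp R (G s) (\<lambda>\<omega>'. M \<omega>' t) \<omega>)"
    by (rule S.real_cond_exp_intA[OF int B])
  also have "\<dots> = (LINT \<omega>:B|R. M \<omega> s)"
    by (rule set_lebesgue_integral_cong_AE) (use BR AE ms in \<open>auto elim: eventually_mono\<close>)
  finally show ?thesis .
qed

lemma set_integrable_R: "integrable R f \<Longrightarrow> B \<in> sets R \<Longrightarrow> set_integrable R B f" for f :: "'a \<Rightarrow> real"
  unfolding set_integrable_def by (rule integrable_mult_indicator)

text \<open>
  The absolute increment is a submartingale; splitting the event by the sign of the increment reduces
  this to the martingale property.
\<close>

lemma martingale_L1_mono:
  assumes M: "is_martingale R G M" and s: "0 \<le> s" "s \<le> r" "r \<le> t" and B: "B \<in> sets (G r)"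
  shows "(LINT \<omega>:B|R. \<bar>M \<omega> r - M \<omega> s\<bar>) \<le> (LINT \<omega>:B|R. \<bar>M \<omega> t - M \<omega> s\<bar>)"
proof -
  have r: "0 \<le> r" and t: "0 \<le> t" using s by auto
  have int: "integrable R (\<lambda>\<omega>. M \<omega> u)" if "0 \<le> u" for u
    using M that unfolding is_martingale_def by blast
  have meas: "(\<lambda>\<omega>. M \<omega> u) \<in> borel_measurable (G r)" if "0 \<le> u" "u \<le> r" for u
    using M that measurable_G_mono[of u r "\<lambda>\<omega>. M \<omega> u" borel] unfolding is_martingale_def adapted_def by auto
  let ?X = "\<lambda>\<omega>. M \<omega> r - M \<omega> s"
  let ?W = "\<lambda>\<omega>. M \<omega> t - M \<omega> s"
  have [measurable]: "?X \<in> borel_measurable (G r)" using meas s r by auto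
  have BP: "B \<subseteq> space (G r)" using sets.sets_into_space[OF B] .
  define B1 where "B1 = {\<omega> \<in> space (G r). \<omega> \<in> B \<and> 0 < ?X \<omega>}"
  define B2 where "B2 = {\<omega> \<in> space (G r). \<omega> \<in> B \<and> \<not> 0 < ?X \<omega>}"
  have B12: "B1 \<in> sets (G r)" "B2 \<in> sets (G r)"
    unfolding B1_def B2_def using B by measurable
  then have B12R: "B1 \<in> sets R" "B2 \<in> sets R" using sets_G_subset[OF r] by auto
  have BR: "B \<in> sets R" using sets_G_subset[OF r B] .
  have dis: "B1 \<inter> B2 = {}" "B1 \<union> B2 = B" using BP by (auto simp: B1_def B2_def)
  have intX: "integrable R ?X" and intW: "integrable R ?W" using int r t s by auto
  have swap: "(LINT \<omega>:B'|R. ?X \<omega>) = (LINT \<omega>:B'|R. ?W \<omega>)" if "B' \<in> sets (G r)" for B'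
    using martingale_set_integral[OF M r s(3) that] int r s t sets_G_subset[OF r that]
    by (simp add: set_integrable_R)
  have "(LINT \<omega>:B|R. \<bar>?X \<omega>\<bar>) = (LINT \<omega>:B1|R. \<bar>?X \<omega>\<bar>) + (LINT \<omega>:B2|R. \<bar>?X \<omega>\<bar>)"
    unfolding dis(2)[symmetric]
    by (intro set_integral_Un dis set_integrable_R B12R) (use intX in auto)
  also have "(LINT \<omega>:B1|R. \<bar>?X \<omega>\<bar>) = (LINT \<omega>:B1|R. ?X \<omega>)"
    by (intro set_lebesgue_integral_cong B12R) (auto simp: B1_def)
  also have "(LINT \<omega>:B2|R. \<bar>?X \<omega>\<bar>) = (LINT \<omega>:B2|R. - ?X \<omega>)"
    by (intro set_lebesgue_integral_cong B12R) (auto simp: B2_def)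
  also have "\<dots> = - (LINT \<omega>:B2|R. ?X \<omega>)"
    by (simp only: set_lebesgue_integral_def scaleR_minus_right Bochner_Integration.integral_minus)
  also have "(LINT \<omega>:B1|R. ?X \<omega>) + - (LINT \<omega>:B2|R. ?X \<omega>) = (LINT \<omega>:B1|R. ?W \<omega>) + - (LINT \<omega>:B2|R. ?W \<omega>)"
    by (simp only: swap[OF B12(1)] swap[OF B12(2)])
  also have "\<dots> = (LINT \<omega>:B1|R. ?W \<omega>) + (LINT \<omega>:B2|R. - ?W \<omega>)"
    by (simp only: set_lebesgue_integral_def scaleR_minus_right Bochner_Integration.integral_minus)
  also have "\<dots> \<le> (LINT \<omega>:B1|R. \<bar>?W \<omega>\<bar>) + (LINT \<omega>:B2|R. \<bar>?W \<omega>\<bar>)"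
    using intW int[OF s(1)] int[OF t] B12R by (intro add_mono set_integral_mono set_integrable_R) auto
  also have "\<dots> = (LINT \<omega>:B|R. \<bar>?W \<omega>\<bar>)"
    unfolding dis(2)[symmetric]
    by (intro set_integral_Un[symmetric] dis set_integrable_R B12R) (use intW in auto)
  finally show ?thesis .
qed

text \<open>
  Stopping a martingale when it leaves a predictable set \<open>K\<close> whose sections are intervals: along
  the grids the stopped increments have mean zero, and they are uniformly integrable because on
  each event known at the exit their absolute mean is at most that of the full increment.  The exit
  time itself need not be a stopping time when the filtration is not right-continuous; observed on a
  grid it is one, and refining the grid recovers the stopped increment.
\<close>

lemma martingale_grid_exit_limit:
  assumes M: "is_martingale R G M" and K: "K \<in> sets Pred"
    and down: "\<And>\<omega> u v. (\<omega>, u) \<in> K \<Longrightarrow> 0 \<le> v \<Longrightarrow> v \<le> u \<Longrightarrow> (\<omega>, v) \<in> K"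
    and s: "0 \<le> s" "s \<le> t" and A: "A \<in> sets (G s)"
    and S: "S \<in> borel_measurable R" "AE \<omega> in R. \<bar>S \<omega>\<bar> \<le> c"
    and lim: "AE \<omega> in R. (\<lambda>j. M \<omega> (grid s t (Suc j) (grid_exit K s t (Suc j) \<omega>)) - M \<omega> s) \<longlonglongrightarrow> S \<omega>"
  shows "(LINT \<omega>:A|R. S \<omega>) = 0"
proof -
  define r where "r j i = grid s t (Suc j) i" for j i
  define \<kappa> where "\<kappa> j \<omega> = grid_exit K s t (Suc j) \<omega>" for j \<omega>
  define Z where "Z j \<omega> = M \<omega> (r j (\<kappa> j \<omega>)) - M \<omega> s" for j \<omega>
  have rb: "s \<le> r j i" "r j i \<le> t" "0 \<le> r j i" if "i \<le> Suc j" for i j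
    using grid_bounds[OF s(2), of "Suc j" i] that s(1) by (auto simp: r_def)
  have rmono: "r j i \<le> r j i'" if "i \<le> i'" for i i' j
    unfolding r_def by (rule grid_mono[OF s(2) that])
  have \<kappa>le: "\<kappa> j \<omega> \<le> Suc j" for j \<omega> unfolding \<kappa>_def by (rule grid_exit_le)
  have \<kappa>iff: "i < \<kappa> j \<omega> \<longleftrightarrow> i < Suc j \<and> (\<omega>, r j i) \<in> K" for i j \<omega>
    unfolding \<kappa>_def r_def by (rule less_grid_exit_iff[OF down s])
  have t: "0 \<le> t" using s by simp
  have int: "integrable R (\<lambda>\<omega>. M \<omega> u)" if "0 \<le> u" for u
    using M that unfolding is_martingale_def by blast
  have ad: "(\<lambda>\<omega>. M \<omega> u) \<in> borel_measurable (G u)" if "0 \<le> u" for u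
    using M that unfolding is_martingale_def adapted_def by auto
  have Kr: "{\<omega> \<in> space P. (\<omega>, u) \<in> K} \<in> sets (G u)" if u: "0 \<le> u" for u
  proof -
    have "(\<lambda>\<omega>. (\<omega>, u)) -` K \<inter> space (G u) \<in> sets (G u)"
      by (rule measurable_sets[OF measurable_Pred_at[OF u] K])
    moreover have "(\<lambda>\<omega>. (\<omega>, u)) -` K \<inter> space (G u) = {\<omega> \<in> space P. (\<omega>, u) \<in> K}" using u by auto
    ultimately show ?thesis by simp
  qed
  have \<kappa>eq: "{\<omega> \<in> space P. \<kappa> j \<omega> = i} \<in> sets (G (r j i))" if i: "i \<le> Suc j" for i j
  proof -
    have "\<kappa> j \<omega> = i \<longleftrightarrow> (\<forall>i'<i. (\<omega>, r j i') \<in> K) \<and> (i < Suc j \<longrightarrow> (\<omega>, r j i) \<notin> K)" for \<omega>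
    proof
      assume "\<kappa> j \<omega> = i"
      then show "(\<forall>i'<i. (\<omega>, r j i') \<in> K) \<and> (i < Suc j \<longrightarrow> (\<omega>, r j i) \<notin> K)"
        using \<kappa>iff[of _ j \<omega>] by blast
    next
      assume *: "(\<forall>i'<i. (\<omega>, r j i') \<in> K) \<and> (i < Suc j \<longrightarrow> (\<omega>, r j i) \<notin> K)"
      have "\<not> i < \<kappa> j \<omega>" using * \<kappa>iff[of i j \<omega>] by blast
      moreover have "\<not> \<kappa> j \<omega> < i" using * \<kappa>iff[of "\<kappa> j \<omega>" j \<omega>] i by auto
      ultimately show "\<kappa> j \<omega> = i" by simp
    qed
    then have "{\<omega> \<in> space P. \<kappa> j \<omega> = i} = {\<omega> \<in> space (G (r j i)).
        (\<forall>i'\<in>{..<i}. \<omega> \<in> {\<omega> \<in> space P. (\<omega>, r j i') \<in> K}) \<and> (i < Suc j \<longrightarrow> \<omega> \<notin> {\<omega> \<in> space P. (\<omega>, r j i) \<in> K})}"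
      using rb(3)[OF i] by auto
    also have "\<dots> \<in> sets (G (r j i))"
    proof -
      have "{\<omega> \<in> space P. (\<omega>, r j i') \<in> K} \<in> sets (G (r j i))" if "i' \<le> i" for i'
        using rb(3)[of i' j] that i by (intro sets_G_mono[OF _ rmono[OF that] Kr]) auto
      then have [measurable]: "{\<omega> \<in> space P. (\<omega>, r j i) \<in> K} \<in> sets (G (r j i))"
        "\<And>i'. i' \<in> {..<i} \<Longrightarrow> {\<omega> \<in> space P. (\<omega>, r j i') \<in> K} \<in> sets (G (r j i))" by auto
      show ?thesis by measurable
    qed
    finally show ?thesis .
  qed
  have Z_sum: "Z j \<omega> = (\<Sum>i<Suc j. indicator K (\<omega>, r j i) * (M \<omega> (r j (Suc i)) - M \<omega> (r j i)))" for j \<omega>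
    using sum_until_grid_exit[OF down s, where f="\<lambda>i. M \<omega> (r j i)" and j="Suc j" and \<omega>=\<omega>]
    by (simp add: Z_def \<kappa>_def r_def)
  have A_R: "A \<in> sets R" by (rule sets_G_subset[OF s(1) A])
  have AP: "A \<subseteq> space P" using sets.sets_into_space[OF A] s by simp
  have ind_int: "integrable R (\<lambda>\<omega>. indicator K (\<omega>, r j i) * (M \<omega> (r j (Suc i)) - M \<omega> (r j i)))"
    if i: "i < Suc j" for i j
  proof -
    let ?E = "{\<omega> \<in> space P. (\<omega>, r j i) \<in> K}"
    have "?E \<in> sets R" using sets_G_subset[OF _ Kr] rb(3)[of i j] i by auto
    moreover have "integrable R (\<lambda>\<omega>. M \<omega> (r j (Suc i)) - M \<omega> (r j i))"
      using int rb(3)[of i j] rb(3)[of "Suc i" j] i by auto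
    ultimately have "integrable R (\<lambda>\<omega>. indicator ?E \<omega> *\<^sub>R (M \<omega> (r j (Suc i)) - M \<omega> (r j i)))"
      by (rule integrable_mult_indicator)
    then show ?thesis
      by (rule Bochner_Integration.integrable_cong[THEN iffD1, rotated -1])
        (auto simp: space_R split: split_indicator)
  qed
  have Z_int: "integrable R (Z j)" for j
    unfolding Z_sum[abs_def] using ind_int by (intro Bochner_Integration.integrable_sum) auto
  have Z_mean: "(LINT \<omega>:A|R. Z j \<omega>) = 0" for j
  proof -
    have zero: "(LINT \<omega>|R. indicator A \<omega> *\<^sub>R (indicator K (\<omega>, r j i) * (M \<omega> (r j (Suc i)) - M \<omega> (r j i)))) = 0"
      if i: "i < Suc j" for i
    proof -
      let ?E = "A \<inter> {\<omega> \<in> space P. (\<omega>, r j i) \<in> K}"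
      have E: "?E \<in> sets (G (r j i))"
        using sets_G_mono[OF s(1) rb(1)[of i j] A] Kr[OF rb(3)[of i j]] i by auto
      have E_R: "?E \<in> sets R" using sets_G_subset[OF rb(3)[of i j] E] i by auto
      have "(LINT \<omega>|R. indicator A \<omega> *\<^sub>R (indicator K (\<omega>, r j i) * (M \<omega> (r j (Suc i)) - M \<omega> (r j i)))) =
        (LINT \<omega>:?E|R. M \<omega> (r j (Suc i)) - M \<omega> (r j i))"
        unfolding set_lebesgue_integral_def
        by (intro Bochner_Integration.integral_cong) (auto simp: space_R split: split_indicator)
      also have "\<dots> = (LINT \<omega>:?E|R. M \<omega> (r j (Suc i))) - (LINT \<omega>:?E|R. M \<omega> (r j i))"
        using i by (intro set_integral_diff set_integrable_R int rb E_R) auto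
      also have "\<dots> = 0"
        using martingale_set_integral[OF M rb(3)[of i j] rmono[of i "Suc i" j] E] i by simp
      finally show ?thesis .
    qed
    have "(LINT \<omega>:A|R. Z j \<omega>) = (\<Sum>i<Suc j. LINT \<omega>|R. indicator A \<omega> *\<^sub>R
        (indicator K (\<omega>, r j i) * (M \<omega> (r j (Suc i)) - M \<omega> (r j i))))"
      unfolding set_lebesgue_integral_def Z_sum scaleR_sum_right
      by (intro Bochner_Integration.integral_sum integrable_mult_indicator A_R ind_int) auto
    also have "\<dots> = 0" using zero by (intro sum.neutral) auto
    finally show ?thesis .
  qed
  define W where "W \<omega> = \<bar>M \<omega> t - M \<omega> s\<bar>" for \<omega>
  have W_int: "integrable R W" unfolding W_def using int s t by auto
  have Zm [measurable]: "Z j \<in> borel_measurable R" for j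
    using Z_int by (rule borel_measurable_integrable)
  have Wm [measurable]: "W \<in> borel_measurable R" using W_int by (rule borel_measurable_integrable)
  define F where "F j = {\<omega> \<in> space R. c + 1 < \<bar>Z j \<omega>\<bar>}" for j
  have F [measurable]: "F j \<in> sets R" for j unfolding F_def by measurable
  \<comment> \<open>Uniform integrability: the event \<open>F j\<close> that the stopped increment exceeds the bound \<open>c\<close> of its limit by
    more than \<open>1\<close> is split according to the exit index.\<close>
  have tail: "(LINT \<omega>|R. indicator (F j) \<omega> * \<bar>Z j \<omega>\<bar>) \<le> (LINT \<omega>|R. indicator (F j) \<omega> * W \<omega>)" for j
  proof -
    let ?E = "\<lambda>i. {\<omega> \<in> space P. \<kappa> j \<omega> = i} \<inter> {\<omega> \<in> space (G (r j i)). c + 1 < \<bar>M \<omega> (r j i) - M \<omega> s\<bar>}"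
    have E: "?E i \<in> sets (G (r j i))" if "i \<le> Suc j" for i
    proof -
      have [measurable]: "(\<lambda>\<omega>. M \<omega> (r j i)) \<in> borel_measurable (G (r j i))"
        "(\<lambda>\<omega>. M \<omega> s) \<in> borel_measurable (G (r j i))"
        using ad[OF rb(3)[OF that]] measurable_G_mono[OF s(1) rb(1)[OF that] ad[OF s(1)]] by auto
      show ?thesis by (intro sets.Int \<kappa>eq that) measurable
    qed
    have E_R: "?E i \<in> sets R" if "i \<le> Suc j" for i
      using sets_G_subset[OF rb(3)[OF that] E[OF that]] .
    have split: "indicator (F j) \<omega> * f (\<kappa> j \<omega>) = (\<Sum>i\<le>Suc j. indicator (?E i) \<omega> * f i)"
      if "\<omega> \<in> space R" for \<omega> and f :: "nat \<Rightarrow> real"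
    proof -
      have "indicator (?E i) \<omega> = (if i = \<kappa> j \<omega> then indicator (F j) \<omega> else (0 :: real))" if "i \<le> Suc j" for i
        using \<open>\<omega> \<in> space R\<close> rb(3)[OF that] by (auto simp: F_def Z_def space_R split: split_indicator)
      then have "(\<Sum>i\<le>Suc j. indicator (?E i) \<omega> * f i) =
          (\<Sum>i\<le>Suc j. if i = \<kappa> j \<omega> then indicator (F j) \<omega> * f i else 0)"
        by (intro sum.cong) auto
      also have "\<dots> = indicator (F j) \<omega> * f (\<kappa> j \<omega>)"
        using \<kappa>le[of j \<omega>] by (subst sum.delta) auto
      finally show ?thesis by simp
    qed
    have "(LINT \<omega>|R. indicator (F j) \<omega> * \<bar>Z j \<omega>\<bar>) =
      (LINT \<omega>|R. (\<Sum>i\<le>Suc j. indicator (?E i) \<omega> * \<bar>M \<omega> (r j i) - M \<omega> s\<bar>))"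
      using split[where f="\<lambda>i. \<bar>M _ (r j i) - M _ s\<bar>"]
      by (intro Bochner_Integration.integral_cong refl) (simp add: Z_def)
    also have "\<dots> = (\<Sum>i\<le>Suc j. LINT \<omega>:?E i|R. \<bar>M \<omega> (r j i) - M \<omega> s\<bar>)"
      unfolding set_lebesgue_integral_def real_scaleR_def
      using integrable_mult_indicator[OF E_R, where f="\<lambda>\<omega>. \<bar>M \<omega> (r j _) - M \<omega> s\<bar>"] int rb(3) s(1)
      by (intro Bochner_Integration.integral_sum) auto
    also have "\<dots> \<le> (\<Sum>i\<le>Suc j. LINT \<omega>:?E i|R. \<bar>M \<omega> t - M \<omega> s\<bar>)"
      using rb E by (intro sum_mono martingale_L1_mono[OF M s(1)]) auto
    also have "\<dots> = (LINT \<omega>|R. (\<Sum>i\<le>Suc j. indicator (?E i) \<omega> * W \<omega>))"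
      unfolding set_lebesgue_integral_def real_scaleR_def W_def[symmetric]
      using integrable_mult_indicator[OF E_R W_int]
      by (intro Bochner_Integration.integral_sum[symmetric]) auto
    also have "\<dots> = (LINT \<omega>|R. indicator (F j) \<omega> * W \<omega>)"
    proof (rule Bochner_Integration.integral_cong[OF refl])
      fix \<omega> assume "\<omega> \<in> space R"
      from split[OF this, of "\<lambda>_. W \<omega>"]
      show "(\<Sum>i\<le>Suc j. indicator (?E i) \<omega> * W \<omega>) = indicator (F j) \<omega> * W \<omega>" by (rule sym)
    qed
    finally show ?thesis .
  qed
  have conv: "AE \<omega> in R. (\<lambda>j. Z j \<omega>) \<longlonglongrightarrow> S \<omega>"
    using lim unfolding Z_def r_def \<kappa>_def .
  have ev: "AE \<omega> in R. \<forall>\<^sub>F j in sequentially. \<omega> \<notin> F j"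
    using conv S(2)
  proof eventually_elim
    case (elim \<omega>)
    have "(\<lambda>j. \<bar>Z j \<omega>\<bar>) \<longlonglongrightarrow> \<bar>S \<omega>\<bar>" using elim(1) by (rule tendsto_rabs)
    moreover have "\<bar>S \<omega>\<bar> < c + 1" using elim(2) by simp
    ultimately have "\<forall>\<^sub>F j in sequentially. \<bar>Z j \<omega>\<bar> < c + 1" by (rule order_tendstoD(2))
    then show ?case by eventually_elim (simp add: F_def)
  qed
  have "(\<lambda>j. LINT \<omega>|R. indicator (F j) \<omega> * W \<omega>) \<longlonglongrightarrow> (LINT \<omega>|R. 0)"
  proof (rule integral_dominated_convergence[where w=W])
    show "AE \<omega> in R. (\<lambda>j. indicator (F j) \<omega> * W \<omega>) \<longlonglongrightarrow> 0"
      using ev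
    proof eventually_elim
      case (elim \<omega>)
      then have "\<forall>\<^sub>F j in sequentially. indicator (F j) \<omega> * W \<omega> = 0"
        by eventually_elim simp
      then show ?case by (rule tendsto_eventually)
    qed
    show "AE \<omega> in R. norm (indicator (F j) \<omega> * W \<omega>) \<le> W \<omega>" for j
      by (intro AE_I2) (auto simp: W_def split: split_indicator)
  qed (use W_int in auto)
  then have W0: "(\<lambda>j. LINT \<omega>|R. indicator (F j) \<omega> * W \<omega>) \<longlonglongrightarrow> 0" by simp
  \<comment> \<open>Off \<open>F j\<close> dominated convergence applies; on \<open>F j\<close> the mean is controlled by \<open>tail\<close>.\<close>
  have "(\<lambda>j. LINT \<omega>|R. indicator A \<omega> * (indicator (space R - F j) \<omega> * Z j \<omega>)) \<longlonglongrightarrow> (LINT \<omega>|R. indicator A \<omega> * S \<omega>)"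
  proof (rule integral_dominated_convergence[where w="\<lambda>_. \<bar>c + 1\<bar>"])
    show "AE \<omega> in R. (\<lambda>j. indicator A \<omega> * (indicator (space R - F j) \<omega> * Z j \<omega>)) \<longlonglongrightarrow> indicator A \<omega> * S \<omega>"
      using ev conv AE_space[of R]
    proof eventually_elim
      case (elim \<omega>)
      have "\<forall>\<^sub>F j in sequentially. Z j \<omega> = indicator (space R - F j) \<omega> * Z j \<omega>"
        using elim(1) by eventually_elim (use elim(3) in simp)
      with elim(2) have "(\<lambda>j. indicator (space R - F j) \<omega> * Z j \<omega>) \<longlonglongrightarrow> S \<omega>"
        by (rule Lim_transform_eventually)
      then show ?case by (rule tendsto_mult_left)
    qed
    show "AE \<omega> in R. norm (indicator A \<omega> * (indicator (space R - F j) \<omega> * Z j \<omega>)) \<le> \<bar>c + 1\<bar>" for j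
      by (intro AE_I2) (auto simp: F_def split: split_indicator)
  qed (use A_R S in auto)
  moreover have "(\<lambda>j. LINT \<omega>|R. indicator A \<omega> * (indicator (space R - F j) \<omega> * Z j \<omega>)) \<longlonglongrightarrow> 0"
  proof (rule Lim_null_comparison[OF _ W0])
    have "norm (LINT \<omega>|R. indicator A \<omega> * (indicator (space R - F j) \<omega> * Z j \<omega>)) \<le> (LINT \<omega>|R. indicator (F j) \<omega> * W \<omega>)" for j
    proof -
      have i1: "integrable R (\<lambda>\<omega>. indicator A \<omega> * (indicator (F j) \<omega> * Z j \<omega>))"
        using integrable_mult_indicator[OF A_R integrable_mult_indicator[OF F Z_int[of j]]] by simp
      have i2: "integrable R (\<lambda>\<omega>. indicator A \<omega> * (indicator (space R - F j) \<omega> * Z j \<omega>))"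
        using integrable_mult_indicator[OF A_R integrable_mult_indicator[OF sets.compl_sets[OF F] Z_int[of j]]] by simp
      have "(LINT \<omega>|R. indicator A \<omega> * (indicator (space R - F j) \<omega> * Z j \<omega>)) +
        (LINT \<omega>|R. indicator A \<omega> * (indicator (F j) \<omega> * Z j \<omega>)) = (LINT \<omega>|R. indicator A \<omega> *\<^sub>R Z j \<omega>)"
        unfolding Bochner_Integration.integral_add[OF i2 i1, symmetric]
        by (intro Bochner_Integration.integral_cong) (auto split: split_indicator)
      also have "\<dots> = 0" using Z_mean[of j] by (simp add: set_lebesgue_integral_def)
      finally have "norm (LINT \<omega>|R. indicator A \<omega> * (indicator (space R - F j) \<omega> * Z j \<omega>)) =
        norm (LINT \<omega>|R. indicator A \<omega> * (indicator (F j) \<omega> * Z j \<omega>))" by simp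
      also have "\<dots> \<le> (LINT \<omega>|R. norm (indicator A \<omega> * (indicator (F j) \<omega> * Z j \<omega>)))"
        by (rule integral_norm_bound)
      also have "\<dots> \<le> (LINT \<omega>|R. indicator (F j) \<omega> * \<bar>Z j \<omega>\<bar>)"
        using i1 integrable_mult_indicator[OF F integrable_abs[OF Z_int[of j]]]
        by (intro integral_mono) (auto split: split_indicator)
      also note tail
      finally show ?thesis .
    qed
    then show "\<forall>\<^sub>F j in sequentially. norm (LINT \<omega>|R. indicator A \<omega> * (indicator (space R - F j) \<omega> * Z j \<omega>))
        \<le> (LINT \<omega>|R. indicator (F j) \<omega> * W \<omega>)" by (intro always_eventually allI)
  qed
  ultimately have "(LINT \<omega>|R. indicator A \<omega> * S \<omega>) = 0" by (rule LIMSEQ_unique)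
  then show ?thesis by (simp add: set_lebesgue_integral_def)
qed

end

lemma eventually_grid_exit_before:
  assumes down: "\<And>u v. (\<omega>, u) \<in> K \<Longrightarrow> 0 \<le> v \<Longrightarrow> v \<le> u \<Longrightarrow> (\<omega>, v) \<in> K"
    and s: "0 \<le> s" "s < u" "u \<le> t" and v: "0 \<le> v" "v < u" "(\<omega>, v) \<notin> K"
  shows "\<forall>\<^sub>F j in sequentially. grid s t (Suc j) (grid_exit K s t (Suc j) \<omega>) < u"
proof -
  have "(\<lambda>j. (t - s) / real (Suc j)) \<longlonglongrightarrow> 0"
    by (rule lim_const_over_n[THEN LIMSEQ_Suc])
  then have "\<forall>\<^sub>F j in sequentially. (t - s) / real (Suc j) < u - v"
    using v(2) by (intro order_tendstoD(2)) auto
  then show ?thesis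
  proof eventually_elim
    case (elim j)
    show ?case
    proof (cases "grid_exit K s t (Suc j) \<omega>")
      case 0 then show ?thesis using s by simp
    next
      case (Suc i)
      have "(\<omega>, grid s t (Suc j) i) \<in> K"
        using less_grid_exit_iff[OF down s(1), where t=t and i=i and j="Suc j"] Suc s by auto
      then have "\<not> v \<le> grid s t (Suc j) i"
        using down[of "grid s t (Suc j) i" v] v by auto
      then show ?thesis using elim unfolding Suc grid_step by linarith
    qed
  qed
qed

lemma before_grid_exit:
  assumes down: "\<And>u v. (\<omega>, u) \<in> K \<Longrightarrow> 0 \<le> v \<Longrightarrow> v \<le> u \<Longrightarrow> (\<omega>, v) \<in> K"
    and s: "0 \<le> s" "s < u" "u \<le> t" and K: "(\<omega>, u) \<in> K"
  shows "u \<le> grid s t (Suc j) (grid_exit K s t (Suc j) \<omega>)"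
proof (rule ccontr)
  let ?n = "grid_exit K s t (Suc j) \<omega>"
  assume "\<not> ?thesis"
  then have less: "grid s t (Suc j) ?n < u" by simp
  then have "?n \<noteq> Suc j" using s by auto
  then have n: "?n < Suc j" using grid_exit_le[of K s t "Suc j" \<omega>] by simp
  have "0 \<le> grid s t (Suc j) ?n"
    using grid_bounds[of s t "Suc j" ?n] n s by auto
  then have "(\<omega>, grid s t (Suc j) ?n) \<in> K" using down[OF K] less by simp
  then have "?n < ?n" using less_grid_exit_iff[OF down s(1), where t=t and i="?n" and j="Suc j"] n s by auto
  then show False by simp
qed

context filtered_space
begin

text \<open>
  A single time has measure zero, so the set of times with running integral at most \<open>c\<close> is closed;
  Fatou's lemma also covers the case that the integral jumps to infinity.
\<close>

lemma running_integral_closed: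
  fixes a :: "'a \<times> real \<Rightarrow> ennreal"
  assumes a: "a \<in> borel_measurable Pred" and \<omega>: "\<omega> \<in> space P" and u: "0 < u"
    and le: "\<And>v. 0 \<le> v \<Longrightarrow> v < u \<Longrightarrow> (\<integral>\<^sup>+w. a (\<omega>, w) * indicator {0..v} w \<partial>lborel) \<le> c"
  shows "(\<integral>\<^sup>+w. a (\<omega>, w) * indicator {0..u} w \<partial>lborel) \<le> c"
proof -
  let ?v = "\<lambda>n. max 0 (u - 1 / real (Suc n))"
  have [measurable]: "(\<lambda>w. a (\<omega>, max 0 w)) \<in> borel_measurable borel"
    by (rule measurable_compose[OF measurable_section[OF \<omega>] a])
  have eq: "a (\<omega>, w) * indicator {0..v} w = a (\<omega>, max 0 w) * indicator {0..v} w" for v w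
    by (auto split: split_indicator)
  have "(\<integral>\<^sup>+w. a (\<omega>, w) * indicator {0..u} w \<partial>lborel) \<le>
    (\<integral>\<^sup>+w. liminf (\<lambda>n. a (\<omega>, max 0 w) * indicator {0..?v n} w) \<partial>lborel)"
  proof (rule nn_integral_mono_AE, rule AE_mp[OF AE_lborel_singleton[of u]], intro AE_I2 impI)
    fix w assume w: "w \<noteq> u"
    show "a (\<omega>, w) * indicator {0..u} w \<le> liminf (\<lambda>n. a (\<omega>, max 0 w) * indicator {0..?v n} w)"
    proof (cases "w \<in> {0..u}")
      case True
      then have "w < u" using w by simp
      have "(\<lambda>n. 1 / real (Suc n)) \<longlonglongrightarrow> 0" using lim_const_over_n[of 1, THEN LIMSEQ_Suc] .
      then have "\<forall>\<^sub>F n in sequentially. 1 / real (Suc n) < u - w"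
        using \<open>w < u\<close> by (intro order_tendstoD(2)) auto
      then have "\<forall>\<^sub>F n in sequentially. a (\<omega>, w) \<le> a (\<omega>, max 0 w) * indicator {0..?v n} w"
        by eventually_elim (use True in \<open>auto split: split_indicator\<close>)
      then have "a (\<omega>, w) \<le> liminf (\<lambda>n. a (\<omega>, max 0 w) * indicator {0..?v n} w)"
        by (rule Liminf_bounded)
      then show ?thesis using True by simp
    qed simp
  qed
  also have "\<dots> \<le> liminf (\<lambda>n. \<integral>\<^sup>+w. a (\<omega>, max 0 w) * indicator {0..?v n} w \<partial>lborel)"
    by (rule nn_integral_liminf) measurable
  also have "\<dots> \<le> c"
  proof (rule Liminf_le)
    show "\<forall>\<^sub>F n in sequentially. (\<integral>\<^sup>+w. a (\<omega>, max 0 w) * indicator {0..?v n} w \<partial>lborel) \<le> c"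
      unfolding eq[symmetric] using u by (intro always_eventually allI le) auto
  qed simp
  finally show ?thesis .
qed

text \<open>
  All of the section of \<open>E\<close> lies before its supremum, and the running integral up to there is still at
  most \<open>c\<close>.
\<close>

lemma running_integral_until_le:
  fixes a :: "'a \<times> real \<Rightarrow> ennreal"
  assumes a: "a \<in> borel_measurable Pred" and \<omega>: "\<omega> \<in> space P"
    and E: "\<And>u. (\<omega>, u) \<in> E \<Longrightarrow> (\<integral>\<^sup>+w. a (\<omega>, w) * indicator {0..u} w \<partial>lborel) \<le> c"
  shows "(\<integral>\<^sup>+u. a (\<omega>, u) * indicator E (\<omega>, u) * indicator {0..t} u \<partial>lborel) \<le> c"
proof -
  let ?V = "\<lambda>u. \<integral>\<^sup>+w. a (\<omega>, w) * indicator {0..u} w \<partial>lborel"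
  let ?S = "{u \<in> {0<..t}. (\<omega>, u) \<in> E}"
  show ?thesis
  proof (cases "?S = {}")
    case True
    have "(\<integral>\<^sup>+u. a (\<omega>, u) * indicator E (\<omega>, u) * indicator {0..t} u \<partial>lborel) = (\<integral>\<^sup>+u. 0 \<partial>(lborel :: real measure))"
    proof (rule nn_integral_cong_AE)
      have "AE u in lborel. u \<noteq> (0::real)" by (rule AE_lborel_singleton)
      then show "AE u in lborel. a (\<omega>, u) * indicator E (\<omega>, u) * indicator {0..t} u = 0"
        by eventually_elim (use True in \<open>auto split: split_indicator\<close>)
    qed
    then show ?thesis by simp
  next
    case False
    define z where "z = Sup ?S"
    have bdd: "bdd_above ?S" by (rule bdd_aboveI[of _ t]) auto
    have upper: "u \<le> z" if "u \<in> ?S" for u unfolding z_def by (rule cSup_upper[OF that bdd])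
    obtain u0 where u0: "u0 \<in> ?S" using False by blast
    have z: "0 < z" using upper[OF u0] u0 by auto
    have "?V v \<le> c" if v: "0 \<le> v" "v < z" for v
    proof -
      obtain u where u: "u \<in> ?S" "v < u"
        using less_cSup_iff[OF _ bdd, of v] u0 v(2) unfolding z_def by blast
      have "?V v \<le> ?V u" using u(2) by (intro nn_integral_mono) (auto split: split_indicator)
      also have "\<dots> \<le> c" using u(1) by (intro E) simp
      finally show ?thesis .
    qed
    then have zK: "?V z \<le> c" by (rule running_integral_closed[OF a \<omega> z])
    have "(\<integral>\<^sup>+u. a (\<omega>, u) * indicator E (\<omega>, u) * indicator {0..t} u \<partial>lborel) \<le> ?V z"
    proof (rule nn_integral_mono)
      fix u
      have "u \<le> z" if "(\<omega>, u) \<in> E" "0 \<le> u" "u \<le> t"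
        using that upper[of u] z by (cases "u = 0") auto
      then show "a (\<omega>, u) * indicator E (\<omega>, u) * indicator {0..t} u \<le> a (\<omega>, u) * indicator {0..z} u"
        by (auto split: split_indicator)
    qed
    with zK show ?thesis by simp
  qed
qed

text \<open>
  The complement is a union of sets \<open>{\<tau> \<le> q} \<times> (q, \<infinity>)\<close> over rational \<open>q\<close>.
\<close>

lemma sets_stopping_time:
  assumes \<tau>: "\<And>t. 0 \<le> t \<Longrightarrow> {\<omega> \<in> space P. \<tau> \<omega> \<le> ennreal t} \<in> sets (G t)"
  shows "{x \<in> space Pred. ennreal (snd x) \<le> \<tau> (fst x)} \<in> sets Pred"
proof -
  let ?Q = "\<rat> \<inter> {0::real..}"
  have "{x \<in> space Pred. ennreal (snd x) \<le> \<tau> (fst x)} =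
    space Pred - (\<Union>q\<in>?Q. {\<omega> \<in> space P. \<tau> \<omega> \<le> ennreal q} \<times> {q<..})"
  proof (rule set_eqI)
    fix x :: "'a \<times> real"
    obtain \<omega> u where x: "x = (\<omega>, u)" by (cases x)
    have "\<not> ennreal u \<le> \<tau> \<omega> \<longleftrightarrow> (\<exists>q\<in>?Q. \<tau> \<omega> \<le> ennreal q \<and> q < u)" if "0 \<le> u"
    proof
      assume "\<not> ennreal u \<le> \<tau> \<omega>"
      then have less: "\<tau> \<omega> < ennreal u" by simp
      then obtain t where t: "0 \<le> t" "\<tau> \<omega> = ennreal t" by (cases "\<tau> \<omega>") auto
      then have "t < u" using less by (simp add: ennreal_less_iff)
      then obtain q where "q \<in> \<rat>" "t < q" "q < u" using Rats_dense_in_real by blast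
      then show "\<exists>q\<in>?Q. \<tau> \<omega> \<le> ennreal q \<and> q < u" using t by (intro bexI[of _ q]) (auto intro: ennreal_leI)
    next
      assume "\<exists>q\<in>?Q. \<tau> \<omega> \<le> ennreal q \<and> q < u"
      then obtain q where q: "0 \<le> q" "\<tau> \<omega> \<le> ennreal q" "q < u" by auto
      then have "\<tau> \<omega> < ennreal u" using q by (intro le_less_trans[OF q(2)]) (simp add: ennreal_less_iff)
      then show "\<not> ennreal u \<le> \<tau> \<omega>" by simp
    qed
    then show "x \<in> {x \<in> space Pred. ennreal (snd x) \<le> \<tau> (fst x)} \<longleftrightarrow>
      x \<in> space Pred - (\<Union>q\<in>?Q. {\<omega> \<in> space P. \<tau> \<omega> \<le> ennreal q} \<times> {q<..})"
      unfolding x by auto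
  qed
  also have "\<dots> \<in> sets Pred"
  proof (intro sets.Diff sets.top sets.countable_UN'')
    show "countable ?Q" using countable_rat by blast
    show "{\<omega> \<in> space P. \<tau> \<omega> \<le> ennreal q} \<times> {q<..} \<in> sets Pred" if "q \<in> ?Q" for q
      using that by (intro sets_Pred_Ici \<tau>) auto
  qed
  finally show ?thesis .
qed

end

context doleans
begin

text \<open>
  Only the compensated process stopped at \<open>\<tau>\<close> is known to be a martingale.  It is stopped once more
  when it leaves the set \<open>K\<close> on which the variation of \<open>k\<close> and the number of jumps are at most \<open>m\<close>.
  There the jump count \<open>c\<close> and the integrals \<open>p\<close>, \<open>q\<close> of the positive and the negative part of \<open>k\<close> are
  bounded, and \<open>c - (p - q)\<close> has mean zero on all events of the past.  As \<open>c\<close> has the same mean as the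
  integral of \<open>l\<close>, the measures with densities \<open>l + k\<^sup>-\<close> and \<open>k\<^sup>+\<close> with respect to \<open>muL\<close>, restricted to
  \<open>E\<close>, agree on rectangles, hence everywhere, and their densities coincide.  The negative part is
  moved to the other side because an intensity is not required to be nonnegative.
\<close>

lemma intensity_eq_jump_density:
  assumes l: "jump_density l" and k: "case_prod k \<in> borel_measurable Pred"
    and k_int: "AE \<omega> in R. \<forall>t\<ge>0. set_integrable lborel {0..t} (k \<omega>)"
    and \<tau>: "\<And>t. 0 \<le> t \<Longrightarrow> {\<omega> \<in> space P. \<tau> \<omega> \<le> ennreal t} \<in> sets (G t)"
    and M: "is_martingale R G (stopped (compensated N k) \<tau>)"
  shows "AE x in muL. (\<integral>\<^sup>+v. ennreal \<bar>k (fst x) v\<bar> * indicator {0..snd x} v \<partial>lborel) \<le> ennreal (real m) \<longrightarrow>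
    x \<in> before_jump m \<longrightarrow> ennreal (snd x) \<le> \<tau> (fst x) \<longrightarrow> l (fst x) (snd x) = k (fst x) (snd x)"
proof -
  define V where "V x = (\<integral>\<^sup>+v. ennreal \<bar>k (fst x) v\<bar> * indicator {0..snd x} v \<partial>lborel)" for x
  define K where "K = {x \<in> space Pred. V x \<le> ennreal (real m) \<and> x \<in> before_jump m}"
  define B where "B = {x \<in> space Pred. ennreal (snd x) \<le> \<tau> (fst x)}"
  define E where "E = K \<inter> B"
  have km [measurable]: "(\<lambda>x. k (fst x) (snd x)) \<in> borel_measurable Pred"
    using k by (simp add: case_prod_beta')
  have lm [measurable]: "(\<lambda>x. l (fst x) (snd x)) \<in> borel_measurable Pred"
    using jump_densityD(1)[OF l] by (simp add: case_prod_beta')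
  have am: "(\<lambda>x. ennreal \<bar>k (fst x) (snd x)\<bar>) \<in> borel_measurable Pred" by measurable
  have [measurable]: "V \<in> borel_measurable Pred"
    using measurable_running_nn_integral[OF am] unfolding V_def[abs_def] by simp
  have [measurable]: "K \<in> sets Pred" unfolding K_def by measurable
  have [measurable]: "B \<in> sets Pred" unfolding B_def by (rule sets_stopping_time[OF \<tau>])
  have E [measurable]: "E \<in> sets Pred" unfolding E_def by measurable
  have V_mono: "V (\<omega>, v) \<le> V (\<omega>, u)" if "v \<le> u" for \<omega> u v
    unfolding V_def using that by (intro nn_integral_mono) (auto split: split_indicator)
  have down: "(\<omega>, v) \<in> K" if "(\<omega>, u) \<in> K" "0 \<le> v" "v \<le> u" for \<omega> u v
    using that V_mono[OF that(3), of \<omega>] by (auto simp: K_def before_jump_iff)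
  have closed: "(\<omega>, u) \<in> K" if \<omega>: "\<omega> \<in> space P" and u: "0 < u" and all: "\<And>v. 0 \<le> v \<Longrightarrow> v < u \<Longrightarrow> (\<omega>, v) \<in> K" for \<omega> u
  proof -
    have "V (\<omega>, u) \<le> ennreal (real m)"
      using running_integral_closed[OF am \<omega> u, of "ennreal (real m)"] all by (auto simp: V_def K_def)
    moreover have "\<not> (J m \<omega> \<and> T m \<omega> < u)"
    proof
      assume *: "J m \<omega> \<and> T m \<omega> < u"
      obtain v where v: "T m \<omega> < v" "v < u" using dense * by blast
      then have "0 \<le> v" using jump_time_nonneg[of m \<omega>] by simp
      with all[OF this v(2)] v * show False by (auto simp: K_def before_jump_iff)
    qed
    ultimately show ?thesis using \<omega> u by (auto simp: K_def before_jump_iff)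
  qed
  have in_B: "(\<omega>, u) \<in> B \<and> u \<le> t \<longleftrightarrow> u \<le> freeze \<tau> \<omega> t" if "\<omega> \<in> space P" "0 \<le> u" "0 \<le> t" for \<omega> u t
    using le_freeze_iff[OF that(2,3), of \<tau> \<omega>] that by (auto simp: B_def)
  have V_E: "(\<integral>\<^sup>+u. ennreal \<bar>k \<omega> u\<bar> * indicator E (\<omega>, u) * indicator {0..t} u \<partial>lborel) \<le> ennreal (real m)"
    if \<omega>: "\<omega> \<in> space P" and t: "0 \<le> t" for \<omega> t
    using running_integral_until_le[OF am \<omega>, of E "ennreal (real m)" t]
    by (auto simp: E_def K_def V_def)
  define f1 where "f1 x = (ennreal (l (fst x) (snd x)) + ennreal (- k (fst x) (snd x))) * indicator E x" for x
  define f2 where "f2 x = ennreal (k (fst x) (snd x)) * indicator E x" for x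
  have [measurable]: "f1 \<in> borel_measurable Pred" "f2 \<in> borel_measurable Pred"
    unfolding f1_def[abs_def] f2_def[abs_def] by measurable
  define c where "c s t \<omega> = jump_sum N (\<lambda>u. indicator (E \<inter> space P \<times> {s<..t}) (\<omega>, u)) \<omega>" for s t \<omega>
  define p where "p s t \<omega> = (\<integral>\<^sup>+u. ennreal (k \<omega> u) * indicator (E \<inter> space P \<times> {s<..t}) (\<omega>, u) * indicator {0..} u \<partial>lborel)" for s t \<omega>
  define q where "q s t \<omega> = (\<integral>\<^sup>+u. ennreal (- k \<omega> u) * indicator (E \<inter> space P \<times> {s<..t}) (\<omega>, u) * indicator {0..} u \<partial>lborel)" for s t \<omega>
  have D: "space P \<times> {s<..t} \<in> sets Pred" if "0 \<le> s" for s t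
    using that by (intro rectangle_in_Pred rectangle_Ioc sets_G_space)
  have meas: "c s t \<in> borel_measurable R" "p s t \<in> borel_measurable R" "q s t \<in> borel_measurable R"
    if "0 \<le> s" for s t
  proof -
    note [measurable] = D[OF that, of t]
    show "c s t \<in> borel_measurable R"
      unfolding c_def[abs_def] by (rule measurable_jump_sum) measurable
    show "p s t \<in> borel_measurable R"
      using measurable_time_integral[of "\<lambda>x. ennreal (k (fst x) (snd x)) * indicator (E \<inter> space P \<times> {s<..t}) x"]
      unfolding p_def[abs_def] by simp
    show "q s t \<in> borel_measurable R"
      using measurable_time_integral[of "\<lambda>x. ennreal (- k (fst x) (snd x)) * indicator (E \<inter> space P \<times> {s<..t}) x"]
      unfolding q_def[abs_def] by simp
  qed
  have bound: "c s t \<omega> \<le> ennreal (real m)" "p s t \<omega> \<le> ennreal (real m)" "q s t \<omega> \<le> ennreal (real m)"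
    if \<omega>: "\<omega> \<in> space P" and s: "0 \<le> s" "s \<le> t" for s t \<omega>
  proof -
    have "c s t \<omega> \<le> jump_sum N (\<lambda>u. indicator (before_jump m) (\<omega>, u)) \<omega>"
      unfolding c_def jump_sum_def
      by (intro suminf_le) (auto simp: E_def K_def split: split_indicator)
    also have "\<dots> \<le> of_nat m" by (rule jumps_before_jump[OF \<omega>])
    finally show "c s t \<omega> \<le> ennreal (real m)" by (simp add: ennreal_of_nat_eq_real_of_nat)
    have "p s t \<omega> \<le> (\<integral>\<^sup>+u. ennreal \<bar>k \<omega> u\<bar> * indicator E (\<omega>, u) * indicator {0..t} u \<partial>lborel)"
      unfolding p_def using s by (intro nn_integral_mono) (auto intro!: ennreal_leI split: split_indicator)
    also have "\<dots> \<le> ennreal (real m)" using s by (intro V_E[OF \<omega>]) simp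
    finally show "p s t \<omega> \<le> ennreal (real m)" .
    have "q s t \<omega> \<le> (\<integral>\<^sup>+u. ennreal \<bar>k \<omega> u\<bar> * indicator E (\<omega>, u) * indicator {0..t} u \<partial>lborel)"
      unfolding q_def using s by (intro nn_integral_mono) (auto intro!: ennreal_leI split: split_indicator)
    also have "\<dots> \<le> ennreal (real m)" using s by (intro V_E[OF \<omega>]) simp
    finally show "q s t \<omega> \<le> ennreal (real m)" .
  qed
  have mean: "(\<integral>\<^sup>+\<omega>. (c s t \<omega> + q s t \<omega>) * indicator A \<omega> \<partial>R) = (\<integral>\<^sup>+\<omega>. p s t \<omega> * indicator A \<omega> \<partial>R)"
    if s: "0 \<le> s" "s \<le> t" and A: "A \<in> sets (G s)" for A s t
  proof -
    have t: "0 \<le> t" using s by simp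
    have A_R: "A \<in> sets R" by (rule sets_G_subset[OF s(1) A])
    define S where "S \<omega> = enn2real (c s t \<omega>) - (enn2real (p s t \<omega>) - enn2real (q s t \<omega>))" for \<omega>
    have bound_R: "0 \<le> enn2real y \<and> enn2real y \<le> real m" if "y \<le> ennreal (real m)" for y
      using enn2real_mono[OF that] by simp
    have bd: "enn2real (c s t \<omega>) \<le> real m" "enn2real (p s t \<omega>) \<le> real m" "enn2real (q s t \<omega>) \<le> real m"
      if "\<omega> \<in> space R" for \<omega>
      using bound[of \<omega>, OF _ s] that bound_R by (auto simp: space_R)
    have zero: "(LINT \<omega>:A|R. S \<omega>) = 0"
    proof (rule martingale_grid_exit_limit[OF M _ _ s A])
      show "K \<in> sets Pred" by measurable
      show "(\<omega>, v) \<in> K" if "(\<omega>, u) \<in> K" "0 \<le> v" "v \<le> u" for \<omega> u v using down that by blast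
      show "S \<in> borel_measurable R"
        unfolding S_def[abs_def] using meas[OF s(1), of t] by measurable
      show "AE \<omega> in R. \<bar>S \<omega>\<bar> \<le> 3 * real m"
      proof (rule AE_I2)
        fix \<omega> assume "\<omega> \<in> space R"
        from bd[OF this] show "\<bar>S \<omega>\<bar> \<le> 3 * real m"
          using enn2real_nonneg[of "c s t \<omega>"] enn2real_nonneg[of "p s t \<omega>"] enn2real_nonneg[of "q s t \<omega>"]
          unfolding S_def by linarith
      qed
      show "AE \<omega> in R. (\<lambda>j. stopped (compensated N k) \<tau> \<omega> (grid s t (Suc j) (grid_exit K s t (Suc j) \<omega>)) -
          stopped (compensated N k) \<tau> \<omega> s) \<longlonglongrightarrow> S \<omega>"
        using k_int
      proof (rule AE_mp, intro AE_I2 impI)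
        fix \<omega> assume "\<omega> \<in> space R" and int: "\<forall>t\<ge>0. set_integrable lborel {0..t} (k \<omega>)"
        then have \<omega>: "\<omega> \<in> space P" by (simp add: space_R)
        define g where "g j = grid s t (Suc j) (grid_exit K s t (Suc j) \<omega>)" for j
        have g: "s \<le> g j" "g j \<le> t" for j
          using grid_bounds[OF s(2), of "Suc j" "grid_exit K s t (Suc j) \<omega>"] grid_exit_le[of K s t "Suc j" \<omega>]
          by (auto simp: g_def)
        \<comment> \<open>As the grid is refined, the interval before the grid exit shrinks to the section of \<open>K\<close>, at every
          single time and not just almost everywhere; so jumps and time integral converge together.\<close>
        have lim: "(\<lambda>j. indicator (B \<inter> space P \<times> {s<..g j}) (\<omega>, u)) \<longlonglongrightarrow>
            (indicator (E \<inter> space P \<times> {s<..t}) (\<omega>, u) :: real)" if "0 \<le> u" for u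
        proof (cases "s < u \<and> u \<le> t \<and> (\<omega>, u) \<in> B")
          case False
          then have "indicator (B \<inter> space P \<times> {s<..g j}) (\<omega>, u) = (0::real)" for j
            using g(2)[of j] by (auto split: split_indicator)
          moreover have "indicator (E \<inter> space P \<times> {s<..t}) (\<omega>, u) = (0::real)"
            using False by (auto simp: E_def split: split_indicator)
          ultimately show ?thesis by simp
        next
          case True
          show ?thesis
          proof (cases "(\<omega>, u) \<in> K")
            case uK: True
            have "u \<le> g j" for j
              unfolding g_def using True by (intro before_grid_exit[OF down s(1) _ _ uK]) auto
            then have "indicator (B \<inter> space P \<times> {s<..g j}) (\<omega>, u) = (1::real)" for j
              using True \<omega> by auto
            moreover have "indicator (E \<inter> space P \<times> {s<..t}) (\<omega>, u) = (1::real)"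
              using True uK \<omega> by (auto simp: E_def)
            ultimately show ?thesis by simp
          next
            case uK: False
            have "0 < u" using True s by linarith
            then obtain v where v: "0 \<le> v" "v < u" "(\<omega>, v) \<notin> K" using closed[OF \<omega>, of u] uK by blast
            have "\<forall>\<^sub>F j in sequentially. g j < u"
              unfolding g_def using True by (intro eventually_grid_exit_before[OF down s(1) _ _ v]) auto
            then have "\<forall>\<^sub>F j in sequentially. indicator (B \<inter> space P \<times> {s<..g j}) (\<omega>, u) = (0::real)"
              by eventually_elim auto
            moreover have "indicator (E \<inter> space P \<times> {s<..t}) (\<omega>, u) = (0::real)"
              using uK by (auto simp: E_def)
            ultimately show ?thesis by (simp add: tendsto_eventually)
          qed
        qed
        define n0 where "n0 = nat \<lfloor>N \<omega> t\<rfloor>"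
        have jumps: "enn2real (jump_sum N (\<lambda>u. indicator (X \<inter> space P \<times> {s<..v}) (\<omega>, u)) \<omega>) =
            (\<Sum>n<n0. indicator (X \<inter> space P \<times> {s<..v}) (\<omega>, T (Suc n) \<omega>))" if "v \<le> t" for X v
        proof -
          have "jump_sum N (\<lambda>u. indicator (X \<inter> space P \<times> {s<..v}) (\<omega>, u)) \<omega> =
            jump_sum N (\<lambda>u. indicator (X \<inter> space P \<times> {s<..v}) (\<omega>, u) * indicator {0..t} u) \<omega>"
            by (intro jump_sum_cong) (use that s in \<open>auto split: split_indicator\<close>)
          also have "\<dots> = (\<Sum>n<n0. indicator (X \<inter> space P \<times> {s<..v}) (\<omega>, T (Suc n) \<omega>))"
            unfolding n0_def by (rule jump_sum_until[OF \<omega> t])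
          also have "\<dots> = ennreal (\<Sum>n<n0. indicator (X \<inter> space P \<times> {s<..v}) (\<omega>, T (Suc n) \<omega>))"
            by (subst sum_ennreal[symmetric]) (auto simp: ennreal_indicator)
          finally show ?thesis by (simp add: sum_nonneg)
        qed
        have ktm: "(\<lambda>u. indicator {0..t} u * k \<omega> u) \<in> borel_measurable borel"
          by (rule measurable_restricted_path[OF k \<omega>]) auto
        have Xm: "(\<lambda>u. indicator X (\<omega>, max 0 u) :: real) \<in> borel_measurable borel" if "X \<in> sets Pred" for X
          by (rule measurable_compose[OF measurable_section[OF \<omega>] borel_measurable_indicator[OF that]])
        have incr: "stopped (compensated N k) \<tau> \<omega> v - stopped (compensated N k) \<tau> \<omega> s =
          (\<Sum>n<n0. indicator (B \<inter> space P \<times> {s<..v}) (\<omega>, T (Suc n) \<omega>)) -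
          (LINT u|lborel. indicator (B \<inter> space P \<times> {s<..v}) (\<omega>, max 0 u) * (indicator {0..t} u * k \<omega> u))"
          if v: "s \<le> v" "v \<le> t" for v
        proof -
          let ?a = "freeze \<tau> \<omega> s" and ?b = "freeze \<tau> \<omega> v"
          have v0: "0 \<le> v" using v s by simp
          have ab: "0 \<le> ?a" "?a \<le> ?b" using s v by (auto intro: freeze_mono)
          have iff: "u \<in> {?a<..?b} \<longleftrightarrow> (\<omega>, u) \<in> B \<inter> space P \<times> {s<..v}" if "0 \<le> u" for u
            using in_B[OF \<omega> that v0] in_B[OF \<omega> that s(1)] v \<omega> by auto
          have "N \<omega> ?b - N \<omega> ?a = enn2real (jump_sum N (indicator {?a<..?b}) \<omega>)"
            using N_mono[OF \<omega> ab] by (simp add: jump_sum_Ioc[OF \<omega> ab])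
          also have "jump_sum N (indicator {?a<..?b}) \<omega> =
              jump_sum N (\<lambda>u. indicator (B \<inter> space P \<times> {s<..v}) (\<omega>, u)) \<omega>"
            by (intro jump_sum_cong) (simp only: indicator_def iff[OF jump_time_nonneg])
          finally have 1: "N \<omega> ?b - N \<omega> ?a = (\<Sum>n<n0. indicator (B \<inter> space P \<times> {s<..v}) (\<omega>, T (Suc n) \<omega>))"
            by (simp add: jumps[OF v(2)])
          have "compensator k \<omega> ?b - compensator k \<omega> ?a = (LINT u:{?a<..?b}|lborel. k \<omega> u)"
            unfolding compensator_def by (rule set_integral_difference[OF _ ab]) (use int in simp)
          also have "\<dots> = (LINT u|lborel. indicator (B \<inter> space P \<times> {s<..v}) (\<omega>, max 0 u) * (indicator {0..t} u * k \<omega> u))"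
            unfolding set_lebesgue_integral_def
          proof (rule Bochner_Integration.integral_cong[OF refl])
            fix u
            have "u \<notin> {?a<..?b}" if "\<not> 0 \<le> u"
              using that ab(1) unfolding greaterThanAtMost_iff by linarith
            moreover have "u \<le> t" if "u \<in> {?a<..?b}"
              using that freeze_le[OF v0, of \<tau> \<omega>] v(2) by simp
            ultimately show "indicator {?a<..?b} u *\<^sub>R k \<omega> u =
              indicator (B \<inter> space P \<times> {s<..v}) (\<omega>, max 0 u) * (indicator {0..t} u * k \<omega> u)"
              using iff[of u] by (cases "0 \<le> u") (auto simp: indicator_def)
          qed
          finally have 2: "compensator k \<omega> ?b - compensator k \<omega> ?a = \<dots>" .
          show ?thesis
            using 1 2 by (simp add: stopped_def compensated_def freeze_def)
        qed
        have S: "S \<omega> = (\<Sum>n<n0. indicator (E \<inter> space P \<times> {s<..t}) (\<omega>, T (Suc n) \<omega>)) -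
          (LINT u|lborel. indicator (E \<inter> space P \<times> {s<..t}) (\<omega>, max 0 u) * (indicator {0..t} u * k \<omega> u))"
        proof -
          let ?h = "\<lambda>u. indicator (E \<inter> space P \<times> {s<..t}) (\<omega>, max 0 u) * (indicator {0..t} u * k \<omega> u)"
          have "E \<inter> space P \<times> {s<..t} \<in> sets Pred" using D[OF s(1)] E by auto
          from Xm[OF this] have hm: "?h \<in> borel_measurable lborel" using ktm by simp
          have p: "(\<integral>\<^sup>+u. ennreal (?h u) \<partial>lborel) = p s t \<omega>"
            unfolding p_def by (intro nn_integral_cong) (use s in \<open>auto split: split_indicator\<close>)
          have q: "(\<integral>\<^sup>+u. ennreal (- ?h u) \<partial>lborel) = q s t \<omega>"
            unfolding q_def by (intro nn_integral_cong) (use s in \<open>auto split: split_indicator\<close>)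
          have "integrable lborel ?h"
          proof (subst integrable_iff_bounded, intro conjI hm)
            have "(\<integral>\<^sup>+u. ennreal (norm (?h u)) \<partial>lborel) \<le>
              (\<integral>\<^sup>+u. ennreal \<bar>k \<omega> u\<bar> * indicator E (\<omega>, u) * indicator {0..t} u \<partial>lborel)"
              by (intro nn_integral_mono) (auto split: split_indicator)
            also have "\<dots> < \<infinity>" using V_E[OF \<omega> t] by (simp add: le_less_trans)
            finally show "(\<integral>\<^sup>+u. ennreal (norm (?h u)) \<partial>lborel) < \<infinity>" .
          qed
          then have "(LINT u|lborel. ?h u) = enn2real (p s t \<omega>) - enn2real (q s t \<omega>)"
            unfolding p[symmetric] q[symmetric] by (rule real_lebesgue_integral_def)
          then show ?thesis unfolding S_def c_def by (simp add: jumps)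
        qed
        have "(\<lambda>j. (\<Sum>n<n0. indicator (B \<inter> space P \<times> {s<..g j}) (\<omega>, T (Suc n) \<omega>)) -
          (LINT u|lborel. indicator (B \<inter> space P \<times> {s<..g j}) (\<omega>, max 0 u) * (indicator {0..t} u * k \<omega> u))) \<longlonglongrightarrow> S \<omega>"
          unfolding S
        proof (intro tendsto_diff tendsto_sum lim jump_time_nonneg)
          show "(\<lambda>j. LINT u|lborel. indicator (B \<inter> space P \<times> {s<..g j}) (\<omega>, max 0 u) * (indicator {0..t} u * k \<omega> u)) \<longlonglongrightarrow>
            (LINT u|lborel. indicator (E \<inter> space P \<times> {s<..t}) (\<omega>, max 0 u) * (indicator {0..t} u * k \<omega> u))"
          proof (rule integral_dominated_convergence[where w="\<lambda>u. \<bar>indicator {0..t} u * k \<omega> u\<bar>"])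
            show "integrable lborel (\<lambda>u. \<bar>indicator {0..t} u * k \<omega> u\<bar>)"
              using int t by (intro integrable_abs) (simp add: set_integrable_def)
            show "AE u in lborel. (\<lambda>j. indicator (B \<inter> space P \<times> {s<..g j}) (\<omega>, max 0 u) * (indicator {0..t} u * k \<omega> u)) \<longlonglongrightarrow>
              indicator (E \<inter> space P \<times> {s<..t}) (\<omega>, max 0 u) * (indicator {0..t} u * k \<omega> u)"
              by (intro AE_I2 tendsto_mult_right lim) simp
            show "AE u in lborel. norm (indicator (B \<inter> space P \<times> {s<..g j}) (\<omega>, max 0 u) * (indicator {0..t} u * k \<omega> u))
              \<le> \<bar>indicator {0..t} u * k \<omega> u\<bar>" for j
              by (intro AE_I2) (auto split: split_indicator)
            have "E \<inter> space P \<times> {s<..t} \<in> sets Pred" "B \<inter> space P \<times> {s<..g j} \<in> sets Pred" for j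
              using D[OF s(1)] by auto
            note [measurable] = this[THEN Xm] ktm
            show "(\<lambda>u. indicator (E \<inter> space P \<times> {s<..t}) (\<omega>, max 0 u) * (indicator {0..t} u * k \<omega> u)) \<in> borel_measurable lborel"
              "\<And>j. (\<lambda>u. indicator (B \<inter> space P \<times> {s<..g j}) (\<omega>, max 0 u) * (indicator {0..t} u * k \<omega> u)) \<in> borel_measurable lborel"
              by simp_all
          qed
        qed
        then show "(\<lambda>j. stopped (compensated N k) \<tau> \<omega> (grid s t (Suc j) (grid_exit K s t (Suc j) \<omega>)) -
          stopped (compensated N k) \<tau> \<omega> s) \<longlonglongrightarrow> S \<omega>"
          unfolding g_def[symmetric] using incr[OF g] by simp
      qed
    qed
    have real: "ennreal (enn2real y) = y" if "y \<le> ennreal (real m)" for y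
      using that by (simp add: le_less_trans[OF that])
    have i: "integrable R (\<lambda>\<omega>. indicator A \<omega> * enn2real (c s t \<omega>))"
      "integrable R (\<lambda>\<omega>. indicator A \<omega> * enn2real (p s t \<omega>))"
      "integrable R (\<lambda>\<omega>. indicator A \<omega> * enn2real (q s t \<omega>))"
      using meas[OF s(1), of t] A_R bd
      by (auto intro!: R.integrable_const_bound[where B="real m"] AE_I2 split: split_indicator)
    have "(LINT \<omega>|R. indicator A \<omega> * enn2real (c s t \<omega>)) + (LINT \<omega>|R. indicator A \<omega> * enn2real (q s t \<omega>)) =
      (LINT \<omega>|R. indicator A \<omega> * enn2real (p s t \<omega>))"
    proof -
      have "(LINT \<omega>:A|R. S \<omega>) = (LINT \<omega>|R. indicator A \<omega> * enn2real (c s t \<omega>) -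
        (indicator A \<omega> * enn2real (p s t \<omega>) - indicator A \<omega> * enn2real (q s t \<omega>)))"
        unfolding set_lebesgue_integral_def S_def by (simp add: right_diff_distrib)
      also have "\<dots> = (LINT \<omega>|R. indicator A \<omega> * enn2real (c s t \<omega>)) -
        ((LINT \<omega>|R. indicator A \<omega> * enn2real (p s t \<omega>)) - (LINT \<omega>|R. indicator A \<omega> * enn2real (q s t \<omega>)))"
        using i by simp
      finally show ?thesis using zero by simp
    qed
    then have sum: "(LINT \<omega>|R. indicator A \<omega> * enn2real (c s t \<omega>) + indicator A \<omega> * enn2real (q s t \<omega>)) =
      (LINT \<omega>|R. indicator A \<omega> * enn2real (p s t \<omega>))" using i by simp
    have "(\<integral>\<^sup>+\<omega>. (c s t \<omega> + q s t \<omega>) * indicator A \<omega> \<partial>R) =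
      (\<integral>\<^sup>+\<omega>. ennreal (indicator A \<omega> * enn2real (c s t \<omega>) + indicator A \<omega> * enn2real (q s t \<omega>)) \<partial>R)"
    proof (rule nn_integral_cong)
      fix \<omega> assume "\<omega> \<in> space R"
      then have \<omega>: "\<omega> \<in> space P" by (simp add: space_R)
      show "(c s t \<omega> + q s t \<omega>) * indicator A \<omega> =
        ennreal (indicator A \<omega> * enn2real (c s t \<omega>) + indicator A \<omega> * enn2real (q s t \<omega>))"
        by (cases "\<omega> \<in> A") (simp_all add: real[OF bound(1)[OF \<omega> s]] real[OF bound(3)[OF \<omega> s]])
    qed
    also have "\<dots> = ennreal (LINT \<omega>|R. indicator A \<omega> * enn2real (c s t \<omega>) + indicator A \<omega> * enn2real (q s t \<omega>))"
      using i by (intro nn_integral_eq_integral) auto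
    also have "\<dots> = (\<integral>\<^sup>+\<omega>. ennreal (indicator A \<omega> * enn2real (p s t \<omega>)) \<partial>R)"
      unfolding sum using i by (intro nn_integral_eq_integral[symmetric]) auto
    also have "\<dots> = (\<integral>\<^sup>+\<omega>. p s t \<omega> * indicator A \<omega> \<partial>R)"
    proof (rule nn_integral_cong)
      fix \<omega> assume "\<omega> \<in> space R"
      then have \<omega>: "\<omega> \<in> space P" by (simp add: space_R)
      show "ennreal (indicator A \<omega> * enn2real (p s t \<omega>)) = p s t \<omega> * indicator A \<omega>"
        by (cases "\<omega> \<in> A") (simp_all add: real[OF bound(2)[OF \<omega> s]])
    qed
    finally show ?thesis .
  qed
  \<comment> \<open>On rectangles the densities are the integrands of \<open>mean\<close>, with \<open>l\<close> replaced by the jumps it stands for.\<close>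
  have f1_Ioc: "emeasure (density muL f1) (A \<times> {s<..t}) = (\<integral>\<^sup>+\<omega>. (c s t \<omega> + q s t \<omega>) * indicator A \<omega> \<partial>R)"
    and f2_Ioc: "emeasure (density muL f2) (A \<times> {s<..t}) = (\<integral>\<^sup>+\<omega>. p s t \<omega> * indicator A \<omega> \<partial>R)"
    if s: "0 \<le> s" "s \<le> t" and A: "A \<in> sets (G s)" for A s t
  proof -
    have [measurable]: "A \<times> {s<..t} \<in> sets Pred" by (intro rectangle_in_Pred rectangle_Ioc s A)
    have A_R: "A \<in> sets R" by (rule sets_G_subset[OF s(1) A])
    have AP: "A \<subseteq> space P" using sets.sets_into_space[OF A] s by simp
    let ?E = "E \<inter> A \<times> {s<..t}"
    have [measurable]: "?E \<in> sets Pred" by measurable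
    have cA: "jump_sum N (\<lambda>u. indicator ?E (\<omega>, u)) \<omega> = c s t \<omega> * indicator A \<omega>" for \<omega>
    proof (cases "\<omega> \<in> A")
      case True then show ?thesis
        unfolding c_def using AP by (auto intro!: jump_sum_cong split: split_indicator)
    next
      case False then show ?thesis by (simp add: jump_sum_eq_0_iff)
    qed
    have AD: "indicator ?E (\<omega>, u) = (indicator (E \<inter> space P \<times> {s<..t}) (\<omega>, u) * indicator A \<omega> :: ennreal)" for \<omega> u
      using AP by (auto split: split_indicator)
    have sect: "(\<integral>\<^sup>+u. h u * indicator ?E (\<omega>, u) * indicator {0..} u \<partial>lborel) =
      (\<integral>\<^sup>+u. h u * indicator (E \<inter> space P \<times> {s<..t}) (\<omega>, u) * indicator {0..} u \<partial>lborel) * indicator A \<omega>"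
      for \<omega> and h :: "real \<Rightarrow> ennreal"
    proof (cases "\<omega> \<in> A")
      case True then show ?thesis
        using AP by (auto intro!: nn_integral_cong split: split_indicator)
    qed simp
    have "emeasure (density muL f1) (A \<times> {s<..t}) = (\<integral>\<^sup>+x. ennreal (l (fst x) (snd x)) * indicator ?E x +
        ennreal (- k (fst x) (snd x)) * indicator ?E x \<partial>muL)"
      by (subst emeasure_density) (measurable, auto simp: f1_def intro!: nn_integral_cong split: split_indicator)
    also have "\<dots> = (\<integral>\<^sup>+x. ennreal (l (fst x) (snd x)) * indicator ?E x \<partial>muL) +
        (\<integral>\<^sup>+x. ennreal (- k (fst x) (snd x)) * indicator ?E x \<partial>muL)"
      by (rule nn_integral_add) measurable
    also have "(\<integral>\<^sup>+x. ennreal (l (fst x) (snd x)) * indicator ?E x \<partial>muL) = emeasure muN ?E"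
      using l unfolding jump_density_def by (subst emeasure_density[symmetric]) auto
    also have "\<dots> = (\<integral>\<^sup>+\<omega>. c s t \<omega> * indicator A \<omega> \<partial>R)"
      by (subst emeasure_jump_measure) (simp_all add: cA)
    also have "(\<integral>\<^sup>+x. ennreal (- k (fst x) (snd x)) * indicator ?E x \<partial>muL) = (\<integral>\<^sup>+\<omega>. q s t \<omega> * indicator A \<omega> \<partial>R)"
      by (subst nn_integral_time_measure) (measurable, simp add: q_def sect)
    also have "(\<integral>\<^sup>+\<omega>. c s t \<omega> * indicator A \<omega> \<partial>R) + \<dots> = (\<integral>\<^sup>+\<omega>. (c s t \<omega> + q s t \<omega>) * indicator A \<omega> \<partial>R)"
      unfolding distrib_right using meas[OF s(1)] A_R by (intro nn_integral_add[symmetric]) auto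
    finally show "emeasure (density muL f1) (A \<times> {s<..t}) = (\<integral>\<^sup>+\<omega>. (c s t \<omega> + q s t \<omega>) * indicator A \<omega> \<partial>R)" .
    have "emeasure (density muL f2) (A \<times> {s<..t}) = (\<integral>\<^sup>+x. ennreal (k (fst x) (snd x)) * indicator ?E x \<partial>muL)"
      by (subst emeasure_density) (measurable, auto simp: f2_def intro!: nn_integral_cong split: split_indicator)
    also have "\<dots> = (\<integral>\<^sup>+\<omega>. p s t \<omega> * indicator A \<omega> \<partial>R)"
      by (subst nn_integral_time_measure) (measurable, simp add: p_def sect)
    finally show "emeasure (density muL f2) (A \<times> {s<..t}) = (\<integral>\<^sup>+\<omega>. p s t \<omega> * indicator A \<omega> \<partial>R)" .
  qed
  have zero: "emeasure (density muL f) (A \<times> {0}) = 0" if "A \<in> sets (G 0)" "f \<in> borel_measurable Pred" for A f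
  proof -
    have "A \<times> {0} \<in> null_sets muL"
      using that(1) emeasure_zero_rectangle(2)[OF that(1)] rectangle_in_Pred[OF rectangle_zero[of A G P]]
      by (intro null_setsI) auto
    then have "A \<times> {0} \<in> null_sets (density muL f)"
      using that(2) absolutely_continuousI_density[of f muL] by (auto simp: absolutely_continuous_def)
    then show ?thesis by (rule null_setsD1)
  qed
  have "density muL f2 = density muL f1"
  proof (rule measure_eqI_Pred)
    fix A s t assume *: "(0::real) \<le> s" "s \<le> t" "A \<in> sets (G s)"
    show "emeasure (density muL f2) (A \<times> {s<..t}) = emeasure (density muL f1) (A \<times> {s<..t})"
      unfolding f1_Ioc[OF *] f2_Ioc[OF *] mean[OF *] ..
  next
    fix n :: nat
    have "emeasure (density muL f2) (space P \<times> {0<..real n}) = (\<integral>\<^sup>+\<omega>. p 0 (real n) \<omega> * indicator (space P) \<omega> \<partial>R)"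
      by (rule f2_Ioc) (auto intro: sets_G_space)
    also have "\<dots> \<le> (\<integral>\<^sup>+\<omega>. ennreal (real m) \<partial>R)"
      using bound(2)[of _ 0 "real n"] by (intro nn_integral_mono) (auto simp: space_R split: split_indicator)
    also have "\<dots> < \<infinity>"
      using R.emeasure_finite[of "space R"] less_top[of "emeasure R (space R)"]
      by (simp add: ennreal_mult_less_top)
    finally show "emeasure (density muL f2) (space P \<times> {0<..real n}) \<noteq> \<infinity>" by simp
  next
    show "emeasure (density muL f2) (space P \<times> {0}) \<noteq> \<infinity>"
      using zero[OF sets_G_space] by simp
  qed (auto simp: zero)
  interpret L: sigma_finite_measure muL by (rule sigma_finite_time_measure)
  have "AE x in muL. f2 x = f1 x"
    using \<open>density muL f2 = density muL f1\<close>
    by (intro L.density_unique_iff[THEN iffD1]) auto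
  then show ?thesis
    using AE_space[of muL]
  proof eventually_elim
    case (elim x)
    show ?case
    proof (intro impI)
      assume "(\<integral>\<^sup>+v. ennreal \<bar>k (fst x) v\<bar> * indicator {0..snd x} v \<partial>lborel) \<le> ennreal (real m)"
        "x \<in> before_jump m" "ennreal (snd x) \<le> \<tau> (fst x)"
      then have "x \<in> E" using elim(2) by (auto simp: E_def K_def B_def V_def)
      then have eq: "ennreal (k (fst x) (snd x)) = ennreal (l (fst x) (snd x)) + ennreal (- k (fst x) (snd x))"
        using elim(1) by (simp add: f1_def f2_def)
      have l0: "0 \<le> l (fst x) (snd x)" using jump_densityD(2)[OF l, of "fst x" "snd x"] elim(2) by auto
      show "l (fst x) (snd x) = k (fst x) (snd x)"
      proof (cases "0 \<le> k (fst x) (snd x)")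
        case True
        then show ?thesis using eq l0 by (simp add: ennreal_neg)
      next
        case False
        then have "ennreal (- k (fst x) (snd x)) = 0" using eq by (simp add: ennreal_neg)
        then show ?thesis using False by simp
      qed
    qed
  qed
qed

text \<open>
  The sets on which the densities were compared exhaust almost all of the product space as the bound
  \<open>m\<close> and the index of the localising sequence grow.
\<close>

lemma intensity_unique:
  assumes l: "jump_density l" and k: "is_intensity R G N k"
  shows "AE \<omega> in R. AE u in lborel. 0 \<le> u \<longrightarrow> l \<omega> u = k \<omega> u"
proof -
  have "predictable_sigma R G = Pred"
    by (simp add: predictable_sigma_def left_continuous_paths_def space_R)
  then have km: "case_prod k \<in> borel_measurable Pred"
    using k by (simp add: is_intensity_def predictable_def)
  have k_int: "AE \<omega> in R. \<forall>t\<ge>0. set_integrable lborel {0..t} (k \<omega>)"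
    using k by (simp add: is_intensity_def)
  obtain \<tau> where \<tau>: "\<And>n. is_stopping_time R G (\<tau> n)"
    and lim: "AE \<omega> in R. incseq (\<lambda>n. \<tau> n \<omega>) \<and> (\<lambda>n. \<tau> n \<omega>) \<longlonglongrightarrow> \<infinity>"
    and M: "\<And>n::nat. is_martingale R G (stopped (compensated N k) (\<tau> n))"
    using k unfolding is_intensity_def is_local_martingale_def by blast
  let ?V = "\<lambda>x. (\<integral>\<^sup>+v. ennreal \<bar>k (fst x) v\<bar> * indicator {0..snd x} v \<partial>lborel)"
  let ?Q = "\<lambda>x. \<forall>m n. ?V x \<le> ennreal (real m) \<longrightarrow> x \<in> before_jump m \<longrightarrow> ennreal (snd x) \<le> \<tau> n (fst x) \<longrightarrow>
    l (fst x) (snd x) = k (fst x) (snd x)"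
  have st: "{\<omega> \<in> space P. \<tau> n \<omega> \<le> ennreal t} \<in> sets (G t)" if "0 \<le> t" for n t
    using \<tau>[of n] that unfolding is_stopping_time_def space_R by auto
  have AE: "AE x in muL. ?Q x"
    unfolding AE_all_countable using intensity_eq_jump_density[OF l km k_int st M] by blast
  have [measurable]: "(\<lambda>x. k (fst x) (snd x)) \<in> borel_measurable Pred"
    using km by (simp add: case_prod_beta')
  have [measurable]: "(\<lambda>x. l (fst x) (snd x)) \<in> borel_measurable Pred"
    using jump_densityD(1)[OF l] by (simp add: case_prod_beta')
  have [measurable]: "?V \<in> borel_measurable Pred"
    using measurable_running_nn_integral[of "\<lambda>x. ennreal \<bar>k (fst x) (snd x)\<bar>"] by simp
  have [measurable]: "Measurable.pred Pred (\<lambda>x. ennreal (snd x) \<le> \<tau> n (fst x))" for n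
    using sets_stopping_time[OF st] by (simp add: pred_def)
  have "{x \<in> space Pred. ?Q x} \<in> sets Pred" by measurable
  from AE_time_measure[THEN iffD1, OF this AE]
  have "AE \<omega> in R. AE u in lborel. 0 \<le> u \<longrightarrow> ?Q (\<omega>, u)" .
  with k_int lim AE_space[of R] show ?thesis
  proof eventually_elim
    case (elim \<omega>)
    then have \<omega>: "\<omega> \<in> space P" by (simp add: space_R)
    from elim(4) show ?case
    proof eventually_elim
      case (elim u)
      show ?case
      proof
        assume u: "0 \<le> u"
        have "set_integrable lborel {0..u} (k \<omega>)" using \<open>\<forall>t\<ge>0. set_integrable lborel {0..t} (k \<omega>)\<close> u by blast
        then have "?V (\<omega>, u) < \<infinity>"
          by (subst (asm) set_integrable_path_iff[OF km \<omega>]) auto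
        then obtain v where v: "0 \<le> v" "?V (\<omega>, u) = ennreal v" by (cases "?V (\<omega>, u)") auto
        obtain m :: nat where m: "max v (N \<omega> u) < real m" using reals_Archimedean2 by blast
        have "\<forall>\<^sub>F n in sequentially. ennreal u < \<tau> n \<omega>"
          using \<open>incseq (\<lambda>n. \<tau> n \<omega>) \<and> (\<lambda>n. \<tau> n \<omega>) \<longlonglongrightarrow> \<infinity>\<close>
          by (intro order_tendstoD(1)[where y="\<infinity>"]) auto
        then obtain n where n: "ennreal u < \<tau> n \<omega>" by (meson eventually_sequentially order_refl)
        have "?V (\<omega>, u) \<le> ennreal (real m)" unfolding v(2) using m by (intro ennreal_leI) simp
        moreover have "(\<omega>, u) \<in> before_jump m"
          using before_jump_after_time[OF \<omega> u _ u, of m] m by simp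
        ultimately show "l \<omega> u = k \<omega> u" using elim u less_imp_le[OF n] by auto
      qed
    qed
  qed
qed

end

text \<open>
  Equality at almost every time determines the compensators, and the exceptional predictable set, having
  null sections, is not charged by the jumps either.
\<close>

lemma (in doleans) same_intensityI:
  assumes avoid: jumps_avoid_null_sets
    and l: "case_prod l \<in> borel_measurable Pred" and k: "case_prod k \<in> borel_measurable Pred"
    and eq: "AE \<omega> in R. AE u in lborel. 0 \<le> u \<longrightarrow> l \<omega> u = k \<omega> u"
  shows "same_intensity R N l k"
  unfolding same_intensity_def
proof (intro conjI eq)
  show "indistinguishable R (compensator l) (compensator k)"
    unfolding indistinguishable_def
    using eq AE_space[of R]
  proof eventually_elim
    case (elim \<omega>)
    then have \<omega>: "\<omega> \<in> space P" by (simp add: space_R)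
    show ?case
    proof (intro allI impI)
      fix t :: real assume "0 \<le> t"
      have "AE u in lborel. indicator {0..t} u *\<^sub>R l \<omega> u = indicator {0..t} u *\<^sub>R k \<omega> u"
        using elim(1) by eventually_elim (auto split: split_indicator)
      then show "compensator l \<omega> t = compensator k \<omega> t"
        unfolding compensator_def set_lebesgue_integral_def
        using measurable_restricted_path[OF l \<omega>, of "{0..t}"] measurable_restricted_path[OF k \<omega>, of "{0..t}"]
        by (intro integral_cong_AE) auto
    qed
  qed
  have [measurable]: "(\<lambda>x. l (fst x) (snd x)) \<in> borel_measurable Pred" "(\<lambda>x. k (fst x) (snd x)) \<in> borel_measurable Pred"
    using l k by (simp_all add: case_prod_beta')
  let ?D = "{x \<in> space Pred. l (fst x) (snd x) \<noteq> k (fst x) (snd x)}"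
  have D: "?D \<in> sets Pred" by measurable
  have "AE \<omega> in R. AE u in lborel. 0 \<le> u \<longrightarrow> (\<omega>, u) \<notin> ?D"
    using eq by eventually_elim (auto elim: eventually_mono)
  from jumps_avoid_null_setsD[OF avoid D this] AE_space[of R]
  show "AE \<omega> in R. AE t in path_measure N \<omega>. 0 \<le> t \<longrightarrow> l \<omega> t = k \<omega> t"
  proof eventually_elim
    case (elim \<omega>)
    then have \<omega>: "\<omega> \<in> space P" by (simp add: space_R)
    have [measurable]: "(\<lambda>u. l \<omega> (max 0 u)) \<in> borel_measurable borel" "(\<lambda>u. k \<omega> (max 0 u)) \<in> borel_measurable borel"
      using measurable_path[OF l \<omega>] measurable_path[OF k \<omega>] by auto
    have "{u :: real. 0 \<le> u \<longrightarrow> l \<omega> (max 0 u) = k \<omega> (max 0 u)} \<in> sets borel" by measurable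
    moreover have "{u :: real. 0 \<le> u \<longrightarrow> l \<omega> (max 0 u) = k \<omega> (max 0 u)} = {u. 0 \<le> u \<longrightarrow> l \<omega> u = k \<omega> u}"
      by (auto simp: max_def)
    ultimately have m: "{u \<in> space borel. 0 \<le> u \<longrightarrow> l \<omega> u = k \<omega> u} \<in> sets borel" by simp
    have "l \<omega> (T (Suc n) \<omega>) = k \<omega> (T (Suc n) \<omega>)" if "J (Suc n) \<omega>" for n
      using elim that \<omega> jump_time_nonneg[of "Suc n" \<omega>] by auto
    then show ?case
      unfolding path_measure_eq_distr[OF \<omega>]
      by (subst AE_distr_iff[OF _ m]) (auto simp: AE_density AE_count_space indicator_def)
  qed
qed

section \<open>The Poisson process\<close>

text \<open>
  Only the characteristic function of an increment is given.  Its second difference at \<open>0\<close>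
  bounds the second moment by Fatou's lemma, and then its derivative at \<open>0\<close> is the mean.
\<close>

lemma poisson_mean:
  fixes X :: "'a \<Rightarrow> real"
  assumes "prob_space M" and X [measurable]: "X \<in> borel_measurable M"
    and char: "\<And>u::real. (LINT \<omega>|M. exp (\<i> * complex_of_real (u * X \<omega>))) =
      exp (complex_of_real r * (exp (\<i> * complex_of_real u) - 1))"
  shows "integrable M X" "(LINT \<omega>|M. X \<omega>) = r"
proof -
  interpret prob_space M by fact
  define u where "u n = 1 / real (Suc n)" for n
  have u: "0 < u n" for n by (simp add: u_def)
  have u_lim: "filterlim u (at_right 0) sequentially"
    unfolding u_def by real_asymp
  have int: "integrable M (\<lambda>\<omega>. exp (\<i> * complex_of_real (v * X \<omega>)))" for v
    by (rule integrable_const_bound[where B=1]) (auto simp: norm_exp_eq_Re)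
  have cis: "exp (\<i> * complex_of_real x) = Complex (cos x) (sin x)" for x
    by (simp add: cis_conv_exp[symmetric] complex_eq_iff)
  have int_cos: "integrable M (\<lambda>\<omega>. cos (v * X \<omega>))" and int_sin: "integrable M (\<lambda>\<omega>. sin (v * X \<omega>))" for v
    using integrable_Re[OF int[of v]] integrable_Im[OF int[of v]] by (simp_all add: cis del: of_real_mult)
  have val: "exp (complex_of_real r * (exp (\<i> * complex_of_real v) - 1)) =
      Complex (exp (r * (cos v - 1)) * cos (r * sin v)) (exp (r * (cos v - 1)) * sin (r * sin v))" for v
    by (simp add: cis complex_eq_iff Re_exp Im_exp)
  have cos: "(LINT \<omega>|M. cos (v * X \<omega>)) = exp (r * (cos v - 1)) * cos (r * sin v)"
    and sin: "(LINT \<omega>|M. sin (v * X \<omega>)) = exp (r * (cos v - 1)) * sin (r * sin v)" for v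
    using char[of v] integral_Re[OF int[of v]] integral_Im[OF int[of v]] unfolding val by (simp_all add: cis del: of_real_mult)
  let ?g = "\<lambda>n \<omega>. 2 * (1 - cos (u n * X \<omega>)) / (u n)\<^sup>2"
  have "(\<integral>\<^sup>+\<omega>. ennreal ((X \<omega>)\<^sup>2) \<partial>M) \<le> ennreal (r + r * r)"
  proof -
    \<comment> \<open>\<open>?g n\<close> is the negative symmetric second difference quotient of \<open>u \<mapsto> cos (u X)\<close> at \<open>0\<close>\<close>
    have "(\<lambda>n. ?g n \<omega>) \<longlonglongrightarrow> (X \<omega>)\<^sup>2" for \<omega>
    proof -
      have "((\<lambda>v::real. 2 * (1 - cos (v * x)) / v\<^sup>2) \<longlongrightarrow> x * x) (at_right 0)" for x :: real
      proof (cases "x = 0")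
        case False
        have "((\<lambda>v::real. 2 * (1 - cos (v * x)) / v\<^sup>2) \<longlongrightarrow> x * x) (at_right 0)" if "x > 0" for x
          using that by real_asymp
        from this[of x] this[of "- x"] False show ?thesis by (cases "x > 0") auto
      qed simp
      from filterlim_compose[OF this u_lim] show ?thesis by (simp add: power2_eq_square)
    qed
    then have "(\<lambda>n. ennreal (?g n \<omega>)) \<longlonglongrightarrow> ennreal ((X \<omega>)\<^sup>2)" for \<omega>
      by (intro tendsto_ennrealI)
    then have "(\<integral>\<^sup>+\<omega>. ennreal ((X \<omega>)\<^sup>2) \<partial>M) = (\<integral>\<^sup>+\<omega>. liminf (\<lambda>n. ennreal (?g n \<omega>)) \<partial>M)"
      by (intro nn_integral_cong lim_imp_Liminf[symmetric]) auto
    also have "\<dots> \<le> liminf (\<lambda>n. \<integral>\<^sup>+\<omega>. ennreal (?g n \<omega>) \<partial>M)"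
      by (rule nn_integral_liminf) measurable
    also have "(\<lambda>n. \<integral>\<^sup>+\<omega>. ennreal (?g n \<omega>) \<partial>M) =
        (\<lambda>n. ennreal (2 * (1 - exp (r * (cos (u n) - 1)) * cos (r * sin (u n))) / (u n)\<^sup>2))"
    proof
      fix n
      have "(\<integral>\<^sup>+\<omega>. ennreal (?g n \<omega>) \<partial>M) = ennreal (LINT \<omega>|M. ?g n \<omega>)"
        using int_cos[of "u n"] by (intro nn_integral_eq_integral) auto
      also have "(LINT \<omega>|M. ?g n \<omega>) = 2 * (1 - (LINT \<omega>|M. cos (u n * X \<omega>))) / (u n)\<^sup>2"
        using int_cos[of "u n"] by (simp add: prob_space)
      finally show "(\<integral>\<^sup>+\<omega>. ennreal (?g n \<omega>) \<partial>M) =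
        ennreal (2 * (1 - exp (r * (cos (u n) - 1)) * cos (r * sin (u n))) / (u n)\<^sup>2)"
        by (simp add: cos)
    qed
    also have "liminf \<dots> = ennreal (r + r * r)"
    proof (rule lim_imp_Liminf)
      have "((\<lambda>v::real. 2 * (1 - exp (r * (cos v - 1)) * cos (r * sin v)) / v\<^sup>2) \<longlongrightarrow> r + r * r) (at_right 0)"
      proof -
        consider "r = 0" | "r > 0" | "r < 0" by linarith
        then show ?thesis by cases (real_asymp | simp)+
      qed
      from filterlim_compose[OF this u_lim]
      show "(\<lambda>n. ennreal (2 * (1 - exp (r * (cos (u n) - 1)) * cos (r * sin (u n))) / (u n)\<^sup>2)) \<longlonglongrightarrow> ennreal (r + r * r)"
        by (rule tendsto_ennrealI)
    qed simp
    finally show ?thesis .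
  qed
  then have "integrable M (\<lambda>\<omega>. (X \<omega>)\<^sup>2)"
    by (intro integrableI_nonneg) (auto simp: le_less_trans)
  then have "integrable M (\<lambda>\<omega>. 1 + (X \<omega>)\<^sup>2)" by simp
  then show iX: "integrable M X"
  proof (rule Bochner_Integration.integrable_bound)
    have "\<bar>x\<bar> \<le> 1 + x\<^sup>2" for x :: real
      using zero_le_power2[of "\<bar>x\<bar> - 1"] by (simp add: power2_eq_square algebra_simps abs_mult_self_eq)
    then show "AE \<omega> in M. norm (X \<omega>) \<le> norm (1 + (X \<omega>)\<^sup>2)" by (intro AE_I2) (simp add: abs_of_nonneg)
  qed measurable
  have "(\<lambda>n. LINT \<omega>|M. sin (u n * X \<omega>) / u n) \<longlonglongrightarrow> (LINT \<omega>|M. X \<omega>)"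
  proof (rule integral_dominated_convergence[where w="\<lambda>\<omega>. \<bar>X \<omega>\<bar>"])
    show "AE \<omega> in M. (\<lambda>n. sin (u n * X \<omega>) / u n) \<longlonglongrightarrow> X \<omega>"
    proof (rule AE_I2)
      fix \<omega>
      have "((\<lambda>v::real. sin (v * x) / v) \<longlongrightarrow> x) (at_right 0)" for x :: real
      proof (cases "x = 0")
        case False
        have "((\<lambda>v::real. sin (v * x) / v) \<longlongrightarrow> x) (at_right 0)" if "x > 0" for x
          using that by real_asymp
        moreover have "((\<lambda>v::real. sin (v * x) / v) \<longlongrightarrow> x) (at_right 0)" if "x < 0" for x
          using that by real_asymp
        ultimately show ?thesis using False by (meson linorder_neqE_linordered_idom)
      qed simp
      from filterlim_compose[OF this u_lim] show "(\<lambda>n. sin (u n * X \<omega>) / u n) \<longlonglongrightarrow> X \<omega>" .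
    qed
    show "AE \<omega> in M. norm (sin (u n * X \<omega>) / u n) \<le> \<bar>X \<omega>\<bar>" for n
      using u[of n] abs_sin_x_le_abs_x[of "u n * X _"]
      by (intro AE_I2) (simp add: abs_mult divide_le_eq mult.commute)
  qed (use iX in auto)
  moreover have "(\<lambda>n. LINT \<omega>|M. sin (u n * X \<omega>) / u n) \<longlonglongrightarrow> r"
  proof -
    have "((\<lambda>v::real. exp (r * (cos v - 1)) * sin (r * sin v) / v) \<longlongrightarrow> r) (at_right 0)"
    proof -
      consider "r = 0" | "r > 0" | "r < 0" by linarith
      then show ?thesis by cases (real_asymp | simp)+
    qed
    from filterlim_compose[OF this u_lim] show ?thesis by (simp add: sin)
  qed
  ultimately show "(LINT \<omega>|M. X \<omega>) = r" by (rule LIMSEQ_unique)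
qed

text \<open>
  Conditioning on \<open>A\<close> leaves the distribution of \<open>X\<close> unchanged up to the factor \<open>emeasure M A\<close>.
\<close>

lemma nn_integral_indep_indicator:
  assumes "prob_space M" and X [measurable]: "X \<in> borel_measurable M" and A [measurable]: "A \<in> sets M"
    and indep: "prob_space.indep_set M {X -` B \<inter> space M | B. B \<in> sets borel} \<A>" "A \<in> \<A>"
  shows "(\<integral>\<^sup>+\<omega>. ennreal (X \<omega>) * indicator A \<omega> \<partial>M) = emeasure M A * (\<integral>\<^sup>+\<omega>. ennreal (X \<omega>) \<partial>M)"
proof -
  interpret prob_space M by fact
  have "distr (density M (indicator A)) borel X = density (distr M borel X) (\<lambda>_. emeasure M A)"
  proof (rule measure_eqI)
    fix B assume "B \<in> sets (distr (density M (indicator A)) borel X)"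
    then have B [measurable]: "B \<in> sets borel" by simp
    have XB [measurable]: "X -` B \<inter> space M \<in> sets M" by measurable
    have "emeasure (distr (density M (indicator A)) borel X) B = emeasure M (A \<inter> (X -` B \<inter> space M))"
    proof -
      have "emeasure (distr (density M (indicator A)) borel X) B = emeasure (density M (indicator A)) (X -` B \<inter> space M)"
        by (subst emeasure_distr) auto
      also have "\<dots> = (\<integral>\<^sup>+\<omega>. indicator (A \<inter> (X -` B \<inter> space M)) \<omega> \<partial>M)"
        by (subst emeasure_density) (measurable, intro nn_integral_cong, simp split: split_indicator)
      finally show ?thesis by simp
    qed
    also have "\<dots> = emeasure M A * emeasure M (X -` B \<inter> space M)"
    proof -
      have "prob ((X -` B \<inter> space M) \<inter> A) = prob (X -` B \<inter> space M) * prob A"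
        by (rule indep_setD[OF indep(1) _ indep(2)]) (use B in blast)
      then show ?thesis
        by (simp add: emeasure_eq_measure Int_commute mult.commute flip: ennreal_mult)
    qed
    also have "\<dots> = emeasure (density (distr M borel X) (\<lambda>_. emeasure M A)) B"
      by (simp add: emeasure_density nn_integral_cmult emeasure_distr)
    finally show "emeasure (distr (density M (indicator A)) borel X) B =
      emeasure (density (distr M borel X) (\<lambda>_. emeasure M A)) B" .
  qed simp
  then have "(\<integral>\<^sup>+x. ennreal x \<partial>distr (density M (indicator A)) borel X) =
    (\<integral>\<^sup>+x. ennreal x \<partial>density (distr M borel X) (\<lambda>_. emeasure M A))" by simp
  then have "(\<integral>\<^sup>+\<omega>. indicator A \<omega> * ennreal (X \<omega>) \<partial>M) = emeasure M A * (\<integral>\<^sup>+\<omega>. ennreal (X \<omega>) \<partial>M)"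
    by (simp add: nn_integral_distr nn_integral_density nn_integral_cmult)
  then show ?thesis by (simp add: mult.commute)
qed

section \<open>The exponential of a path with jumps\<close>

text \<open>
  A telescoping sum over a grid of mesh \<open>1/n\<close> is of order \<open>n \<cdot> 1/n\<^sup>2\<close>.
\<close>

lemma quadratic_increments_constant:
  fixes E :: "real \<Rightarrow> real"
  assumes ab: "a \<le> b" and E: "\<And>u v. a \<le> u \<Longrightarrow> u \<le> v \<Longrightarrow> v \<le> b \<Longrightarrow> \<bar>E v - E u\<bar> \<le> K * (v - u)\<^sup>2"
  shows "E b = E a"
proof -
  have "\<bar>E b - E a\<bar> \<le> K * (b - a)\<^sup>2 / real (Suc n)" for n
  proof -
    let ?g = "grid a b (Suc n)"
    have "E b - E a = (\<Sum>i<Suc n. E (?g (Suc i)) - E (?g i))"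
      by (subst sum_lessThan_telescope) simp
    also have "\<bar>\<dots>\<bar> \<le> (\<Sum>i<Suc n. \<bar>E (?g (Suc i)) - E (?g i)\<bar>)" by (rule sum_abs)
    also have "\<dots> \<le> (\<Sum>i<Suc n. K * ((b - a) / real (Suc n))\<^sup>2)"
    proof (rule sum_mono)
      fix i assume i: "i \<in> {..<Suc n}"
      have "?g (Suc i) - ?g i = (b - a) / real (Suc n)" by (simp only: grid_step)
      then show "\<bar>E (?g (Suc i)) - E (?g i)\<bar> \<le> K * ((b - a) / real (Suc n))\<^sup>2"
        using E[of "?g i" "?g (Suc i)"] grid_mono[OF ab, of i "Suc i" "Suc n"]
          grid_bounds[OF ab, of "Suc n" i] grid_bounds[OF ab, of "Suc n" "Suc i"] i by auto
    qed
    also have "\<dots> = real (Suc n) * (K * ((b - a) / real (Suc n))\<^sup>2)"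
      by (simp only: sum_constant card_lessThan)
    also have "\<dots> = K * (b - a)\<^sup>2 / real (Suc n)"
      by (simp add: power2_eq_square del: of_nat_Suc)
    finally show ?thesis .
  qed
  moreover have "(\<lambda>n. K * (b - a)\<^sup>2 / real (Suc n)) \<longlonglongrightarrow> 0"
    by (rule lim_const_over_n[THEN LIMSEQ_Suc])
  ultimately have "\<bar>E b - E a\<bar> \<le> 0"
    by (intro LIMSEQ_le_const) auto
  then show ?thesis by simp
qed

lemma bounded_set_integrable:
  fixes f :: "real \<Rightarrow> real"
  assumes [measurable]: "f \<in> borel_measurable borel" "S \<in> sets borel"
    and S: "S \<subseteq> {a..b}" and f: "\<And>u. u \<in> S \<Longrightarrow> \<bar>f u\<bar> \<le> c"
  shows "set_integrable lborel S f"
  unfolding set_integrable_def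
proof (rule Bochner_Integration.integrable_bound)
  show "integrable lborel (\<lambda>u. indicator {a..b} u *\<^sub>R \<bar>c\<bar>)"
    by (rule integrable_scaleR_left) (auto simp: emeasure_lborel_Icc_eq intro!: integrable_real_indicator)
  show "AE u in lborel. norm (indicator S u *\<^sub>R f u) \<le> norm (indicator {a..b} u *\<^sub>R \<bar>c\<bar>)"
    using f S by (intro AE_I2) (force split: split_indicator)
qed measurable

lemma set_integral_Ioc_bound:
  fixes f :: "real \<Rightarrow> real"
  assumes [measurable]: "f \<in> borel_measurable borel" and "u \<le> v"
    and f: "\<And>w. w \<in> {u<..v} \<Longrightarrow> \<bar>f w\<bar> \<le> c"
  shows "\<bar>LINT w:{u<..v}|lborel. f w\<bar> \<le> c * (v - u)"
proof -
  have "\<bar>LINT w:{u<..v}|lborel. f w\<bar> \<le> (LINT w:{u<..v}|lborel. \<bar>f w\<bar>)"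
    unfolding set_lebesgue_integral_def
    using integral_norm_bound[of lborel "\<lambda>w. indicator {u<..v} w *\<^sub>R f w"] by (simp add: abs_mult)
  also have "\<dots> \<le> (LINT w:{u<..v}|lborel. c)"
  proof (rule set_integral_mono)
    show "set_integrable lborel {u<..v} (\<lambda>w. \<bar>f w\<bar>)"
      by (rule bounded_set_integrable[of _ _ u v c]) (use f in auto)
    show "set_integrable lborel {u<..v} (\<lambda>w. c)"
      by (rule bounded_set_integrable[of _ _ u v "\<bar>c\<bar>"]) auto
  qed (rule f)
  also have "\<dots> = c * (v - u)"
    using assms(2) by (simp add: set_lebesgue_integral_def)
  finally show ?thesis .
qed

lemma exp_minus_one_bound: "\<bar>exp x - 1\<bar> \<le> \<bar>x\<bar> * exp \<bar>x\<bar>" for x :: real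
proof -
  obtain t where t: "\<bar>t\<bar> \<le> \<bar>x\<bar>" "exp x = (\<Sum>m<1. x ^ m / fact m) + exp t / fact 1 * x ^ 1"
    using Maclaurin_exp_le[of x 1] by blast
  then have "\<bar>exp x - 1\<bar> = exp t * \<bar>x\<bar>" by (simp add: abs_mult)
  also have "\<dots> \<le> exp \<bar>x\<bar> * \<bar>x\<bar>" using t(1) by (intro mult_right_mono) auto
  finally show ?thesis by (simp add: mult.commute)
qed

lemma exp_minus_linear_bound: "\<bar>exp x - 1 - x\<bar> \<le> x\<^sup>2 * exp \<bar>x\<bar>" for x :: real
proof -
  obtain t where t: "\<bar>t\<bar> \<le> \<bar>x\<bar>" "exp x = (\<Sum>m<2. x ^ m / fact m) + exp t / fact 2 * x ^ 2"
    using Maclaurin_exp_le[of x 2] by blast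
  have "(\<Sum>m<2. x ^ m / fact m) = 1 + x" by (simp add: numeral_2_eq_2)
  then have "\<bar>exp x - 1 - x\<bar> = exp t / 2 * x\<^sup>2" using t(2) by simp
  also have "\<dots> \<le> exp \<bar>x\<bar> * x\<^sup>2"
  proof (rule mult_right_mono)
    have "exp t \<le> exp \<bar>x\<bar>" using t(1) by simp
    then show "exp t / 2 \<le> exp \<bar>x\<bar>" using exp_gt_zero[of t] by linarith
  qed simp
  finally show ?thesis by (simp add: mult.commute)
qed

lemma measurable_primitive:
  fixes h :: "real \<Rightarrow> real"
  assumes [measurable]: "h \<in> borel_measurable borel"
  shows "(\<lambda>u. LINT v:{0..u}|lborel. h v) \<in> borel_measurable borel"
  unfolding set_lebesgue_integral_def indicator_def atLeastAtMost_iff by measurable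

text \<open>
  The primitive of \<open>h\<close> need not be differentiable everywhere; but the defect in the equation for its
  exponential grows only quadratically over short intervals, and so does not grow at all.
\<close>

lemma exp_integral_increment:
  fixes h :: "real \<Rightarrow> real"
  assumes h [measurable]: "h \<in> borel_measurable borel" and C: "\<And>u. \<bar>h u\<bar> \<le> C"
    and ab: "0 \<le> a" "a \<le> b"
  defines "F \<equiv> \<lambda>u. LINT v:{0..u}|lborel. h v"
  shows "exp (F b) - exp (F a) = (LINT u:{a<..b}|lborel. h u * exp (F u))"
proof -
  have C0: "0 \<le> C" using C[of 0] by simp
  define D where "D = exp (C * b)"
  have D0: "0 < D" "1 \<le> D" using C0 ab by (simp_all add: D_def)
  have [measurable]: "F \<in> borel_measurable borel" unfolding F_def by (rule measurable_primitive[OF h])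
  have h_int: "set_integrable lborel {0..u} h" for u
    by (rule bounded_set_integrable[of _ _ 0 u, OF _ _ _ C]) auto
  have F_incr: "F v - F u = (LINT w:{u<..v}|lborel. h w)" if "0 \<le> u" "u \<le> v" for u v
    unfolding F_def by (rule set_integral_difference[OF h_int that])
  have F_lip: "\<bar>F v - F u\<bar> \<le> C * (v - u)" if "0 \<le> u" "u \<le> v" for u v
    unfolding F_incr[OF that] by (rule set_integral_Ioc_bound[OF h that(2) C])
  have F0: "F 0 = 0" by (simp add: F_def set_integral_point)
  have F_bound: "exp \<bar>F v - F u\<bar> \<le> D" if "0 \<le> u" "u \<le> v" "v \<le> b" for u v
  proof -
    have "C * (v - u) \<le> C * b" using that C0 by (intro mult_left_mono) auto
    then show ?thesis using F_lip[OF that(1,2)] by (simp add: D_def)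
  qed
  have \<Phi>_bound: "exp (F u) \<le> D" if "0 \<le> u" "u \<le> b" for u
  proof -
    have "exp (F u) \<le> exp \<bar>F u - F 0\<bar>" by (simp add: F0)
    also have "\<dots> \<le> D" by (rule F_bound) (use that in auto)
    finally show ?thesis .
  qed
  have \<Phi>_lip: "\<bar>exp (F w) - exp (F u)\<bar> \<le> D\<^sup>2 * C * (w - u)" if w: "0 \<le> u" "u \<le> w" "w \<le> b" for u w
  proof -
    have "exp (F w) - exp (F u) = exp (F u) * (exp (F w - F u) - 1)"
      by (simp add: exp_diff right_diff_distrib)
    then have "\<bar>exp (F w) - exp (F u)\<bar> = exp (F u) * \<bar>exp (F w - F u) - 1\<bar>" by (simp add: abs_mult)
    also have "\<dots> \<le> D * (C * (w - u) * D)"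
    proof (rule mult_mono)
      have "\<bar>exp (F w - F u) - 1\<bar> \<le> \<bar>F w - F u\<bar> * exp \<bar>F w - F u\<bar>" by (rule exp_minus_one_bound)
      also have "\<dots> \<le> C * (w - u) * D"
        using F_lip[OF w(1,2)] F_bound[OF w] C0 w by (intro mult_mono) auto
      finally show "\<bar>exp (F w - F u) - 1\<bar> \<le> C * (w - u) * D" .
    qed (use \<Phi>_bound[of u] w D0 in auto)
    finally show ?thesis by (simp add: power2_eq_square algebra_simps)
  qed
  have \<Phi>h_int: "set_integrable lborel {0..u} (\<lambda>u. h u * exp (F u))" if "u \<le> b" for u
  proof (rule bounded_set_integrable[of _ _ 0 u])
    show "\<bar>h w * exp (F w)\<bar> \<le> C * D" if "w \<in> {0..u}" for w
      unfolding abs_mult using C[of w] \<Phi>_bound[of w] that \<open>u \<le> b\<close> C0 by (intro mult_mono) auto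
  qed auto
  \<comment> \<open>the defect in the integral equation that \<open>exp (F u)\<close> is to satisfy\<close>
  define E where "E u = exp (F u) - (LINT w:{0..u}|lborel. h w * exp (F w))" for u
  have "E b = E a"
  proof (rule quadratic_increments_constant[OF ab(2)])
    fix u v assume uv: "a \<le> u" "u \<le> v" "v \<le> b"
    then have u0: "0 \<le> u" using ab by simp
    let ?\<delta> = "F v - F u"
    have i1: "set_integrable lborel {u<..v} (\<lambda>w. exp (F u) * h w)"
      by (rule bounded_set_integrable[of _ _ u v "exp (F u) * C"]) (use C in \<open>auto simp: abs_mult\<close>)
    have i2: "set_integrable lborel {u<..v} (\<lambda>w. h w * (exp (F w) - exp (F u)))"
    proof (rule bounded_set_integrable[of _ _ u v])
      show "\<bar>h w * (exp (F w) - exp (F u))\<bar> \<le> C * (D\<^sup>2 * C * (v - u))" if "w \<in> {u<..v}" for w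
        unfolding abs_mult using C[of w] \<Phi>_lip[OF u0, of w] that uv C0 D0
        by (intro mult_mono order_trans[OF \<Phi>_lip[OF u0, of w]]) auto
    qed auto
    have "(LINT w:{0..v}|lborel. h w * exp (F w)) - (LINT w:{0..u}|lborel. h w * exp (F w)) =
      (LINT w:{u<..v}|lborel. h w * exp (F w))"
      by (rule set_integral_difference[OF \<Phi>h_int[OF uv(3)] u0 uv(2)])
    also have "\<dots> = (LINT w:{u<..v}|lborel. exp (F u) * h w + h w * (exp (F w) - exp (F u)))"
      by (simp add: algebra_simps)
    also have "\<dots> = (LINT w:{u<..v}|lborel. exp (F u) * h w) + (LINT w:{u<..v}|lborel. h w * (exp (F w) - exp (F u)))"
      by (rule set_integral_add(2)[OF i1 i2])
    also have "(LINT w:{u<..v}|lborel. exp (F u) * h w) = exp (F u) * ?\<delta>"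
      by (simp add: F_incr[OF u0 uv(2)])
    finally have "E v - E u = exp (F u) * (exp ?\<delta> - 1 - ?\<delta>) - (LINT w:{u<..v}|lborel. h w * (exp (F w) - exp (F u)))"
      by (simp add: E_def exp_diff right_diff_distrib)
    then have "\<bar>E v - E u\<bar> \<le> exp (F u) * \<bar>exp ?\<delta> - 1 - ?\<delta>\<bar> + \<bar>LINT w:{u<..v}|lborel. h w * (exp (F w) - exp (F u))\<bar>"
      using abs_triangle_ineq4[of "exp (F u) * (exp ?\<delta> - 1 - ?\<delta>)"
          "LINT w:{u<..v}|lborel. h w * (exp (F w) - exp (F u))"] by (simp add: abs_mult)
    also have "\<dots> \<le> D * ((C * (v - u))\<^sup>2 * D) + C * (D\<^sup>2 * C * (v - u)) * (v - u)"
    proof (rule add_mono)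
      show "exp (F u) * \<bar>exp ?\<delta> - 1 - ?\<delta>\<bar> \<le> D * ((C * (v - u))\<^sup>2 * D)"
      proof (rule mult_mono)
        have "\<bar>exp ?\<delta> - 1 - ?\<delta>\<bar> \<le> \<bar>?\<delta>\<bar>\<^sup>2 * exp \<bar>?\<delta>\<bar>" using exp_minus_linear_bound[of ?\<delta>] by simp
        also have "\<dots> \<le> (C * (v - u))\<^sup>2 * D"
          using F_lip[OF u0 uv(2)] F_bound[OF u0 uv(2,3)] by (intro mult_mono power_mono) auto
        finally show "\<bar>exp ?\<delta> - 1 - ?\<delta>\<bar> \<le> (C * (v - u))\<^sup>2 * D" .
      qed (use \<Phi>_bound[of u] u0 uv D0 in auto)
      show "\<bar>LINT w:{u<..v}|lborel. h w * (exp (F w) - exp (F u))\<bar> \<le> C * (D\<^sup>2 * C * (v - u)) * (v - u)"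
      proof (rule set_integral_Ioc_bound[OF _ uv(2)])
        show "\<bar>h w * (exp (F w) - exp (F u))\<bar> \<le> C * (D\<^sup>2 * C * (v - u))" if "w \<in> {u<..v}" for w
          unfolding abs_mult using C[of w] that uv C0 D0
          by (intro mult_mono order_trans[OF \<Phi>_lip[OF u0, of w]]) auto
      qed measurable
    qed
    also have "\<dots> = 2 * D\<^sup>2 * C\<^sup>2 * (v - u)\<^sup>2" by (simp add: power2_eq_square algebra_simps)
    finally show "\<bar>E v - E u\<bar> \<le> 2 * D\<^sup>2 * C\<^sup>2 * (v - u)\<^sup>2" .
  qed
  then show ?thesis
    using set_integral_difference[OF \<Phi>h_int[OF order_refl] ab] by (simp add: E_def)
qed

text \<open>
  Between jumps the exponential solves \<open>dZ = Z h du\<close>, and at the jump time \<open>\<tau> i\<close> it is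
  multiplied by \<open>c i\<close>; the induction adds the last jump.
\<close>

lemma exponential_with_jumps:
  fixes h :: "real \<Rightarrow> real" and \<tau> c :: "nat \<Rightarrow> real"
  assumes h [measurable]: "h \<in> borel_measurable borel" and C: "\<And>u. \<bar>h u\<bar> \<le> C" and t: "0 \<le> t"
    and \<tau>: "\<And>i. i < j \<Longrightarrow> 0 \<le> \<tau> i \<and> \<tau> i \<le> t" "\<And>i i'. i < i' \<Longrightarrow> i' < j \<Longrightarrow> \<tau> i < \<tau> i'"
  defines "F \<equiv> \<lambda>u. LINT v:{0..u}|lborel. h v"
  shows "exp (F t) * (\<Prod>i<j. c i) = 1 + (\<Sum>i<j. exp (F (\<tau> i)) * (\<Prod>i'<i. c i') * (c i - 1)) +
    (LINT u:{0<..t}|lborel. h u * (exp (F u) * (\<Prod>i<j. if \<tau> i < u then c i else 1)))"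
  using \<tau>
proof (induction j)
  case 0
  have "F 0 = 0" by (simp add: F_def set_integral_point)
  then show ?case
    using exp_integral_increment[OF h C order_refl t] by (simp add: F_def)
next
  case (Suc j)
  have \<tau>j: "0 \<le> \<tau> j" "\<tau> j \<le> t" using Suc.prems(1)[of j] by auto
  have C0: "0 \<le> C" using C[of 0] by simp
  have [measurable]: "F \<in> borel_measurable borel" unfolding F_def by (rule measurable_primitive[OF h])
  let ?p = "\<Prod>i<j. c i"
  let ?P = "\<lambda>k u. \<Prod>i<k. if \<tau> i < u then c i else 1"
  have F_le: "exp (F u) \<le> exp (C * t)" if "0 \<le> u" "u \<le> t" for u
  proof -
    have h_int: "set_integrable lborel {0..u} h"
      by (rule bounded_set_integrable[of _ _ 0 u, OF _ _ _ C]) auto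
    have "F u \<le> (LINT v:{0..u}|lborel. C)"
      unfolding F_def
    proof (rule set_integral_mono[OF h_int])
      show "set_integrable lborel {0..u} (\<lambda>v. C)"
        by (rule bounded_set_integrable[of _ _ 0 u "\<bar>C\<bar>"]) auto
    qed (use C in \<open>auto simp: abs_le_iff\<close>)
    also have "\<dots> = C * u" using that by (simp add: set_lebesgue_integral_def)
    also have "\<dots> \<le> C * t" using that C0 by (intro mult_left_mono) auto
    finally show ?thesis by simp
  qed
  have int_j: "set_integrable lborel {0<..t} (\<lambda>u. h u * (exp (F u) * ?P j u))"
  proof (rule bounded_set_integrable[of _ _ 0 t])
    show "\<bar>h u * (exp (F u) * ?P j u)\<bar> \<le> C * (exp (C * t) * (\<Prod>i<j. max 1 \<bar>c i\<bar>))" if "u \<in> {0<..t}" for u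
    proof -
      have "\<bar>?P j u\<bar> \<le> (\<Prod>i<j. max 1 \<bar>c i\<bar>)"
        unfolding abs_prod by (rule prod_mono) auto
      then show ?thesis
        unfolding abs_mult using C[of u] F_le[of u] that C0 by (intro mult_mono) auto
    qed
  qed auto
  have int_e: "set_integrable lborel {0<..t} (\<lambda>u. indicator {\<tau> j<..t} u * ((c j - 1) * ?p * (h u * exp (F u))))"
  proof (rule bounded_set_integrable[of _ _ 0 t])
    show "\<bar>indicator {\<tau> j<..t} u * ((c j - 1) * ?p * (h u * exp (F u)))\<bar> \<le>
      1 * (\<bar>(c j - 1) * ?p\<bar> * (C * exp (C * t)))" if "u \<in> {0<..t}" for u
      unfolding abs_mult[of "indicator {\<tau> j<..t} u"] abs_mult[of "(c j - 1) * ?p"] abs_mult[of "h u"]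
      using C[of u] F_le[of u] that C0 by (intro mult_mono) (auto split: split_indicator)
  qed auto
  have "(LINT u:{0<..t}|lborel. h u * (exp (F u) * ?P (Suc j) u)) =
    (LINT u:{0<..t}|lborel. h u * (exp (F u) * ?P j u) +
       indicator {\<tau> j<..t} u * ((c j - 1) * ?p * (h u * exp (F u))))"
  proof (rule set_lebesgue_integral_cong)
    show "\<forall>u. u \<in> {0<..t} \<longrightarrow> h u * (exp (F u) * ?P (Suc j) u) = h u * (exp (F u) * ?P j u) +
       indicator {\<tau> j<..t} u * ((c j - 1) * ?p * (h u * exp (F u)))"
    proof (intro allI impI)
      fix u assume u: "u \<in> {0<..t}"
      show "h u * (exp (F u) * ?P (Suc j) u) = h u * (exp (F u) * ?P j u) +
         indicator {\<tau> j<..t} u * ((c j - 1) * ?p * (h u * exp (F u)))"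
      proof (cases "\<tau> j < u")
        case True
        then have "?P j u = ?p"
          using Suc.prems(2) by (intro prod.cong) (auto intro: less_trans)
        then show ?thesis using True u by (simp add: algebra_simps)
      next
        case False
        then show ?thesis by simp
      qed
    qed
  qed simp
  also have "\<dots> = (LINT u:{0<..t}|lborel. h u * (exp (F u) * ?P j u)) +
    (LINT u:{0<..t}|lborel. indicator {\<tau> j<..t} u * ((c j - 1) * ?p * (h u * exp (F u))))"
    by (rule set_integral_add(2)[OF int_j int_e])
  also have "(LINT u:{0<..t}|lborel. indicator {\<tau> j<..t} u * ((c j - 1) * ?p * (h u * exp (F u)))) =
    (LINT u:{\<tau> j<..t}|lborel. (c j - 1) * ?p * (h u * exp (F u)))"
    unfolding set_lebesgue_integral_def
    by (intro Bochner_Integration.integral_cong) (use \<tau>j in \<open>auto split: split_indicator\<close>)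
  also have "\<dots> = (c j - 1) * ?p * (LINT u:{\<tau> j<..t}|lborel. h u * exp (F u))"
    by (rule set_integral_mult_right)
  also have "(LINT u:{\<tau> j<..t}|lborel. h u * exp (F u)) = exp (F t) - exp (F (\<tau> j))"
    using exp_integral_increment[OF h C \<tau>j] by (simp add: F_def)
  finally have I: "(LINT u:{0<..t}|lborel. h u * (exp (F u) * ?P (Suc j) u)) =
    (LINT u:{0<..t}|lborel. h u * (exp (F u) * ?P j u)) + (c j - 1) * ?p * (exp (F t) - exp (F (\<tau> j)))" .
  have IH: "exp (F t) * ?p = 1 + (\<Sum>i<j. exp (F (\<tau> i)) * (\<Prod>i'<i. c i') * (c i - 1)) +
    (LINT u:{0<..t}|lborel. h u * (exp (F u) * ?P j u))"
    by (rule Suc.IH) (use Suc.prems in auto)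
  have "exp (F t) * (\<Prod>i<Suc j. c i) = exp (F t) * ?p + (c j - 1) * ?p * exp (F t)"
    by (simp add: algebra_simps)
  also have "\<dots> = 1 + (\<Sum>i<Suc j. exp (F (\<tau> i)) * (\<Prod>i'<i. c i') * (c i - 1)) +
    (LINT u:{0<..t}|lborel. h u * (exp (F u) * ?P (Suc j) u))"
    unfolding I IH by (simp add: algebra_simps)
  finally show ?case .
qed

section \<open>The likelihood process\<close>

context counting_process
begin

text \<open>
  The likelihood ratio at time \<open>t\<close> with the Stieltjes integral of the logarithm written out as a
  product over the jumps; for a positive intensity it is \<open>exp (zeta N l 0 t \<omega>)\<close>, as \<open>exp_zeta\<close> shows.
\<close>

definition likelihood :: "('a \<Rightarrow> real \<Rightarrow> real) \<Rightarrow> real \<Rightarrow> 'a \<Rightarrow> real" where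
  "likelihood l t \<omega> = exp (LINT u:{0..t}|lborel. 1 - l \<omega> u) * (\<Prod>n<nat \<lfloor>N \<omega> t\<rfloor>. l \<omega> (T (Suc n) \<omega>))"

lemma likelihood_pos:
  "(\<And>u. 0 \<le> u \<Longrightarrow> 0 < l \<omega> u) \<Longrightarrow> 0 < likelihood l t \<omega>"
  unfolding likelihood_def by (intro mult_pos_pos prod_pos) (auto simp: jump_time_nonneg)

lemma measurable_likelihood:
  assumes l: "case_prod l \<in> borel_measurable Pred" and t: "0 \<le> t"
  shows "likelihood l t \<in> borel_measurable (G t)"
proof -
  have [measurable]: "(\<lambda>x. l (fst x) (snd x)) \<in> borel_measurable Pred"
    using l by (simp add: case_prod_beta')
  have "(\<lambda>x. LINT v:{0..snd x}|lborel. 1 - l (fst x) v) \<in> borel_measurable Pred"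
    using measurable_running_integral[of "\<lambda>x. 1 - l (fst x) (snd x)"] by simp
  from measurable_compose[OF measurable_Pred_at[OF t] this]
  have [measurable]: "(\<lambda>\<omega>. LINT v:{0..t}|lborel. 1 - l \<omega> v) \<in> borel_measurable (G t)" by simp
  let ?c = "\<lambda>n \<omega>. if real n \<le> N \<omega> t then T n \<omega> else t"
  have [measurable]: "(\<lambda>\<omega>. N \<omega> t) \<in> borel_measurable (G t)"
    using adapted_N t by (simp add: adapted_def)
  have [measurable]: "(\<lambda>\<omega>. l \<omega> (?c n \<omega>)) \<in> borel_measurable (G t)" for n
    using measurable_compose[OF measurable_at_clipped_jump_time[OF t] l] by simp
  have [measurable]: "(\<lambda>\<omega>. \<Prod>n<nat \<lfloor>N \<omega> t\<rfloor>. l \<omega> (?c (Suc n) \<omega>)) \<in> borel_measurable (G t)"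
    by (rule measurable_compose_countable[where f="\<lambda>k \<omega>. \<Prod>n<k. l \<omega> (?c (Suc n) \<omega>)" and g="\<lambda>\<omega>. nat \<lfloor>N \<omega> t\<rfloor>"]) measurable
  have m: "(\<lambda>\<omega>. exp (LINT u:{0..t}|lborel. 1 - l \<omega> u) * (\<Prod>n<nat \<lfloor>N \<omega> t\<rfloor>. l \<omega> (?c (Suc n) \<omega>))) \<in> borel_measurable (G t)"
    by measurable
  show ?thesis
  proof (rule measurable_cong[THEN iffD1, OF _ m])
    fix \<omega> assume "\<omega> \<in> space (G t)"
    then have \<omega>: "\<omega> \<in> space P" using t by simp
    have "real (Suc n) \<le> N \<omega> t" if "n < nat \<lfloor>N \<omega> t\<rfloor>" for n
      using that jumps_until[OF \<omega> t, of n] jump_time_le_iff[OF \<omega> t, of "Suc n"] by blast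
    then show "exp (LINT u:{0..t}|lborel. 1 - l \<omega> u) * (\<Prod>n<nat \<lfloor>N \<omega> t\<rfloor>. l \<omega> (?c (Suc n) \<omega>)) = likelihood l t \<omega>"
      unfolding likelihood_def by (intro arg_cong2[where f="(*)"] refl prod.cong) auto
  qed
qed

lemma exp_zeta:
  assumes \<omega>: "\<omega> \<in> space P" and l: "case_prod l \<in> borel_measurable Pred"
    and pos: "\<And>u. 0 \<le> u \<Longrightarrow> 0 < l \<omega> u" and t: "0 \<le> t"
  shows "exp (zeta N l 0 t \<omega>) = likelihood l t \<omega>"
proof -
  let ?f = "\<lambda>u. indicator {0<..t} u * ln (l \<omega> u)"
  have [measurable]: "(\<lambda>u. l \<omega> (max 0 u)) \<in> borel_measurable borel" by (rule measurable_path[OF l \<omega>])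
  have "(\<lambda>u. indicator {0<..t} u * ln (l \<omega> (max 0 u))) \<in> borel_measurable borel" by measurable
  moreover have "indicator {0<..t} u * ln (l \<omega> (max 0 u)) = ?f u" for u by (auto split: split_indicator)
  ultimately have f [measurable]: "?f \<in> borel_measurable borel" by simp
  let ?n = "nat \<lfloor>N \<omega> t\<rfloor>"
  have iff: "J (Suc n) \<omega> \<and> T (Suc n) \<omega> \<le> t \<longleftrightarrow> n < ?n" for n by (rule jumps_until[OF \<omega> t])
  have val: "(if J (Suc n) \<omega> then 1 else 0) * ?f (T (Suc n) \<omega>) = (if n < ?n then ln (l \<omega> (T (Suc n) \<omega>)) else 0)" for n
    using iff[of n] jump_time_pos[OF \<omega>, of n] by (auto split: split_indicator)
  have ind: "indicator {n. J (Suc n) \<omega>} = (\<lambda>n. ennreal (if J (Suc n) \<omega> then 1 else 0))"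
    by (auto simp: indicator_def)
  have "(LINT u:{0<..t}|path_measure N \<omega>. ln (l \<omega> u)) =
      (LINT n|density (count_space UNIV) (\<lambda>n. ennreal (if J (Suc n) \<omega> then 1 else 0)). ?f (T (Suc n) \<omega>))"
    unfolding set_lebesgue_integral_def path_measure_eq_distr[OF \<omega>] real_scaleR_def ind
    by (rule integral_distr[OF _ f]) simp
  also have "\<dots> = (LINT n|count_space UNIV. (if J (Suc n) \<omega> then 1 else 0) *\<^sub>R ?f (T (Suc n) \<omega>))"
    by (rule integral_density) auto
  also have "\<dots> = (LINT n|count_space UNIV. (if n < ?n then ln (l \<omega> (T (Suc n) \<omega>)) else 0))"
    unfolding real_scaleR_def val ..
  also have "\<dots> = (\<Sum>n | n < ?n. ln (l \<omega> (T (Suc n) \<omega>)))"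
  proof -
    have "{n. (if n < ?n then ln (l \<omega> (T (Suc n) \<omega>)) else 0) \<noteq> 0} \<subseteq> {n. n < ?n}" by auto
    then have "(LINT n|count_space UNIV. (if n < ?n then ln (l \<omega> (T (Suc n) \<omega>)) else 0)) =
      (\<Sum>n\<in>{n. n < ?n}. if n < ?n then ln (l \<omega> (T (Suc n) \<omega>)) else 0)"
      by (subst lebesgue_integral_count_space_finite_support)
        (auto intro: finite_subset intro!: sum.mono_neutral_left)
    then show ?thesis by simp
  qed
  finally have "(LINT u:{0<..t}|path_measure N \<omega>. ln (l \<omega> u)) = (\<Sum>n<?n. ln (l \<omega> (T (Suc n) \<omega>)))"
    by (simp add: lessThan_def)
  then have "exp (LINT u:{0<..t}|path_measure N \<omega>. ln (l \<omega> u)) = (\<Prod>n<?n. l \<omega> (T (Suc n) \<omega>))"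
    using pos jump_time_nonneg by (simp add: exp_sum)
  then show ?thesis by (simp add: zeta_def likelihood_def exp_add)
qed

text \<open>
  The left limit at \<open>u\<close> of the likelihood if at most the first \<open>m\<close> jumps carry a factor: leaving out
  the jump at \<open>u\<close> itself makes it predictable.
\<close>

definition likelihood_before :: "('a \<Rightarrow> real \<Rightarrow> real) \<Rightarrow> nat \<Rightarrow> 'a \<Rightarrow> real \<Rightarrow> real" where
  "likelihood_before l m \<omega> u = exp (LINT v:{0..u}|lborel. 1 - l \<omega> v) *
     (\<Prod>i<m. if J (Suc i) \<omega> \<and> T (Suc i) \<omega> < u then l \<omega> (T (Suc i) \<omega>) else 1)"

lemma predictable_likelihood_before:
  assumes l: "case_prod l \<in> borel_measurable Pred"
  shows "case_prod (likelihood_before l m) \<in> borel_measurable Pred"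
proof -
  have [measurable]: "(\<lambda>x. l (fst x) (snd x)) \<in> borel_measurable Pred"
    using l by (simp add: case_prod_beta')
  have [measurable]: "(\<lambda>x. LINT v:{0..snd x}|lborel. 1 - l (fst x) v) \<in> borel_measurable Pred"
    using measurable_running_integral[of "\<lambda>x. 1 - l (fst x) (snd x)"] by simp
  have [measurable]: "(\<lambda>x. if J (Suc i) (fst x) \<and> T (Suc i) (fst x) < snd x then l (fst x) (T (Suc i) (fst x)) else 1)
     \<in> borel_measurable Pred" for i
    using predictable_after_jump[OF l, of "Suc i" 1] by (simp add: case_prod_beta')
  show ?thesis unfolding likelihood_before_def case_prod_beta' by measurable
qed

lemma likelihood_before_bounds:
  assumes l: "\<And>u. 0 \<le> u \<Longrightarrow> 0 < l \<omega> u \<and> l \<omega> u \<le> b" and \<omega>: "\<omega> \<in> space P"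
    and meas: "case_prod l \<in> borel_measurable Pred" and u: "0 \<le> u" "u \<le> t"
  shows "0 < likelihood_before l m \<omega> u" "likelihood_before l m \<omega> u \<le> exp t * (max 1 b) ^ m"
proof -
  let ?p = "\<lambda>i. if J (Suc i) \<omega> \<and> T (Suc i) \<omega> < u then l \<omega> (T (Suc i) \<omega>) else 1"
  have p: "0 < ?p i \<and> ?p i \<le> max 1 b" for i
    using l[OF jump_time_nonneg, of "Suc i"] by (auto intro: max.coboundedI2)
  show "0 < likelihood_before l m \<omega> u"
    unfolding likelihood_before_def using p by (intro mult_pos_pos prod_pos) auto
  have "(\<Prod>i<m. ?p i) \<le> (\<Prod>i<m. max 1 b)"
    by (rule prod_mono) (use p less_imp_le in blast)
  then have P: "(\<Prod>i<m. ?p i) \<le> (max 1 b) ^ m" by simp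
  have P0: "0 \<le> (\<Prod>i<m. ?p i)"
    by (rule prod_nonneg) (use p less_imp_le in blast)
  have [measurable]: "(\<lambda>u. l \<omega> (max 0 u)) \<in> borel_measurable borel" by (rule measurable_path[OF meas \<omega>])
  have "(LINT v:{0..u}|lborel. 1 - l \<omega> v) = (LINT v:{0..u}|lborel. 1 - l \<omega> (max 0 v))"
    unfolding set_lebesgue_integral_def by (intro Bochner_Integration.integral_cong) (auto split: split_indicator)
  also have "\<dots> \<le> (LINT v:{0..u}|lborel. 1)"
  proof (rule set_integral_mono)
    show "set_integrable lborel {0..u} (\<lambda>v. 1 - l \<omega> (max 0 v))"
    proof (rule bounded_set_integrable[of _ _ 0 u "1 + b"])
      show "\<bar>1 - l \<omega> (max 0 v)\<bar> \<le> 1 + b" for v using l[of "max 0 v"] by auto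
    qed auto
    show "set_integrable lborel {0..u} (\<lambda>v. 1 :: real)" by (rule bounded_set_integrable[of _ _ 0 u 1]) auto
    show "1 - l \<omega> (max 0 v) \<le> 1" for v using l[of "max 0 v"] by auto
  qed
  also have "\<dots> = u" using u by (simp add: set_lebesgue_integral_def)
  finally have "exp (LINT v:{0..u}|lborel. 1 - l \<omega> v) \<le> exp t" using u by simp
  then show "likelihood_before l m \<omega> u \<le> exp t * (max 1 b) ^ m"
    unfolding likelihood_before_def using P P0 by (intro mult_mono) auto
qed

text \<open>
  The likelihood \<open>Z\<close> solves \<open>dZ = W (l - 1) (dN - du)\<close>, where \<open>W\<close> is its left limit.  The terms are
  distributed so that all are nonnegative and the equation can be integrated without regard to
  integrability.
\<close>

lemma likelihood_equation:
  assumes \<omega>: "\<omega> \<in> space P" and meas: "case_prod l \<in> borel_measurable Pred"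
    and l: "\<And>u. 0 \<le> u \<Longrightarrow> 0 < l \<omega> u \<and> l \<omega> u \<le> b"
    and one: "\<And>u. 0 \<le> u \<Longrightarrow> (\<omega>, u) \<notin> before_jump m \<Longrightarrow> l \<omega> u = 1" and t: "0 \<le> t"
  defines "W \<equiv> likelihood_before l m \<omega>"
  shows "ennreal (likelihood l t \<omega>) + jump_sum N (\<lambda>u. ennreal (W u) * indicator {0..t} u) \<omega> +
      (\<integral>\<^sup>+u. ennreal (W u * l \<omega> u) * indicator {0<..t} u \<partial>lborel) =
    1 + jump_sum N (\<lambda>u. ennreal (W u * l \<omega> u) * indicator {0..t} u) \<omega> +
      (\<integral>\<^sup>+u. ennreal (W u) * indicator {0<..t} u \<partial>lborel)"
proof -
  let ?j = "nat \<lfloor>N \<omega> t\<rfloor>"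
  let ?\<tau> = "\<lambda>i. T (Suc i) \<omega>"
  let ?c = "\<lambda>i. l \<omega> (?\<tau> i)"
  define h where "h u = 1 - l \<omega> (max 0 u)" for u
  have lm [measurable]: "(\<lambda>u. l \<omega> (max 0 u)) \<in> borel_measurable borel" by (rule measurable_path[OF meas \<omega>])
  have hm [measurable]: "h \<in> borel_measurable borel" unfolding h_def[abs_def] by measurable
  have hC: "\<bar>h u\<bar> \<le> 1 + b" for u unfolding h_def using l[of "max 0 u"] by auto
  have F: "(LINT v:{0..u}|lborel. h v) = (LINT v:{0..u}|lborel. 1 - l \<omega> v)" for u
    unfolding set_lebesgue_integral_def h_def by (intro Bochner_Integration.integral_cong) (auto split: split_indicator)
  have iff: "J (Suc i) \<omega> \<and> ?\<tau> i \<le> t \<longleftrightarrow> i < ?j" for i by (rule jumps_until[OF \<omega> t])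
  have ord: "?\<tau> i < ?\<tau> i'" if "i < i'" "i' < ?j" for i i'
    using jump_time_strict_mono[OF \<omega>, of "Suc i'" "Suc i"] iff[of i'] that by auto
  have beyond: "?c i = 1" if "J (Suc i) \<omega>" "m \<le> i" for i
  proof (rule one[OF jump_time_nonneg])
    have "J m \<omega>" using reaches_mono[OF that(1)] that(2) by simp
    moreover have "T m \<omega> < ?\<tau> i" using that by (intro jump_time_strict_mono[OF \<omega>]) auto
    ultimately show "(\<omega>, ?\<tau> i) \<notin> before_jump m" by (simp add: before_jump_iff)
  qed
  have W: "W u = exp (LINT v:{0..u}|lborel. h v) * (\<Prod>i<?j. if ?\<tau> i < u then ?c i else 1)" if u: "u \<le> t" for u
  proof -
    let ?K = "{i. i < ?j \<and> ?\<tau> i < u}"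
    have iffK: "J (Suc i) \<omega> \<and> ?\<tau> i < u \<longleftrightarrow> i \<in> ?K" for i using iff[of i] u by auto
    have "(\<Prod>i<m. if J (Suc i) \<omega> \<and> ?\<tau> i < u then ?c i else 1) = (\<Prod>i<m. if i \<in> ?K then ?c i else 1)"
      by (intro prod.cong) (auto simp only: iffK)
    also have "\<dots> = (\<Prod>i\<in>{..<m} \<inter> ?K. ?c i)" by (simp add: prod.inter_restrict)
    also have "\<dots> = (\<Prod>i\<in>?K. ?c i)"
    proof (rule prod.mono_neutral_left)
      show "\<forall>i\<in>?K - {..<m} \<inter> ?K. ?c i = 1"
      proof
        fix i assume "i \<in> ?K - {..<m} \<inter> ?K"
        then have "J (Suc i) \<omega>" "m \<le> i" using iff[of i] by auto
        then show "?c i = 1" by (rule beyond)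
      qed
    qed auto
    also have "\<dots> = (\<Prod>i\<in>{..<?j} \<inter> ?K. ?c i)" by (intro prod.cong) auto
    also have "\<dots> = (\<Prod>i<?j. if i \<in> ?K then ?c i else 1)" by (simp add: prod.inter_restrict)
    also have "\<dots> = (\<Prod>i<?j. if ?\<tau> i < u then ?c i else 1)" by (intro prod.cong) auto
    finally show ?thesis unfolding W_def likelihood_before_def F by simp
  qed
  have W\<tau>: "W (?\<tau> i) = exp (LINT v:{0..?\<tau> i}|lborel. h v) * (\<Prod>i'<i. ?c i')" if i: "i < ?j" for i
  proof -
    have "?\<tau> i' < ?\<tau> i \<longleftrightarrow> i' < i" if "i' < ?j" for i'
      using ord[of i' i] ord[of i i'] that i by (metis less_asym less_irrefl linorder_neqE_nat)
    then have "(\<Prod>i'<?j. if ?\<tau> i' < ?\<tau> i then ?c i' else 1) = (\<Prod>i'<?j. if i' < i then ?c i' else 1)"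
      by (intro prod.cong) auto
    also have "\<dots> = (\<Prod>i'\<in>{..<?j} \<inter> {i'. i' < i}. ?c i')" by (simp add: prod.inter_restrict)
    also have "{..<?j} \<inter> {i'. i' < i} = {..<i}" using i by auto
    finally show ?thesis using W[of "?\<tau> i"] iff[of i] i by simp
  qed
  have "likelihood l t \<omega> = exp (LINT v:{0..t}|lborel. h v) * (\<Prod>i<?j. ?c i)"
    by (simp add: likelihood_def F)
  also have "\<dots> = 1 + (\<Sum>i<?j. exp (LINT v:{0..?\<tau> i}|lborel. h v) * (\<Prod>i'<i. ?c i') * (?c i - 1)) +
    (LINT u:{0<..t}|lborel. h u * (exp (LINT v:{0..u}|lborel. h v) * (\<Prod>i<?j. if ?\<tau> i < u then ?c i else 1)))"
    by (rule exponential_with_jumps[OF hm hC t]) (use iff ord in \<open>auto simp: jump_time_nonneg\<close>)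
  also have "(\<Sum>i<?j. exp (LINT v:{0..?\<tau> i}|lborel. h v) * (\<Prod>i'<i. ?c i') * (?c i - 1)) =
      (\<Sum>i<?j. W (?\<tau> i) * ?c i) - (\<Sum>i<?j. W (?\<tau> i))"
    by (simp add: W\<tau> sum_subtractf right_diff_distrib)
  also have "(LINT u:{0<..t}|lborel. h u * (exp (LINT v:{0..u}|lborel. h v) * (\<Prod>i<?j. if ?\<tau> i < u then ?c i else 1))) =
      (LINT u:{0<..t}|lborel. W u - W u * l \<omega> u)"
    unfolding set_lebesgue_integral_def
  proof (rule Bochner_Integration.integral_cong[OF refl])
    fix u
    show "indicator {0<..t} u *\<^sub>R (h u * (exp (LINT v|lborel. indicator {0..u} v *\<^sub>R h v) *
        (\<Prod>i<?j. if ?\<tau> i < u then ?c i else 1))) = indicator {0<..t} u *\<^sub>R (W u - W u * l \<omega> u)"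
    proof (cases "u \<in> {0<..t}")
      case True
      then have "u \<le> t" "h u = 1 - l \<omega> u" by (auto simp: h_def)
      then show ?thesis
        using W[OF \<open>u \<le> t\<close>] by (simp add: set_lebesgue_integral_def left_diff_distrib mult.commute)
    qed simp
  qed
  finally have eq: "likelihood l t \<omega> = 1 + ((\<Sum>i<?j. W (?\<tau> i) * ?c i) - (\<Sum>i<?j. W (?\<tau> i))) +
      (LINT u:{0<..t}|lborel. W u - W u * l \<omega> u)" .
  have Wb: "0 < W u" "W u \<le> exp t * (max 1 b) ^ m" if "0 \<le> u" "u \<le> t" for u
    unfolding W_def by (rule likelihood_before_bounds[where l=l and \<omega>=\<omega> and b=b, OF l \<omega> meas that]; assumption)+
  have b0: "0 < b" using l[of 0] by simp
  have Wm: "(\<lambda>u. W (max 0 u)) \<in> borel_measurable borel"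
    unfolding W_def by (rule measurable_path[OF predictable_likelihood_before[OF meas] \<omega>])
  have set_int: "set_integrable lborel {0<..t} f"
    if "(\<lambda>u. f (max 0 u)) \<in> borel_measurable borel" "\<And>u. 0 \<le> u \<Longrightarrow> u \<le> t \<Longrightarrow> \<bar>f u\<bar> \<le> c" for f :: "real \<Rightarrow> real" and c
  proof -
    have "set_integrable lborel {0<..t} (\<lambda>u. f (max 0 u))"
      by (rule bounded_set_integrable[of _ _ 0 t c]) (use that in auto)
    then show ?thesis
      unfolding set_integrable_def
      by (rule Bochner_Integration.integrable_cong[THEN iffD1, rotated -1]) (auto split: split_indicator)
  qed
  have i1: "set_integrable lborel {0<..t} W"
  proof (rule set_int[OF Wm])
    show "\<bar>W u\<bar> \<le> exp t * (max 1 b) ^ m" if "0 \<le> u" "u \<le> t" for u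
      using Wb[OF that] by (simp add: abs_of_pos)
  qed
  have i2: "set_integrable lborel {0<..t} (\<lambda>u. W u * l \<omega> u)"
  proof (rule set_int)
    show "\<bar>W u * l \<omega> u\<bar> \<le> exp t * (max 1 b) ^ m * b" if "0 \<le> u" "u \<le> t" for u
      unfolding abs_mult using Wb[OF that] l[OF that(1)] by (intro mult_mono) auto
  qed (use Wm lm in measurable)
  have eq': "likelihood l t \<omega> + (\<Sum>i<?j. W (?\<tau> i)) + (LINT u:{0<..t}|lborel. W u * l \<omega> u) =
      1 + (\<Sum>i<?j. W (?\<tau> i) * ?c i) + (LINT u:{0<..t}|lborel. W u)"
    using eq set_integral_diff(2)[OF i1 i2] by simp
  have W\<tau>0: "0 \<le> W (?\<tau> i)" "0 \<le> W (?\<tau> i) * ?c i" if "i < ?j" for i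
  proof -
    have "0 < W (?\<tau> i)" "0 < ?c i"
      using Wb(1)[of "?\<tau> i"] l[of "?\<tau> i"] iff[of i] that by (auto simp: jump_time_nonneg)
    then show "0 \<le> W (?\<tau> i)" "0 \<le> W (?\<tau> i) * ?c i" by auto
  qed
  have j1: "jump_sum N (\<lambda>u. ennreal (W u) * indicator {0..t} u) \<omega> = ennreal (\<Sum>i<?j. W (?\<tau> i))"
    unfolding jump_sum_until[OF \<omega> t] using W\<tau>0 by (intro sum_ennreal) auto
  have j2: "jump_sum N (\<lambda>u. ennreal (W u * l \<omega> u) * indicator {0..t} u) \<omega> = ennreal (\<Sum>i<?j. W (?\<tau> i) * ?c i)"
    unfolding jump_sum_until[OF \<omega> t] using W\<tau>0 by (intro sum_ennreal) auto
  have W0: "0 \<le> W u" "0 \<le> W u * l \<omega> u" if "u \<in> {0<..t}" for u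
    using Wb(1)[of u] l[of u] that by (auto intro!: mult_nonneg_nonneg)
  have n1: "(\<integral>\<^sup>+u. ennreal (W u) * indicator {0<..t} u \<partial>lborel) = ennreal (LINT u:{0<..t}|lborel. W u)"
    by (rule nn_integral_path[where X="\<lambda>_. W", OF i1 W0(1)])
  have n2: "(\<integral>\<^sup>+u. ennreal (W u * l \<omega> u) * indicator {0<..t} u \<partial>lborel) = ennreal (LINT u:{0<..t}|lborel. W u * l \<omega> u)"
    by (rule nn_integral_path[where X="\<lambda>_ u. W u * l \<omega> u", OF i2 W0(2)])
  have pos: "0 \<le> likelihood l t \<omega>" "0 \<le> (\<Sum>i<?j. W (?\<tau> i))" "0 \<le> (\<Sum>i<?j. W (?\<tau> i) * ?c i)"
    using likelihood_pos[of l \<omega> t] l by (auto intro!: sum_nonneg less_imp_le[of 0 "likelihood l t \<omega>"] W\<tau>0)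
  have pos': "0 \<le> (LINT u:{0<..t}|lborel. W u)" "0 \<le> (LINT u:{0<..t}|lborel. W u * l \<omega> u)"
    unfolding set_lebesgue_integral_def
    by (intro Bochner_Integration.integral_nonneg, use W0 in \<open>simp split: split_indicator\<close>)+
  show ?thesis
    unfolding j1 j2 n1 n2 using eq' pos pos'
    by (simp add: ennreal_plus[symmetric] ennreal_1[symmetric] del: ennreal_plus ennreal_1)
qed

end

text \<open>
  By Watanabe's characterisation, equality of the two Doleans measures says that \<open>N\<close> is a Poisson
  process of rate one under \<open>P\<close>.
\<close>

locale poisson_space = doleans P G N P for P :: "'a measure" and G N +
  assumes unit_rate: "jump_measure P G N P = time_measure P G P"
    and emeasure_P: "emeasure P (space P) = 1"
begin

text \<open>
  Integrating the equation for the likelihood, the jump terms cancel against the time terms because \<open>W\<close>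
  and \<open>W l\<close> are predictable and the Doleans measures agree.  Boundedness of \<open>l\<close> and the bound on the
  number of jumps that matter make these terms finite, so that they can be cancelled.
\<close>

lemma likelihood_mean_bounded:
  assumes meas: "case_prod l \<in> borel_measurable Pred"
    and l: "\<And>\<omega> u. \<omega> \<in> space P \<Longrightarrow> 0 \<le> u \<Longrightarrow> 0 < l \<omega> u \<and> l \<omega> u \<le> b"
    and one: "\<And>\<omega> u. \<omega> \<in> space P \<Longrightarrow> 0 \<le> u \<Longrightarrow> (\<omega>, u) \<notin> before_jump m \<Longrightarrow> l \<omega> u = 1" and t: "0 \<le> t"
  shows "(\<integral>\<^sup>+\<omega>. ennreal (likelihood l t \<omega>) \<partial>P) = 1"
proof -
  let ?W = "likelihood_before l m"
  let ?f = "\<lambda>x. ennreal (?W (fst x) (snd x)) * indicator {0..t} (snd x)"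
  let ?g = "\<lambda>x. ennreal (?W (fst x) (snd x) * l (fst x) (snd x)) * indicator {0..t} (snd x)"
  have [measurable]: "(\<lambda>x. l (fst x) (snd x)) \<in> borel_measurable Pred"
    using meas by (simp add: case_prod_beta')
  have [measurable]: "(\<lambda>x. ?W (fst x) (snd x)) \<in> borel_measurable Pred"
    using predictable_likelihood_before[OF meas, of m] by (simp add: case_prod_beta')
  have fg [measurable]: "?f \<in> borel_measurable Pred" "?g \<in> borel_measurable Pred"
    by measurable
  have [measurable]: "likelihood l t \<in> borel_measurable P"
    by (rule measurable_from_G[OF t measurable_likelihood[OF meas t]])
  have restrict: "(\<integral>\<^sup>+u. k u * indicator {0<..t} u \<partial>lborel) = (\<integral>\<^sup>+u. (k u * indicator {0..t} u) * indicator {0..} u \<partial>lborel)"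
    for k :: "real \<Rightarrow> ennreal"
  proof (rule nn_integral_cong_AE)
    have "AE u in lborel. u \<noteq> (0::real)" by (rule AE_lborel_singleton)
    then show "AE u in lborel. k u * indicator {0<..t} u = (k u * indicator {0..t} u) * indicator {0..} u"
      by eventually_elim (auto split: split_indicator)
  qed
  have b0: "0 \<le> b" if "\<omega> \<in> space P" for \<omega> using l[OF that, of 0] by simp
  define X where "X = (\<integral>\<^sup>+x. ?f x \<partial>muL)"
  define Y where "Y = (\<integral>\<^sup>+x. ?g x \<partial>muL)"
  have XT: "X = (\<integral>\<^sup>+\<omega>. \<integral>\<^sup>+u. ?f (\<omega>, u) * indicator {0..} u \<partial>lborel \<partial>P)"
    and YT: "Y = (\<integral>\<^sup>+\<omega>. \<integral>\<^sup>+u. ?g (\<omega>, u) * indicator {0..} u \<partial>lborel \<partial>P)"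
    unfolding X_def Y_def by (rule nn_integral_time_measure, rule fg)+
  have XJ: "X = (\<integral>\<^sup>+\<omega>. jump_sum N (\<lambda>u. ?f (\<omega>, u)) \<omega> \<partial>P)"
    and YJ: "Y = (\<integral>\<^sup>+\<omega>. jump_sum N (\<lambda>u. ?g (\<omega>, u)) \<omega> \<partial>P)"
    unfolding X_def Y_def unit_rate[symmetric] by (rule nn_integral_jump_measure, rule fg)+
  have fin: "(\<integral>\<^sup>+x. H x \<partial>muL) < \<infinity>"
    if H: "H \<in> borel_measurable Pred" and le: "\<And>\<omega> u. \<omega> \<in> space P \<Longrightarrow> 0 \<le> u \<Longrightarrow> H (\<omega>, u) \<le> ennreal c * indicator {0..t} u" for H c
  proof -
    have "(\<integral>\<^sup>+x. H x \<partial>muL) \<le> (\<integral>\<^sup>+\<omega>. \<integral>\<^sup>+u. ennreal c * indicator {0..t} u \<partial>lborel \<partial>P)"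
      unfolding nn_integral_time_measure[OF H]
    proof (intro nn_integral_mono)
      fix \<omega> u assume "\<omega> \<in> space P"
      then show "H (\<omega>, u) * indicator {0..} u \<le> ennreal c * indicator {0..t} u"
        using le[of \<omega> u] by (cases "0 \<le> u") auto
    qed
    also have "\<dots> < \<infinity>" using t by (simp add: nn_integral_cmult emeasure_P ennreal_mult_less_top)
    finally show ?thesis .
  qed
  have Wb: "0 < ?W \<omega> u" "?W \<omega> u \<le> exp t * (max 1 b) ^ m" if "\<omega> \<in> space P" "0 \<le> u" "u \<le> t" for \<omega> u
    by (rule likelihood_before_bounds[OF l[OF that(1)] that(1) meas that(2,3)]; assumption)+
  have X: "X < \<infinity>"
    unfolding X_def using Wb
    by (intro fin[OF fg(1), of "exp t * (max 1 b) ^ m"]) (auto intro: ennreal_leI split: split_indicator)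
  have Y: "Y < \<infinity>"
    unfolding Y_def
  proof (rule fin[OF fg(2), of "exp t * (max 1 b) ^ m * b"])
    fix \<omega> and u :: real assume \<omega>: "\<omega> \<in> space P" and u: "0 \<le> u"
    have "?W \<omega> u * l \<omega> u \<le> exp t * (max 1 b) ^ m * b" if "u \<le> t"
      using Wb[OF \<omega> u that] l[OF \<omega> u] by (intro mult_mono) auto
    then show "?g (\<omega>, u) \<le> ennreal (exp t * (max 1 b) ^ m * b) * indicator {0..t} u"
      by (auto intro: ennreal_leI split: split_indicator)
  qed
  have m1: "(\<lambda>\<omega>. jump_sum N (\<lambda>u. ?f (\<omega>, u)) \<omega>) \<in> borel_measurable P"
    "(\<lambda>\<omega>. jump_sum N (\<lambda>u. ?g (\<omega>, u)) \<omega>) \<in> borel_measurable P"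
    by (intro measurable_jump_sum fg)+
  have m2: "(\<lambda>\<omega>. \<integral>\<^sup>+u. ?f (\<omega>, u) * indicator {0..} u \<partial>lborel) \<in> borel_measurable P"
    "(\<lambda>\<omega>. \<integral>\<^sup>+u. ?g (\<omega>, u) * indicator {0..} u \<partial>lborel) \<in> borel_measurable P"
    by (intro measurable_time_integral fg)+
  have "(\<integral>\<^sup>+\<omega>. ennreal (likelihood l t \<omega>) \<partial>P) + X + Y =
    (\<integral>\<^sup>+\<omega>. ennreal (likelihood l t \<omega>) + jump_sum N (\<lambda>u. ?f (\<omega>, u)) \<omega> +
       (\<integral>\<^sup>+u. ?g (\<omega>, u) * indicator {0..} u \<partial>lborel) \<partial>P)"
    unfolding XJ YT using m1 m2 by (simp add: nn_integral_add)
  also have "\<dots> = (\<integral>\<^sup>+\<omega>. 1 + jump_sum N (\<lambda>u. ?g (\<omega>, u)) \<omega> +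
       (\<integral>\<^sup>+u. ?f (\<omega>, u) * indicator {0..} u \<partial>lborel) \<partial>P)"
  proof (rule nn_integral_cong)
    fix \<omega> assume \<omega>: "\<omega> \<in> space P"
    show "ennreal (likelihood l t \<omega>) + jump_sum N (\<lambda>u. ?f (\<omega>, u)) \<omega> +
       (\<integral>\<^sup>+u. ?g (\<omega>, u) * indicator {0..} u \<partial>lborel) = 1 + jump_sum N (\<lambda>u. ?g (\<omega>, u)) \<omega> +
       (\<integral>\<^sup>+u. ?f (\<omega>, u) * indicator {0..} u \<partial>lborel)"
      using likelihood_equation[OF \<omega> meas l[OF \<omega>] one[OF \<omega>] t] unfolding restrict by simp
  qed
  also have "\<dots> = 1 + Y + X"
    unfolding XT YJ using m1 m2 by (simp add: nn_integral_add emeasure_P)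
  finally have "(X + Y) + (\<integral>\<^sup>+\<omega>. ennreal (likelihood l t \<omega>) \<partial>P) = (X + Y) + 1"
    by (simp add: ac_simps)
  then show ?thesis using X Y by (auto simp: ennreal_add_left_cancel)
qed

text \<open>
  Truncated intensities have likelihoods of mean one, and Fatou's lemma passes the bound to the limit;
  mass may be lost there.
\<close>

lemma likelihood_mean_le:
  assumes meas: "case_prod l \<in> borel_measurable Pred"
    and l: "\<And>\<omega> u. \<omega> \<in> space P \<Longrightarrow> 0 \<le> u \<Longrightarrow> 0 < l \<omega> u" and t: "0 \<le> t"
    and int: "AE \<omega> in P. set_integrable lborel {0..t} (l \<omega>)"
  shows "(\<integral>\<^sup>+\<omega>. ennreal (likelihood l t \<omega>) \<partial>P) \<le> 1"
proof -
  define L where "L k \<omega> u = (if l \<omega> u \<le> real k \<and> (\<omega>, u) \<in> before_jump k then l \<omega> u else 1)" for k \<omega> u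
  have [measurable]: "(\<lambda>x. l (fst x) (snd x)) \<in> borel_measurable Pred"
    using meas by (simp add: case_prod_beta')
  have Lm: "case_prod (L k) \<in> borel_measurable Pred" for k
  proof -
    have "(\<lambda>x. if l (fst x) (snd x) \<le> real k \<and> x \<in> before_jump k then l (fst x) (snd x) else 1) \<in> borel_measurable Pred"
      by measurable
    then show ?thesis by (simp add: L_def case_prod_beta')
  qed
  have mean: "(\<integral>\<^sup>+\<omega>. ennreal (likelihood (L k) t \<omega>) \<partial>P) = 1" for k
    by (rule likelihood_mean_bounded[OF Lm, of k "max 1 (real k)" k])
      (use l t in \<open>auto simp: L_def\<close>)
  have conv: "AE \<omega> in P. (\<lambda>k. likelihood (L k) t \<omega>) \<longlonglongrightarrow> likelihood l t \<omega>"
    using int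
  proof (rule AE_mp, intro AE_I2 impI)
    fix \<omega> assume \<omega>: "\<omega> \<in> space P" and i: "set_integrable lborel {0..t} (l \<omega>)"
    have ev: "\<forall>\<^sub>F k in sequentially. L k \<omega> u = l \<omega> u" if u: "0 \<le> u" "u \<le> t" for u
    proof -
      obtain k0 :: nat where k0: "max (l \<omega> u) (N \<omega> t) < real k0" using reals_Archimedean2 by blast
      have "L k \<omega> u = l \<omega> u" if "k0 \<le> k" for k
      proof -
        have "max (l \<omega> u) (N \<omega> t) < real k" using k0 that by (meson less_le_trans of_nat_mono)
        then show ?thesis using before_jump_after_time[OF \<omega> t _ u, of k] by (simp add: L_def)
      qed
      then show ?thesis by (auto simp: eventually_sequentially)
    qed
    have p: "(\<lambda>k. \<Prod>n<nat \<lfloor>N \<omega> t\<rfloor>. L k \<omega> (T (Suc n) \<omega>)) \<longlonglongrightarrow> (\<Prod>n<nat \<lfloor>N \<omega> t\<rfloor>. l \<omega> (T (Suc n) \<omega>))"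
    proof (rule tendsto_prod)
      fix n assume "n \<in> {..<nat \<lfloor>N \<omega> t\<rfloor>}"
      then have "T (Suc n) \<omega> \<le> t" using jumps_until[OF \<omega> t, of n] by simp
      then show "(\<lambda>k. L k \<omega> (T (Suc n) \<omega>)) \<longlonglongrightarrow> l \<omega> (T (Suc n) \<omega>)"
        by (intro tendsto_eventually ev jump_time_nonneg)
    qed
    have "(\<lambda>k. LINT u:{0..t}|lborel. 1 - L k \<omega> u) \<longlonglongrightarrow> (LINT u:{0..t}|lborel. 1 - l \<omega> u)"
      unfolding set_lebesgue_integral_def
    proof (rule integral_dominated_convergence[where w="\<lambda>u. \<bar>indicator {0..t} u *\<^sub>R (1 - l \<omega> u)\<bar>"])
      have "set_integrable lborel {0..t} (\<lambda>u. 1 - l \<omega> u)"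
        by (intro set_integral_diff(1) i bounded_set_integrable[of _ _ 0 t 1]) auto
      then show 1: "integrable lborel (\<lambda>u. \<bar>indicator {0..t} u *\<^sub>R (1 - l \<omega> u)\<bar>)"
        "(\<lambda>u. indicator {0..t} u *\<^sub>R (1 - l \<omega> u)) \<in> borel_measurable lborel"
        unfolding set_integrable_def by auto
      show "(\<lambda>u. indicator {0..t} u *\<^sub>R (1 - L k \<omega> u)) \<in> borel_measurable lborel" for k
      proof -
        have "case_prod (\<lambda>\<omega> u. 1 - L k \<omega> u) \<in> borel_measurable Pred"
          using Lm[of k] by (simp add: case_prod_beta')
        from measurable_restricted_path[OF this \<omega>, of "{0..t}"] show ?thesis by simp
      qed
      show "AE u in lborel. (\<lambda>k. indicator {0..t} u *\<^sub>R (1 - L k \<omega> u)) \<longlonglongrightarrow> indicator {0..t} u *\<^sub>R (1 - l \<omega> u)"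
      proof (rule AE_I2)
        fix u
        show "(\<lambda>k. indicator {0..t} u *\<^sub>R (1 - L k \<omega> u)) \<longlonglongrightarrow> indicator {0..t} u *\<^sub>R (1 - l \<omega> u)"
        proof (cases "u \<in> {0..t}")
          case True
          then have "(\<lambda>k. L k \<omega> u) \<longlonglongrightarrow> l \<omega> u" by (intro tendsto_eventually ev) auto
          then show ?thesis by (intro tendsto_intros)
        qed simp
      qed
      show "AE u in lborel. norm (indicator {0..t} u *\<^sub>R (1 - L k \<omega> u)) \<le> \<bar>indicator {0..t} u *\<^sub>R (1 - l \<omega> u)\<bar>" for k
        by (intro AE_I2) (auto simp: L_def split: split_indicator)
    qed
    with p show "(\<lambda>k. likelihood (L k) t \<omega>) \<longlonglongrightarrow> likelihood l t \<omega>"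
      unfolding likelihood_def by (intro tendsto_mult tendsto_exp)
  qed
  have m: "likelihood (L k) t \<in> borel_measurable P" for k
    by (rule measurable_from_G[OF t measurable_likelihood[OF Lm t]])
  have "(\<integral>\<^sup>+\<omega>. ennreal (likelihood l t \<omega>) \<partial>P) = (\<integral>\<^sup>+\<omega>. liminf (\<lambda>k. ennreal (likelihood (L k) t \<omega>)) \<partial>P)"
  proof (rule nn_integral_cong_AE)
    show "AE \<omega> in P. ennreal (likelihood l t \<omega>) = liminf (\<lambda>k. ennreal (likelihood (L k) t \<omega>))"
      using conv
    proof eventually_elim
      case (elim \<omega>)
      then have "(\<lambda>k. ennreal (likelihood (L k) t \<omega>)) \<longlonglongrightarrow> ennreal (likelihood l t \<omega>)"
        by (rule tendsto_ennrealI)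
      then show ?case by (intro lim_imp_Liminf[symmetric]) auto
    qed
  qed
  also have "\<dots> \<le> liminf (\<lambda>k. \<integral>\<^sup>+\<omega>. ennreal (likelihood (L k) t \<omega>) \<partial>P)"
    by (rule nn_integral_liminf) (use m in measurable)
  also have "\<dots> = 1" unfolding mean by (simp add: Liminf_const)
  finally show ?thesis .
qed

text \<open>
  Switching the intensity on only after time \<open>s\<close> and only on an event \<open>A\<close> of the past of \<open>s\<close> turns
  the bound on the mean into one on conditional means.
\<close>

lemma likelihood_ratio_le:
  assumes meas: "case_prod l \<in> borel_measurable Pred"
    and l: "\<And>\<omega> u. \<omega> \<in> space P \<Longrightarrow> 0 \<le> u \<Longrightarrow> 0 < l \<omega> u" and s: "0 \<le> s" "s \<le> t"
    and int: "AE \<omega> in P. set_integrable lborel {0..t} (l \<omega>)" and A: "A \<in> sets (G s)"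
  shows "(\<integral>\<^sup>+\<omega>. ennreal (likelihood l t \<omega> / likelihood l s \<omega>) * indicator A \<omega> \<partial>P) \<le> emeasure P A"
proof -
  have t: "0 \<le> t" using s by simp
  have A_P: "A \<in> sets P" by (rule sets_G_subset[OF s(1) A])
  define k where "k \<omega> u = (if (\<omega>, u) \<in> A \<times> {s<..} then l \<omega> u else 1)" for \<omega> u
  have [measurable]: "(\<lambda>x. l (fst x) (snd x)) \<in> borel_measurable Pred"
    using meas by (simp add: case_prod_beta')
  have [measurable]: "A \<times> {s<..} \<in> sets Pred" by (rule sets_Pred_Ici[OF s(1) A])
  have "(\<lambda>x. if x \<in> A \<times> {s<..} then l (fst x) (snd x) else 1) \<in> borel_measurable Pred" by measurable
  then have km: "case_prod k \<in> borel_measurable Pred" by (simp add: k_def case_prod_beta')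
  have lm: "likelihood l u \<in> borel_measurable P" if "0 \<le> u" for u
    by (rule measurable_from_G[OF that measurable_likelihood[OF meas that]])
  have k_int: "AE \<omega> in P. set_integrable lborel {0..t} (k \<omega>)"
    using int
  proof (rule AE_mp, intro AE_I2 impI)
    fix \<omega> assume \<omega>: "\<omega> \<in> space P" and i: "set_integrable lborel {0..t} (l \<omega>)"
    have 1: "set_integrable lborel {0..t} (\<lambda>u. 1 + \<bar>l \<omega> u\<bar>)"
      by (intro set_integral_add(1) bounded_set_integrable[of _ _ 0 t 1] set_integrable_abs i) auto
    show "set_integrable lborel {0..t} (k \<omega>)"
      unfolding set_integrable_def
    proof (rule Bochner_Integration.integrable_bound[OF 1[unfolded set_integrable_def]])
      show "(\<lambda>u. indicator {0..t} u *\<^sub>R k \<omega> u) \<in> borel_measurable lborel"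
        using measurable_restricted_path[OF km \<omega>, of "{0..t}"] by simp
    qed (auto simp: k_def split: split_indicator)
  qed
  \<comment> \<open>\<open>k\<close> has likelihood \<open>1\<close> off \<open>A\<close>, and on \<open>A\<close> only the factors after time \<open>s\<close> remain.\<close>
  have kl: "AE \<omega> in P. ennreal (likelihood k t \<omega>) =
     indicator (space P - A) \<omega> + ennreal (likelihood l t \<omega> / likelihood l s \<omega>) * indicator A \<omega>"
    using int
  proof (rule AE_mp, intro AE_I2 impI)
    fix \<omega> assume \<omega>: "\<omega> \<in> space P" and i: "set_integrable lborel {0..t} (l \<omega>)"
    let ?n = "\<lambda>u. nat \<lfloor>N \<omega> u\<rfloor>"
    show "ennreal (likelihood k t \<omega>) =
       indicator (space P - A) \<omega> + ennreal (likelihood l t \<omega> / likelihood l s \<omega>) * indicator A \<omega>"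
    proof (cases "\<omega> \<in> A")
      case False
      then have "k \<omega> = (\<lambda>u. 1)" by (auto simp: k_def)
      then show ?thesis using False \<omega> by (simp add: likelihood_def)
    next
      case True
      have i': "set_integrable lborel {0..t} (\<lambda>u. 1 - l \<omega> u)"
        by (intro set_integral_diff(1) i bounded_set_integrable[of _ _ 0 t 1]) auto
      have "(LINT u:{0..t}|lborel. 1 - k \<omega> u) = (LINT u:{s<..t}|lborel. 1 - l \<omega> u)"
        unfolding set_lebesgue_integral_def
        by (intro Bochner_Integration.integral_cong) (use True s in \<open>auto simp: k_def split: split_indicator\<close>)
      also have "\<dots> = (LINT u:{0..t}|lborel. 1 - l \<omega> u) - (LINT u:{0..s}|lborel. 1 - l \<omega> u)"
        by (rule set_integral_difference[OF i' s, symmetric])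
      finally have 1: "exp (LINT u:{0..t}|lborel. 1 - k \<omega> u) =
        exp (LINT u:{0..t}|lborel. 1 - l \<omega> u) / exp (LINT u:{0..s}|lborel. 1 - l \<omega> u)"
        by (simp add: exp_diff)
      have ns: "?n s \<le> ?n t" using N_mono[OF \<omega> s] by (intro nat_mono floor_mono)
      have before: "n < ?n s \<longleftrightarrow> T (Suc n) \<omega> \<le> s" if "n < ?n t" for n
        using jumps_until[OF \<omega> s(1), of n] jumps_until[OF \<omega> t, of n] that by blast
      have "(\<Prod>n<?n t. k \<omega> (T (Suc n) \<omega>)) * (\<Prod>n<?n s. l \<omega> (T (Suc n) \<omega>)) =
        (\<Prod>n<?n t. k \<omega> (T (Suc n) \<omega>)) * (\<Prod>n<?n t. if n < ?n s then l \<omega> (T (Suc n) \<omega>) else 1)"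
      proof -
        have "(\<Prod>n<?n t. if n < ?n s then l \<omega> (T (Suc n) \<omega>) else 1) = (\<Prod>n\<in>{..<?n t} \<inter> {n. n < ?n s}. l \<omega> (T (Suc n) \<omega>))"
          by (simp add: prod.inter_restrict)
        also have "{..<?n t} \<inter> {n. n < ?n s} = {..<?n s}" using ns by auto
        finally show ?thesis by simp
      qed
      also have "\<dots> = (\<Prod>n<?n t. l \<omega> (T (Suc n) \<omega>))"
        unfolding prod.distrib[symmetric] by (intro prod.cong) (use True before in \<open>auto simp: k_def\<close>)
      finally have "(\<Prod>n<?n t. k \<omega> (T (Suc n) \<omega>)) = (\<Prod>n<?n t. l \<omega> (T (Suc n) \<omega>)) / (\<Prod>n<?n s. l \<omega> (T (Suc n) \<omega>))"
        using l[OF \<omega> jump_time_nonneg] by (subst eq_divide_eq) (auto simp: less_imp_neq[symmetric])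
      with 1 show ?thesis using True by (simp add: likelihood_def)
    qed
  qed
  have "emeasure P (space P - A) + (\<integral>\<^sup>+\<omega>. ennreal (likelihood l t \<omega> / likelihood l s \<omega>) * indicator A \<omega> \<partial>P) =
    (\<integral>\<^sup>+\<omega>. ennreal (likelihood k t \<omega>) \<partial>P)"
  proof -
    have [measurable]: "likelihood l s \<in> borel_measurable P" "likelihood l t \<in> borel_measurable P"
      using lm s t by auto
    note [measurable] = A_P
    show ?thesis
      unfolding nn_integral_cong_AE[OF kl] by (subst nn_integral_add) auto
  qed
  also have "\<dots> \<le> 1"
    by (rule likelihood_mean_le[OF km _ t k_int]) (auto simp: k_def l)
  also have "1 = emeasure P (space P - A) + emeasure P A"
    using emeasure_compl[OF A_P] emeasure_P R.emeasure_finite[of A] sets.sets_into_space[OF A_P]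
      emeasure_mono[of A "space P" P] by (simp add: diff_add_cancel_ennreal)
  finally show ?thesis
    using R.emeasure_finite[of "space P - A"] by (simp add: ennreal_add_left_cancel_le)
qed

text \<open>
  The likelihood at time \<open>s\<close> is known at time \<open>s\<close>, so it can be multiplied into the bound for the ratio.
\<close>

lemma likelihood_supermartingale:
  assumes meas: "case_prod l \<in> borel_measurable Pred"
    and l: "\<And>\<omega> u. \<omega> \<in> space P \<Longrightarrow> 0 \<le> u \<Longrightarrow> 0 < l \<omega> u" and s: "0 \<le> s" "s \<le> t"
    and int: "AE \<omega> in P. set_integrable lborel {0..t} (l \<omega>)" and A: "A \<in> sets (G s)"
  shows "(\<integral>\<^sup>+\<omega>. ennreal (likelihood l t \<omega>) * indicator A \<omega> \<partial>P) \<le>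
    (\<integral>\<^sup>+\<omega>. ennreal (likelihood l s \<omega>) * indicator A \<omega> \<partial>P)"
proof -
  have t: "0 \<le> t" using s by simp
  let ?r = "\<lambda>\<omega>. ennreal (likelihood l t \<omega> / likelihood l s \<omega>)"
  have [measurable]: "likelihood l s \<in> borel_measurable P" "likelihood l t \<in> borel_measurable P"
    using measurable_from_G[OF _ measurable_likelihood[OF meas]] s t by auto
  have ratio: "(\<integral>\<^sup>+\<omega>. f \<omega> * ?r \<omega> \<partial>P) \<le> (\<integral>\<^sup>+\<omega>. f \<omega> \<partial>P)" if "f \<in> borel_measurable (G s)" for f
    using that
  proof (induction rule: borel_measurable_induct)
    case (cong f g)
    then have "\<And>\<omega>. \<omega> \<in> space P \<Longrightarrow> f \<omega> = g \<omega>" using s by simp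
    with cong(4) show ?case by (simp cong: nn_integral_cong)
  next
    case (set B)
    then show ?case
      using likelihood_ratio_le[OF meas l s int set] sets_G_subset[OF s(1) set] by (simp add: mult.commute)
  next
    case (mult f c)
    have [measurable]: "f \<in> borel_measurable P" by (rule measurable_from_G[OF s(1) mult(2)])
    show ?case
      using mult_left_mono[OF mult(4), of c] by (simp add: nn_integral_cmult mult.assoc)
  next
    case (add f g)
    have [measurable]: "f \<in> borel_measurable P" "g \<in> borel_measurable P"
      by (rule measurable_from_G[OF s(1)], fact)+
    show ?case
      using add_mono[OF add.IH(2) add.IH(1)] by (simp add: nn_integral_add distrib_right)
  next
    case (seq U)
    have [measurable]: "U i \<in> borel_measurable P" for i by (rule measurable_from_G[OF s(1) seq(1)])
    have "(\<integral>\<^sup>+\<omega>. (SUP i. U i) \<omega> * ?r \<omega> \<partial>P) = (\<integral>\<^sup>+\<omega>. (SUP i. U i \<omega> * ?r \<omega>) \<partial>P)"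
      by (intro nn_integral_cong) (simp add: SUP_mult_right_ennreal image_comp)
    also have "\<dots> = (SUP i. \<integral>\<^sup>+\<omega>. U i \<omega> * ?r \<omega> \<partial>P)"
      by (rule nn_integral_monotone_convergence_SUP)
        (use seq(3) in \<open>auto simp: incseq_def le_fun_def intro: mult_right_mono\<close>)
    also have "\<dots> \<le> (SUP i. \<integral>\<^sup>+\<omega>. U i \<omega> \<partial>P)" by (intro SUP_mono') (rule seq.IH)
    also have "\<dots> = (\<integral>\<^sup>+\<omega>. (SUP i. U i \<omega>) \<partial>P)"
      by (rule nn_integral_monotone_convergence_SUP[symmetric]) (use seq(3) in auto)
    finally show ?case by (simp add: image_comp)
  qed
  have [measurable]: "A \<in> sets (G s)" "likelihood l s \<in> borel_measurable (G s)"
    using A measurable_likelihood[OF meas s(1)] by auto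
  have "(\<integral>\<^sup>+\<omega>. ennreal (likelihood l t \<omega>) * indicator A \<omega> \<partial>P) =
    (\<integral>\<^sup>+\<omega>. (ennreal (likelihood l s \<omega>) * indicator A \<omega>) * ?r \<omega> \<partial>P)"
  proof (rule nn_integral_cong)
    fix \<omega> assume \<omega>: "\<omega> \<in> space P"
    have "0 < likelihood l s \<omega>" "0 < likelihood l t \<omega>" using likelihood_pos[where l=l and \<omega>=\<omega>, OF l[OF \<omega>]] by auto
    then have "ennreal (likelihood l t \<omega>) = ennreal (likelihood l s \<omega>) * ?r \<omega>"
      by (simp add: ennreal_mult[symmetric])
    then show "ennreal (likelihood l t \<omega>) * indicator A \<omega> = (ennreal (likelihood l s \<omega>) * indicator A \<omega>) * ?r \<omega>"
      by (simp add: ac_simps)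
  qed
  also have "\<dots> \<le> (\<integral>\<^sup>+\<omega>. ennreal (likelihood l s \<omega>) * indicator A \<omega> \<partial>P)"
    by (rule ratio) measurable
  finally show ?thesis .
qed

end

section \<open>Change of measure by a predictable intensity\<close>

lemma DERIV_ln_minimum:
  fixes B C :: real
  assumes "\<And>\<epsilon>. \<bar>\<epsilon>\<bar> < 1 \<Longrightarrow> ln (1 + \<epsilon>) * C \<le> \<epsilon> * B"
  shows "C = B"
proof -
  have "((\<lambda>\<epsilon>. \<epsilon> * B - ln (1 + \<epsilon>) * C) has_real_derivative (B - C)) (at 0)"
    by (auto intro!: derivative_eq_intros)
  moreover have "\<forall>\<epsilon>. \<bar>0 - \<epsilon>\<bar> < 1 \<longrightarrow> 0 * B - ln (1 + 0) * C \<le> \<epsilon> * B - ln (1 + \<epsilon>) * C"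
    using assms by simp
  ultimately have "B - C = 0" using DERIV_local_min[of _ "B - C" 0 1] by auto
  then show ?thesis by simp
qed

text \<open>
  The upper bound on \<open>Q\<close> is what Fatou's lemma leaves of a density that is the lower limit of the
  likelihoods at integer times.
\<close>

locale likelihood_change = poisson_space P G N for P :: "'a measure" and G N +
  fixes l :: "'a \<Rightarrow> real \<Rightarrow> real" and Q :: "'a measure"
  assumes l_meas: "case_prod l \<in> borel_measurable Pred"
    and l_pos: "\<And>\<omega> u. \<omega> \<in> space P \<Longrightarrow> 0 \<le> u \<Longrightarrow> 0 < l \<omega> u"
    and l_int: "AE \<omega> in P. \<forall>t\<ge>0. set_integrable lborel {0..t} (l \<omega>)"
    and space_Q: "space Q = space P"
    and sets_Q: "\<And>t. 0 \<le> t \<Longrightarrow> sets (G t) \<subseteq> sets Q"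
    and emeasure_Q: "emeasure Q (space P) = 1"
    and Q_le: "\<And>A s. 0 \<le> s \<Longrightarrow> A \<in> sets (G s) \<Longrightarrow>
      emeasure Q A \<le> liminf (\<lambda>n. \<integral>\<^sup>+\<omega>. ennreal (likelihood l (real n) \<omega>) * indicator A \<omega> \<partial>P)"
begin

sublocale Q: doleans P G N Q
proof -
  interpret Q: finite_measure Q by (rule finite_measureI) (simp add: space_Q emeasure_Q)
  show "doleans P G N Q" by unfold_locales (fact space_Q, fact sets_Q)
qed

lemma lm [measurable]: "(\<lambda>x. l (fst x) (snd x)) \<in> borel_measurable Pred"
  using l_meas by (simp add: case_prod_beta')

lemma l_int_upto: "AE \<omega> in P. set_integrable lborel {0..t} (l \<omega>)" if "0 \<le> t"
  using l_int by eventually_elim (use that in auto)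

lemma emeasure_Q_le:
  assumes s: "0 \<le> s" and A: "A \<in> sets (G s)"
  shows "emeasure Q A \<le> (\<integral>\<^sup>+\<omega>. ennreal (likelihood l s \<omega>) * indicator A \<omega> \<partial>P)"
proof (rule order_trans[OF Q_le[OF s A]], rule Liminf_le)
  obtain k :: nat where k: "s \<le> real k" using real_arch_simple by blast
  show "\<forall>\<^sub>F n in sequentially. (\<integral>\<^sup>+\<omega>. ennreal (likelihood l (real n) \<omega>) * indicator A \<omega> \<partial>P) \<le>
      (\<integral>\<^sup>+\<omega>. ennreal (likelihood l s \<omega>) * indicator A \<omega> \<partial>P)"
    using eventually_ge_at_top[of k]
  proof eventually_elim
    case (elim n)
    then have "real k \<le> real n" by simp
    with k have "s \<le> real n" by linarith
    then show ?case
      by (intro likelihood_supermartingale[OF l_meas l_pos s _ l_int_upto A]) auto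
  qed
qed simp

text \<open>
  The likelihood has mean at most one and the total mass of \<open>Q\<close> is one, so no mass is lost and
  the inequality is an equality.
\<close>

lemma emeasure_Q_eq:
  assumes s: "0 \<le> s" and A: "A \<in> sets (G s)"
  shows "emeasure Q A = (\<integral>\<^sup>+\<omega>. ennreal (likelihood l s \<omega>) * indicator A \<omega> \<partial>P)"
proof -
  let ?x = "\<lambda>A. \<integral>\<^sup>+\<omega>. ennreal (likelihood l s \<omega>) * indicator A \<omega> \<partial>P"
  have [measurable]: "likelihood l s \<in> borel_measurable P"
    by (rule measurable_from_G[OF s measurable_likelihood[OF l_meas s]])
  have A': "space P - A \<in> sets (G s)" using sets.compl_sets[OF A] s by simp
  have [measurable]: "A \<in> sets P" "space P - A \<in> sets P" using A A' sets_G_subset[OF s] by auto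
  have AP: "A \<subseteq> space P" using sets.sets_into_space[OF A] s by simp
  have "?x A + ?x (space P - A) = (\<integral>\<^sup>+\<omega>. ennreal (likelihood l s \<omega>) \<partial>P)"
    by (subst nn_integral_add[symmetric]) (auto intro!: nn_integral_cong split: split_indicator)
  also have "\<dots> \<le> 1"
    by (rule likelihood_mean_le[OF l_meas l_pos s l_int_upto[OF s]])
  also have "1 = emeasure Q A + emeasure Q (space P - A)"
  proof -
    have AQ: "A \<in> sets Q" "space P - A \<in> sets Q" using sets_Q[OF s] A A' by auto
    have "emeasure Q A + emeasure Q (space P - A) = emeasure Q (A \<union> (space P - A))"
      by (rule plus_emeasure) (use AQ in auto)
    also have "A \<union> (space P - A) = space P" using AP by auto
    finally show ?thesis using emeasure_Q by simp
  qed
  also have "\<dots> \<le> emeasure Q A + ?x (space P - A)"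
    by (intro add_left_mono emeasure_Q_le[OF s A'])
  finally have *: "?x (space P - A) + ?x A \<le> ?x (space P - A) + emeasure Q A"
    by (simp add: add.commute)
  have "?x (space P - A) \<le> (\<integral>\<^sup>+\<omega>. ennreal (likelihood l s \<omega>) \<partial>P)"
    by (intro nn_integral_mono) (auto split: split_indicator)
  also have "\<dots> \<le> 1" by (rule likelihood_mean_le[OF l_meas l_pos s l_int_upto[OF s]])
  finally have "?x (space P - A) < top" by (simp add: le_less_trans)
  with * have "?x A \<le> emeasure Q A" by (auto simp: ennreal_add_left_cancel_le)
  with emeasure_Q_le[OF s A] show ?thesis by (rule antisym)
qed

lemma nn_integral_Q:
  assumes s: "0 \<le> s" and f: "f \<in> borel_measurable (G s)"
  shows "(\<integral>\<^sup>+\<omega>. f \<omega> \<partial>Q) = (\<integral>\<^sup>+\<omega>. ennreal (likelihood l s \<omega>) * f \<omega> \<partial>P)"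
proof -
  note [measurable] = f
  have [measurable]: "likelihood l s \<in> borel_measurable (G s)" by (rule measurable_likelihood[OF l_meas s])
  have Lm: "(\<lambda>\<omega>. ennreal (likelihood l s \<omega>)) \<in> borel_measurable (G s)" by measurable
  have restr: "restr_to_subalg Q (G s) = density (restr_to_subalg P (G s)) (\<lambda>\<omega>. ennreal (likelihood l s \<omega>))"
  proof (rule measure_eqI)
    fix A assume "A \<in> sets (restr_to_subalg Q (G s))"
    then have A [measurable]: "A \<in> sets (G s)" by (simp only: sets_restr_to_subalg[OF Q.subalgebra_R[OF s]])
    have A': "A \<in> sets (restr_to_subalg P (G s))" using A by (simp only: sets_restr_to_subalg[OF subalgebra_R[OF s]])
    have "emeasure (density (restr_to_subalg P (G s)) (\<lambda>\<omega>. ennreal (likelihood l s \<omega>))) A =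
      (\<integral>\<^sup>+\<omega>. ennreal (likelihood l s \<omega>) * indicator A \<omega> \<partial>restr_to_subalg P (G s))"
      by (rule emeasure_density[OF measurable_in_subalg[OF subalgebra_R[OF s] Lm] A'])
    also have "\<dots> = emeasure Q A"
      unfolding emeasure_Q_eq[OF s A]
      by (rule nn_integral_subalgebra2[OF subalgebra_R[OF s]]) measurable
    finally show "emeasure (restr_to_subalg Q (G s)) A =
      emeasure (density (restr_to_subalg P (G s)) (\<lambda>\<omega>. ennreal (likelihood l s \<omega>))) A"
      unfolding emeasure_restr_to_subalg[OF Q.subalgebra_R[OF s] A] by (rule sym)
  qed (simp only: sets_density sets_restr_to_subalg[OF Q.subalgebra_R[OF s]] sets_restr_to_subalg[OF subalgebra_R[OF s]])
  have "(\<integral>\<^sup>+\<omega>. f \<omega> \<partial>Q) = (\<integral>\<^sup>+\<omega>. f \<omega> \<partial>restr_to_subalg Q (G s))"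
    by (rule nn_integral_subalgebra2[OF Q.subalgebra_R[OF s] f, symmetric])
  also have "\<dots> = (\<integral>\<^sup>+\<omega>. f \<omega> \<partial>density (restr_to_subalg P (G s)) (\<lambda>\<omega>. ennreal (likelihood l s \<omega>)))"
    unfolding restr ..
  also have "\<dots> = (\<integral>\<^sup>+\<omega>. ennreal (likelihood l s \<omega>) * f \<omega> \<partial>restr_to_subalg P (G s))"
    using measurable_in_subalg[OF subalgebra_R[OF s] Lm] measurable_in_subalg[OF subalgebra_R[OF s] f]
    by (intro nn_integral_density)
  also have "\<dots> = (\<integral>\<^sup>+\<omega>. ennreal (likelihood l s \<omega>) * f \<omega> \<partial>P)"
    by (rule nn_integral_subalgebra2[OF subalgebra_R[OF s]]) measurable
  finally show ?thesis .
qed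

lemma null_Q_iff_null_P:
  assumes s: "0 \<le> s" and A: "A \<in> sets (G s)"
  shows "emeasure Q A = 0 \<longleftrightarrow> emeasure P A = 0"
proof -
  have [measurable]: "likelihood l s \<in> borel_measurable P"
    by (rule measurable_from_G[OF s measurable_likelihood[OF l_meas s]])
  have AP [measurable]: "A \<in> sets P" by (rule sets_G_subset[OF s A])
  have "emeasure Q A = 0 \<longleftrightarrow> (AE \<omega> in P. ennreal (likelihood l s \<omega>) * indicator A \<omega> = 0)"
    unfolding emeasure_Q_eq[OF s A] by (rule nn_integral_0_iff_AE) measurable
  also have "\<dots> \<longleftrightarrow> (AE \<omega> in P. \<omega> \<notin> A)"
  proof (rule AE_cong)
    fix \<omega> assume \<omega>: "\<omega> \<in> space P"
    have "0 < likelihood l s \<omega>" by (rule likelihood_pos) (rule l_pos[OF \<omega>])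
    then show "ennreal (likelihood l s \<omega>) * indicator A \<omega> = 0 \<longleftrightarrow> \<omega> \<notin> A"
      by (auto split: split_indicator)
  qed
  also have "\<dots> \<longleftrightarrow> emeasure P A = 0"
    using AP by (simp add: AE_iff_null_sets[OF AP, symmetric] null_sets_def)
  finally show ?thesis .
qed

text \<open>
  The likelihoods are positive, so \<open>P\<close> and \<open>Q\<close> have the same null sets in the past of any finite time, and
  nullity of a section is decided by the countably many events that it is null up to time \<open>n\<close>.  The two
  measures need not have the same null sets in the past of infinity.
\<close>

lemma AE_null_sections_iff:
  assumes D: "D \<in> sets Pred"
  shows "(AE \<omega> in Q. AE u in lborel. 0 \<le> u \<longrightarrow> (\<omega>, u) \<notin> D) \<longleftrightarrow>
    (AE \<omega> in P. AE u in lborel. 0 \<le> u \<longrightarrow> (\<omega>, u) \<notin> D)"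
proof -
  let ?I = "\<lambda>t \<omega>. \<integral>\<^sup>+v. indicator D (\<omega>, v) * indicator {0..t} v \<partial>lborel :: ennreal"
  define A where "A n = {\<omega> \<in> space P. ?I (real n) \<omega> \<noteq> 0}" for n :: nat
  have Im: "?I t \<in> borel_measurable (G t)" if "0 \<le> t" for t
    using measurable_compose[OF measurable_Pred_at[OF that] measurable_running_nn_integral[of "indicator D"]] D by simp
  have A_G: "A n \<in> sets (G (real n))" for n
  proof -
    have [measurable]: "?I (real n) \<in> borel_measurable (G (real n))" by (rule Im) simp
    have "{\<omega> \<in> space (G (real n)). ?I (real n) \<omega> \<noteq> 0} \<in> sets (G (real n))" by measurable
    then show ?thesis by (simp add: A_def)
  qed
  have iff: "(AE u in lborel. 0 \<le> u \<longrightarrow> (\<omega>, u) \<notin> D) \<longleftrightarrow> (\<forall>n. \<omega> \<notin> A n)" if \<omega>: "\<omega> \<in> space P" for \<omega>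
  proof -
    have "?I (real n) \<omega> = 0 \<longleftrightarrow> (AE u in lborel. 0 \<le> u \<longrightarrow> u \<le> real n \<longrightarrow> (\<omega>, u) \<notin> D)" for n
    proof -
      have S: "D \<inter> {x \<in> space Pred. snd x \<le> real n} \<in> sets Pred" using D by measurable
      have "?I (real n) \<omega> = (\<integral>\<^sup>+u. indicator (D \<inter> {x \<in> space Pred. snd x \<le> real n}) (\<omega>, u) * indicator {0..} u \<partial>lborel)"
        by (intro nn_integral_cong) (use \<omega> in \<open>auto split: split_indicator\<close>)
      then have "?I (real n) \<omega> = 0 \<longleftrightarrow> (AE u in lborel. 0 \<le> u \<longrightarrow> (\<omega>, u) \<notin> D \<inter> {x \<in> space Pred. snd x \<le> real n})"
        using section_null_iff[OF \<omega> S] by simp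
      also have "\<dots> \<longleftrightarrow> (AE u in lborel. 0 \<le> u \<longrightarrow> u \<le> real n \<longrightarrow> (\<omega>, u) \<notin> D)"
        by (intro AE_cong) (use \<omega> in auto)
      finally show ?thesis .
    qed
    then have "(\<forall>n. \<omega> \<notin> A n) \<longleftrightarrow> (\<forall>n. AE u in lborel. 0 \<le> u \<longrightarrow> u \<le> real n \<longrightarrow> (\<omega>, u) \<notin> D)"
      using \<omega> by (simp add: A_def)
    also have "\<dots> \<longleftrightarrow> (AE u in lborel. \<forall>n. 0 \<le> u \<longrightarrow> u \<le> real n \<longrightarrow> (\<omega>, u) \<notin> D)"
      by (rule AE_all_countable[symmetric])
    also have "\<dots> \<longleftrightarrow> (AE u in lborel. 0 \<le> u \<longrightarrow> (\<omega>, u) \<notin> D)"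
      by (intro AE_cong) (use real_arch_simple in blast)
    finally show ?thesis by simp
  qed
  have "(AE \<omega> in Q. \<omega> \<notin> A n) \<longleftrightarrow> (AE \<omega> in P. \<omega> \<notin> A n)" for n
  proof -
    have AQ: "A n \<in> sets Q" and AP: "A n \<in> sets P"
      using sets_Q[OF of_nat_0_le_iff[of n]] sets_G_subset[OF of_nat_0_le_iff A_G[of n]] A_G[of n] by blast+
    have "A n \<in> null_sets Q \<longleftrightarrow> A n \<in> null_sets P"
      using null_Q_iff_null_P[OF of_nat_0_le_iff A_G[of n]] AQ AP by (blast intro: null_setsI dest: null_setsD1)
    then show ?thesis
      unfolding AE_iff_null_sets[OF AQ] AE_iff_null_sets[OF AP] .
  qed
  then have "(AE \<omega> in Q. \<forall>n. \<omega> \<notin> A n) \<longleftrightarrow> (AE \<omega> in P. \<forall>n. \<omega> \<notin> A n)"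
    unfolding AE_all_countable by blast
  moreover have "(AE \<omega> in Q. \<forall>n. \<omega> \<notin> A n) \<longleftrightarrow> (AE \<omega> in Q. AE u in lborel. 0 \<le> u \<longrightarrow> (\<omega>, u) \<notin> D)"
    by (rule AE_cong) (use iff space_Q in blast)
  moreover have "(AE \<omega> in P. \<forall>n. \<omega> \<notin> A n) \<longleftrightarrow> (AE \<omega> in P. AE u in lborel. 0 \<le> u \<longrightarrow> (\<omega>, u) \<notin> D)"
    by (rule AE_cong) (use iff in blast)
  ultimately show ?thesis by blast
qed

lemma l_int_Q: "AE \<omega> in Q. \<forall>n. set_integrable lborel {0..real n} (l \<omega>)"
proof -
  let ?I = "\<lambda>t \<omega>. \<integral>\<^sup>+v. ennreal \<bar>l \<omega> v\<bar> * indicator {0..t} v \<partial>lborel"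
  define A where "A n = {\<omega> \<in> space P. ?I (real n) \<omega> = \<infinity>}" for n :: nat
  have "(\<lambda>x. ennreal \<bar>l (fst x) (snd x)\<bar>) \<in> borel_measurable Pred" by measurable
  note am = measurable_running_nn_integral[OF this]
  have Im: "?I t \<in> borel_measurable (G t)" if "0 \<le> t" for t
    using measurable_compose[OF measurable_Pred_at[OF that] am] by simp
  have A_G: "A n \<in> sets (G (real n))" for n
  proof -
    have [measurable]: "?I (real n) \<in> borel_measurable (G (real n))" by (rule Im) simp
    have "{\<omega> \<in> space (G (real n)). ?I (real n) \<omega> = \<infinity>} \<in> sets (G (real n))" by measurable
    then show ?thesis by (simp add: A_def)
  qed
  have iff: "set_integrable lborel {0..real n} (l \<omega>) \<longleftrightarrow> \<omega> \<notin> A n" if \<omega>: "\<omega> \<in> space P" for \<omega> n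
    using set_integrable_path_iff[OF l_meas \<omega>, of "{0..real n}"] \<omega> by (auto simp: less_top A_def)
  have "AE \<omega> in Q. \<omega> \<notin> A n" for n
  proof -
    have "AE \<omega> in P. \<omega> \<notin> A n"
      using l_int_upto[OF of_nat_0_le_iff[of n]] AE_space[of P] by eventually_elim (use iff in auto)
    moreover have AQ: "A n \<in> sets Q" and AP: "A n \<in> sets P"
      using sets_Q[OF of_nat_0_le_iff[of n]] sets_G_subset[OF of_nat_0_le_iff A_G[of n]] A_G[of n] by blast+
    ultimately have "A n \<in> null_sets P" by (simp add: AE_iff_null_sets)
    then have "A n \<in> null_sets Q"
      using null_Q_iff_null_P[OF of_nat_0_le_iff A_G[of n]] AQ by (blast intro: null_setsI dest: null_setsD1)
    then show ?thesis using AQ by (simp add: AE_iff_null_sets)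
  qed
  then have "AE \<omega> in Q. \<forall>n. \<omega> \<notin> A n" unfolding AE_all_countable by blast
  with AE_space[of Q] show ?thesis
    by eventually_elim (use iff space_Q in auto)
qed

text \<open>
  Multiplying the intensity by \<open>1 + \<epsilon>\<close> on a predictable set \<open>D\<close> multiplies the likelihood by
  \<open>(1 + \<epsilon>)\<^sup>c exp (- \<epsilon> b)\<close>, where \<open>c\<close> is the number of jumps in \<open>D\<close> and \<open>b\<close> the integral
  of the intensity over \<open>D\<close>.  Its mean stays at most one for both signs of \<open>\<epsilon>\<close>, which to first order
  says that \<open>c\<close> and \<open>b\<close> have the same \<open>Q\<close>-mean.
\<close>

lemma jump_density_local:
  assumes D [measurable]: "D \<in> sets Pred"
    and D_le: "\<And>\<omega> u. (\<omega>, u) \<in> D \<Longrightarrow> u \<le> t \<and> (\<omega>, u) \<in> before_jump m \<and>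
      (\<integral>\<^sup>+v. ennreal (l \<omega> v) * indicator {0..u} v \<partial>lborel) \<le> ennreal (real m)" and t: "0 \<le> t"
  shows "emeasure Q.muN D = (\<integral>\<^sup>+x. ennreal (l (fst x) (snd x)) * indicator D x \<partial>Q.muL)"
proof -
  define cc where "cc \<omega> = jump_sum N (\<lambda>u. indicator D (\<omega>, u) * indicator {0..t} u) \<omega>" for \<omega>
  define bb where "bb \<omega> = (\<integral>\<^sup>+u. ennreal (l \<omega> u) * indicator D (\<omega>, u) * indicator {0..t} u \<partial>lborel)" for \<omega>
  have DP: "\<omega> \<in> space P" "0 \<le> u" "u \<le> t" if "(\<omega>, u) \<in> D" for \<omega> u
    using sets.sets_into_space[OF D] that D_le[OF that] by auto
  have ccG: "cc \<in> borel_measurable (G t)"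
    unfolding cc_def[abs_def] by (rule measurable_jump_sum_until[OF _ t]) simp
  have bbG: "bb \<in> borel_measurable (G t)"
  proof -
    have "(\<lambda>x. ennreal (l (fst x) (snd x)) * indicator D x) \<in> borel_measurable Pred" by measurable
    from measurable_compose[OF measurable_Pred_at[OF t] measurable_running_nn_integral[OF this]]
    show ?thesis by (simp add: bb_def[abs_def])
  qed
  have cc_le: "cc \<omega> \<le> ennreal (real m)" if \<omega>: "\<omega> \<in> space P" for \<omega>
  proof -
    have "cc \<omega> \<le> jump_sum N (\<lambda>u. indicator (before_jump m) (\<omega>, u)) \<omega>"
      unfolding cc_def jump_sum_def using D_le
      by (intro suminf_le) (auto split: split_indicator)
    also have "\<dots> \<le> of_nat m" by (rule jumps_before_jump[OF \<omega>])
    finally show ?thesis by (simp add: ennreal_of_nat_eq_real_of_nat)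
  qed
  have bb_le: "bb \<omega> \<le> ennreal (real m)" if \<omega>: "\<omega> \<in> space P" for \<omega>
    unfolding bb_def
    using running_integral_until_le[where a="\<lambda>x. ennreal (l (fst x) (snd x))" and E=D and c="ennreal (real m)" and t=t, OF _ \<omega>]
      D_le by simp
  let ?c = "\<lambda>\<omega>. enn2real (cc \<omega>)" and ?b = "\<lambda>\<omega>. enn2real (bb \<omega>)"
  have real: "ennreal (enn2real y) = y" "enn2real y \<le> real m" if "y \<le> ennreal (real m)" for y
    using that enn2real_mono[OF that] by (simp_all add: le_less_trans[OF that])
  have [measurable]: "cc \<in> borel_measurable Q" "bb \<in> borel_measurable Q"
    using Q.measurable_from_G[OF t ccG] Q.measurable_from_G[OF t bbG] by auto
  have ic: "integrable Q ?c" and ib: "integrable Q ?b"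
    by (rule Q.R.integrable_const_bound[where B="real m"];
        use cc_le bb_le real(2) in \<open>auto intro!: AE_I2 simp: space_Q\<close>)+
  have "ln (1 + \<epsilon>) * (LINT \<omega>|Q. ?c \<omega>) \<le> \<epsilon> * (LINT \<omega>|Q. ?b \<omega>)" if \<epsilon>: "\<bar>\<epsilon>\<bar> < 1" for \<epsilon>
  proof -
    define k where "k \<omega> u = l \<omega> u * (1 + \<epsilon> * indicator D (\<omega>, u))" for \<omega> u
    have "(\<lambda>x. l (fst x) (snd x) * (1 + \<epsilon> * indicator D x)) \<in> borel_measurable Pred" by measurable
    then have km: "case_prod k \<in> borel_measurable Pred" by (simp add: k_def case_prod_beta')
    have kpos: "0 < k \<omega> u" if "\<omega> \<in> space P" "0 \<le> u" for \<omega> u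
      using l_pos[OF that] \<epsilon> unfolding k_def by (intro mult_pos_pos) (auto split: split_indicator)
    have k_int: "AE \<omega> in P. set_integrable lborel {0..t} (k \<omega>)"
      using l_int_upto[OF t]
    proof (rule AE_mp, intro AE_I2 impI)
      fix \<omega> assume \<omega>: "\<omega> \<in> space P" and i: "set_integrable lborel {0..t} (l \<omega>)"
      have 1: "set_integrable lborel {0..t} (\<lambda>u. 2 * l \<omega> u)" using i by simp
      show "set_integrable lborel {0..t} (k \<omega>)"
        unfolding set_integrable_def
      proof (rule Bochner_Integration.integrable_bound[OF 1[unfolded set_integrable_def]])
        show "(\<lambda>u. indicator {0..t} u *\<^sub>R k \<omega> u) \<in> borel_measurable lborel"
          using measurable_restricted_path[OF km \<omega>, of "{0..t}"] by simp
        show "AE u in lborel. norm (indicator {0..t} u *\<^sub>R k \<omega> u) \<le> norm (indicator {0..t} u *\<^sub>R (2 * l \<omega> u))"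
        proof (rule AE_I2)
          fix u
          have "\<bar>1 + \<epsilon> * indicator D (\<omega>, u)\<bar> \<le> 2" using \<epsilon> by (auto split: split_indicator)
          from mult_left_mono[OF this abs_ge_zero[of "l \<omega> u"]]
          show "norm (indicator {0..t} u *\<^sub>R k \<omega> u) \<le> norm (indicator {0..t} u *\<^sub>R (2 * l \<omega> u))"
            by (auto simp: k_def abs_mult split: split_indicator)
        qed
      qed
    qed
    let ?Y = "\<lambda>\<omega>. exp (ln (1 + \<epsilon>) * ?c \<omega> - \<epsilon> * ?b \<omega>)"
    have YG: "(\<lambda>\<omega>. ennreal (?Y \<omega>)) \<in> borel_measurable (G t)" using ccG bbG by measurable
    have eq: "AE \<omega> in P. ennreal (likelihood l t \<omega>) * ennreal (?Y \<omega>) = ennreal (likelihood k t \<omega>)"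
      using l_int_upto[OF t]
    proof (rule AE_mp, intro AE_I2 impI)
      fix \<omega> assume \<omega>: "\<omega> \<in> space P" and i: "set_integrable lborel {0..t} (l \<omega>)"
      let ?n = "nat \<lfloor>N \<omega> t\<rfloor>"
      have Dm: "(\<lambda>u. indicator D (\<omega>, max 0 u) :: real) \<in> borel_measurable borel"
        by (rule measurable_compose[OF measurable_section[OF \<omega>] borel_measurable_indicator[OF D]])
      have iD: "set_integrable lborel {0..t} (\<lambda>u. l \<omega> u * indicator D (\<omega>, u))"
        unfolding set_integrable_def
      proof (rule Bochner_Integration.integrable_bound[OF i[unfolded set_integrable_def]])
        have "case_prod (\<lambda>\<omega> u. l \<omega> u * indicator D (\<omega>, u)) \<in> borel_measurable Pred"
          using lm by (simp add: case_prod_beta')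
        from measurable_restricted_path[OF this \<omega>, of "{0..t}"]
        show "(\<lambda>u. indicator {0..t} u *\<^sub>R (l \<omega> u * indicator D (\<omega>, u))) \<in> borel_measurable lborel" by simp
      qed (auto split: split_indicator)
      have b: "?b \<omega> = (LINT u:{0..t}|lborel. l \<omega> u * indicator D (\<omega>, u))"
      proof -
        have nn: "0 \<le> l \<omega> u * indicator D (\<omega>, u)" if "u \<in> {0..t}" for u
          using l_pos[OF \<omega>, of u] that by (auto split: split_indicator)
        have "bb \<omega> = (\<integral>\<^sup>+u. ennreal (l \<omega> u * indicator D (\<omega>, u)) * indicator {0..t} u \<partial>lborel)"
          unfolding bb_def by (intro nn_integral_cong) (auto split: split_indicator)
        also have "\<dots> = ennreal (LINT u:{0..t}|lborel. l \<omega> u * indicator D (\<omega>, u))"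
          by (rule nn_integral_path[where X="\<lambda>_ u. l \<omega> u * indicator D (\<omega>, u)", OF iD nn])
        finally have "?b \<omega> = enn2real (ennreal (LINT u:{0..t}|lborel. l \<omega> u * indicator D (\<omega>, u)))" by simp
        moreover have "0 \<le> (LINT u:{0..t}|lborel. l \<omega> u * indicator D (\<omega>, u))"
          unfolding set_lebesgue_integral_def
          by (intro Bochner_Integration.integral_nonneg) (use nn in \<open>simp split: split_indicator\<close>)
        ultimately show ?thesis by simp
      qed
      have c: "?c \<omega> = (\<Sum>n<?n. indicator D (\<omega>, T (Suc n) \<omega>))"
      proof -
        have "cc \<omega> = ennreal (\<Sum>n<?n. indicator D (\<omega>, T (Suc n) \<omega>))"
          unfolding cc_def jump_sum_until[OF \<omega> t]
          by (subst sum_ennreal[symmetric]) (auto simp: ennreal_indicator)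
        then show ?thesis by (simp add: sum_nonneg)
      qed
      have i1: "set_integrable lborel {0..t} (\<lambda>u. 1 - l \<omega> u)"
        by (intro set_integral_diff(1) i bounded_set_integrable[of _ _ 0 t 1]) auto
      have i2: "set_integrable lborel {0..t} (\<lambda>u. \<epsilon> * (l \<omega> u * indicator D (\<omega>, u)))"
        using iD by simp
      have "(LINT u:{0..t}|lborel. 1 - k \<omega> u) = (LINT u:{0..t}|lborel. (1 - l \<omega> u) - \<epsilon> * (l \<omega> u * indicator D (\<omega>, u)))"
        by (simp add: k_def algebra_simps)
      also have "\<dots> = (LINT u:{0..t}|lborel. 1 - l \<omega> u) - \<epsilon> * ?b \<omega>"
        unfolding set_integral_diff(2)[OF i1 i2] b by simp
      finally have 1: "exp (LINT u:{0..t}|lborel. 1 - k \<omega> u) = exp (LINT u:{0..t}|lborel. 1 - l \<omega> u) * exp (- \<epsilon> * ?b \<omega>)"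
        by (simp add: exp_add[symmetric])
      have "(\<Prod>n<?n. k \<omega> (T (Suc n) \<omega>)) =
        (\<Prod>n<?n. l \<omega> (T (Suc n) \<omega>)) * (\<Prod>n<?n. exp (ln (1 + \<epsilon>) * indicator D (\<omega>, T (Suc n) \<omega>)))"
        unfolding prod.distrib[symmetric] k_def using \<epsilon> by (intro prod.cong) (auto split: split_indicator)
      also have "(\<Prod>n<?n. exp (ln (1 + \<epsilon>) * indicator D (\<omega>, T (Suc n) \<omega>))) = exp (ln (1 + \<epsilon>) * ?c \<omega>)"
        unfolding c sum_distrib_left by (rule exp_sum[OF finite_lessThan, symmetric])
      finally have "likelihood k t \<omega> = likelihood l t \<omega> * ?Y \<omega>"
        unfolding likelihood_def 1 by (simp add: exp_add[symmetric] exp_diff exp_minus field_simps)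
      then show "ennreal (likelihood l t \<omega>) * ennreal (?Y \<omega>) = ennreal (likelihood k t \<omega>)"
        by (simp add: ennreal_mult'')
    qed
    have "(\<integral>\<^sup>+\<omega>. ennreal (?Y \<omega>) \<partial>Q) = (\<integral>\<^sup>+\<omega>. ennreal (likelihood k t \<omega>) \<partial>P)"
      unfolding nn_integral_Q[OF t YG] by (rule nn_integral_cong_AE[OF eq])
    also have "\<dots> \<le> 1" by (rule likelihood_mean_le[OF km kpos t k_int])
    finally have Y1: "(\<integral>\<^sup>+\<omega>. ennreal (?Y \<omega>) \<partial>Q) \<le> 1" .
    have iY: "integrable Q ?Y"
      using Y1 by (intro integrableI_nonneg) (auto simp: le_less_trans)
    have "(LINT \<omega>|Q. 1 + (ln (1 + \<epsilon>) * ?c \<omega> - \<epsilon> * ?b \<omega>)) \<le> (LINT \<omega>|Q. ?Y \<omega>)"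
      using ic ib iY by (intro integral_mono exp_ge_add_one_self) auto
    also have "\<dots> \<le> 1"
    proof -
      have "ennreal (LINT \<omega>|Q. ?Y \<omega>) = (\<integral>\<^sup>+\<omega>. ennreal (?Y \<omega>) \<partial>Q)"
        by (rule nn_integral_eq_integral[symmetric, OF iY]) auto
      with Y1 show ?thesis by (metis ennreal_1 ennreal_le_iff zero_le_one)
    qed
    finally show ?thesis
      using ic ib emeasure_Q space_Q by (simp add: measure_def)
  qed
  then have CB: "(LINT \<omega>|Q. ?c \<omega>) = (LINT \<omega>|Q. ?b \<omega>)" by (rule DERIV_ln_minimum)
  have "emeasure Q.muN D = (\<integral>\<^sup>+\<omega>. ennreal (?c \<omega>) \<partial>Q)"
    unfolding Q.emeasure_jump_measure[OF D]
  proof (rule nn_integral_cong)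
    fix \<omega> assume "\<omega> \<in> space Q"
    then have \<omega>: "\<omega> \<in> space P" by (simp add: space_Q)
    have "jump_sum N (\<lambda>u. indicator D (\<omega>, u)) \<omega> = cc \<omega>"
      unfolding cc_def by (intro jump_sum_cong) (use DP in \<open>auto split: split_indicator\<close>)
    then show "jump_sum N (\<lambda>u. indicator D (\<omega>, u)) \<omega> = ennreal (?c \<omega>)"
      using real(1)[OF cc_le[OF \<omega>]] by simp
  qed
  also have "\<dots> = ennreal (LINT \<omega>|Q. ?c \<omega>)" by (rule nn_integral_eq_integral[OF ic]) auto
  also have "\<dots> = (\<integral>\<^sup>+\<omega>. ennreal (?b \<omega>) \<partial>Q)"
    unfolding CB by (rule nn_integral_eq_integral[symmetric, OF ib]) auto
  also have "\<dots> = (\<integral>\<^sup>+x. ennreal (l (fst x) (snd x)) * indicator D x \<partial>Q.muL)"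
  proof -
    have H: "(\<lambda>x. ennreal (l (fst x) (snd x)) * indicator D x) \<in> borel_measurable Pred" by measurable
    show ?thesis
      unfolding Q.nn_integral_time_measure[OF H]
    proof (rule nn_integral_cong)
      fix \<omega> assume "\<omega> \<in> space Q"
      then have \<omega>: "\<omega> \<in> space P" by (simp add: space_Q)
      have "bb \<omega> = (\<integral>\<^sup>+u. ennreal (l (fst (\<omega>, u)) (snd (\<omega>, u))) * indicator D (\<omega>, u) * indicator {0..} u \<partial>lborel)"
        unfolding bb_def by (intro nn_integral_cong) (use DP in \<open>auto split: split_indicator\<close>)
      then show "ennreal (?b \<omega>) = (\<integral>\<^sup>+u. ennreal (l (fst (\<omega>, u)) (snd (\<omega>, u))) * indicator D (\<omega>, u) * indicator {0..} u \<partial>lborel)"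
        using real(1)[OF bb_le[OF \<omega>]] by simp
    qed
  qed
  finally show ?thesis .
qed

text \<open>
  The sets to which the identity applies exhaust the space, and the identity passes to their union by
  monotone convergence.
\<close>

theorem jump_density_Q: "Q.jump_density l"
  unfolding Q.jump_density_def
proof (intro conjI l_meas)
  show "\<forall>\<omega>\<in>space P. \<forall>u\<ge>0. 0 \<le> l \<omega> u" using l_pos less_imp_le by blast
  define V where "V x = (\<integral>\<^sup>+v. ennreal (l (fst x) v) * indicator {0..snd x} v \<partial>lborel)" for x
  define E where "E k = {x \<in> space Pred. snd x \<le> real k \<and> x \<in> before_jump k \<and> V x \<le> ennreal (real k)}" for k
  have [measurable]: "V \<in> borel_measurable Pred"
    using measurable_running_nn_integral[of "\<lambda>x. ennreal (l (fst x) (snd x))"] unfolding V_def[abs_def] by simp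
  have [measurable]: "E k \<in> sets Pred" for k unfolding E_def by measurable
  have bj: "x \<in> before_jump k'" if x: "x \<in> before_jump k" and kk: "k \<le> k'" for x k k'
  proof -
    obtain \<omega> u where xe: "x = (\<omega>, u)" by (cases x)
    then have \<omega>: "\<omega> \<in> space P" using x by (simp add: before_jump_iff)
    have "J k \<omega> \<and> T k \<omega> \<le> T k' \<omega>" if "J k' \<omega>"
      using reaches_mono[OF that kk] jump_time_strict_mono[OF \<omega> that, of k] kk by (cases "k = k'") auto
    then show ?thesis using x unfolding xe before_jump_iff by auto
  qed
  have E_mono: "E k \<subseteq> E k'" if "k \<le> k'" for k k'
    using that bj order_trans[OF _ ennreal_leI[of "real k" "real k'"]] unfolding E_def by fastforce
  have exhaust: "AE \<omega> in Q. \<forall>u\<ge>0. \<exists>k. (\<omega>, u) \<in> E k"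
    using l_int_Q AE_space[of Q]
  proof eventually_elim
    case (elim \<omega>)
    then have \<omega>: "\<omega> \<in> space P" by (simp add: space_Q)
    show ?case
    proof (intro allI impI)
      fix u :: real assume u: "0 \<le> u"
      obtain n :: nat where n: "u \<le> real n" using real_arch_simple by blast
      have "V (\<omega>, u) \<le> (\<integral>\<^sup>+v. ennreal \<bar>l \<omega> v\<bar> * indicator {0..real n} v \<partial>lborel)"
        unfolding V_def using n by (intro nn_integral_mono) (auto intro: ennreal_leI split: split_indicator)
      also have "\<dots> < \<infinity>"
        using elim(1) set_integrable_path_iff[OF l_meas \<omega>, of "{0..real n}"] by auto
      finally obtain v where v: "0 \<le> v" "V (\<omega>, u) = ennreal v" by (cases "V (\<omega>, u)") auto
      obtain k :: nat where k: "max v (max u (N \<omega> u)) < real k" using reals_Archimedean2 by blast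
      have "V (\<omega>, u) \<le> ennreal (real k)" unfolding v(2) using k by (intro ennreal_leI) simp
      moreover have "(\<omega>, u) \<in> before_jump k"
        using before_jump_after_time[OF \<omega> u _ u, of k] k by simp
      ultimately show "\<exists>k. (\<omega>, u) \<in> E k"
        using \<omega> u k by (intro exI[of _ k]) (auto simp: E_def)
    qed
  qed
  show "Q.muN = density Q.muL (\<lambda>x. ennreal (l (fst x) (snd x)))" (is "_ = ?M")
  proof (rule measure_eqI)
    fix D assume "D \<in> sets Q.muN"
    then have D [measurable]: "D \<in> sets Pred" by simp
    have local: "emeasure Q.muN (D \<inter> E k) = emeasure ?M (D \<inter> E k)" for k
    proof -
      have "emeasure Q.muN (D \<inter> E k) = (\<integral>\<^sup>+x. ennreal (l (fst x) (snd x)) * indicator (D \<inter> E k) x \<partial>Q.muL)"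
      proof (rule jump_density_local[of _ "real k" k])
        show "D \<inter> E k \<in> sets Pred" by measurable
      qed (auto simp: E_def V_def)
      also have "\<dots> = emeasure ?M (D \<inter> E k)"
        by (rule emeasure_density[symmetric]) measurable
      finally show ?thesis .
    qed
    let ?U = "\<Union>k. E k"
    have UP: "{x \<in> space Pred. x \<in> ?U} \<in> sets Pred" by measurable
    have "AE x in Q.muN. x \<in> ?U"
      by (rule Q.AE_jump_measure[THEN iffD2, OF UP], use exhaust in eventually_elim) (use jump_time_nonneg in blast)
    moreover have "AE x in Q.muL. x \<in> ?U"
      by (rule Q.AE_time_measure[THEN iffD2, OF UP], use exhaust in eventually_elim) (intro AE_I2, blast)
    then have "AE x in ?M. x \<in> ?U"
      by (subst AE_density) (measurable, auto elim: eventually_mono)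
    moreover have limit: "emeasure M D = (SUP k. emeasure M (D \<inter> E k))"
      if "sets M = sets Pred" "AE x in M. x \<in> ?U" for M
    proof -
      have "emeasure M D = emeasure M (\<Union>k. D \<inter> E k)"
      proof (rule emeasure_eq_AE)
        show "AE x in M. x \<in> D \<longleftrightarrow> x \<in> (\<Union>k. D \<inter> E k)"
          using that(2) by eventually_elim auto
      qed (use that(1) in auto)
      also have "\<dots> = (SUP k. emeasure M (D \<inter> E k))"
        by (rule SUP_emeasure_incseq[symmetric]) (use that(1) E_mono in \<open>auto simp: incseq_def\<close>)
      finally show ?thesis .
    qed
    ultimately show "emeasure Q.muN D = emeasure ?M D"
      using local by simp
  qed simp
qed

end

section \<open>Intensities under the likelihood measure\<close>

text \<open>
  The likelihoods are only compared along integer times, where Fatou's lemma is available.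
\<close>

lemma exp_ereal_Liminf_le:
  "exp_ereal (Liminf at_top (\<lambda>t. ereal (z t))) \<le> liminf (\<lambda>n. ennreal (exp (z (real n))))"
proof -
  let ?L = "Liminf at_top (\<lambda>t. ereal (z t))"
  have ge: "ennreal (exp c) \<le> liminf (\<lambda>n. ennreal (exp (z (real n))))" if "ereal c < ?L" for c
  proof (rule Liminf_bounded)
    have "\<forall>\<^sub>F t in at_top. ereal c < ereal (z t)" using that by (rule less_LiminfD)
    then have "\<forall>\<^sub>F n in sequentially. ereal c < ereal (z (real n))"
      by (rule eventually_compose_filterlim[OF _ filterlim_real_sequentially])
    then show "\<forall>\<^sub>F n in sequentially. ennreal (exp c) \<le> ennreal (exp (z (real n)))"
      by eventually_elim (auto intro: ennreal_leI)
  qed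
  show ?thesis
  proof (cases ?L)
    case (real r)
    have "(\<lambda>n. ennreal (exp (r - 1 / real (Suc n)))) \<longlonglongrightarrow> ennreal (exp (r - 0))"
      by (intro tendsto_ennrealI tendsto_intros) (rule lim_const_over_n[THEN LIMSEQ_Suc])
    moreover have "ennreal (exp (r - 1 / real (Suc n))) \<le> liminf (\<lambda>n. ennreal (exp (z (real n))))" for n
      by (rule ge) (simp add: real)
    ultimately have "ennreal (exp (r - 0)) \<le> liminf (\<lambda>n. ennreal (exp (z (real n))))"
      by (meson LIMSEQ_le_const2)
    then show ?thesis by (simp add: real exp_ereal_def)
  next
    case PInf
    have "of_nat n \<le> liminf (\<lambda>n. ennreal (exp (z (real n))))" for n
    proof -
      have "real n \<le> exp (real n)" using exp_ge_add_one_self[of "real n"] by linarith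
      then have "of_nat n \<le> ennreal (exp (real n))"
        by (simp add: ennreal_of_nat_eq_real_of_nat ennreal_leI)
      also have "\<dots> \<le> liminf (\<lambda>n. ennreal (exp (z (real n))))" by (rule ge) (simp add: PInf)
      finally show ?thesis .
    qed
    then have "liminf (\<lambda>n. ennreal (exp (z (real n)))) = top"
      by (metis linorder_not_less ennreal_Ex_less_of_nat top.not_eq_extremum)
    then show ?thesis by simp
  next
    case MInf
    then show ?thesis by (simp add: exp_ereal_def)
  qed
qed

text \<open>
  When integration against \<open>f\<close> fails to be countably additive, as it may for a function that is not
  measurable, \<open>density\<close> is the zero measure; so one event of nonzero mass shows that all events have the
  mass given by the integral.  This applies to the likelihood at infinity, a lower limit over
  uncountably many times.
\<close>

lemma emeasure_density_nonzero:
  assumes "emeasure (density M f) B \<noteq> 0" "A \<in> sets M"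
  shows "emeasure (density M f) A = (\<integral>\<^sup>+x. f x * indicator A x \<partial>M)"
  using assms unfolding density_def emeasure_measure_of_conv
  by (auto split: if_splits simp: sets.sigma_sets_eq)

theorem theorem1:
  fixes P Q :: "'a measure"
    and F G :: "real \<Rightarrow> 'a measure"
    and N lam :: "'a \<Rightarrow> real \<Rightarrow> real"
  assumes "prob_space P"
    and "is_filtration P F"
    and "poisson_process P F N 1"
    and "intensity_conditions P F N lam"
    and "Q = likelihood_measure P F N lam"
    and "emeasure Q (space P) = 1"
    and "is_filtration P G"
    and "filtration_le (natural_filtration P N) G"
    and "filtration_le G F"
  shows "(\<exists>lamG. is_intensity Q G N lamG \<and>
            ((\<forall>t\<ge>0. integrable Q (\<lambda>\<omega>. N \<omega> t)) \<longrightarrow> is_martingale Q G (compensated N lamG)) \<and>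
            (\<forall>lam'. is_intensity Q G N lam' \<longrightarrow> same_intensity Q N lamG lam')) \<and>
         (predictable P G lam \<longrightarrow>
            (\<forall>lamG. is_intensity Q G N lamG \<longrightarrow> same_intensity P N lam lamG))"
proof -
  interpret prob_space P by fact
  note poisson = \<open>poisson_process P F N 1\<close>[unfolded poisson_process_def]
  note cond = \<open>intensity_conditions P F N lam\<close>[unfolded intensity_conditions_def]
  have F_sub: "sets (F t) \<subseteq> sets P" if "0 \<le> t" for t
    using \<open>is_filtration P F\<close> that by (simp add: is_filtration_def subalgebra_def)
  have GF: "sets (G t) \<subseteq> sets (F t)" if "0 \<le> t" for t
    using \<open>filtration_le G F\<close> that by (simp add: filtration_le_def)
  have space_G: "space (G t) = space P" if "0 \<le> t" for t
    using \<open>is_filtration P G\<close> that by (simp add: is_filtration_def subalgebra_def)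
  have adapted_N: "adapted G N"
    unfolding adapted_def
  proof (intro allI impI measurableI)
    fix t :: real and B :: "real set" assume t: "0 \<le> t" and B: "B \<in> sets borel"
    let ?gen = "\<Union>s\<in>{0..t}. {(\<lambda>\<omega>. N \<omega> s) -` B \<inter> space P |B. B \<in> sets borel}"
    have sub: "?gen \<subseteq> Pow (space P)" by auto
    have "(\<lambda>\<omega>. N \<omega> t) -` B \<inter> space P \<in> ?gen"
      using t B by (intro UN_I[of t]) auto
    then have "(\<lambda>\<omega>. N \<omega> t) -` B \<inter> space P \<in> sets (natural_filtration P N t)"
      unfolding natural_filtration_def sets_measure_of[OF sub] by (rule sigma_sets.Basic)
    then show "(\<lambda>\<omega>. N \<omega> t) -` B \<inter> space (G t) \<in> sets (G t)"
      using \<open>filtration_le (natural_filtration P N) G\<close> t space_G[OF t] by (auto simp: filtration_le_def)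
  qed simp
  interpret counting_process P G N
  proof unfold_locales
    show "is_filtration P G" by fact
    show "adapted G N" by (rule adapted_N)
  qed (use poisson in blast)+
  interpret P: doleans P G N P
    by unfold_locales (use F_sub GF in blast)+
  \<comment> \<open>The increments of the Poisson process have mean \<open>t - s\<close> and are independent of the past.\<close>
  have "P.muN = P.muL"
  proof (rule P.jump_measure_eq_time_measure)
    fix A s t assume st: "(0::real) \<le> s" "s \<le> t" and A: "A \<in> sets (G s)"
    let ?X = "\<lambda>\<omega>. N \<omega> t - N \<omega> s"
    have t: "0 \<le> t" using st by simp
    have Xm: "?X \<in> borel_measurable P"
      using adapted_N st t unfolding adapted_def
      by (intro borel_measurable_diff P.measurable_from_G[OF st(1)] P.measurable_from_G[OF t]) simp_all
    have "(LINT \<omega>|P. exp (\<i> * complex_of_real (u * ?X \<omega>))) =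
      exp (complex_of_real (t - s) * (exp (\<i> * complex_of_real u) - 1))" for u :: real
      using poisson st by simp
    note mean = poisson_mean[OF \<open>prob_space P\<close> Xm this]
    have "(\<integral>\<^sup>+\<omega>. ennreal (?X \<omega>) * indicator A \<omega> \<partial>P) = emeasure P A * (\<integral>\<^sup>+\<omega>. ennreal (?X \<omega>) \<partial>P)"
    proof (rule nn_integral_indep_indicator[OF \<open>prob_space P\<close> Xm P.sets_G_subset[OF st(1) A]])
      show "indep_set {?X -` B \<inter> space P |B. B \<in> sets borel} (sets (F s))" using poisson st by blast
      show "A \<in> sets (F s)" using A GF[OF st(1)] by blast
    qed
    also have "(\<integral>\<^sup>+\<omega>. ennreal (?X \<omega>) \<partial>P) = ennreal (t - s)"
      using mean N_mono[OF _ st] by (subst nn_integral_eq_integral) auto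
    finally show "(\<integral>\<^sup>+\<omega>. ennreal (?X \<omega>) * indicator A \<omega> \<partial>P) = emeasure P A * ennreal (t - s)" .
  qed
  then interpret P: poisson_space P G N
    by unfold_locales (simp_all add: emeasure_space_1)
  have avoid_P: P.jumps_avoid_null_sets by (rule P.jumps_avoid_null_setsI[OF P.unit_rate])
  define Z where "Z \<omega> = exp_ereal (zeta_infty N lam 0 \<omega>)" for \<omega>
  let ?Finf = "filtration_infty P F"
  have gen: "(\<Union>t\<in>{0..}. sets (F t)) \<subseteq> Pow (space P)"
    using F_sub sets.space_closed[of P] by (intro UN_least) (meson order_trans atLeast_iff)
  have "(\<Union>t\<in>{0..}. sets (F t)) \<subseteq> sets P" using F_sub by (intro UN_least) simp
  then have "sigma_sets (space P) (\<Union>t\<in>{0..}. sets (F t)) \<subseteq> sets P" by (rule sets.sigma_sets_subset)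
  then have sub: "subalgebra (density P Z) ?Finf"
    unfolding subalgebra_def filtration_infty_def sets_measure_of[OF gen] space_measure_of[OF gen] by simp
  have Q: "Q = restr_to_subalg (density P Z) ?Finf"
    using \<open>Q = likelihood_measure P F N lam\<close> by (simp add: likelihood_measure_def Z_def[abs_def])
  have sets_Q: "sets Q = sets ?Finf" unfolding Q by (rule sets_restr_to_subalg[OF sub])
  have space_Q: "space Q = space P" unfolding Q by (simp add: space_restr_to_subalg)
  have G_Q: "sets (G t) \<subseteq> sets Q" if "0 \<le> t" for t
  proof
    fix A assume "A \<in> sets (G t)"
    then have "A \<in> (\<Union>t\<in>{0..}. sets (F t))" using GF[OF that] that by (intro UN_I[of t]) (simp, blast)
    then show "A \<in> sets Q"
      unfolding sets_Q filtration_infty_def sets_measure_of[OF gen] by (rule sigma_sets.Basic)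
  qed
  have Q_sub: "sets Q \<subseteq> sets P" unfolding sets_Q using sub by (simp add: subalgebra_def)
  have Q_eq: "emeasure Q A = (\<integral>\<^sup>+\<omega>. Z \<omega> * indicator A \<omega> \<partial>P)" if A: "A \<in> sets Q" for A
  proof -
    have "space P \<in> sets Q" using sets.top[of Q] space_Q by simp
    then have "emeasure (density P Z) (space P) \<noteq> 0"
      using \<open>emeasure Q (space P) = 1\<close> emeasure_restr_to_subalg[OF sub, of "space P"] sets_Q by (simp add: Q)
    from emeasure_density_nonzero[OF this, of A] show ?thesis
      using A Q_sub emeasure_restr_to_subalg[OF sub, of A] sets_Q by (simp add: Q subset_iff)
  qed
  interpret Q: finite_measure Q
    by (rule finite_measureI) (simp add: space_Q \<open>emeasure Q (space P) = 1\<close>)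
  interpret Q: doleans P G N Q
    by unfold_locales (fact space_Q, fact G_Q)
  have AE_Q: "AE \<omega> in Q. \<phi> \<omega>" if \<phi>: "AE \<omega> in P. \<phi> \<omega>" and m: "{\<omega> \<in> space Q. \<not> \<phi> \<omega>} \<in> sets Q" for \<phi>
  proof -
    have "emeasure Q {\<omega> \<in> space Q. \<not> \<phi> \<omega>} = (\<integral>\<^sup>+\<omega>. Z \<omega> * indicator {\<omega> \<in> space Q. \<not> \<phi> \<omega>} \<omega> \<partial>P)"
      by (rule Q_eq[OF m])
    also have "\<dots> = (\<integral>\<^sup>+\<omega>. 0 \<partial>P)"
      by (rule nn_integral_cong_AE, use \<phi> in eventually_elim) simp
    finally show ?thesis using m by (intro AE_I[of _ _ "{\<omega> \<in> space Q. \<not> \<phi> \<omega>}"]) auto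
  qed
  \<comment> \<open>\<open>Q\<close> inherits the null sets of \<open>P\<close> that it can measure.\<close>
  have avoid_Q: Q.jumps_avoid_null_sets
    unfolding Q.jumps_avoid_null_sets_def
  proof
    fix D assume D: "D \<in> sets Pred"
    have [measurable]: "(\<lambda>\<omega>. \<integral>\<^sup>+u. indicator D (\<omega>, u) * indicator {0..} u \<partial>lborel :: ennreal) \<in> borel_measurable Q"
      "(\<lambda>\<omega>. jump_sum N (\<lambda>u. indicator D (\<omega>, u)) \<omega>) \<in> borel_measurable Q"
      using Q.measurable_time_integral[of "indicator D"] Q.measurable_jump_sum[of "indicator D"] D by auto
    show "AE \<omega> in Q. (\<integral>\<^sup>+u. indicator D (\<omega>, u) * indicator {0..} u \<partial>lborel) = (0 :: ennreal) \<longrightarrow>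
        jump_sum N (\<lambda>u. indicator D (\<omega>, u)) \<omega> = 0"
    proof (rule AE_Q)
      show "AE \<omega> in P. (\<integral>\<^sup>+u. indicator D (\<omega>, u) * indicator {0..} u \<partial>lborel) = (0 :: ennreal) \<longrightarrow>
        jump_sum N (\<lambda>u. indicator D (\<omega>, u)) \<omega> = 0"
        using avoid_P D unfolding P.jumps_avoid_null_sets_def by blast
    qed measurable
  qed
  have predictable: "case_prod k \<in> borel_measurable Pred" if "is_intensity Q G N k" for k
  proof -
    have "predictable_sigma Q G = Pred"
      by (simp add: predictable_sigma_def left_continuous_paths_def space_Q)
    then show ?thesis using that by (simp add: is_intensity_def predictable_def)
  qed
  obtain lamG where lamG: "Q.jump_density lamG" using Q.jump_density_exists[OF avoid_Q] by blast
  show ?thesis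
  proof (intro conjI exI[of _ lamG] allI impI)
    show "is_intensity Q G N lamG" by (rule Q.jump_density_is_intensity[OF lamG])
    show "is_martingale Q G (compensated N lamG)" if "\<forall>t\<ge>0. integrable Q (\<lambda>\<omega>. N \<omega> t)"
      by (rule Q.jump_density_martingale[OF lamG]) (use that in blast)
    show "same_intensity Q N lamG k" if "is_intensity Q G N k" for k
      by (rule Q.same_intensityI[OF avoid_Q Q.jump_densityD(1)[OF lamG] predictable[OF that]
            Q.intensity_unique[OF lamG that]])
  next
    fix k assume pred: "predictable P G lam" and k: "is_intensity Q G N k"
    have meas: "case_prod lam \<in> borel_measurable Pred" using pred by (simp add: predictable_def)
    have pos: "0 < lam \<omega> u" if "\<omega> \<in> space P" "0 \<le> u" for \<omega> u using cond that by blast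
    have int: "AE \<omega> in P. \<forall>t\<ge>0. set_integrable lborel {0..t} (lam \<omega>)"
    proof -
      have "AE \<omega> in P. \<forall>n::nat. (\<integral>\<^sup>+u\<in>{0..real n}. ennreal (lam \<omega> u) \<partial>lborel) < \<infinity>"
        unfolding AE_all_countable using cond by simp
      then show ?thesis
      proof (rule AE_mp, intro AE_I2 impI allI)
        fix \<omega> and t :: real
        assume \<omega>: "\<omega> \<in> space P" and fin: "\<forall>n::nat. (\<integral>\<^sup>+u\<in>{0..real n}. ennreal (lam \<omega> u) \<partial>lborel) < \<infinity>" and t: "0 \<le> t"
        obtain n :: nat where n: "t \<le> real n" using real_arch_simple by blast
        have "(\<integral>\<^sup>+u. ennreal \<bar>lam \<omega> u\<bar> * indicator {0..t} u \<partial>lborel) \<le> (\<integral>\<^sup>+u\<in>{0..real n}. ennreal (lam \<omega> u) \<partial>lborel)"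
          using pos[OF \<omega>] n by (intro nn_integral_mono) (auto simp: abs_of_pos split: split_indicator)
        also have "\<dots> < \<infinity>" using fin by blast
        finally show "set_integrable lborel {0..t} (lam \<omega>)"
          by (subst set_integrable_path_iff[OF meas \<omega>]) auto
      qed
    qed
    \<comment> \<open>The stochastic integral in \<open>zeta\<close> is a finite sum of logarithms on every path, so the likelihood is the
      explicit exponential at all finite times.\<close>
    interpret C: likelihood_change P G N lam Q
    proof
      show "emeasure Q A \<le> liminf (\<lambda>n. \<integral>\<^sup>+\<omega>. ennreal (likelihood lam (real n) \<omega>) * indicator A \<omega> \<partial>P)"
        if s: "0 \<le> s" and A: "A \<in> sets (G s)" for A s
      proof -
        have [measurable]: "A \<in> sets P" by (rule P.sets_G_subset[OF s A])
        have Lm [measurable]: "likelihood lam (real n) \<in> borel_measurable P" for n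
          by (rule P.measurable_from_G[OF _ measurable_likelihood[OF meas]]) simp_all
        have "emeasure Q A = (\<integral>\<^sup>+\<omega>. Z \<omega> * indicator A \<omega> \<partial>P)" using G_Q[OF s] A by (intro Q_eq) blast
        also have "\<dots> \<le> (\<integral>\<^sup>+\<omega>. liminf (\<lambda>n. ennreal (likelihood lam (real n) \<omega>) * indicator A \<omega>) \<partial>P)"
        proof (rule nn_integral_mono)
          fix \<omega> assume \<omega>: "\<omega> \<in> space P"
          have "Z \<omega> \<le> liminf (\<lambda>n. ennreal (exp (zeta N lam 0 (real n) \<omega>)))"
            unfolding Z_def zeta_infty_def by (rule exp_ereal_Liminf_le)
          also have "(\<lambda>n. ennreal (exp (zeta N lam 0 (real n) \<omega>))) = (\<lambda>n. ennreal (likelihood lam (real n) \<omega>))"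
            using exp_zeta[where l=lam, OF \<omega> meas pos[OF \<omega>]] by simp
          finally show "Z \<omega> * indicator A \<omega> \<le> liminf (\<lambda>n. ennreal (likelihood lam (real n) \<omega>) * indicator A \<omega>)"
            by (auto split: split_indicator)
        qed
        also have "\<dots> \<le> liminf (\<lambda>n. \<integral>\<^sup>+\<omega>. ennreal (likelihood lam (real n) \<omega>) * indicator A \<omega> \<partial>P)"
          by (rule nn_integral_liminf) measurable
        finally show ?thesis .
      qed
    qed (fact meas, rule pos, assumption+, fact int, fact space_Q, rule G_Q, assumption, fact \<open>emeasure Q (space P) = 1\<close>)
    have km [measurable]: "(\<lambda>x. k (fst x) (snd x)) \<in> borel_measurable Pred"
      using predictable[OF k] by (simp add: case_prod_beta')
    let ?D = "{x \<in> space Pred. lam (fst x) (snd x) \<noteq> k (fst x) (snd x)}"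
    have D: "?D \<in> sets Pred" by measurable
    have "AE \<omega> in Q. AE u in lborel. 0 \<le> u \<longrightarrow> (\<omega>, u) \<notin> ?D"
      using Q.intensity_unique[OF C.jump_density_Q k]
      by eventually_elim (auto elim: eventually_mono)
    then have "AE \<omega> in P. AE u in lborel. 0 \<le> u \<longrightarrow> (\<omega>, u) \<notin> ?D"
      by (rule C.AE_null_sections_iff[OF D, THEN iffD1])
    with AE_space[of P] have "AE \<omega> in P. AE u in lborel. 0 \<le> u \<longrightarrow> lam \<omega> u = k \<omega> u"
      by eventually_elim (auto elim!: eventually_mono)
    then show "same_intensity P N lam k"
      by (rule P.same_intensityI[OF avoid_P meas predictable[OF k]])
  qed
qed

end
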